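(* Let $M$ be an odd Poisson supermanifold with odd bracket $\{\ ,\ \}$, let $\boldsymbol{\rho}$ be a non-degenerate volume form on $M$, and let $\Delta_{\boldsymbol{\rho}}$ be the corresponding odd Laplace operator on functions, $\Delta_{\boldsymbol{\rho}}f=\mathrm{div}_{\boldsymbol{\rho}}X_f$. Then the operator $\Delta_{\boldsymbol{\rho}}^2$, which is an (even) vector field on $M$, is a derivation of the odd bracket: $\Delta_{\boldsymbol{\rho}}^2\{f,g\}=\{\Delta_{\boldsymbol{\rho}}^2f,g\}+\{f,\Delta_{\boldsymbol{\rho}}^2g\}$ for all functions $f,g\in C^\infty(M)$. That is, $\Delta_{\boldsymbol{\rho}}^2$ is a Poisson vector field.
   Context: Setting. $M$ is a smooth supermanifold with local coordinates $x^a$ of parity $\tilde a$; tilde denotes parity; derivatives are left derivatives. An odd Poisson (Schouten) structure on $M$ is an odd function $\mathfrak{S}=\frac12\mathfrak{S}^{ab}(x)p_bp_a$ on $T^*M$, quadratic in the momenta, with $\mathfrak{S}^{ab}=(-1)^{\tilde a\tilde b}\mathfrak{S}^{ba}$ of parity $\tilde a+\tilde b+1$, satisfying $(\mathfrak{S},\mathfrak{S})=0$ for the canonical even Poisson bracket $(\ ,\ )$ on $T^*M$. The odd bracket is $\{f,g\}=(f,(\mathfrak{S},g))=-(-1)^{\tilde f(\tilde a+1)}\mathfrak{S}^{ab}\frac{\partial f}{\partial x^b}\frac{\partial g}{\partial x^a}$; the condition $(\mathfrak{S},\mathfrak{S})=0$ is equivalent to its (graded) Jacobi identity $\{f,\{g,h\}\}=\{\{f,g\},h\}+(-1)^{(\tilde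 f+1)(\tilde g+1)}\{g,\{f,h\}\}$. A supermanifold with such a structure is an odd Poisson (= Schouten) manifold. Hamiltonian vector field: $X_f:=(-1)^{\tilde f+1}\{f,\ \}=(-1)^{\tilde a\tilde f}\mathfrak{S}^{ab}\frac{\partial f}{\partial x^b}\frac{\partial}{\partial x^a}$, of parity $\tilde f+1$. A volume form is locally $\boldsymbol{\rho}=\rho\,Dx$, where $Dx$ is the Berezin coordinate volume element (transforming by the Berezinian); non-degenerate means it is a basis element of the module of volume forms ($\rho$ even and invertible). The divergence is $\mathrm{div}_{\boldsymbol{\rho}}X=\frac1\rho(-1)^{\tilde a(\tilde X+1)}\frac{\partial(\rho X^a)}{\partial x^a}$. The odd Laplace operator on functions is $\Delta_{\boldsymbol{\rho}}f:=\mathrm{div}_{\boldsymbol{\rho}}X_f=\frac1\rho\frac{\partial}{\partial x^a}\left(\rho\,\mathfrak{S}^{ab}\frac{\partial f}{\partial x^b}\right)$. *)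

theory Defs
  imports "HOL-Analysis.Analysis" "HOL-Library.Function_Algebras"
begin

section \<open>The Grassmann algebra\<close>

text \<open>
  Elements are families of real coefficients indexed by the finite sets of generators;
  the set \<open>I = {i\<^sub>1 < \<dots> < i\<^sub>k}\<close> stands for the monomial \<open>\<xi>\<^bsub>i\<^sub>1\<^esub> \<dots> \<xi>\<^bsub>i\<^sub>k\<^esub>\<close>.
  The algebra on the generators \<open>\<xi>\<^sub>0, \<dots>, \<xi>\<^bsub>q-1\<^esub>\<close> is the subalgebra of the elements whose
  coefficients vanish outside the subsets of \<open>{..<q}\<close>.
\<close>

typedef grassmann = "{g :: nat set \<Rightarrow> real. \<forall>I. infinite I \<longrightarrow> g I = 0}"
  morphisms coeff Abs_grassmann
  by (rule exI[of _ "\<lambda>_. 0"]) simp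

lemma coeff_infinite [simp]: "infinite I \<Longrightarrow> coeff g I = 0"
  using coeff[of g] by simp

lemma grassmann_eqI: "(\<And>I. finite I \<Longrightarrow> coeff g I = coeff h I) \<Longrightarrow> g = h"
  by (metis coeff_infinite coeff_inject ext)

lemma coeff_Abs: "(\<And>I. infinite I \<Longrightarrow> g I = 0) \<Longrightarrow> coeff (Abs_grassmann g) = g"
  by (simp add: Abs_grassmann_inverse)

text \<open>The sign in \<open>\<xi>\<^sub>I \<xi>\<^sub>J = \<plusminus> \<xi>\<^bsub>I \<union> J\<^esub>\<close> for disjoint \<open>I\<close>, \<open>J\<close>.\<close>
definition merge_sign :: "nat set \<Rightarrow> nat set \<Rightarrow> real" where
  "merge_sign I J = (-1) ^ card {(i, j). i \<in> I \<and> j \<in> J \<and> j < i}"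

lemma merge_sign_empty [simp]: "merge_sign {} J = 1" "merge_sign I {} = 1"
  by (simp_all add: merge_sign_def)

lemma merge_sign_Un_left:
  assumes "finite I" "finite J" "finite K" "I \<inter> J = {}"
  shows "merge_sign (I \<union> J) K = merge_sign I K * merge_sign J K"
proof -
  have "{(i, j). i \<in> I \<union> J \<and> j \<in> K \<and> j < i} =
      {(i, j). i \<in> I \<and> j \<in> K \<and> j < i} \<union> {(i, j). i \<in> J \<and> j \<in> K \<and> j < i}" by auto
  moreover have "finite {(i, j). i \<in> I \<and> j \<in> K \<and> j < i}"
    by (rule finite_subset[of _ "I \<times> K"]) (use assms in auto)
  moreover have "finite {(i, j). i \<in> J \<and> j \<in> K \<and> j < i}"
    by (rule finite_subset[of _ "J \<times> K"]) (use assms in auto)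
  moreover have "{(i, j). i \<in> I \<and> j \<in> K \<and> j < i} \<inter> {(i, j). i \<in> J \<and> j \<in> K \<and> j < i} = {}"
    using assms by auto
  ultimately show ?thesis
    by (simp add: merge_sign_def card_Un_disjoint power_add)
qed

lemma merge_sign_Un_right:
  assumes "finite I" "finite J" "finite K" "J \<inter> K = {}"
  shows "merge_sign I (J \<union> K) = merge_sign I J * merge_sign I K"
proof -
  have "{(i, j). i \<in> I \<and> j \<in> J \<union> K \<and> j < i} =
      {(i, j). i \<in> I \<and> j \<in> J \<and> j < i} \<union> {(i, j). i \<in> I \<and> j \<in> K \<and> j < i}" by auto
  moreover have "finite {(i, j). i \<in> I \<and> j \<in> J \<and> j < i}"
    by (rule finite_subset[of _ "I \<times> J"]) (use assms in auto)
  moreover have "finite {(i, j). i \<in> I \<and> j \<in> K \<and> j < i}"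
    by (rule finite_subset[of _ "I \<times> K"]) (use assms in auto)
  moreover have "{(i, j). i \<in> I \<and> j \<in> J \<and> j < i} \<inter> {(i, j). i \<in> I \<and> j \<in> K \<and> j < i} = {}"
    using assms by auto
  ultimately show ?thesis
    by (simp add: merge_sign_def card_Un_disjoint power_add)
qed

instantiation grassmann :: "{zero, one, plus, minus, uminus, times, scaleR}"
begin

definition zero_grassmann where "0 = Abs_grassmann (\<lambda>I. 0)"
definition one_grassmann where "1 = Abs_grassmann (\<lambda>I. if I = {} then 1 else 0)"
definition plus_grassmann where "g + h = Abs_grassmann (\<lambda>I. coeff g I + coeff h I)"
definition minus_grassmann where "g - h = Abs_grassmann (\<lambda>I. coeff g I - coeff h I)"
definition uminus_grassmann where "- g = Abs_grassmann (\<lambda>I. - coeff g I)"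
definition scaleR_grassmann where "r *\<^sub>R g = Abs_grassmann (\<lambda>I. r * coeff g I)"
definition times_grassmann where
  "g * h = Abs_grassmann (\<lambda>K. if finite K
      then \<Sum>I\<in>Pow K. merge_sign I (K - I) * coeff g I * coeff h (K - I) else 0)"

instance ..

end

lemma coeff_zero [simp]: "coeff 0 I = 0"
  by (simp add: zero_grassmann_def coeff_Abs)

lemma coeff_one: "coeff 1 I = (if I = {} then 1 else 0)"
  by (subst one_grassmann_def, subst coeff_Abs) auto

lemma coeff_add [simp]: "coeff (g + h) I = coeff g I + coeff h I"
  by (simp add: plus_grassmann_def coeff_Abs)

lemma coeff_diff [simp]: "coeff (g - h) I = coeff g I - coeff h I"
  by (simp add: minus_grassmann_def coeff_Abs)

lemma coeff_uminus [simp]: "coeff (- g) I = - coeff g I"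
  by (simp add: uminus_grassmann_def coeff_Abs)

lemma coeff_scaleR [simp]: "coeff (r *\<^sub>R g) I = r * coeff g I"
  by (simp add: scaleR_grassmann_def coeff_Abs)

lemma coeff_mult:
  "finite K \<Longrightarrow> coeff (g * h) K = (\<Sum>I\<in>Pow K. merge_sign I (K - I) * coeff g I * coeff h (K - I))"
  by (simp add: times_grassmann_def coeff_Abs)

lemma grassmann_mult_assoc: "(f * g) * h = f * (g * h)" for f g h :: grassmann
proof (rule grassmann_eqI)
  fix K :: "nat set" assume K: "finite K"
  let ?T = "\<lambda>I J N. merge_sign I J * merge_sign I N * merge_sign J N * coeff f I * coeff g J * coeff h N"
  have fin: "finite L" if "L \<subseteq> K" for L using K that finite_subset by blast
  have "coeff ((f * g) * h) K =
      (\<Sum>L\<in>Pow K. \<Sum>I\<in>Pow L. ?T I (L - I) (K - L))"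
  proof (subst coeff_mult[OF K], rule sum.cong[OF refl])
    fix L assume "L \<in> Pow K"
    hence L: "L \<subseteq> K" by simp
    have "merge_sign L (K - L) = merge_sign I (K - L) * merge_sign (L - I) (K - L)" if "I \<subseteq> L" for I
      using merge_sign_Un_left[of I "L - I" "K - L"] fin that L K
      by (metis Diff_disjoint Diff_partition Diff_subset finite_Diff finite_subset)
    thus "merge_sign L (K - L) * coeff (f * g) L * coeff h (K - L) =
        (\<Sum>I\<in>Pow L. ?T I (L - I) (K - L))"
      by (simp add: coeff_mult fin[OF L] sum_distrib_left sum_distrib_right)
         (rule sum.cong, auto simp: algebra_simps)
  qed
  also have "\<dots> = (\<Sum>(L, I)\<in>Sigma (Pow K) Pow. ?T I (L - I) (K - L))"
    by (rule sum.Sigma) (use K fin in auto)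
  also have "\<dots> = (\<Sum>(I, J)\<in>Sigma (Pow K) (\<lambda>I. Pow (K - I)). ?T I J (K - I - J))"
  proof (rule sum.reindex_bij_witness[of _ "\<lambda>(I, J). (I \<union> J, I)" "\<lambda>(L, I). (I, L - I)"])
    fix a assume "a \<in> Sigma (Pow K) Pow"
    then obtain L I where a: "a = (L, I)" "L \<subseteq> K" "I \<subseteq> L" by auto
    have "K - I - (L - I) = K - L" using a by auto
    thus "(case case a of (L, I) \<Rightarrow> (I, L - I) of (I, J) \<Rightarrow> ?T I J (K - I - J)) =
        (case a of (L, I) \<Rightarrow> ?T I (L - I) (K - L))" using a by simp
  qed auto
  also have "\<dots> = (\<Sum>I\<in>Pow K. \<Sum>J\<in>Pow (K - I). ?T I J (K - I - J))"
    by (rule sum.Sigma[symmetric]) (use K in auto)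
  also have "\<dots> = coeff (f * (g * h)) K"
  proof (subst coeff_mult[OF K], rule sum.cong[OF refl])
    fix I assume "I \<in> Pow K"
    hence I: "I \<subseteq> K" by simp
    have "merge_sign I (K - I) = merge_sign I J * merge_sign I (K - I - J)" if "J \<subseteq> K - I" for J
      using merge_sign_Un_right[of I J "K - I - J"] fin that I K
      by (metis Diff_disjoint Diff_partition finite_Diff finite_subset)
    thus "(\<Sum>J\<in>Pow (K - I). ?T I J (K - I - J)) =
        merge_sign I (K - I) * coeff f I * coeff (g * h) (K - I)"
      using K by (simp add: coeff_mult sum_distrib_left)
         (rule sum.cong, auto simp: algebra_simps)
  qed
  finally show "coeff ((f * g) * h) K = coeff (f * (g * h)) K" .
qed

instance grassmann :: real_algebra_1
proof
  fix f g h :: grassmann and r s :: real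
  show "f + g + h = f + (g + h)" "f + g = g + f" "0 + f = f" "- f + f = 0" "f - g = f + - g"
    by (rule grassmann_eqI; simp)+
  show "r *\<^sub>R (f + g) = r *\<^sub>R f + r *\<^sub>R g" "(r + s) *\<^sub>R f = r *\<^sub>R f + s *\<^sub>R f"
    "r *\<^sub>R s *\<^sub>R f = (r * s) *\<^sub>R f" "1 *\<^sub>R f = f"
    by (rule grassmann_eqI; simp add: algebra_simps)+
  show "f * g * h = f * (g * h)" by (rule grassmann_mult_assoc)
  show "(f + g) * h = f * h + g * h" "f * (g + h) = f * g + f * h"
    by (rule grassmann_eqI; simp add: coeff_mult algebra_simps sum.distrib)+
  show "r *\<^sub>R f * g = r *\<^sub>R (f * g)" "f * r *\<^sub>R g = r *\<^sub>R (f * g)"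
    by (rule grassmann_eqI; simp add: coeff_mult sum_distrib_left mult.assoc mult.left_commute)+
  show "1 * f = f"
  proof (rule grassmann_eqI)
    fix K :: "nat set" assume K: "finite K"
    have "coeff (1 * f) K = (\<Sum>I\<in>Pow K. if I = {} then coeff f K else 0)"
      by (subst coeff_mult[OF K], rule sum.cong) (auto simp: coeff_one)
    thus "coeff (1 * f) K = coeff f K" using K by simp
  qed
  show "f * 1 = f"
  proof (rule grassmann_eqI)
    fix K :: "nat set" assume K: "finite K"
    have "coeff (f * 1) K = (\<Sum>I\<in>Pow K. if I = K then coeff f K else 0)"
      by (subst coeff_mult[OF K], rule sum.cong) (auto simp: coeff_one)
    thus "coeff (f * 1) K = coeff f K" using K by simp
  qed
  show "(0 :: grassmann) \<noteq> 1"
    by (metis coeff_one coeff_zero zero_neq_one)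
qed

definition generator :: "nat \<Rightarrow> grassmann" where
  "generator j = Abs_grassmann (\<lambda>I. if I = {j} then 1 else 0)"

text \<open>The component of parity \<open>n mod 2\<close>.\<close>
definition parity_part :: "nat \<Rightarrow> grassmann \<Rightarrow> grassmann" where
  "parity_part n g = Abs_grassmann (\<lambda>I. if card I mod 2 = n mod 2 then coeff g I else 0)"

text \<open>The left derivative \<open>\<partial>/\<partial>\<xi>\<^sub>j\<close>: the generator \<open>\<xi>\<^sub>j\<close> is moved to the front and removed.\<close>
definition odd_deriv :: "nat \<Rightarrow> grassmann \<Rightarrow> grassmann" where
  "odd_deriv j g = Abs_grassmann (\<lambda>I. if finite I \<and> j \<notin> I
      then (-1) ^ card {i \<in> I. i < j} * coeff g (insert j I) else 0)"

section \<open>Superdomains\<close>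

text \<open>
  The space \<open>\<real>\<^sup>p\<close> is \<^term>\<open>Euclidean_space p\<close>, whose points are the \<open>x :: nat \<Rightarrow> real\<close> that vanish
  from index \<open>p\<close> on. Functions on the superdomain \<open>V\<close> of dimension \<open>p|q\<close> are Grassmann-valued
  functions on \<open>V\<close>, set to zero outside \<open>V\<close>, so that equality of functions is equality in HOL; in
  particular the unit of the algebra of functions on \<open>V\<close> is \<open>restr V 1\<close>.
\<close>

type_synonym superfun = "(nat \<Rightarrow> real) \<Rightarrow> grassmann"

definition partial_real :: "nat \<Rightarrow> ((nat \<Rightarrow> real) \<Rightarrow> real) \<Rightarrow> (nat \<Rightarrow> real) \<Rightarrow> real" where
  "partial_real i h x = deriv (\<lambda>t. h (x(i := t))) (x i)"

text \<open>Class \<open>C\<^sup>k\<close>: all partial derivatives up to order \<open>k\<close> exist and are continuous.\<close>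
primrec Ck_on :: "nat \<Rightarrow> nat \<Rightarrow> (nat \<Rightarrow> real) set \<Rightarrow> ((nat \<Rightarrow> real) \<Rightarrow> real) \<Rightarrow> bool" where
  "Ck_on p 0 V h \<longleftrightarrow> continuous_on V h"
| "Ck_on p (Suc k) V h \<longleftrightarrow> continuous_on V h \<and>
     (\<forall>i<p. (\<forall>x\<in>V. (\<lambda>t. h (x(i := t))) differentiable at (x i)) \<and> Ck_on p k V (partial_real i h))"

definition smooth_on :: "nat \<Rightarrow> (nat \<Rightarrow> real) set \<Rightarrow> ((nat \<Rightarrow> real) \<Rightarrow> real) \<Rightarrow> bool" where
  "smooth_on p V h \<longleftrightarrow> (\<forall>k. Ck_on p k V h)"

definition restr :: "(nat \<Rightarrow> real) set \<Rightarrow> superfun \<Rightarrow> superfun" where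
  "restr V f = (\<lambda>x. if x \<in> V then f x else 0)"

definition superfuns :: "nat \<Rightarrow> nat \<Rightarrow> (nat \<Rightarrow> real) set \<Rightarrow> superfun set" where
  "superfuns p q V = {f. (\<forall>x. x \<notin> V \<longrightarrow> f x = 0) \<and>
     (\<forall>x\<in>V. \<forall>I. \<not> I \<subseteq> {..<q} \<longrightarrow> coeff (f x) I = 0) \<and>
     (\<forall>I. I \<subseteq> {..<q} \<longrightarrow> smooth_on p V (\<lambda>x. coeff (f x) I))}"

definition part :: "nat \<Rightarrow> superfun \<Rightarrow> superfun" where
  "part n f = (\<lambda>x. parity_part n (f x))"

definition has_parity :: "nat \<Rightarrow> superfun \<Rightarrow> bool" where
  "has_parity n f \<longleftrightarrow> part n f = f"

text \<open>
  The coordinates are \<open>x\<^sup>a\<close> with \<open>a < p + q\<close>: the first \<open>p\<close> are even and \<open>x\<^bsup>p+j\<^esup>\<close> is \<open>\<xi>\<^sub>j\<close>.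
  Parities are natural numbers that matter only modulo 2.
\<close>

definition parity :: "nat \<Rightarrow> nat \<Rightarrow> nat" where
  "parity p a = (if a < p then 0 else 1)"

definition coordinate :: "nat \<Rightarrow> (nat \<Rightarrow> real) set \<Rightarrow> nat \<Rightarrow> superfun" where
  "coordinate p V a = restr V (\<lambda>x. if a < p then of_real (x a) else generator (a - p))"

definition partial :: "nat \<Rightarrow> (nat \<Rightarrow> real) set \<Rightarrow> nat \<Rightarrow> superfun \<Rightarrow> superfun" where
  "partial p V a f = restr V (\<lambda>x. if a < p
      then Abs_grassmann (\<lambda>I. partial_real a (\<lambda>y. coeff (f y) I) x)
      else odd_deriv (a - p) (f x))"

definition superfun_inverse :: "nat \<Rightarrow> nat \<Rightarrow> (nat \<Rightarrow> real) set \<Rightarrow> superfun \<Rightarrow> superfun" where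
  "superfun_inverse p q V f =
     (THE h. h \<in> superfuns p q V \<and> f * h = restr V 1 \<and> h * f = restr V 1)"

definition superalgebra_hom ::
  "nat \<Rightarrow> nat \<Rightarrow> (nat \<Rightarrow> real) set \<Rightarrow> (nat \<Rightarrow> real) set \<Rightarrow> (superfun \<Rightarrow> superfun) \<Rightarrow> bool" where
  "superalgebra_hom p q V V' \<psi> \<longleftrightarrow>
     (\<forall>f\<in>superfuns p q V. \<psi> f \<in> superfuns p q V') \<and>
     \<psi> (restr V 1) = restr V' 1 \<and>
     (\<forall>f\<in>superfuns p q V. \<forall>g\<in>superfuns p q V. \<psi> (f + g) = \<psi> f + \<psi> g \<and> \<psi> (f * g) = \<psi> f * \<psi> g) \<and>
     (\<forall>r. \<forall>f\<in>superfuns p q V. \<psi> (\<lambda>x. r *\<^sub>R f x) = (\<lambda>x. r *\<^sub>R \<psi> f x)) \<and>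
     (\<forall>n. \<forall>f\<in>superfuns p q V. has_parity n f \<longrightarrow> has_parity n (\<psi> f))"

section \<open>The Berezinian\<close>

text \<open>
  Determinants are taken only of matrices with even entries; these commute, so the order of the
  factors is immaterial.
\<close>
definition superdet :: "nat \<Rightarrow> (nat \<Rightarrow> nat \<Rightarrow> superfun) \<Rightarrow> superfun" where
  "superdet n A = (\<Sum>\<pi> | \<pi> permutes {..<n}. of_int (sign \<pi>) * prod_list (map (\<lambda>i. A i (\<pi> i)) [0..<n]))"

text \<open>Only the entries with indices below \<open>n\<close> are relevant, and these are unique.\<close>
definition supermatrix_inverse ::
  "nat \<Rightarrow> nat \<Rightarrow> (nat \<Rightarrow> real) set \<Rightarrow> nat \<Rightarrow> (nat \<Rightarrow> nat \<Rightarrow> superfun) \<Rightarrow> nat \<Rightarrow> nat \<Rightarrow> superfun" where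
  "supermatrix_inverse p q V n A = (SOME B. \<forall>i<n. \<forall>j<n. B i j \<in> superfuns p q V \<and>
     (\<Sum>k<n. A i k * B k j) = restr V (if i = j then 1 else 0) \<and>
     (\<Sum>k<n. B i k * A k j) = restr V (if i = j then 1 else 0))"

text \<open>
  \<open>Ber J = det (J\<^sub>0\<^sub>0 - J\<^sub>0\<^sub>1 J\<^sub>1\<^sub>1\<^sup>-\<^sup>1 J\<^sub>1\<^sub>0) / det J\<^sub>1\<^sub>1\<close> for an even matrix \<open>J\<close> of format \<open>p|q\<close>.
\<close>
definition berezinian ::
  "nat \<Rightarrow> nat \<Rightarrow> (nat \<Rightarrow> real) set \<Rightarrow> (nat \<Rightarrow> nat \<Rightarrow> superfun) \<Rightarrow> superfun" where
  "berezinian p q V J =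
     (let D = (\<lambda>i j. J (p + i) (p + j)); E = supermatrix_inverse p q V q D
      in superdet p (\<lambda>i j. J i j - (\<Sum>k<q. \<Sum>l<q. J i (p + k) * E k l * J (p + l) j)) *
         superfun_inverse p q V (superdet q D))"

section \<open>Supermanifolds\<close>

text \<open>
  A supermanifold of dimension \<open>p|q\<close> is glued from superdomains. A chart \<open>c\<close> consists of an open
  set \<open>cdom c\<close> of the underlying space and a homeomorphism \<open>cmap c\<close> onto an open subset of \<open>\<real>\<^sup>p\<close>.
  For open \<open>W\<close> contained in the domains of \<open>c\<close> and \<open>d\<close>, the map \<open>pull c d W\<close> takes the coordinate
  expression of a function on \<open>W\<close> in the chart \<open>d\<close> to its expression in the chart \<open>c\<close>. It is a
  morphism of superalgebras and compatible with restrictions, i.e. the charts are glued by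
  isomorphisms of ringed spaces over the homeomorphisms \<open>cmap d \<circ> (cmap c)\<^sup>-\<^sup>1\<close>. Such isomorphisms
  induce local homomorphisms on stalks, so the values of the pulled back even coordinates
  modulo nilpotents are given by \<open>cmap d \<circ> (cmap c)\<^sup>-\<^sup>1\<close>; this need not be required.
\<close>

record ('m, 'c) supermanifold_data =
  body :: "'m topology"
  edim :: nat
  odim :: nat
  charts :: "'c set"
  cdom :: "'c \<Rightarrow> 'm set"
  cmap :: "'c \<Rightarrow> 'm \<Rightarrow> nat \<Rightarrow> real"
  pull :: "'c \<Rightarrow> 'c \<Rightarrow> 'm set \<Rightarrow> superfun \<Rightarrow> superfun"

definition cimg :: "('m, 'c) supermanifold_data \<Rightarrow> 'c \<Rightarrow> 'm set \<Rightarrow> (nat \<Rightarrow> real) set" where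
  "cimg M c W = cmap M c ` W"

abbreviation crange :: "('m, 'c) supermanifold_data \<Rightarrow> 'c \<Rightarrow> (nat \<Rightarrow> real) set" where
  "crange M c \<equiv> cimg M c (cdom M c)"

abbreviation local_functions :: "('m, 'c) supermanifold_data \<Rightarrow> 'c \<Rightarrow> 'm set \<Rightarrow> superfun set" where
  "local_functions M c W \<equiv> superfuns (edim M) (odim M) (cimg M c W)"

definition overlap :: "('m, 'c) supermanifold_data \<Rightarrow> 'c \<Rightarrow> 'c \<Rightarrow> 'm set" where
  "overlap M c d = cdom M c \<inter> cdom M d"

definition supermanifold :: "('m, 'c) supermanifold_data \<Rightarrow> bool" where
  "supermanifold M \<longleftrightarrow>
     Hausdorff_space (body M) \<and> second_countable (body M) \<and>
     (\<Union>c\<in>charts M. cdom M c) = topspace (body M) \<and>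
     (\<forall>c\<in>charts M. openin (body M) (cdom M c) \<and> openin (Euclidean_space (edim M)) (crange M c) \<and>
        homeomorphic_map (subtopology (body M) (cdom M c))
          (subtopology (Euclidean_space (edim M)) (crange M c)) (cmap M c)) \<and>
     (\<forall>c\<in>charts M. \<forall>d\<in>charts M. \<forall>W. openin (body M) W \<and> W \<subseteq> overlap M c d \<longrightarrow>
        superalgebra_hom (edim M) (odim M) (cimg M d W) (cimg M c W) (pull M c d W) \<and>
        (\<forall>W'. openin (body M) W' \<and> W' \<subseteq> W \<longrightarrow> (\<forall>f\<in>local_functions M d W.
           pull M c d W' (restr (cimg M d W') f) = restr (cimg M c W') (pull M c d W f)))) \<and>
     (\<forall>c\<in>charts M. \<forall>W. openin (body M) W \<and> W \<subseteq> cdom M c \<longrightarrow>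
        (\<forall>f\<in>local_functions M c W. pull M c c W f = f)) \<and>
     (\<forall>c\<in>charts M. \<forall>d\<in>charts M. \<forall>e\<in>charts M. \<forall>W.
        openin (body M) W \<and> W \<subseteq> cdom M c \<inter> cdom M d \<inter> cdom M e \<longrightarrow>
        (\<forall>f\<in>local_functions M e W. pull M c d W (pull M d e W f) = pull M c e W f))"

text \<open>The expression in the chart \<open>c\<close>, on the overlap, of a function \<open>f\<close> given in the chart \<open>d\<close>.\<close>
definition transfer :: "('m, 'c) supermanifold_data \<Rightarrow> 'c \<Rightarrow> 'c \<Rightarrow> superfun \<Rightarrow> superfun" where
  "transfer M c d f = pull M c d (overlap M c d) (restr (cimg M d (overlap M c d)) f)"

text \<open>The algebra \<open>C\<^sup>\<infinity>(M)\<close>: compatible families of local expressions.\<close>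
definition smooth_functions :: "('m, 'c) supermanifold_data \<Rightarrow> ('c \<Rightarrow> superfun) set" where
  "smooth_functions M = {f. (\<forall>c\<in>charts M. f c \<in> local_functions M c (cdom M c)) \<and>
     (\<forall>c. c \<notin> charts M \<longrightarrow> f c = 0) \<and>
     (\<forall>c\<in>charts M. \<forall>d\<in>charts M. transfer M c d (f d) = restr (cimg M c (overlap M c d)) (f c))}"

abbreviation indices :: "('m, 'c) supermanifold_data \<Rightarrow> nat set" where
  "indices M \<equiv> {..<edim M + odim M}"

abbreviation par :: "('m, 'c) supermanifold_data \<Rightarrow> nat \<Rightarrow> nat" where
  "par M \<equiv> parity (edim M)"

abbreviation pd :: "('m, 'c) supermanifold_data \<Rightarrow> 'c \<Rightarrow> nat \<Rightarrow> superfun \<Rightarrow> superfun" where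
  "pd M c \<equiv> partial (edim M) (crange M c)"

text \<open>\<open>jacobian M c d a i\<close> is \<open>\<partial>y\<^sup>i/\<partial>x\<^sup>a\<close> for the coordinates \<open>x\<close> of \<open>c\<close> and \<open>y\<close> of \<open>d\<close>.\<close>
definition jacobian :: "('m, 'c) supermanifold_data \<Rightarrow> 'c \<Rightarrow> 'c \<Rightarrow> nat \<Rightarrow> nat \<Rightarrow> superfun" where
  "jacobian M c d a i = partial (edim M) (cimg M c (overlap M c d)) a
     (transfer M c d (coordinate (edim M) (crange M d) i))"

text \<open>Vector fields \<open>X = X\<^sup>a \<partial>/\<partial>x\<^sup>a\<close> of parity \<open>n\<close>, given by their components in the charts.\<close>
definition vector_field :: "('m, 'c) supermanifold_data \<Rightarrow> nat \<Rightarrow> ('c \<Rightarrow> nat \<Rightarrow> superfun) \<Rightarrow> bool" where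
  "vector_field M n X \<longleftrightarrow>
     (\<forall>c\<in>charts M. \<forall>a\<in>indices M. X c a \<in> local_functions M c (cdom M c) \<and> has_parity (par M a + n) (X c a)) \<and>
     (\<forall>c\<in>charts M. \<forall>d\<in>charts M. \<forall>i\<in>indices M.
        transfer M c d (X d i) = (\<Sum>a\<in>indices M. X c a * jacobian M c d a i))"

definition apply_field ::
  "('m, 'c) supermanifold_data \<Rightarrow> ('c \<Rightarrow> nat \<Rightarrow> superfun) \<Rightarrow> ('c \<Rightarrow> superfun) \<Rightarrow> 'c \<Rightarrow> superfun" where
  "apply_field M X f = (\<lambda>c. \<Sum>a\<in>indices M. X c a * pd M c a (f c))"

section \<open>The cotangent bundle over a chart\<close>

text \<open>
  The cotangent bundle of a superdomain \<open>V\<close> of dimension \<open>p|q\<close> is a superdomain of dimension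
  \<open>2p|2q\<close>. Its even coordinates are the even \<open>x\<^sup>a\<close> followed by their momenta \<open>p\<^sub>a\<close>, its odd
  coordinates are the odd \<open>x\<^sup>a\<close> followed by their momenta; \<open>pos_index\<close> and \<open>mom_index\<close> give the
  place of \<open>x\<^sup>a\<close> and \<open>p\<^sub>a\<close> in the resulting list of \<open>2p + 2q\<close> coordinates.
\<close>

definition pos_index :: "nat \<Rightarrow> nat \<Rightarrow> nat" where
  "pos_index p a = (if a < p then a else p + a)"

definition mom_index :: "nat \<Rightarrow> nat \<Rightarrow> nat \<Rightarrow> nat" where
  "mom_index p q a = (if a < p then p + a else p + q + a)"

definition base_point :: "nat \<Rightarrow> (nat \<Rightarrow> real) \<Rightarrow> nat \<Rightarrow> real" where
  "base_point p y = (\<lambda>i. if i < p then y i else 0)"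

definition cotangent :: "nat \<Rightarrow> (nat \<Rightarrow> real) set \<Rightarrow> (nat \<Rightarrow> real) set" where
  "cotangent p V = {y \<in> topspace (Euclidean_space (2 * p)). base_point p y \<in> V}"

definition lift_to_cotangent :: "nat \<Rightarrow> (nat \<Rightarrow> real) set \<Rightarrow> superfun \<Rightarrow> superfun" where
  "lift_to_cotangent p V f = restr (cotangent p V) (\<lambda>y. f (base_point p y))"

text \<open>
  The canonical even Poisson bracket on the cotangent bundle,
  \<open>(F,G) = (-1)\<^bsup>a(F+1)\<^esup> \<partial>F/\<partial>p\<^sub>a \<partial>G/\<partial>x\<^sup>a - (-1)\<^bsup>aF\<^esup> \<partial>F/\<partial>x\<^sup>a \<partial>G/\<partial>p\<^sub>a\<close> (letters in exponents denote
  parities), extended from homogeneous \<open>F\<close> by linearity. With this sign convention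
  \<open>(f,(S,g)) = -(-1)\<^bsup>f(a+1)\<^esup> S\<^sup>a\<^sup>b \<partial>f/\<partial>x\<^sup>b \<partial>g/\<partial>x\<^sup>a\<close> for functions \<open>f\<close>, \<open>g\<close> of \<open>x\<close> and
  \<open>S = 1/2 S\<^sup>a\<^sup>b p\<^sub>b p\<^sub>a\<close>.
\<close>
definition canonical_bracket ::
  "nat \<Rightarrow> nat \<Rightarrow> (nat \<Rightarrow> real) set \<Rightarrow> superfun \<Rightarrow> superfun \<Rightarrow> superfun" where
  "canonical_bracket p q V F G =
     (let dx = (\<lambda>a. partial (2 * p) (cotangent p V) (pos_index p a));
          dp = (\<lambda>a. partial (2 * p) (cotangent p V) (mom_index p q a))
      in \<Sum>n<2. \<Sum>a<p + q.
           (-1) ^ (parity p a * (n + 1)) * dp a (part n F) * dx a G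
         - (-1) ^ (parity p a * n) * dx a (part n F) * dp a G)"

definition quadratic_hamiltonian ::
  "nat \<Rightarrow> nat \<Rightarrow> (nat \<Rightarrow> real) set \<Rightarrow> (nat \<Rightarrow> nat \<Rightarrow> superfun) \<Rightarrow> superfun" where
  "quadratic_hamiltonian p q V S =
     (let P = (\<lambda>a. coordinate (2 * p) (cotangent p V) (mom_index p q a))
      in (\<lambda>y. (1/2) *\<^sub>R (\<Sum>a<p + q. \<Sum>b<p + q. lift_to_cotangent p V (S a b) * P b * P a) y))"

section \<open>Odd Poisson structures\<close>

text \<open>
  An odd function \<open>1/2 S\<^sup>a\<^sup>b p\<^sub>b p\<^sub>a\<close> on the cotangent bundle, given by its coefficients in the charts.
  The transformation law says that the functions over two charts agree on the overlap: it results
  from substituting \<open>p\<^sub>a = (\<partial>y\<^sup>i/\<partial>x\<^sup>a) p\<^sub>i\<close> and comparing the coefficients of \<open>p\<^sub>j p\<^sub>i\<close>; the sign comes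
  from moving \<open>p\<^sub>j\<close> past \<open>\<partial>y\<^sup>i/\<partial>x\<^sup>a\<close>.
\<close>
definition odd_poisson_structure ::
  "('m, 'c) supermanifold_data \<Rightarrow> ('c \<Rightarrow> nat \<Rightarrow> nat \<Rightarrow> superfun) \<Rightarrow> bool" where
  "odd_poisson_structure M S \<longleftrightarrow>
     (\<forall>c\<in>charts M. \<forall>a\<in>indices M. \<forall>b\<in>indices M.
        S c a b \<in> local_functions M c (cdom M c) \<and>
        has_parity (par M a + par M b + 1) (S c a b) \<and>
        S c a b = (-1) ^ (par M a * par M b) * S c b a) \<and>
     (\<forall>c\<in>charts M. \<forall>d\<in>charts M. \<forall>i\<in>indices M. \<forall>j\<in>indices M.
        transfer M c d (S d i j) = (\<Sum>a\<in>indices M. \<Sum>b\<in>indices M.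
          (-1) ^ (par M j * (par M a + par M i)) * S c a b * jacobian M c d b j * jacobian M c d a i)) \<and>
     (\<forall>c\<in>charts M.
        let H = quadratic_hamiltonian (edim M) (odim M) (crange M c) (S c)
        in canonical_bracket (edim M) (odim M) (crange M c) H H = 0)"

text \<open>
  The bracket \<open>{f,g} = -(-1)\<^bsup>f(a+1)\<^esup> S\<^sup>a\<^sup>b \<partial>f/\<partial>x\<^sup>b \<partial>g/\<partial>x\<^sup>a\<close>, extended from homogeneous \<open>f\<close> by
  linearity.
\<close>
definition odd_bracket ::
  "('m, 'c) supermanifold_data \<Rightarrow> ('c \<Rightarrow> nat \<Rightarrow> nat \<Rightarrow> superfun) \<Rightarrow>
   ('c \<Rightarrow> superfun) \<Rightarrow> ('c \<Rightarrow> superfun) \<Rightarrow> 'c \<Rightarrow> superfun" where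
  "odd_bracket M S f g = (\<lambda>c. \<Sum>n<2. \<Sum>a\<in>indices M. \<Sum>b\<in>indices M.
     - ((-1) ^ (n * (par M a + 1)) * S c a b * pd M c b (part n (f c)) * pd M c a (g c)))"

text \<open>The components of \<open>X\<^sub>f\<close> for \<open>f\<close> of parity \<open>n\<close>; the field has parity \<open>n + 1\<close>.\<close>
definition hamiltonian_field ::
  "('m, 'c) supermanifold_data \<Rightarrow> ('c \<Rightarrow> nat \<Rightarrow> nat \<Rightarrow> superfun) \<Rightarrow> nat \<Rightarrow>
   ('c \<Rightarrow> superfun) \<Rightarrow> 'c \<Rightarrow> nat \<Rightarrow> superfun" where
  "hamiltonian_field M S n f = (\<lambda>c a. \<Sum>b\<in>indices M. (-1) ^ (par M a * n) * S c a b * pd M c b (f c))"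

section \<open>Volume forms and the odd Laplace operator\<close>

text \<open>
  A volume form is given by the coefficients \<open>\<rho> c\<close> of the coordinate volume elements. Since
  \<open>Dy = Ber(\<partial>y/\<partial>x) Dx\<close>, the coefficient for \<open>x\<close> is that for \<open>y\<close> times \<open>Ber(\<partial>y/\<partial>x)\<close>.
\<close>
definition nondegenerate_volume_form ::
  "('m, 'c) supermanifold_data \<Rightarrow> ('c \<Rightarrow> superfun) \<Rightarrow> bool" where
  "nondegenerate_volume_form M \<rho> \<longleftrightarrow>
     (\<forall>c\<in>charts M. \<rho> c \<in> local_functions M c (cdom M c) \<and> has_parity 0 (\<rho> c) \<and>
        (\<exists>h\<in>local_functions M c (cdom M c). \<rho> c * h = restr (crange M c) 1)) \<and>
     (\<forall>c\<in>charts M. \<forall>d\<in>charts M.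
        restr (cimg M c (overlap M c d)) (\<rho> c) = transfer M c d (\<rho> d) *
          berezinian (edim M) (odim M) (cimg M c (overlap M c d)) (jacobian M c d))"

text \<open>The divergence of a vector field of parity \<open>n\<close>.\<close>
definition divergence ::
  "('m, 'c) supermanifold_data \<Rightarrow> ('c \<Rightarrow> superfun) \<Rightarrow> nat \<Rightarrow>
   ('c \<Rightarrow> nat \<Rightarrow> superfun) \<Rightarrow> 'c \<Rightarrow> superfun" where
  "divergence M \<rho> n X = (\<lambda>c. superfun_inverse (edim M) (odim M) (crange M c) (\<rho> c) *
     (\<Sum>a\<in>indices M. (-1) ^ (par M a * (n + 1)) * pd M c a (\<rho> c * X c a)))"

text \<open>\<open>div X\<^sub>f\<close>, summed over the homogeneous components of \<open>f\<close>.\<close>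
definition odd_laplacian ::
  "('m, 'c) supermanifold_data \<Rightarrow> ('c \<Rightarrow> nat \<Rightarrow> nat \<Rightarrow> superfun) \<Rightarrow> ('c \<Rightarrow> superfun) \<Rightarrow>
   ('c \<Rightarrow> superfun) \<Rightarrow> 'c \<Rightarrow> superfun" where
  "odd_laplacian M S \<rho> f =
     (\<Sum>n<2. divergence M \<rho> (n + 1) (hamiltonian_field M S n (\<lambda>c. part n (f c))))"

end

theory Submission
  imports "Jordan_Normal_Form.Determinant" Defs
begin

text \<open>
  In a chart \<open>\<Delta>(fg) = \<Delta>f g + (-1)\<^sup>f f \<Delta>g + 2 B(f,g)\<close>, where \<open>B\<close> is the odd bracket up to sign. For even
  \<open>f\<close>, \<open>g\<close> the Jacobi identity says that \<open>X\<^bsub>B(f,g)\<^esub>\<close> is, up to sign, the commutator of \<open>X\<^sub>f\<close> and \<open>X\<^sub>g\<close>; its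
  divergence is therefore \<open>X\<^sub>f(div X\<^sub>g)\<close> plus the symmetric term, so \<open>\<Delta>\<close> is a derivation of \<open>B\<close> up to sign.
  Auxiliary odd parameters carry this over to odd functions. Applying \<open>\<Delta>\<close> twice to a product then leaves
  \<open>\<Delta>\<^sup>2(fg) = \<Delta>\<^sup>2f g + f \<Delta>\<^sup>2g\<close>, so that \<open>\<Delta>\<^sup>2\<close> is a vector field; as it commutes with \<open>\<Delta>\<close>, applying \<open>\<Delta>\<close> to this
  identity shows that \<open>\<Delta>\<^sup>2\<close> is a derivation of the bracket. The local operators agree on overlaps because the
  logarithmic derivative of the Berezinian is the supertrace of that of the Jacobian.
\<close>

section \<open>Parity and odd derivatives in the Grassmann algebra\<close>

text \<open>Three facts are not directly at hand. The Jacobi identity is given only as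
  \<open>(H,H) = 0\<close>, a form cubic in the momenta; odd momenta have no values to insert, so
  its coefficients are reached by three derivations that replace momenta by constant covectors. The
  charts are glued by abstract algebra homomorphisms, so the chain rule must be proved. And a
  derivation must be shown to be a combination of partial derivatives before the square is a vector
  field. The last two rest on one principle: a derivation over a point that kills the coordinates
  vanishes, because Hadamard's lemma pushes its values into ever higher powers of a nilpotent ideal.
  The parameters are numbered \<open>2 * q\<close>, \<open>2 * q + 1\<close>,
  \<open>2 * q + 2\<close>: the cotangent bundle uses the odd generators below \<open>2 * q\<close>,
  and derivatives along its coordinates must kill the parameters. Two of them make the two factors
  of a product even; the third stands for an odd covector component when one index of the Jacobi
  identity is isolated. Each is cancelled at the end by differentiating in it.\<close>

definition twist :: "nat \<Rightarrow> grassmann \<Rightarrow> grassmann" where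
  "twist n g = Abs_grassmann (\<lambda>I. (-1) ^ (n * card I) * coeff g I)"

definition gpar :: "nat \<Rightarrow> grassmann \<Rightarrow> bool" where
  "gpar n g \<longleftrightarrow> (\<forall>I. finite I \<longrightarrow> card I mod 2 \<noteq> n mod 2 \<longrightarrow> coeff g I = 0)"

text \<open>The subalgebra on the generators with numbers in \<open>J\<close>. The set is arbitrary,
  not an initial segment, so that parameters can be adjoined and split off one by one.\<close>

definition gsupp :: "nat set \<Rightarrow> grassmann \<Rightarrow> bool" where
  "gsupp J g \<longleftrightarrow> (\<forall>I. \<not> I \<subseteq> J \<longrightarrow> coeff g I = 0)"

lemma coeff_twist [simp]: "coeff (twist n g) I = (-1) ^ (n * card I) * coeff g I"
  by (simp add: twist_def coeff_Abs)

lemma coeff_parity_part: "coeff (parity_part n g) I = (if card I mod 2 = n mod 2 then coeff g I else 0)"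
  by (simp add: parity_part_def coeff_Abs)

lemma coeff_odd_deriv:
  "coeff (odd_deriv j g) I = (if finite I \<and> j \<notin> I then (-1) ^ card {i \<in> I. i < j} * coeff g (insert j I) else 0)"
  by (simp add: odd_deriv_def coeff_Abs)

lemma coeff_generator: "coeff (generator j) I = (if I = {j} then 1 else 0)"
  unfolding generator_def by (subst coeff_Abs) auto

lemma coeff_neg_one_power [simp]: "coeff ((-1) ^ k * g) I = (-1) ^ k * coeff g I"
  by (induction k) (simp_all add: mult.assoc)

lemma coeff_sum [simp]: "coeff (\<Sum>a\<in>A. f a) I = (\<Sum>a\<in>A. coeff (f a) I)"
  by (induction A rule: infinite_finite_induct) auto

lemma coeff_of_real: "coeff (of_real r) I = (if I = {} then r else 0)"
  by (simp add: of_real_def coeff_one)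

lemma coeff_mult_empty [simp]: "coeff (g * h) {} = coeff g {} * coeff h {}"
  by (simp add: coeff_mult)

lemma neg_one_power_mod2: "m mod 2 = n mod 2 \<Longrightarrow> (-1) ^ m = ((-1) ^ n :: 'a :: ring_1)"
  by (metis minus_one_power_iff even_iff_mod_2_eq_zero)

lemma gpar_iff_parity_part: "gpar n g \<longleftrightarrow> parity_part n g = g"
proof
  show "parity_part n g = g" if "gpar n g"
    using that by (intro grassmann_eqI) (auto simp: coeff_parity_part gpar_def)
  show "gpar n g" if "parity_part n g = g"
    unfolding gpar_def by (metis that coeff_parity_part)
qed

lemma gpar_parity_part [simp]: "gpar n (parity_part n g)"
  by (simp add: gpar_def coeff_parity_part)

lemma parity_part_gpar:
  "gpar m g \<Longrightarrow> parity_part n g = (if m mod 2 = n mod 2 then g else 0)"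
  by (rule grassmann_eqI) (auto simp: coeff_parity_part gpar_def)

lemma gpar_cong: "gpar m g \<Longrightarrow> m mod 2 = n mod 2 \<Longrightarrow> gpar n g"
  by (simp add: gpar_def)

lemma gpar_0 [simp]: "gpar n 0" by (simp add: gpar_def)
lemma gpar_add: "gpar n g \<Longrightarrow> gpar n h \<Longrightarrow> gpar n (g + h)" by (simp add: gpar_def)
lemma gpar_diff: "gpar n g \<Longrightarrow> gpar n h \<Longrightarrow> gpar n (g - h)" by (simp add: gpar_def)
lemma gpar_uminus: "gpar n g \<Longrightarrow> gpar n (- g)" by (simp add: gpar_def)
lemma gpar_sign: "gpar n g \<Longrightarrow> gpar n ((-1) ^ k * g)" by (simp add: gpar_def)
lemma gpar_1 [simp]: "gpar 0 1" by (simp add: gpar_def coeff_one)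
lemma gpar_of_real [simp]: "gpar 0 (of_real r)" by (simp add: gpar_def coeff_of_real)
lemma gpar_generator [simp]: "gpar 1 (generator j)" by (simp add: gpar_def coeff_generator)

lemma gpar_mult:
  assumes "gpar m g" "gpar n h" shows "gpar (m + n) (g * h)"
  unfolding gpar_def
proof (intro allI impI)
  fix K :: "nat set" assume K: "finite K" "card K mod 2 \<noteq> (m + n) mod 2"
  show "coeff (g * h) K = 0"
  proof (subst coeff_mult[OF K(1)], rule sum.neutral, rule ballI)
    fix I assume I: "I \<in> Pow K"
    have "card K = card I + card (K - I)"
      using I K card_Un_disjoint[of I "K - I"] finite_subset[of I K] by (auto simp: Un_absorb1 Un_commute)
    hence "card I mod 2 \<noteq> m mod 2 \<or> card (K - I) mod 2 \<noteq> n mod 2"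
      using K(2) by (metis mod_add_eq)
    thus "merge_sign I (K - I) * coeff g I * coeff h (K - I) = 0"
      using assms K(1) I finite_subset[of I K] unfolding gpar_def by auto
  qed
qed

lemma gpar_odd_deriv:
  assumes "gpar m g" shows "gpar (m + 1) (odd_deriv j g)"
  unfolding gpar_def
proof (intro allI impI)
  fix I :: "nat set" assume "finite I" "card I mod 2 \<noteq> (m + 1) mod 2"
  hence "card (insert j I) mod 2 \<noteq> m mod 2" if "j \<notin> I"
    using that by (metis Suc_eq_plus1 card_insert_disjoint mod_Suc_eq mod_add_self2 add_2_eq_Suc' mod_Suc)
  thus "coeff (odd_deriv j g) I = 0"
    using assms \<open>finite I\<close> by (auto simp: coeff_odd_deriv gpar_def)
qed

lemma parity_decomposition: "parity_part 0 g + parity_part 1 g = g"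
  by (rule grassmann_eqI) (auto simp: coeff_parity_part)

lemma twist_gpar: "gpar m g \<Longrightarrow> twist n g = (-1) ^ (n * m) * g"
proof (rule grassmann_eqI)
  fix I :: "nat set" assume g: "gpar m g" "finite I"
  show "coeff (twist n g) I = coeff ((-1) ^ (n * m) * g) I"
  proof (cases "card I mod 2 = m mod 2")
    case True
    hence "(n * card I) mod 2 = (n * m) mod 2" by (metis mod_mult_right_eq)
    from neg_one_power_mod2[OF this, where 'a = real] show ?thesis by simp
  qed (use g in \<open>simp add: gpar_def\<close>)
qed

lemma twist_add: "twist n (g + h) = twist n g + twist n h"
  by (rule grassmann_eqI) (simp add: algebra_simps)
lemma twist_0 [simp]: "twist n 0 = 0"
  by (rule grassmann_eqI) simp
lemma twist_zero [simp]: "twist 0 g = g"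
  by (rule grassmann_eqI) simp
lemma twist_parity: "twist n g = parity_part 0 g + (-1) ^ n * parity_part 1 g"
  by (rule grassmann_eqI) (auto simp: coeff_parity_part minus_one_power_iff)

lemma card_split: "finite K \<Longrightarrow> I \<subseteq> K \<Longrightarrow> card K = card I + card (K - I)"
  by (metis card_Diff_subset card_mono finite_subset le_add_diff_inverse)

text \<open>Of the two orders in which \<open>I\<close> and \<open>J\<close> can be merged, exactly
  one makes a given pair an inversion, so the two sets of inversions partition
  \<open>I \<times> J\<close>.\<close>

lemma merge_sign_swap:
  assumes "finite I" "finite J" "I \<inter> J = {}"
  shows "merge_sign I J * merge_sign J I = (-1) ^ (card I * card J)"
proof -
  let ?A = "{(i, j). i \<in> I \<and> j \<in> J \<and> j < i}" and ?B = "{(i, j). i \<in> J \<and> j \<in> I \<and> j < i}"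
  have "?A \<subseteq> I \<times> J" "?B \<subseteq> J \<times> I" by auto
  hence fin: "finite ?A" "finite (prod.swap ` ?B)"
    using assms by (auto intro: finite_subset[OF _ finite_cartesian_product] )
  have "I \<times> J = ?A \<union> prod.swap ` ?B"
    using assms(3) by (force simp: image_iff)
  moreover have "?A \<inter> prod.swap ` ?B = {}" by auto
  ultimately have "card I * card J = card ?A + card (prod.swap ` ?B)"
    using card_Un_disjoint[OF fin] card_cartesian_product[of I J] by simp
  also have "card (prod.swap ` ?B) = card ?B" by (rule card_image) (simp add: inj_on_def)
  finally show ?thesis by (simp add: merge_sign_def power_add)
qed

lemma merge_sign_swap':
  assumes "finite I" "finite J" "I \<inter> J = {}"
  shows "merge_sign I J = (-1) ^ (card I * card J) * merge_sign J I"
proof -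
  have "merge_sign J I * merge_sign J I = 1" by (simp add: merge_sign_def flip: power_mult_distrib)
  thus ?thesis using merge_sign_swap[OF assms] by (metis mult.assoc mult.right_neutral)
qed

text \<open>Complementation in \<open>K\<close> exchanges the factors, and
  \<open>merge_sign_swap'\<close> gives the sign of a term from the cardinalities. Terms with the
  wrong parities vanish, so the cardinalities may be replaced by \<open>m\<close> and
  \<open>n\<close>.\<close>

lemma grassmann_commute:
  assumes "gpar m g" "gpar n h" shows "g * h = (-1) ^ (m * n) * (h * g)"
proof (rule grassmann_eqI)
  fix K :: "nat set" assume K: "finite K"
  have "coeff (g * h) K = (\<Sum>I\<in>Pow K. merge_sign (K - I) I * coeff g (K - I) * coeff h I)"
    unfolding coeff_mult[OF K]
    by (rule sum.reindex_bij_witness[of _ "\<lambda>I. K - I" "\<lambda>I. K - I"]) (auto simp: double_diff)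
  also have "\<dots> = (-1) ^ (m * n) * coeff (h * g) K"
    unfolding coeff_mult[OF K] sum_distrib_left
  proof (rule sum.cong[OF refl])
    fix I assume I: "I \<in> Pow K"
    have fin: "finite I" "finite (K - I)" using I K finite_subset by auto
    show "merge_sign (K - I) I * coeff g (K - I) * coeff h I = (-1) ^ (m * n) * (merge_sign I (K - I) * coeff h I * coeff g (K - I))"
    proof (cases "card (K - I) mod 2 = m mod 2 \<and> card I mod 2 = n mod 2")
      case True
      hence "(-1) ^ (card (K - I) * card I) = ((-1) ^ (m * n) :: real)"
        by (intro neg_one_power_mod2) (metis mod_mult_eq)
      thus ?thesis using merge_sign_swap'[of "K - I" I] fin by auto
    next
      case False
      hence "coeff g (K - I) = 0 \<or> coeff h I = 0" using assms fin unfolding gpar_def by blast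
      thus ?thesis by auto
    qed
  qed
  finally show "coeff (g * h) K = coeff ((-1) ^ (m * n) * (h * g)) K" by simp
qed

lemma merge_sign_singleton_left: "merge_sign {j} L = (-1) ^ card {i \<in> L. i < j}"
proof -
  have "{(i, l). i \<in> {j} \<and> l \<in> L \<and> l < i} = Pair j ` {i \<in> L. i < j}" by auto
  thus ?thesis by (simp add: merge_sign_def card_image inj_on_def)
qed

lemma merge_sign_singleton_right: "merge_sign L {j} = (-1) ^ card {i \<in> L. j < i}"
proof -
  have "{(i, l). i \<in> L \<and> l \<in> {j} \<and> l < i} = (\<lambda>i. (i, j)) ` {i \<in> L. j < i}" by auto
  thus ?thesis by (simp add: merge_sign_def card_image inj_on_def)
qed

lemma card_less_split:
  assumes "finite K" "I \<subseteq> K"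
  shows "card {i \<in> K. i < (j :: nat)} = card {i \<in> I. i < j} + card {i \<in> K - I. i < j}"
proof -
  have "{i \<in> K. i < j} - {i \<in> I. i < j} = {i \<in> K - I. i < j}" by auto
  thus ?thesis using card_split[of "{i \<in> K. i < j}" "{i \<in> I. i < j}"] assms by auto
qed

lemma sign_square [simp]: "(-1) ^ k * ((-1) ^ k * x) = (x :: 'a :: ring_1)"
  by (simp flip: power_add mult.assoc)

text \<open>Carrying the generator from the front of the monomial to its place passes the elements
  below it, carrying it on to the end passes those above: together all of \<open>I\<close>. This is
  the sign in the Leibniz rule.\<close>

lemma sign_below_above:
  assumes "finite I" "j \<notin> I"
  shows "(-1) ^ card {i \<in> I. i < j} * merge_sign I {j} = (-1) ^ card I"
proof -
  have "I = {i \<in> I. i < j} \<union> {i \<in> I. j < i}" using assms by (auto simp: not_less order_le_less)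
  hence "card I = card {i \<in> I. i < j} + card {i \<in> I. j < i}"
    using card_Un_disjoint[of "{i \<in> I. i < j}" "{i \<in> I. j < i}"] assms(1) by fastforce
  thus ?thesis by (simp add: merge_sign_singleton_right power_add)
qed

lemma odd_deriv_mult: "odd_deriv j (g * h) = odd_deriv j g * h + twist 1 g * odd_deriv j h"
proof (rule grassmann_eqI)
  fix K :: "nat set" assume K: "finite K"
  show "coeff (odd_deriv j (g * h)) K = coeff (odd_deriv j g * h + twist 1 g * odd_deriv j h) K"
  proof (cases "j \<in> K")
    case True
    \<comment> \<open>The left side has no monomial containing the generator. On the right, a subset
      \<open>I\<close> of \<open>L\<close> contributes through the first product and
      \<open>insert j I\<close> through the second, with opposite signs.\<close>
    define L where "L = K - {j}"
    have KL: "K = insert j L" "j \<notin> L" "finite L" using True K by (auto simp: L_def)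
    have P: "(\<Sum>I\<in>Pow K. f I) = (\<Sum>I\<in>Pow L. f I + f (insert j I))" for f :: "nat set \<Rightarrow> real"
    proof -
      have "(\<Sum>I\<in>Pow K. f I) = (\<Sum>I\<in>Pow L. f I) + (\<Sum>I\<in>insert j ` Pow L. f I)"
        unfolding KL(1) Pow_insert by (rule sum.union_disjoint) (use KL in auto)
      also have "(\<Sum>I\<in>insert j ` Pow L. f I) = (\<Sum>I\<in>Pow L. f (insert j I))"
        by (rule sum.reindex[unfolded comp_def]) (use KL in \<open>auto simp: inj_on_def\<close>)
      finally show ?thesis by (simp add: sum.distrib)
    qed
    have "coeff (odd_deriv j g * h) K + coeff (twist 1 g * odd_deriv j h) K = 0"
      unfolding coeff_mult[OF K] P sum.distrib[symmetric]
    proof (rule sum.neutral, rule ballI)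
      fix I assume I: "I \<in> Pow L"
      have fin: "finite I" "finite (L - I)" using I KL finite_subset by auto
      have j: "j \<notin> I" using I KL by auto
      have eq: "K - insert j I = L - I" "K - I = insert j (L - I)" using KL j by auto
      have 1: "merge_sign I (insert j (L - I)) = merge_sign I {j} * merge_sign I (L - I)"
        using merge_sign_Un_right[of I "{j}" "L - I"] fin KL by auto
      have 2: "merge_sign (insert j I) (L - I) = merge_sign {j} (L - I) * merge_sign I (L - I)"
        using merge_sign_Un_left[of "{j}" I "L - I"] fin j by auto
      have 3: "(-1) ^ card {i \<in> I. i < j} * merge_sign I {j} = (-1) ^ card I"
        by (rule sign_below_above) (use fin j in auto)
      have 4: "merge_sign {j} (L - I) * (-1) ^ card {i \<in> L - I. i < j} = 1"
        by (simp add: merge_sign_singleton_left flip: power_mult_distrib)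
      have "merge_sign I (K - I) * coeff (odd_deriv j g) I * coeff h (K - I) =
         ((-1) ^ card {i \<in> I. i < j} * merge_sign I {j}) * merge_sign I (L - I) * coeff g (insert j I) * coeff h (insert j (L - I))"
        using fin j by (simp add: coeff_odd_deriv eq 1 mult_ac)
      moreover have "merge_sign (insert j I) (K - insert j I) * coeff (twist 1 g) (insert j I) * coeff (odd_deriv j h) (K - insert j I) =
         - ((merge_sign {j} (L - I) * (-1) ^ card {i \<in> L - I. i < j}) * (-1) ^ card I * merge_sign I (L - I) * coeff g (insert j I) * coeff h (insert j (L - I)))"
        unfolding eq using fin j KL by (simp add: coeff_odd_deriv 2 mult_ac del: insert_Diff_if)
      moreover have "coeff (odd_deriv j g) (insert j I) = 0" by (simp add: coeff_odd_deriv)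
      moreover have "coeff (odd_deriv j h) (K - I) = 0" by (simp add: coeff_odd_deriv eq)
      ultimately show "merge_sign I (K - I) * coeff (odd_deriv j g) I * coeff h (K - I) +
           merge_sign (insert j I) (K - insert j I) * coeff (odd_deriv j g) (insert j I) * coeff h (K - insert j I) +
           (merge_sign I (K - I) * coeff (twist 1 g) I * coeff (odd_deriv j h) (K - I) +
            merge_sign (insert j I) (K - insert j I) * coeff (twist 1 g) (insert j I) * coeff (odd_deriv j h) (K - insert j I)) = 0"
        unfolding 3 4 by simp
    qed
    thus ?thesis using True by (simp add: coeff_odd_deriv)
  next
    case False
    \<comment> \<open>Subsets of \<open>insert j K\<close> containing \<open>j\<close> yield the
      derivative of the left factor, the others that of the right factor.\<close>
    let ?t = "\<lambda>I. merge_sign I (insert j K - I) * coeff g I * coeff h (insert j K - I)"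
    let ?s = "(-1) ^ card {i \<in> K. i < j} :: real"
    have "coeff (odd_deriv j (g * h)) K = ?s * (\<Sum>I\<in>Pow (insert j K). ?t I)"
      using K False by (simp add: coeff_odd_deriv coeff_mult)
    also have "Pow (insert j K) = Pow K \<union> insert j ` Pow K" by (rule Pow_insert)
    also have "(\<Sum>I\<in>Pow K \<union> insert j ` Pow K. ?t I) = (\<Sum>I\<in>Pow K. ?t I) + (\<Sum>I\<in>insert j ` Pow K. ?t I)"
      by (rule sum.union_disjoint) (use K False in auto)
    also have "(\<Sum>I\<in>insert j ` Pow K. ?t I) = (\<Sum>I\<in>Pow K. ?t (insert j I))"
      by (rule sum.reindex[unfolded comp_def]) (use False in \<open>auto simp: inj_on_def\<close>)
    also have "?s * ((\<Sum>I\<in>Pow K. ?t I) + (\<Sum>I\<in>Pow K. ?t (insert j I))) =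
       (\<Sum>I\<in>Pow K. ?s * ?t (insert j I)) + (\<Sum>I\<in>Pow K. ?s * ?t I)"
      by (simp add: sum_distrib_left distrib_left)
    also have "(\<Sum>I\<in>Pow K. ?s * ?t (insert j I)) = coeff (odd_deriv j g * h) K"
      unfolding coeff_mult[OF K]
    proof (rule sum.cong[OF refl])
      fix I assume I: "I \<in> Pow K"
      have fin: "finite I" "finite (K - I)" using I K finite_subset by auto
      have eq: "insert j K - insert j I = K - I" using False by auto
      have "merge_sign (insert j I) (K - I) = merge_sign {j} (K - I) * merge_sign I (K - I)"
        using merge_sign_Un_left[of "{j}" I "K - I"] I fin False by auto
      thus "?s * ?t (insert j I) = merge_sign I (K - I) * coeff (odd_deriv j g) I * coeff h (K - I)"
        unfolding eq using I K False fin card_less_split[of K I j]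
        by (auto simp: coeff_odd_deriv merge_sign_singleton_left power_add algebra_simps)
    qed
    also have "(\<Sum>I\<in>Pow K. ?s * ?t I) = coeff (twist 1 g * odd_deriv j h) K"
      unfolding coeff_mult[OF K]
    proof (rule sum.cong[OF refl])
      fix I assume I: "I \<in> Pow K"
      have fin: "finite I" "finite (K - I)" using I K finite_subset by auto
      have eq: "insert j K - I = insert j (K - I)" using False I by auto
      have 1: "merge_sign I (insert j (K - I)) = merge_sign I {j} * merge_sign I (K - I)"
        using merge_sign_Un_right[of I "{j}" "K - I"] I fin False by auto
      have 2: "(-1) ^ card {i \<in> I. i < j} * merge_sign I {j} = (-1) ^ card I"
        by (rule sign_below_above) (use fin False I in auto)
      have "?s * ?t I = (-1) ^ card {i \<in> K - I. i < j} * ((-1) ^ card {i \<in> I. i < j} * merge_sign I {j}) *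
         merge_sign I (K - I) * coeff g I * coeff h (insert j (K - I))"
        unfolding eq 1 using I K card_less_split[of K I j] by (simp add: power_add algebra_simps)
      also have "\<dots> = merge_sign I (K - I) * coeff (twist 1 g) I * coeff (odd_deriv j h) (K - I)"
        unfolding 2 using fin I False by (auto simp: coeff_odd_deriv algebra_simps)
      finally show "?s * ?t I = merge_sign I (K - I) * coeff (twist 1 g) I * coeff (odd_deriv j h) (K - I)" .
    qed
    finally show ?thesis by simp
  qed
qed

lemma odd_deriv_add: "odd_deriv j (g + h) = odd_deriv j g + odd_deriv j h"
  by (rule grassmann_eqI) (simp add: coeff_odd_deriv distrib_left)
lemma odd_deriv_0 [simp]: "odd_deriv j 0 = 0"
  by (rule grassmann_eqI) (simp add: coeff_odd_deriv)
lemma odd_deriv_generator: "odd_deriv j (generator k) = (if j = k then 1 else 0)"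
  by (rule grassmann_eqI) (auto simp: coeff_odd_deriv coeff_generator coeff_one)
lemma odd_deriv_of_real [simp]: "odd_deriv j (of_real r) = 0"
  by (rule grassmann_eqI) (simp add: coeff_odd_deriv coeff_of_real)

lemma odd_deriv_gsupp: "gsupp J g \<Longrightarrow> j \<notin> J \<Longrightarrow> odd_deriv j g = 0"
  by (rule grassmann_eqI) (simp add: coeff_odd_deriv gsupp_def)

text \<open>For \<open>j < k\<close> the presence of \<open>j\<close> changes by one the number of
  generators in front of \<open>k\<close>, while \<open>k\<close> does not count for
  \<open>j\<close>. The case \<open>k < j\<close> is the same by symmetry, and for
  \<open>j = k\<close> both sides are zero.\<close>

lemma odd_deriv_anticommute: "odd_deriv j (odd_deriv k g) = - odd_deriv k (odd_deriv j g)"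
proof (rule grassmann_eqI)
  have *: "coeff (odd_deriv j (odd_deriv k g)) I = - coeff (odd_deriv k (odd_deriv j g)) I"
    if I: "finite I" and jk: "j < k" for j k I
  proof (cases "j \<in> I \<or> k \<in> I")
    case False
    have "{i \<in> insert j I. i < k} = insert j {i \<in> I. i < k}" "{i \<in> insert k I. i < j} = {i \<in> I. i < j}"
      using jk by auto
    thus ?thesis using False I jk by (simp add: coeff_odd_deriv insert_commute)
  qed (use I jk in \<open>auto simp: coeff_odd_deriv\<close>)
  fix I :: "nat set" assume I: "finite I"
  consider "j < k" | "j = k" | "k < j" by linarith
  thus "coeff (odd_deriv j (odd_deriv k g)) I = coeff (- odd_deriv k (odd_deriv j g)) I"
    by cases (use *[OF I, of j k] *[OF I, of k j] in \<open>auto simp: coeff_odd_deriv\<close>)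
qed

lemma gsupp_0 [simp]: "gsupp J 0" by (simp add: gsupp_def)
lemma gsupp_add: "gsupp J g \<Longrightarrow> gsupp J h \<Longrightarrow> gsupp J (g + h)" by (simp add: gsupp_def)
lemma gsupp_generator: "j \<in> J \<Longrightarrow> gsupp J (generator j)" by (auto simp add: gsupp_def coeff_generator)
lemma gsupp_mono: "gsupp J g \<Longrightarrow> J \<subseteq> K \<Longrightarrow> gsupp K g" by (auto simp add: gsupp_def)

section \<open>Smooth functions on coordinate domains\<close>

lemma openin_Euclidean_space_iff:
  "openin (Euclidean_space p) V \<longleftrightarrow> (\<exists>U. open U \<and> V = U \<inter> {x. \<forall>i\<ge>p. x i = 0})"
  unfolding Euclidean_space_def openin_subtopology euclidean_product_topology by simp

lemma Euclidean_space_eq_0: "openin (Euclidean_space p) V \<Longrightarrow> x \<in> V \<Longrightarrow> p \<le> i \<Longrightarrow> x i = 0"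
  by (auto simp: openin_Euclidean_space_iff)

text \<open>Open boxes in the space of the first \<open>p\<close> coordinates. They form a
  neighbourhood base and contain the segment from any of their points towards the centre in each
  single coordinate, as Hadamard's lemma requires.\<close>

definition cube :: "nat \<Rightarrow> (nat \<Rightarrow> real) \<Rightarrow> real \<Rightarrow> (nat \<Rightarrow> real) set" where
  "cube p x r = {y. (\<forall>i\<ge>p. y i = 0) \<and> (\<forall>i<p. \<bar>y i - x i\<bar> < r)}"

lemma openin_cube: "openin (Euclidean_space p) (cube p x r)"
proof -
  have "open (\<Inter>i\<in>{..<p}. {y :: nat \<Rightarrow> real. \<bar>y i - x i\<bar> < r})"
    by (intro open_INT ballI open_Collect_less continuous_intros continuous_on_product_coordinates) auto
  moreover have "cube p x r = (\<Inter>i\<in>{..<p}. {y. \<bar>y i - x i\<bar> < r}) \<inter> {x. \<forall>i\<ge>p. x i = 0}"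
    by (auto simp: cube_def)
  ultimately show ?thesis unfolding openin_Euclidean_space_iff by blast
qed

lemma cube_subset_open:
  assumes V: "openin (Euclidean_space p) V" and x: "x \<in> V"
  shows "\<exists>r>0. cube p x r \<subseteq> V"
proof -
  obtain U where U: "open U" "V = U \<inter> {x. \<forall>i\<ge>p. x i = 0}"
    using V by (auto simp: openin_Euclidean_space_iff)
  have "openin (product_topology (\<lambda>i. euclidean) UNIV) U"
    using U(1) by (simp add: euclidean_product_topology)
  then obtain X where X: "\<And>i. open (X i)" "x \<in> Pi\<^sub>E UNIV X" "Pi\<^sub>E UNIV X \<subseteq> U"
    using x U(2) unfolding openin_product_topology_alt by simp metis
  have "\<exists>e>0. \<forall>t. \<bar>t - x i\<bar> < e \<longrightarrow> t \<in> X i" for i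
    using X(1)[of i] X(2) by (auto simp: open_dist dist_real_def)
  then obtain e where e: "\<And>i. e i > 0" "\<And>i t. \<bar>t - x i\<bar> < e i \<Longrightarrow> t \<in> X i" by metis
  \<comment> \<open>Only the \<open>p\<close> free coordinates constrain the radius; the 1 keeps the
    set nonempty when \<open>p = 0\<close>.\<close>
  define r where "r = Min (insert 1 (e ` {..<p}))"
  have "r > 0" using e(1) by (auto simp: r_def)
  moreover have "r \<le> e i" if "i < p" for i using that by (auto simp: r_def intro!: Min_le)
  moreover have "x i = 0" if "p \<le> i" for i using Euclidean_space_eq_0[OF V x that] .
  ultimately have "cube p x r \<subseteq> V"
    using e(2) X(3) unfolding U(2) cube_def
    by (auto simp: subset_iff) (metis e(1) abs_zero diff_self less_le_trans not_le_imp_less PiE_UNIV_domain Pi_I)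
  thus ?thesis using \<open>r > 0\<close> by blast
qed

lemma mem_cube [simp]: "openin (Euclidean_space p) V \<Longrightarrow> x \<in> V \<Longrightarrow> 0 < r \<Longrightarrow> x \<in> cube p x r"
  by (simp add: cube_def Euclidean_space_eq_0)

lemma eventually_update_in:
  assumes "openin (Euclidean_space p) V" "x \<in> V" "i < p"
  shows "\<forall>\<^sub>F t in nhds (x i). x(i := t) \<in> V"
proof -
  obtain r where r: "r > 0" "cube p x r \<subseteq> V" using cube_subset_open[OF assms(1,2)] by blast
  have "\<forall>\<^sub>F t in nhds (x i). \<bar>t - x i\<bar> < r"
    using r(1) by (auto simp: eventually_nhds_metric dist_real_def)
  thus ?thesis
    by eventually_elim (use r assms Euclidean_space_eq_0[OF assms(1,2)] in \<open>auto simp: cube_def subset_iff\<close>)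
qed

lemma partial_real_cong:
  assumes "openin (Euclidean_space p) V" "\<And>y. y \<in> V \<Longrightarrow> h y = h' y" "x \<in> V" "i < p"
  shows "partial_real i h x = partial_real i h' x"
    "(\<lambda>t. h (x(i := t))) differentiable at (x i) \<longleftrightarrow> (\<lambda>t. h' (x(i := t))) differentiable at (x i)"
proof -
  have ev: "\<forall>\<^sub>F t in nhds (x i). h (x(i := t)) = h' (x(i := t))"
    using eventually_update_in[OF assms(1,3,4)] by eventually_elim (use assms(2) in auto)
  show "partial_real i h x = partial_real i h' x"
    unfolding partial_real_def by (rule deriv_cong_ev[OF ev refl])
  have "((\<lambda>t. h (x(i := t))) has_real_derivative D) (at (x i)) \<longleftrightarrow> ((\<lambda>t. h' (x(i := t))) has_real_derivative D) (at (x i))" for D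
    by (rule DERIV_cong_ev[OF refl ev refl])
  thus "(\<lambda>t. h (x(i := t))) differentiable at (x i) \<longleftrightarrow> (\<lambda>t. h' (x(i := t))) differentiable at (x i)"
    by (simp add: real_differentiable_def)
qed

lemma Ck_on_cong:
  assumes "openin (Euclidean_space p) V" "\<And>y. y \<in> V \<Longrightarrow> h y = h' y"
  shows "Ck_on p k V h \<longleftrightarrow> Ck_on p k V h'"
  using assms(2)
proof (induction k arbitrary: h h')
  case 0
  thus ?case by (simp cong: continuous_on_cong)
next
  case (Suc k)
  have "continuous_on V h \<longleftrightarrow> continuous_on V h'" using Suc.prems by (simp cong: continuous_on_cong)
  moreover have "Ck_on p k V (partial_real i h) \<longleftrightarrow> Ck_on p k V (partial_real i h')" if "i < p" for i
    by (rule Suc.IH) (use partial_real_cong(1)[of p V h h'] assms(1) Suc.prems that in auto)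
  moreover have "(\<lambda>t. h (x(i := t))) differentiable at (x i) \<longleftrightarrow> (\<lambda>t. h' (x(i := t))) differentiable at (x i)"
    if "i < p" "x \<in> V" for i x
    by (rule partial_real_cong(2)[of p V h h']) (use assms(1) Suc.prems that in auto)
  ultimately show ?case by auto
qed

lemma Ck_on_subset: "Ck_on p k V h \<Longrightarrow> V' \<subseteq> V \<Longrightarrow> Ck_on p k V' h"
  by (induction k arbitrary: h) (auto intro: continuous_on_subset)

lemma Ck_on_SucD: "Ck_on p (Suc k) V h \<Longrightarrow> Ck_on p k V h"
proof (induction k arbitrary: h)
  case (Suc k)
  show ?case using Suc.IH Suc.prems
    unfolding Ck_on.simps(2)[of p "Suc k"] Ck_on.simps(2)[of p k V h] by blast
qed simp

lemma smooth_on_cong: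
  "openin (Euclidean_space p) V \<Longrightarrow> (\<And>y. y \<in> V \<Longrightarrow> h y = h' y) \<Longrightarrow> smooth_on p V h \<longleftrightarrow> smooth_on p V h'"
  unfolding smooth_on_def using Ck_on_cong by blast

lemma smooth_on_subset: "smooth_on p V h \<Longrightarrow> V' \<subseteq> V \<Longrightarrow> smooth_on p V' h"
  unfolding smooth_on_def using Ck_on_subset by blast

lemma smooth_on_continuous: "smooth_on p V h \<Longrightarrow> continuous_on V h"
  unfolding smooth_on_def using Ck_on.simps(1) by blast

lemma smooth_on_partial: "smooth_on p V h \<Longrightarrow> i < p \<Longrightarrow> smooth_on p V (partial_real i h)"
  unfolding smooth_on_def using Ck_on.simps(2) by blast

lemma Ck_on_DERIV:
  assumes "Ck_on p (Suc k) V h" "x \<in> V" "i < p"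
  shows "((\<lambda>t. h (x(i := t))) has_real_derivative partial_real i h x) (at (x i))"
  using assms by (auto simp: partial_real_def DERIV_deriv_iff_real_differentiable)

lemma smooth_on_DERIV:
  assumes "smooth_on p V h" "x \<in> V" "i < p"
  shows "((\<lambda>t. h (x(i := t))) has_real_derivative partial_real i h x) (at (x i))"
  using assms Ck_on_DERIV[of p 0 V h] unfolding smooth_on_def by blast

lemma smooth_on_DERIV':
  assumes "smooth_on p V h" "x(i := t) \<in> V" "i < p"
  shows "((\<lambda>t. h (x(i := t))) has_real_derivative partial_real i h (x(i := t))) (at t)"
  using smooth_on_DERIV[OF assms(1,2,3)] by simp

lemma partial_real_eqI:
  "((\<lambda>t. h (x(i := t))) has_real_derivative D) (at (x i)) \<Longrightarrow> partial_real i h x = D"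
  unfolding partial_real_def by (rule DERIV_imp_deriv)

text \<open>\<open>partial_real\<close> is controlled on \<open>V\<close> only, so the derivative
  may be given by any formula \<open>D\<close> that agrees with it there.\<close>

lemma Ck_on_SucI:
  assumes V: "openin (Euclidean_space p) V" and "continuous_on V h"
    and der: "\<And>i x. i < p \<Longrightarrow> x \<in> V \<Longrightarrow> ((\<lambda>t. h (x(i := t))) has_real_derivative D i x) (at (x i))"
    and "\<And>i. i < p \<Longrightarrow> Ck_on p k V (D i)"
  shows "Ck_on p (Suc k) V h"
proof -
  have "Ck_on p k V (partial_real i h)" if "i < p" for i
    using Ck_on_cong[OF V, of "partial_real i h" "D i" k] partial_real_eqI der that assms(4) by blast
  thus ?thesis using assms(2) der by (auto simp: real_differentiable_def)
qed

lemma Ck_on_const [simp]: "Ck_on p k V (\<lambda>x. c)"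
proof (induction k arbitrary: c)
  case (Suc k)
  have "partial_real i (\<lambda>x. c) = (\<lambda>x. 0)" for i by (rule ext) (simp add: partial_real_def)
  thus ?case using Suc by simp
qed simp

lemma Ck_on_coordinate: "Ck_on p k V (\<lambda>x. x j)"
proof (cases k)
  case (Suc l)
  have "partial_real i (\<lambda>x. x j) = (\<lambda>x. if i = j then 1 else 0)" for i
    by (rule ext, rule partial_real_eqI) (auto intro!: derivative_eq_intros)
  moreover have "(\<lambda>t. if j = i then t else x j) differentiable at (x i)" for i and x :: "nat \<Rightarrow> real"
    by (cases "j = i") auto
  ultimately show ?thesis using Suc by (auto intro!: continuous_on_subset[OF continuous_on_product_coordinates])
qed (auto intro!: continuous_on_subset[OF continuous_on_product_coordinates])

lemma Ck_on_add:
  assumes V: "openin (Euclidean_space p) V"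
  shows "Ck_on p k V f \<Longrightarrow> Ck_on p k V g \<Longrightarrow> Ck_on p k V (\<lambda>x. f x + g x)"
proof (induction k arbitrary: f g)
  case (Suc k)
  show ?case
  proof (rule Ck_on_SucI[OF V])
    show "((\<lambda>t. f (x(i := t)) + g (x(i := t))) has_real_derivative partial_real i f x + partial_real i g x) (at (x i))"
      if "i < p" "x \<in> V" for i x
      using that Suc.prems by (auto intro!: derivative_eq_intros Ck_on_DERIV simp del: Ck_on.simps)
  qed (use Suc in \<open>auto intro!: continuous_intros\<close>)
qed (auto intro!: continuous_intros)

lemma Ck_on_mult:
  assumes V: "openin (Euclidean_space p) V"
  shows "Ck_on p k V f \<Longrightarrow> Ck_on p k V g \<Longrightarrow> Ck_on p k V (\<lambda>x. f x * g x)"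
proof (induction k arbitrary: f g)
  case (Suc k)
  show ?case
  proof (rule Ck_on_SucI[OF V])
    show "((\<lambda>t. f (x(i := t)) * g (x(i := t))) has_real_derivative partial_real i f x * g x + partial_real i g x * f x) (at (x i))"
      if "i < p" "x \<in> V" for i x
      using DERIV_mult[OF Ck_on_DERIV[OF Suc.prems(1) that(2,1)] Ck_on_DERIV[OF Suc.prems(2) that(2,1)]]
      by (simp only: fun_upd_triv)
    show "Ck_on p k V (\<lambda>x. partial_real i f x * g x + partial_real i g x * f x)" if "i < p" for i
      using Suc.prems that Suc.prems[THEN Ck_on_SucD] by (intro Ck_on_add[OF V] Suc.IH) auto
  qed (use Suc in \<open>auto intro!: continuous_intros\<close>)
qed (auto intro!: continuous_intros)

lemma Ck_on_inverse:
  assumes V: "openin (Euclidean_space p) V" and nz: "\<And>x. x \<in> V \<Longrightarrow> f x \<noteq> 0"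
  shows "Ck_on p k V f \<Longrightarrow> Ck_on p k V (\<lambda>x. inverse (f x))"
proof (induction k)
  case (Suc k)
  show ?case
  proof (rule Ck_on_SucI[OF V])
    show "((\<lambda>t. inverse (f (x(i := t)))) has_real_derivative (-1) * (inverse (f x) * (partial_real i f x * inverse (f x)))) (at (x i))"
      if "i < p" "x \<in> V" for i x
    proof -
      have "f (x(i := x i)) \<noteq> 0" using nz that by simp
      from DERIV_inverse'[OF Ck_on_DERIV[OF Suc.prems that(2,1)] this] show ?thesis
        by (simp only: fun_upd_triv mult_minus1 mult.assoc)
    qed
    \<comment> \<open>The derivative of the reciprocal is a product of reciprocals and a derivative
      of \<open>f\<close>, so the induction hypothesis covers it at the lower order.\<close>
    show "Ck_on p k V (\<lambda>x. (-1) * (inverse (f x) * (partial_real i f x * inverse (f x))))" if "i < p" for i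
      using Suc.prems that Suc.prems[THEN Ck_on_SucD] by (intro Ck_on_mult[OF V] Suc.IH Ck_on_const) auto
  qed (use Suc nz in \<open>auto intro!: continuous_intros\<close>)
qed (use nz in \<open>auto intro!: continuous_intros\<close>)

lemma smooth_on_const [simp]: "smooth_on p V (\<lambda>x. c)" by (simp add: smooth_on_def)
lemma smooth_on_coordinate: "smooth_on p V (\<lambda>x. x j)" by (simp add: smooth_on_def Ck_on_coordinate)
lemma smooth_on_add: "openin (Euclidean_space p) V \<Longrightarrow> smooth_on p V f \<Longrightarrow> smooth_on p V g \<Longrightarrow> smooth_on p V (\<lambda>x. f x + g x)"
  by (simp add: smooth_on_def Ck_on_add)
lemma smooth_on_mult: "openin (Euclidean_space p) V \<Longrightarrow> smooth_on p V f \<Longrightarrow> smooth_on p V g \<Longrightarrow> smooth_on p V (\<lambda>x. f x * g x)"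
  by (simp add: smooth_on_def Ck_on_mult)
lemma smooth_on_inverse: "openin (Euclidean_space p) V \<Longrightarrow> smooth_on p V f \<Longrightarrow> (\<And>x. x \<in> V \<Longrightarrow> f x \<noteq> 0) \<Longrightarrow> smooth_on p V (\<lambda>x. inverse (f x))"
  by (simp add: smooth_on_def Ck_on_inverse)
lemma smooth_on_cmult: "openin (Euclidean_space p) V \<Longrightarrow> smooth_on p V f \<Longrightarrow> smooth_on p V (\<lambda>x. c * f x)"
  by (intro smooth_on_mult) auto
lemma smooth_on_uminus: "openin (Euclidean_space p) V \<Longrightarrow> smooth_on p V f \<Longrightarrow> smooth_on p V (\<lambda>x. - f x)"
  using smooth_on_cmult[of p V f "-1"] by simp
lemma smooth_on_diff: "openin (Euclidean_space p) V \<Longrightarrow> smooth_on p V f \<Longrightarrow> smooth_on p V g \<Longrightarrow> smooth_on p V (\<lambda>x. f x - g x)"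
  using smooth_on_add[of p V f "\<lambda>x. - g x"] smooth_on_uminus[of p V g] by simp
lemma smooth_on_sum:
  assumes "openin (Euclidean_space p) V" "\<And>a. a \<in> A \<Longrightarrow> smooth_on p V (f a)"
  shows "smooth_on p V (\<lambda>x. \<Sum>a\<in>A. f a x)"
  using assms(2) by (induction A rule: infinite_finite_induct) (auto intro!: smooth_on_add[OF assms(1)])

section \<open>Symmetry of second partial derivatives\<close>

lemma continuous_on_cube_nbhd:
  fixes g :: "(nat \<Rightarrow> real) \<Rightarrow> real"
  assumes "openin (Euclidean_space p) V" "x \<in> V" "continuous_on V g" "e > 0"
  shows "\<exists>r>0. cube p x r \<subseteq> V \<and> (\<forall>y\<in>cube p x r. \<bar>g y - g x\<bar> < e)"
proof -
  obtain T where T: "open T" "T \<inter> V = g -` ball (g x) e \<inter> V"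
    using assms(3) unfolding continuous_on_open_invariant by (metis open_ball)
  obtain U where U: "open U" "V = U \<inter> {x. \<forall>i\<ge>p. x i = 0}"
    using assms(1) by (auto simp: openin_Euclidean_space_iff)
  have "openin (Euclidean_space p) (T \<inter> V)"
    unfolding openin_Euclidean_space_iff using T(1) U by (intro exI[of _ "T \<inter> U"]) auto
  moreover have "x \<in> T \<inter> V" using assms T by auto
  ultimately obtain r where "r > 0" "cube p x r \<subseteq> T \<inter> V" using cube_subset_open by blast
  thus ?thesis using T(2) by (intro exI[of _ r]) (auto simp: dist_real_def subset_iff set_eq_iff abs_minus_commute)
qed

text \<open>The mean value theorem, first in direction \<open>i\<close> for the difference in
  direction \<open>j\<close>, then in direction \<open>j\<close>. The second difference does not
  change when \<open>i\<close> and \<open>j\<close> are exchanged, but the mixed derivative obtained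
  does.\<close>

lemma mixed_difference:
  assumes h: "smooth_on p V h" and ij: "i \<noteq> j" "i < p" "j < p" and e: "e > 0"
    and sq: "\<And>s t. x i \<le> s \<Longrightarrow> s \<le> x i + e \<Longrightarrow> x j \<le> t \<Longrightarrow> t \<le> x j + e \<Longrightarrow> x(i := s, j := t) \<in> V"
  shows "\<exists>s t. x i < s \<and> s < x i + e \<and> x j < t \<and> t < x j + e \<and>
    h (x(i := x i + e, j := x j + e)) - h (x(i := x i + e)) - h (x(j := x j + e)) + h x
      = e\<^sup>2 * partial_real j (partial_real i h) (x(i := s, j := t))"
proof -
  define F where "F = (\<lambda>s. h (x(i := s, j := x j + e)) - h (x(i := s, j := x j)))"
  have "\<exists>s>x i. s < x i + e \<and> F (x i + e) - F (x i) = (x i + e - x i) *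
     (partial_real i h (x(i := s, j := x j + e)) - partial_real i h (x(i := s, j := x j)))"
  proof (rule MVT2)
    fix s assume s: "x i \<le> s" "s \<le> x i + e"
    have *: "((\<lambda>s. h (x(i := s, j := t))) has_real_derivative partial_real i h (x(i := s, j := t))) (at s)"
      if "x j \<le> t" "t \<le> x j + e" for t
      using smooth_on_DERIV'[OF h, of "x(j := t)" i s] sq[OF s that] ij by (simp add: fun_upd_twist)
    show "(F has_real_derivative partial_real i h (x(i := s, j := x j + e)) - partial_real i h (x(i := s, j := x j))) (at s)"
      unfolding F_def by (intro DERIV_diff *) (use e in auto)
  qed (use e in auto)
  then obtain s where s: "x i < s" "s < x i + e" and F: "F (x i + e) - F (x i) = e *
     (partial_real i h (x(i := s, j := x j + e)) - partial_real i h (x(i := s, j := x j)))" by auto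
  have "\<exists>t>x j. t < x j + e \<and> partial_real i h (x(i := s, j := x j + e)) - partial_real i h (x(i := s, j := x j)) =
     (x j + e - x j) * partial_real j (partial_real i h) (x(i := s, j := t))"
  proof (rule MVT2)
    fix t assume t: "x j \<le> t" "t \<le> x j + e"
    show "((\<lambda>t. partial_real i h (x(i := s, j := t))) has_real_derivative partial_real j (partial_real i h) (x(i := s, j := t))) (at t)"
      by (rule smooth_on_DERIV'[OF smooth_on_partial[OF h]]) (use sq[of s t] s t ij in auto)
  qed (use e in auto)
  then obtain t where t: "x j < t" "t < x j + e" and G: "partial_real i h (x(i := s, j := x j + e)) - partial_real i h (x(i := s, j := x j)) =
     e * partial_real j (partial_real i h) (x(i := s, j := t))" by auto
  have "F (x i + e) - F (x i) = h (x(i := x i + e, j := x j + e)) - h (x(i := x i + e)) - h (x(j := x j + e)) + h x"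
  proof -
    have "x(i := x i + e, j := x j) = x(i := x i + e)" "x(i := x i, j := x j + e) = x(j := x j + e)"
      using ij by auto
    thus ?thesis by (simp add: F_def)
  qed
  thus ?thesis using F G s t by (intro exI[of _ s] exI[of _ t]) (simp add: power2_eq_square)
qed

text \<open>The second difference over a small square is \<open>e\<^sup>2\<close> times either mixed
  derivative, taken at two points of that square. If the two values at \<open>x\<close> were
  different, continuity would keep them apart.\<close>

lemma partial_real_commute:
  assumes V: "openin (Euclidean_space p) V" and h: "smooth_on p V h" and x: "x \<in> V" and ij: "i < p" "j < p"
  shows "partial_real i (partial_real j h) x = partial_real j (partial_real i h) x"
proof (rule ccontr)
  let ?A = "partial_real i (partial_real j h)" and ?B = "partial_real j (partial_real i h)"
  assume neq: "?A x \<noteq> ?B x"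
  hence "i \<noteq> j" by auto
  \<comment> \<open>Half the gap: open intervals of this radius around the two values are
    disjoint.\<close>
  define d where "d = \<bar>?A x - ?B x\<bar> / 2"
  have d: "d > 0" using neq by (simp add: d_def)
  have "continuous_on V ?A" "continuous_on V ?B"
    using h ij by (auto intro!: smooth_on_continuous smooth_on_partial)
  then obtain r1 r2 where r: "r1 > 0" "cube p x r1 \<subseteq> V" "\<And>y. y \<in> cube p x r1 \<Longrightarrow> \<bar>?A y - ?A x\<bar> < d"
    "r2 > 0" "cube p x r2 \<subseteq> V" "\<And>y. y \<in> cube p x r2 \<Longrightarrow> \<bar>?B y - ?B x\<bar> < d"
    using continuous_on_cube_nbhd[OF V x _ d] by meson
  define e where "e = min r1 r2 / 2"
  have e: "e > 0" "e < r1" "e < r2" using r by (auto simp: e_def)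
  have in_cube: "x(i := s, j := t) \<in> cube p x r1" "x(i := s, j := t) \<in> cube p x r2"
    if "x i \<le> s" "s \<le> x i + e" "x j \<le> t" "t \<le> x j + e" for s t
    using that e Euclidean_space_eq_0[OF V x] ij \<open>i \<noteq> j\<close> by (auto simp: cube_def)
  from mixed_difference[OF h \<open>i \<noteq> j\<close> ij e(1), of x] in_cube r
  obtain s t where 1: "x i < s" "s < x i + e" "x j < t" "t < x j + e"
    "h (x(i := x i + e, j := x j + e)) - h (x(i := x i + e)) - h (x(j := x j + e)) + h x = e\<^sup>2 * ?B (x(i := s, j := t))"
    by blast
  from mixed_difference[OF h not_sym[OF \<open>i \<noteq> j\<close>] ij(2,1) e(1), of x] in_cube r
  obtain t' s' where 2: "x i < s'" "s' < x i + e" "x j < t'" "t' < x j + e"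
    "h (x(j := x j + e, i := x i + e)) - h (x(j := x j + e)) - h (x(i := x i + e)) + h x = e\<^sup>2 * ?A (x(i := s', j := t'))"
    using fun_upd_twist[OF \<open>i \<noteq> j\<close>, of x] by (metis subsetD)
  have "e\<^sup>2 * ?B (x(i := s, j := t)) = e\<^sup>2 * ?A (x(i := s', j := t'))"
    using 1(5) 2(5) unfolding fun_upd_twist[OF \<open>i \<noteq> j\<close>, of x] by linarith
  hence "?B (x(i := s, j := t)) = ?A (x(i := s', j := t'))" using e by simp
  moreover have "\<bar>?B (x(i := s, j := t)) - ?B x\<bar> < d" using in_cube 1 r by auto
  moreover have "\<bar>?A (x(i := s', j := t')) - ?A x\<bar> < d" using in_cube 2 r by auto
  ultimately show False unfolding d_def by argo
qed

text \<open>Weighted average of \<open>h\<close> along the segment in direction \<open>i\<close>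
  from \<open>y(i := y0 i)\<close> to \<open>y\<close>. The weight \<open>s ^ m\<close> makes the
  family closed under differentiation: each derivative in direction \<open>i\<close> contributes a
  factor \<open>s\<close>.\<close>

definition segment_integral :: "(nat \<Rightarrow> real) \<Rightarrow> nat \<Rightarrow> nat \<Rightarrow> ((nat \<Rightarrow> real) \<Rightarrow> real) \<Rightarrow> (nat \<Rightarrow> real) \<Rightarrow> real" where
  "segment_integral y0 i m h y = integral (cbox 0 1) (\<lambda>s. s ^ m * h (y(i := y0 i + s * (y i - y0 i))))"

lemma cube_shrink:
  assumes "y \<in> cube p y0 r" "i < p" "0 \<le> s" "s \<le> 1"
  shows "y(i := y0 i + s * (y i - y0 i)) \<in> cube p y0 r"
proof -
  have "\<bar>s * (y i - y0 i)\<bar> \<le> \<bar>y i - y0 i\<bar>" using assms by (simp add: abs_mult mult_left_le_one_le)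
  thus ?thesis using assms by (auto simp: cube_def)
qed

lemma continuous_on_segment:
  assumes "continuous_on (cube p y0 r) h" "i < p"
  shows "continuous_on (cube p y0 r \<times> cbox 0 1) (\<lambda>(y, s). s ^ m * h (y(i := y0 i + s * (y i - y0 i))))"
proof -
  let ?A = "\<lambda>z :: (nat \<Rightarrow> real) \<times> real. (fst z)(i := y0 i + snd z * (fst z i - y0 i))"
  have c: "continuous_on S (\<lambda>z :: (nat \<Rightarrow> real) \<times> real. fst z j)" for S j
    by (rule continuous_on_compose2[OF continuous_on_product_coordinates continuous_on_fst[OF continuous_on_id]]) auto
  have "continuous_on (cube p y0 r \<times> cbox 0 1) ?A"
  proof (rule continuous_on_coordinatewise_then_product)
    show "continuous_on (cube p y0 r \<times> cbox 0 1) (\<lambda>z. ?A z j)" for j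
      by (cases "j = i") (auto intro!: continuous_intros c)
  qed
  hence "continuous_on (cube p y0 r \<times> cbox 0 1) (\<lambda>z. h (?A z))"
    by (rule continuous_on_compose2[OF assms(1)]) (use cube_shrink assms(2) in auto)
  thus ?thesis by (auto simp: case_prod_beta intro!: continuous_intros)
qed

text \<open>Differentiation under the integral sign yields an integral of the same family, so the
  order can be raised by induction with \<open>h\<close> and \<open>m\<close> arbitrary.\<close>

lemma Ck_on_segment_integral:
  assumes i: "i < p"
  shows "smooth_on p (cube p y0 r) h \<Longrightarrow> Ck_on p k (cube p y0 r) (segment_integral y0 i m h)"
proof (induction k arbitrary: h m)
  case 0
  show ?case unfolding Ck_on.simps segment_integral_def
    by (rule integral_continuous_on_param) (rule continuous_on_segment[OF smooth_on_continuous[OF 0] i])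
next
  case (Suc k)
  let ?m = "\<lambda>j. if j = i then Suc m else m"
  show ?case
  proof (rule Ck_on_SucI[OF openin_cube, where D = "\<lambda>j. segment_integral y0 i (?m j) (partial_real j h)"])
    show "continuous_on (cube p y0 r) (segment_integral y0 i m h)"
      unfolding segment_integral_def
      by (rule integral_continuous_on_param) (rule continuous_on_segment[OF smooth_on_continuous[OF Suc.prems] i])
    show "Ck_on p k (cube p y0 r) (segment_integral y0 i (?m j) (partial_real j h))" if "j < p" for j
      by (rule Suc.IH) (rule smooth_on_partial[OF Suc.prems that])
    fix j y assume j: "j < p" and y: "y \<in> cube p y0 r"
    let ?T = "ball (y0 j) r"
    let ?B = "\<lambda>t s. (y(j := t))(i := y0 i + s * ((y(j := t)) i - y0 i))"
    have T: "y(j := t) \<in> cube p y0 r" if "t \<in> ?T" for t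
      using y that j by (auto simp: cube_def dist_real_def)
    have yj: "y j \<in> ?T" using y j by (auto simp: cube_def dist_real_def abs_minus_commute)
    have "((\<lambda>t. integral (cbox 0 1) (\<lambda>s. s ^ m * h (?B t s))) has_real_derivative
       integral (cbox 0 1) (\<lambda>s. s ^ ?m j * partial_real j h (?B (y j) s))) (at (y j) within ?T)"
    proof (rule leibniz_rule_field_derivative[OF _ _ _ yj])
      fix t s :: real assume t: "t \<in> ?T" and s: "s \<in> cbox 0 1"
      have inB: "?B t s \<in> cube p y0 r" using cube_shrink[OF T[OF t] i] s by auto
      show "((\<lambda>t. s ^ m * h (?B t s)) has_real_derivative s ^ ?m j * partial_real j h (?B t s)) (at t within ?T)"
      proof (cases "j = i")
        case True
        have "((\<lambda>t. h (y(i := y0 i + s * (t - y0 i)))) has_real_derivative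
            partial_real i h (y(i := y0 i + s * (t - y0 i))) * s) (at t)"
          by (rule DERIV_chain2[OF smooth_on_DERIV'[OF Suc.prems _ i]])
             (use inB True in \<open>auto intro!: derivative_eq_intros\<close>)
        from DERIV_cmult[OF this, of "s ^ m"] show ?thesis
          using True by (auto intro: has_field_derivative_at_within simp: mult_ac)
      next
        case False
        let ?y = "y(i := y0 i + s * (y i - y0 i))"
        have "((\<lambda>t. h (?y(j := t))) has_real_derivative partial_real j h (?y(j := t))) (at t)"
          by (rule smooth_on_DERIV'[OF Suc.prems _ j])
             (use inB False in \<open>auto simp: fun_upd_twist\<close>)
        from DERIV_cmult[OF this, of "s ^ m"] show ?thesis
          using False by (auto intro: has_field_derivative_at_within simp: fun_upd_twist)
      qed
    next
      fix t assume t: "t \<in> ?T"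
      show "(\<lambda>s. s ^ m * h (?B t s)) integrable_on cbox 0 1"
        by (rule integrable_continuous)
           (rule continuous_on_compose2[OF continuous_on_segment[OF smooth_on_continuous[OF Suc.prems] i, of m],
             where f = "Pair (y(j := t))", unfolded prod.case], use T[OF t] in \<open>auto intro!: continuous_intros\<close>)
    next
      have "continuous_on (?T \<times> cbox 0 1) (\<lambda>z :: real \<times> real. (y(j := fst z), snd z))"
      proof (intro continuous_on_Pair continuous_on_coordinatewise_then_product)
        show "continuous_on (?T \<times> cbox 0 1) (\<lambda>z :: real \<times> real. (y(j := fst z)) l)" for l
          by (cases "l = j") (auto intro!: continuous_intros)
      qed (auto intro!: continuous_intros)
      hence "continuous_on (?T \<times> cbox 0 1) (\<lambda>z. (\<lambda>(y, s). s ^ ?m j * partial_real j h (y(i := y0 i + s * (y i - y0 i)))) (y(j := fst z), snd z))"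
        by (rule continuous_on_compose2[OF continuous_on_segment[OF smooth_on_continuous[OF smooth_on_partial[OF Suc.prems j]] i]])
           (use T in auto)
      thus "continuous_on (?T \<times> cbox 0 1) (\<lambda>(t, s). s ^ ?m j * partial_real j h (?B t s))"
        by (simp add: case_prod_beta)
    qed auto
    thus "((\<lambda>t. segment_integral y0 i m h (y(j := t))) has_real_derivative
        segment_integral y0 i (?m j) (partial_real j h) y) (at (y j))"
      unfolding segment_integral_def using at_within_open[OF yj open_ball] by simp
  qed
qed

text \<open>The fundamental theorem of calculus on the segment from \<open>y(i := y0 i)\<close> to
  \<open>y\<close>; the inner derivative \<open>y i - y0 i\<close> is the factor split off.\<close>

lemma Hadamard:
  assumes h: "smooth_on p (cube p y0 r) h" and i: "i < p"
  shows "smooth_on p (cube p y0 r) (segment_integral y0 i 0 (partial_real i h))"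
    and "y \<in> cube p y0 r \<Longrightarrow> h y = h (y(i := y0 i)) + (y i - y0 i) * segment_integral y0 i 0 (partial_real i h) y"
proof -
  show "smooth_on p (cube p y0 r) (segment_integral y0 i 0 (partial_real i h))"
    unfolding smooth_on_def[of _ _ "segment_integral _ _ _ _"]
    using Ck_on_segment_integral[OF i smooth_on_partial[OF h i]] by blast
  assume y: "y \<in> cube p y0 r"
  let ?A = "\<lambda>s. y(i := y0 i + s * (y i - y0 i))"
  have "((\<lambda>s. partial_real i h (?A s) * (y i - y0 i)) has_integral h (?A 1) - h (?A 0)) {0..1}"
  proof (rule fundamental_theorem_of_calculus)
    fix s :: real assume s: "s \<in> {0..1}"
    have "((\<lambda>s. h (?A s)) has_real_derivative partial_real i h (?A s) * (y i - y0 i)) (at s)"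
      by (rule DERIV_chain2[OF smooth_on_DERIV'[OF h _ i]])
         (use cube_shrink[OF y i, of s] s in \<open>auto intro!: derivative_eq_intros\<close>)
    thus "((\<lambda>s. h (?A s)) has_vector_derivative partial_real i h (?A s) * (y i - y0 i)) (at s within {0..1})"
      by (auto intro: has_vector_derivative_at_within simp: has_real_derivative_iff_has_vector_derivative)
  qed simp
  from integral_unique[OF this] show "h y = h (y(i := y0 i)) + (y i - y0 i) * segment_integral y0 i 0 (partial_real i h) y"
    by (simp add: segment_integral_def mult.commute)
qed

section \<open>Superfunctions on a superdomain\<close>

lemma minus_one_power_apply [simp]: "((-1) ^ k) x = ((-1) ^ k :: 'a :: ring_1)"
  by (induction k) simp_all

lemma sum_fun_apply: "(\<Sum>a\<in>A. f a) x = (\<Sum>a\<in>A. f a x)"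
  by (induction A rule: infinite_finite_induct) auto

lemma minus_one_power_commute: "f * ((-1) ^ k * g) = (-1) ^ k * (f * (g :: 'a :: ring_1))"
  by (induction k) (simp_all add: mult.assoc)

lemma restr_apply: "restr V f x = (if x \<in> V then f x else 0)"
  by (simp add: restr_def)

lemma restr_mult: "restr V (f * g) = restr V f * restr V g" by (auto simp: restr_def)
lemma restr_sign: "restr V ((-1) ^ k * f) = (-1) ^ k * restr V f" by (rule ext) (simp add: restr_apply)
lemma restr_sum: "restr V (\<Sum>a\<in>A. f a) = (\<Sum>a\<in>A. restr V (f a))" by (rule ext) (simp add: restr_apply sum_fun_apply)
lemma restr_0 [simp]: "restr V 0 = 0" by (auto simp: restr_apply)
lemma restr_restr: "V' \<subseteq> V \<Longrightarrow> restr V' (restr V f) = restr V' f" by (rule ext) (auto simp: restr_apply)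

definition tw :: "nat \<Rightarrow> superfun \<Rightarrow> superfun" where
  "tw n f = (\<lambda>x. twist n (f x))"

lemma has_parity_iff: "has_parity n f \<longleftrightarrow> (\<forall>x. gpar n (f x))"
  by (auto simp: has_parity_def part_def gpar_iff_parity_part fun_eq_iff)

lemma has_parity_part [simp]: "has_parity n (part n f)"
  by (simp add: has_parity_iff part_def)
lemma part_has_parity: "has_parity m f \<Longrightarrow> part n f = (if m mod 2 = n mod 2 then f else 0)"
  unfolding part_def has_parity_iff by (auto simp: parity_part_gpar[of m] fun_eq_iff)
lemma part_decomposition: "part 0 f + part 1 f = f"
  by (rule ext) (simp add: part_def parity_decomposition[simplified])
lemma has_parity_cong: "has_parity m f \<Longrightarrow> m mod 2 = n mod 2 \<Longrightarrow> has_parity n f"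
  unfolding has_parity_iff using gpar_cong by blast
lemma has_parity_0 [simp]: "has_parity n 0" by (simp add: has_parity_iff)
lemma has_parity_add: "has_parity n f \<Longrightarrow> has_parity n g \<Longrightarrow> has_parity n (f + g)"
  by (simp add: has_parity_iff gpar_add)
lemma has_parity_diff: "has_parity n f \<Longrightarrow> has_parity n g \<Longrightarrow> has_parity n (f - g)"
  by (simp add: has_parity_iff gpar_diff)
lemma has_parity_uminus: "has_parity n f \<Longrightarrow> has_parity n (- f)"
  by (simp add: has_parity_iff gpar_uminus)
lemma has_parity_sign: "has_parity n f \<Longrightarrow> has_parity n ((-1) ^ k * f)"
  by (simp add: has_parity_iff gpar_sign)
lemma has_parity_mult: "has_parity m f \<Longrightarrow> has_parity n g \<Longrightarrow> has_parity (m + n) (f * g)"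
  by (simp add: has_parity_iff gpar_mult)
lemma has_parity_sum: "(\<And>a. a \<in> A \<Longrightarrow> has_parity n (f a)) \<Longrightarrow> has_parity n (\<Sum>a\<in>A. f a)"
  by (induction A rule: infinite_finite_induct) (auto intro: has_parity_add)
lemma has_parity_restr: "has_parity n f \<Longrightarrow> has_parity n (restr V f)"
  by (simp add: has_parity_iff restr_apply)

lemma tw_has_parity: "has_parity m f \<Longrightarrow> tw n f = (-1) ^ (n * m) * f"
  by (rule ext) (simp add: tw_def has_parity_iff twist_gpar[of m])
lemma tw_zero [simp]: "tw 0 f = f" by (simp add: tw_def)

lemma superfun_commute: "has_parity m f \<Longrightarrow> has_parity n g \<Longrightarrow> f * g = (-1) ^ (m * n) * (g * f)"
  by (rule ext) (simp add: has_parity_iff grassmann_commute[of m _ n])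

lemma superfun_commute_even: "has_parity 0 f \<Longrightarrow> f * g = g * f"
  using superfun_commute[of 0 f 0 "part 0 g"] superfun_commute[of 0 f 1 "part 1 g"]
  by (metis (no_types) part_decomposition has_parity_part distrib_left distrib_right mult_zero_left power_0 mult_1)

lemma superfun_left_commute:
  "has_parity m f \<Longrightarrow> has_parity n g \<Longrightarrow> f * (g * h) = (-1) ^ (m * n) * (g * (f * h))"
  using superfun_commute[of m f n g] by (simp add: mult.assoc[symmetric])

text \<open>
  \<open>J\<close> is larger than \<open>{..<q}\<close> when auxiliary odd parameters are adjoined.
\<close>
definition sfun :: "nat \<Rightarrow> nat set \<Rightarrow> (nat \<Rightarrow> real) set \<Rightarrow> superfun set" where
  "sfun p J V = {f. (\<forall>x. x \<notin> V \<longrightarrow> f x = 0) \<and> (\<forall>x. gsupp J (f x)) \<and> (\<forall>I. smooth_on p V (\<lambda>x. coeff (f x) I))}"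

lemma gsupp_mult: assumes "gsupp J g" "gsupp J h" shows "gsupp J (g * h)"
  unfolding gsupp_def
proof (intro allI impI)
  fix I assume I: "\<not> I \<subseteq> J"
  show "coeff (g * h) I = 0"
  proof (cases "finite I")
    case True
    show ?thesis
    proof (subst coeff_mult[OF True], rule sum.neutral, rule ballI)
      fix K assume "K \<in> Pow I"
      hence "\<not> K \<subseteq> J \<or> \<not> I - K \<subseteq> J" using I by auto
      thus "merge_sign K (I - K) * coeff g K * coeff h (I - K) = 0"
        using assms unfolding gsupp_def by (metis mult_zero_right mult_zero_left)
    qed
  qed simp
qed

lemma gsupp_odd_deriv: "gsupp J g \<Longrightarrow> gsupp J (odd_deriv j g)"
  unfolding gsupp_def by (auto simp: coeff_odd_deriv)
lemma gsupp_parity_part: "gsupp J g \<Longrightarrow> gsupp J (parity_part n g)"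
  unfolding gsupp_def by (auto simp: coeff_parity_part)
lemma gsupp_of_real [simp]: "gsupp J (of_real r)" by (simp add: gsupp_def coeff_of_real)
lemma gsupp_1 [simp]: "gsupp J 1" by (simp add: gsupp_def coeff_one)

lemma sfun_mono: "f \<in> sfun p J V \<Longrightarrow> J \<subseteq> K \<Longrightarrow> f \<in> sfun p K V"
  by (auto simp: sfun_def intro: gsupp_mono)

lemma sfun_outside: "f \<in> sfun p J V \<Longrightarrow> x \<notin> V \<Longrightarrow> f x = 0" by (simp add: sfun_def)
lemma restr_sfun: "f \<in> sfun p J V \<Longrightarrow> restr V f = f"
  by (rule ext) (simp add: restr_apply sfun_outside)
lemma sfun_smooth: "f \<in> sfun p J V \<Longrightarrow> smooth_on p V (\<lambda>x. coeff (f x) I)" by (simp add: sfun_def)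

definition const_fun :: "(nat \<Rightarrow> real) set \<Rightarrow> grassmann \<Rightarrow> superfun" where
  "const_fun V c = restr V (\<lambda>_. c)"

lemma restr_one: "restr V 1 = const_fun V 1" by (simp add: const_fun_def restr_def fun_eq_iff)

lemma unit_mult_sfun: "f \<in> sfun p J V \<Longrightarrow> restr V 1 * f = f" "f \<in> sfun p J V \<Longrightarrow> f * restr V 1 = f"
  by (auto simp: restr_def fun_eq_iff sfun_outside)

lemma part_linear: "part n (f + g) = part n f + part n g"
  by (rule ext) (auto simp: part_def intro!: grassmann_eqI simp: coeff_parity_part)
lemma part_zero [simp]: "part n 0 = 0"
  by (rule ext) (auto simp: part_def intro!: grassmann_eqI simp: coeff_parity_part)
lemma part_sum: "part n (\<Sum>a\<in>A. f a) = (\<Sum>a\<in>A. part n (f a))"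
proof (induction A rule: infinite_finite_induct)
  case (insert x F)
  show ?case unfolding sum.insert[OF insert.hyps] part_linear insert.IH ..
next
  case (infinite A)
  show ?case unfolding sum.infinite[OF infinite] by (rule part_zero)
next
  case empty
  show ?case unfolding sum.empty by (rule part_zero)
qed

section \<open>Calculus on an open superdomain\<close>

locale open_domain =
  fixes p :: nat and V :: "(nat \<Rightarrow> real) set"
  assumes open_V: "openin (Euclidean_space p) V"
begin

abbreviation D where "D a \<equiv> partial p V a"

text \<open>A coefficient at an index set outside \<open>{..<q}\<close> is zero on \<open>V\<close>,
  hence smooth. So \<open>sfun\<close> can ask for smoothness at every index set and still describe
  the same functions.\<close>

lemma superfuns_eq_sfun: "superfuns p q V = sfun p {..<q} V"
proof -
  have "gsupp {..<q} (f x)" if "f \<in> superfuns p q V" for f x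
    using that unfolding superfuns_def gsupp_def by (cases "x \<in> V") auto
  moreover have "smooth_on p V (\<lambda>x. coeff (f x) I)" if "f \<in> superfuns p q V" for f I
  proof (cases "I \<subseteq> {..<q}")
    case False
    hence "smooth_on p V (\<lambda>x. coeff (f x) I) \<longleftrightarrow> smooth_on p V (\<lambda>x. 0)"
      using that by (intro smooth_on_cong open_V) (auto simp: superfuns_def)
    thus ?thesis by simp
  qed (use that in \<open>simp add: superfuns_def\<close>)
  moreover have "f x = 0" if "f \<in> superfuns p q V" "x \<notin> V" for f x
    using that by (simp add: superfuns_def)
  ultimately have "superfuns p q V \<subseteq> sfun p {..<q} V" unfolding sfun_def by blast
  moreover have "sfun p {..<q} V \<subseteq> superfuns p q V"
    unfolding sfun_def superfuns_def gsupp_def by blast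
  ultimately show ?thesis by blast
qed

lemma sfun_0 [simp]: "0 \<in> sfun p J V" by (simp add: sfun_def)
lemma sfun_add: "f \<in> sfun p J V \<Longrightarrow> g \<in> sfun p J V \<Longrightarrow> f + g \<in> sfun p J V"
  by (auto simp: sfun_def intro!: smooth_on_add open_V gsupp_add)
lemma sfun_sign: "f \<in> sfun p J V \<Longrightarrow> (-1) ^ k * f \<in> sfun p J V"
  by (auto simp: sfun_def gsupp_def intro!: smooth_on_cmult open_V)
lemma sfun_uminus: "f \<in> sfun p J V \<Longrightarrow> - f \<in> sfun p J V"
  using sfun_sign[of f J 1] by simp
lemma sfun_diff: "f \<in> sfun p J V \<Longrightarrow> g \<in> sfun p J V \<Longrightarrow> f - g \<in> sfun p J V"
  using sfun_add[of f J "- g"] sfun_uminus by simp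
lemma sfun_sum: "(\<And>a. a \<in> A \<Longrightarrow> f a \<in> sfun p J V) \<Longrightarrow> (\<Sum>a\<in>A. f a) \<in> sfun p J V"
  by (induction A rule: infinite_finite_induct) (auto intro: sfun_add)
lemma sfun_mult: "f \<in> sfun p J V \<Longrightarrow> g \<in> sfun p J V \<Longrightarrow> f * g \<in> sfun p J V"
proof -
  assume f: "f \<in> sfun p J V" and g: "g \<in> sfun p J V"
  have "smooth_on p V (\<lambda>x. coeff ((f * g) x) K)" for K
  proof (cases "finite K")
    case True
    have "smooth_on p V (\<lambda>x. \<Sum>I\<in>Pow K. merge_sign I (K - I) * coeff (f x) I * coeff (g x) (K - I))"
      by (intro smooth_on_sum smooth_on_mult open_V sfun_smooth[OF f] sfun_smooth[OF g] smooth_on_const)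
    thus ?thesis by (simp add: coeff_mult[OF True])
  qed simp
  thus ?thesis using f g by (auto simp: sfun_def intro: gsupp_mult)
qed
lemma sfun_part: "f \<in> sfun p J V \<Longrightarrow> part n f \<in> sfun p J V"
proof -
  assume f: "f \<in> sfun p J V"
  have "smooth_on p V (\<lambda>x. coeff (part n f x) I)" for I
    using sfun_smooth[OF f, of I] by (cases "card I mod 2 = n mod 2") (simp_all add: part_def coeff_parity_part)
  moreover have "parity_part n 0 = 0" by (rule grassmann_eqI) (simp add: coeff_parity_part)
  ultimately show ?thesis using f by (auto simp: sfun_def part_def gsupp_parity_part)
qed
lemma sfun_tw: "f \<in> sfun p J V \<Longrightarrow> tw n f \<in> sfun p J V"
  by (auto simp: sfun_def tw_def gsupp_def intro!: smooth_on_cmult open_V)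
lemma sfun_const_fun: "gsupp J c \<Longrightarrow> const_fun V c \<in> sfun p J V"
proof -
  assume c: "gsupp J c"
  have "smooth_on p V (\<lambda>x. coeff (const_fun V c x) I) \<longleftrightarrow> smooth_on p V (\<lambda>x. coeff c I)" for I
    by (rule smooth_on_cong[OF open_V]) (simp add: const_fun_def restr_apply)
  thus ?thesis using c by (auto simp: sfun_def const_fun_def restr_apply)
qed
lemma sfun_unit: "restr V 1 \<in> sfun p J V"
  unfolding restr_one by (rule sfun_const_fun) simp
lemma sfun_coordinate:
  assumes "\<And>j. a = p + j \<Longrightarrow> j \<in> J" shows "coordinate p V a \<in> sfun p J V"
proof (cases "a < p")
  case True
  have "smooth_on p V (\<lambda>x. coeff (coordinate p V a x) I) \<longleftrightarrow> smooth_on p V (\<lambda>x. if I = {} then x a else 0)" for I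
    by (rule smooth_on_cong[OF open_V]) (use True in \<open>simp add: coordinate_def restr_apply coeff_of_real\<close>)
  moreover have "smooth_on p V (\<lambda>x. if I = {} then x a else 0)" for I :: "nat set"
    by (cases "I = {}") (auto simp: smooth_on_coordinate)
  ultimately show ?thesis using True by (auto simp: sfun_def coordinate_def restr_apply)
next
  case False
  hence "coordinate p V a = const_fun V (generator (a - p))"
    by (auto simp: coordinate_def const_fun_def)
  thus ?thesis using sfun_const_fun[of J "generator (a - p)"] gsupp_generator[of "a - p" J] assms[of "a - p"] False by simp
qed

lemma has_parity_coordinate: "has_parity (parity p a) (coordinate p V a)"
  using gpar_generator by (auto simp: has_parity_iff coordinate_def restr_apply parity_def)

lemma coeff_D_even: "a < p \<Longrightarrow> x \<in> V \<Longrightarrow> coeff (D a f x) I = partial_real a (\<lambda>y. coeff (f y) I) x"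
  unfolding partial_def restr_apply
  by (simp, subst coeff_Abs) (auto simp: partial_real_def)

lemma D_outside: "x \<notin> V \<Longrightarrow> D a f x = 0" by (simp add: partial_def restr_apply)
lemma D_odd: "\<not> a < p \<Longrightarrow> x \<in> V \<Longrightarrow> D a f x = odd_deriv (a - p) (f x)"
  by (simp add: partial_def restr_apply)

lemma D_eqI: "(\<And>x I. x \<in> V \<Longrightarrow> a < p \<Longrightarrow> finite I \<Longrightarrow> partial_real a (\<lambda>y. coeff (f y) I) x = coeff (g x) I) \<Longrightarrow>
   (\<And>x. x \<in> V \<Longrightarrow> \<not> a < p \<Longrightarrow> odd_deriv (a - p) (f x) = g x) \<Longrightarrow> (\<And>x. x \<notin> V \<Longrightarrow> g x = 0) \<Longrightarrow> D a f = g"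
proof (rule ext)
  fix x
  assume *: "\<And>x I. x \<in> V \<Longrightarrow> a < p \<Longrightarrow> finite I \<Longrightarrow> partial_real a (\<lambda>y. coeff (f y) I) x = coeff (g x) I"
   "\<And>x. x \<in> V \<Longrightarrow> \<not> a < p \<Longrightarrow> odd_deriv (a - p) (f x) = g x" "\<And>x. x \<notin> V \<Longrightarrow> g x = 0"
  show "D a f x = g x"
  proof (cases "x \<in> V \<and> a < p")
    case True
    thus ?thesis by (intro grassmann_eqI) (simp add: coeff_D_even *)
  next
    case False
    thus ?thesis using * by (cases "x \<in> V") (auto simp: D_outside D_odd)
  qed
qed

lemma sfun_D: "f \<in> sfun p J V \<Longrightarrow> D a f \<in> sfun p J V"
proof -
  assume f: "f \<in> sfun p J V"
  have s: "smooth_on p V (\<lambda>x. coeff (D a f x) I)" for I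
  proof (cases "a < p")
    case True
    have "smooth_on p V (\<lambda>x. coeff (D a f x) I) \<longleftrightarrow> smooth_on p V (partial_real a (\<lambda>y. coeff (f y) I))"
      by (rule smooth_on_cong[OF open_V]) (simp add: coeff_D_even True)
    thus ?thesis using smooth_on_partial[OF sfun_smooth[OF f] True] by simp
  next
    case False
    have "smooth_on p V (\<lambda>x. coeff (D a f x) I) \<longleftrightarrow> smooth_on p V (\<lambda>x. (if finite I \<and> a - p \<notin> I
      then (-1) ^ card {i \<in> I. i < a - p} else 0) * coeff (f x) (insert (a - p) I))"
      by (rule smooth_on_cong[OF open_V]) (simp add: D_odd False coeff_odd_deriv)
    moreover have "smooth_on p V (\<lambda>x. (if finite I \<and> a - p \<notin> I
      then (-1) ^ card {i \<in> I. i < a - p} else 0) * coeff (f x) (insert (a - p) I))"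
      by (rule smooth_on_cmult[OF open_V sfun_smooth[OF f]])
    ultimately show ?thesis by simp
  qed
  have "gsupp J (D a f x)" for x
  proof (cases "x \<in> V \<and> a < p")
    case True
    have "coeff (D a f x) I = 0" if "\<not> I \<subseteq> J" for I
    proof -
      have "(\<lambda>y. coeff (f y) I) = (\<lambda>y. 0)" using f that by (auto simp: sfun_def gsupp_def)
      thus ?thesis using True by (simp add: coeff_D_even partial_real_def)
    qed
    thus ?thesis by (simp add: gsupp_def)
  next
    case False
    thus ?thesis using f by (cases "x \<in> V") (auto simp: D_outside D_odd sfun_def intro: gsupp_odd_deriv)
  qed
  thus ?thesis using s by (simp add: sfun_def D_outside)
qed

lemma coeff_DERIV:
  assumes "f \<in> sfun p J V" "x \<in> V" "a < p"
  shows "((\<lambda>t. coeff (f (x(a := t))) I) has_real_derivative coeff (D a f x) I) (at (x a))"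
  using smooth_on_DERIV[OF sfun_smooth[OF assms(1)] assms(2,3)] assms by (simp add: coeff_D_even)

lemma has_parity_D: "has_parity m f \<Longrightarrow> has_parity (parity p a + m) (D a f)"
proof (cases "a < p")
  case True
  assume f: "has_parity m f"
  have "coeff (D a f x) I = 0" if "finite I" "card I mod 2 \<noteq> m mod 2" "x \<in> V" for x I
  proof -
    have "(\<lambda>y. coeff (f y) I) = (\<lambda>y. 0)" using f that by (auto simp: has_parity_iff gpar_def)
    thus ?thesis using True that by (simp add: coeff_D_even partial_real_def)
  qed
  moreover have "D a f x = 0" if "x \<notin> V" for x using that by (simp add: D_outside)
  ultimately have "gpar m (D a f x)" for x by (cases "x \<in> V") (auto simp: gpar_def)
  thus ?thesis using True by (simp add: has_parity_iff parity_def)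
next
  case False
  assume f: "has_parity m f"
  have "gpar (m + 1) (D a f x)" for x
    using f gpar_odd_deriv[of m "f x" "a - p"] by (cases "x \<in> V") (simp_all add: D_outside D_odd False has_parity_iff)
  thus ?thesis using False by (simp add: has_parity_iff parity_def)
qed

lemma D_0 [simp]: "D a 0 = 0"
  by (rule D_eqI) (auto simp: partial_real_def)

lemma D_add: "f \<in> sfun p J V \<Longrightarrow> g \<in> sfun p J V \<Longrightarrow> D a (f + g) = D a f + D a g"
  by (rule D_eqI) (auto simp: D_outside D_odd odd_deriv_add intro!: partial_real_eqI derivative_eq_intros coeff_DERIV)

lemma D_sign: "f \<in> sfun p J V \<Longrightarrow> D a ((-1) ^ k * f) = (-1) ^ k * D a f"
proof (rule D_eqI, goal_cases)
  case (1 x I)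
  show ?case using DERIV_cmult[OF coeff_DERIV[OF 1(1,2,3)], of "(-1) ^ k" I] by (intro partial_real_eqI) simp
next
  case (2 x)
  thus ?case by (intro grassmann_eqI) (simp add: D_odd coeff_odd_deriv)
qed (simp add: D_outside)

lemma D_uminus: "f \<in> sfun p J V \<Longrightarrow> D a (- f) = - D a f"
  using D_sign[of f J a 1] by simp

lemma D_diff: "f \<in> sfun p J V \<Longrightarrow> g \<in> sfun p J V \<Longrightarrow> D a (f - g) = D a f - D a g"
  using D_add[of f J "- g" a] D_uminus[of g J a] sfun_uminus[of g J] by simp

lemma D_sum: "(\<And>b. b \<in> A \<Longrightarrow> f b \<in> sfun p J V) \<Longrightarrow> D a (\<Sum>b\<in>A. f b) = (\<Sum>b\<in>A. D a (f b))"
  by (induction A rule: infinite_finite_induct) (auto simp: D_add[where J = J] sfun_sum)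

text \<open>In an even direction every coefficient of a product is a finite sum of products of real
  functions; in an odd direction this is \<open>odd_deriv_mult\<close> pointwise. \<open>tw\<close>
  carries the sign for factors that are not homogeneous.\<close>

lemma D_mult:
  assumes f: "f \<in> sfun p J V" and g: "g \<in> sfun p J V"
  shows "D a (f * g) = D a f * g + tw (parity p a) f * D a g"
proof (rule D_eqI, goal_cases)
  case (1 x I)
  have "((\<lambda>t. \<Sum>K\<in>Pow I. merge_sign K (I - K) * coeff (f (x(a := t))) K * coeff (g (x(a := t))) (I - K)) has_real_derivative
    (\<Sum>K\<in>Pow I. merge_sign K (I - K) * coeff (D a f x) K * coeff (g x) (I - K) +
        merge_sign K (I - K) * coeff (f x) K * coeff (D a g x) (I - K))) (at (x a))"
  proof (rule DERIV_sum)
    fix K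
    show "((\<lambda>t. merge_sign K (I - K) * coeff (f (x(a := t))) K * coeff (g (x(a := t))) (I - K)) has_real_derivative
       merge_sign K (I - K) * coeff (D a f x) K * coeff (g x) (I - K) +
        merge_sign K (I - K) * coeff (f x) K * coeff (D a g x) (I - K)) (at (x a))"
      using DERIV_mult[OF DERIV_cmult[OF coeff_DERIV[OF f 1(1,2), of K], of "merge_sign K (I - K)"] coeff_DERIV[OF g 1(1,2), of "I - K"]]
      by (simp only: fun_upd_triv mult_ac)
  qed
  thus ?case
    using 1 by (intro partial_real_eqI) (simp add: coeff_mult sum.distrib parity_def)
next
  case (2 x)
  thus ?case by (simp add: odd_deriv_mult D_odd tw_def parity_def)
qed (simp add: D_outside)

lemma D_mult_parity:
  assumes "f \<in> sfun p J V" "g \<in> sfun p J V" "has_parity m f"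
  shows "D a (f * g) = D a f * g + (-1) ^ (parity p a * m) * (f * D a g)"
  unfolding D_mult[OF assms(1,2)] tw_has_parity[OF assms(3)] by (simp add: mult.assoc)

text \<open>Two even directions commute by the symmetry of second derivatives, two odd ones
  anticommute in the Grassmann algebra; in the mixed case the odd derivative only rearranges
  coefficients with constant signs.\<close>

lemma D_commute:
  assumes f: "f \<in> sfun p J V"
  shows "D a (D b f) = (-1) ^ (parity p a * parity p b) * D b (D a f)"
proof -
  have mixed: "D a (D b f) = D b (D a f)" if a: "a < p" and b: "\<not> b < p" for a b
  proof (rule D_eqI, goal_cases)
    case (1 x I)
    let ?s = "if finite I \<and> b - p \<notin> I then (-1) ^ card {i \<in> I. i < b - p} else 0"
    have "((\<lambda>t. ?s * coeff (f (x(a := t))) (insert (b - p) I)) has_real_derivative ?s * coeff (D a f x) (insert (b - p) I)) (at (x a))"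
      by (rule DERIV_cmult[OF coeff_DERIV[OF f 1(1,2)]])
    hence "partial_real a (\<lambda>y. ?s * coeff (f y) (insert (b - p) I)) x = ?s * coeff (D a f x) (insert (b - p) I)"
      by (rule partial_real_eqI)
    moreover have "partial_real a (\<lambda>y. coeff (D b f y) I) x = partial_real a (\<lambda>y. ?s * coeff (f y) (insert (b - p) I)) x"
      by (rule partial_real_cong[OF open_V _ 1(1,2)]) (simp add: D_odd b coeff_odd_deriv)
    ultimately show ?case by (simp add: D_odd b 1 coeff_odd_deriv)
  qed (use a in \<open>auto simp: D_outside\<close>)
  consider "a < p" "b < p" | "a < p" "\<not> b < p" | "\<not> a < p" "b < p" | "\<not> a < p" "\<not> b < p" by blast
  thus ?thesis
  proof cases
    case 1
    have "D a (D b f) = D b (D a f)"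
    proof (rule D_eqI, goal_cases)
      case (1 x I)
      have "partial_real a (\<lambda>y. coeff (D b f y) I) x = partial_real a (partial_real b (\<lambda>y. coeff (f y) I)) x"
        by (rule partial_real_cong[OF open_V _ 1(1)]) (use \<open>a < p\<close> \<open>b < p\<close> in \<open>auto simp: coeff_D_even\<close>)
      also have "\<dots> = partial_real b (partial_real a (\<lambda>y. coeff (f y) I)) x"
        by (rule partial_real_commute[OF open_V sfun_smooth[OF f] 1(1) \<open>a < p\<close> \<open>b < p\<close>])
      also have "\<dots> = partial_real b (\<lambda>y. coeff (D a f y) I) x"
        by (rule partial_real_cong[OF open_V _ 1(1)]) (use \<open>a < p\<close> \<open>b < p\<close> in \<open>auto simp: coeff_D_even\<close>)
      finally show ?case using \<open>b < p\<close> 1 by (simp add: coeff_D_even)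
    qed (use 1 in \<open>auto simp: D_outside\<close>)
    thus ?thesis using 1 by (simp add: parity_def)
  next
    case 2
    thus ?thesis using mixed[of a b] by (simp add: parity_def)
  next
    case 3
    thus ?thesis using mixed[of b a] by (simp add: parity_def)
  next
    case 4
    have "D a (D b f) x = - D b (D a f) x" for x
      by (cases "x \<in> V") (simp_all add: D_outside D_odd 4 odd_deriv_anticommute[of "a - p"])
    thus ?thesis using 4 by (simp add: parity_def fun_eq_iff)
  qed
qed

lemma D_const_fun: "D a (const_fun V c) = (if a < p then 0 else const_fun V (odd_deriv (a - p) c))"
proof (rule D_eqI, goal_cases)
  case (1 x I)
  have "partial_real a (\<lambda>y. coeff (const_fun V c y) I) x = partial_real a (\<lambda>y. coeff c I) x"
    by (rule partial_real_cong[OF open_V _ 1(1,2)]) (simp add: const_fun_def restr_apply)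
  thus ?case using 1 by (simp add: partial_real_def)
qed (auto simp: const_fun_def restr_apply)

lemma D_coordinate: "D a (coordinate p V b) = (if a = b then restr V 1 else 0)"
proof (cases "b < p")
  case False
  hence "coordinate p V b = const_fun V (generator (b - p))" by (auto simp: coordinate_def const_fun_def)
  hence "D a (coordinate p V b) = D a (const_fun V (generator (b - p)))" by simp
  also have "\<dots> = (if a = b then restr V 1 else 0)"
    unfolding D_const_fun odd_deriv_generator restr_one using False by (auto simp: const_fun_def restr_def fun_eq_iff)
  finally show ?thesis .
next
  case True
  show ?thesis
  proof (rule D_eqI, goal_cases)
    case (1 x I)
    have "partial_real a (\<lambda>y. coeff (coordinate p V b y) I) x = partial_real a (\<lambda>y. if I = {} then y b else 0) x"
      by (rule partial_real_cong[OF open_V _ 1(1,2)]) (use True in \<open>simp add: coordinate_def restr_apply coeff_of_real\<close>)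
    also have "\<dots> = (if a = b \<and> I = {} then 1 else 0)"
    proof (rule partial_real_eqI)
      have "((\<lambda>t. (x(a := t)) b) has_real_derivative (if a = b then 1 else 0)) (at (x a))"
        by (cases "a = b") auto
      thus "((\<lambda>t. if I = {} then (x(a := t)) b else 0) has_real_derivative (if a = b \<and> I = {} then 1 else 0)) (at (x a))"
        by (cases "I = {}") auto
    qed
    finally show ?case using 1 by (auto simp: restr_apply coeff_one)
  qed (use True in \<open>auto simp: coordinate_def restr_apply\<close>)
qed

lemma restr_sfun_subset:
  assumes "open_domain p V'" "V' \<subseteq> V" "f \<in> sfun p J V" shows "restr V' f \<in> sfun p J V'"
proof -
  interpret V': open_domain p V' by fact
  have "smooth_on p V' (\<lambda>x. coeff (restr V' f x) I) \<longleftrightarrow> smooth_on p V' (\<lambda>x. coeff (f x) I)" for I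
    by (rule smooth_on_cong[OF V'.open_V]) (simp add: restr_apply)
  thus ?thesis using assms smooth_on_subset[OF sfun_smooth[OF assms(3)] assms(2)]
    by (auto simp: sfun_def restr_apply)
qed

lemma D_restr:
  assumes "open_domain p V'" "V' \<subseteq> V" shows "partial p V' a (restr V' f) = restr V' (D a f)"
proof -
  interpret V': open_domain p V' by fact
  show ?thesis
  proof (rule V'.D_eqI, goal_cases)
    case (1 x I)
    have "partial_real a (\<lambda>y. coeff (restr V' f y) I) x = partial_real a (\<lambda>y. coeff (f y) I) x"
      by (rule partial_real_cong[OF V'.open_V _ 1(1,2)]) (simp add: restr_apply)
    thus ?case using 1 assms(2) by (auto simp: restr_apply coeff_D_even)
  qed (use assms(2) in \<open>auto simp: restr_apply D_odd\<close>)
qed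

end

lemma restr_coordinate: "V' \<subseteq> V \<Longrightarrow> restr V' (coordinate p V a) = coordinate p V' a"
  by (auto simp: coordinate_def restr_apply fun_eq_iff)

section \<open>Derivations of superfunctions\<close>

text \<open>The filtration by degree; for finitely many generators its members are the powers of the
  ideal generated by them.\<close>

definition gord :: "nat \<Rightarrow> grassmann \<Rightarrow> bool" where
  "gord k g \<longleftrightarrow> (\<forall>I. finite I \<longrightarrow> card I < k \<longrightarrow> coeff g I = 0)"

lemma gord_0 [simp]: "gord 0 g" by (simp add: gord_def)
lemma gord_zero [simp]: "gord k 0" by (simp add: gord_def)
lemma gord_1: "gord 1 g \<longleftrightarrow> coeff g {} = 0" by (auto simp: gord_def)
lemma gord_add: "gord k g \<Longrightarrow> gord k h \<Longrightarrow> gord k (g + h)" by (simp add: gord_def)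
lemma gord_twist: "gord k g \<Longrightarrow> gord k (twist n g)" by (simp add: gord_def)

lemma gord_mult: assumes "gord m g" "gord n h" shows "gord (m + n) (g * h)"
  unfolding gord_def
proof (intro allI impI)
  fix K :: "nat set" assume K: "finite K" "card K < m + n"
  show "coeff (g * h) K = 0"
  proof (subst coeff_mult[OF K(1)], rule sum.neutral, rule ballI)
    fix I assume I: "I \<in> Pow K"
    hence "finite I" "finite (K - I)" "card K = card I + card (K - I)" using K card_split[of K I] finite_subset by auto
    hence "coeff g I = 0 \<or> coeff h (K - I) = 0"
      using assms K(2) unfolding gord_def by (metis add_le_mono leI not_less)
    thus "merge_sign I (K - I) * coeff g I * coeff h (K - I) = 0" by auto
  qed
qed

text \<open>A product of more generators than \<open>K\<close> has elements contains a
  repetition.\<close>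

lemma gord_eq_0: "gord k g \<Longrightarrow> gsupp K g \<Longrightarrow> finite K \<Longrightarrow> card K < k \<Longrightarrow> g = 0"
  by (rule grassmann_eqI) (metis card_mono coeff_zero gord_def gsupp_def le_less_trans)

lemma coeff_generator_mult:
  assumes "finite K"
  shows "coeff (generator j * d) K = (if j \<in> K then merge_sign {j} (K - {j}) * coeff d (K - {j}) else 0)"
proof -
  have "coeff (generator j * d) K = (\<Sum>I\<in>Pow K. if I = {j} then merge_sign {j} (K - {j}) * coeff d (K - {j}) else 0)"
    unfolding coeff_mult[OF assms] by (rule sum.cong) (auto simp: coeff_generator)
  thus ?thesis using assms by (simp add: sum.delta)
qed

text \<open>Writes \<open>c\<close> as the generator times its left derivative plus a remainder,
  where neither the derivative nor the remainder contains the generator. Constants are treated in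
  this way by induction over the generators.\<close>

lemma grassmann_generator_split:
  assumes c: "gsupp (insert j J) c" and j: "j \<notin> J"
  shows "gsupp J (odd_deriv j c)" "gsupp J (c - generator j * odd_deriv j c)"
proof -
  show "gsupp J (odd_deriv j c)"
    unfolding gsupp_def
  proof (intro allI impI)
    fix I assume "\<not> I \<subseteq> J"
    hence "j \<notin> I \<longrightarrow> \<not> insert j I \<subseteq> insert j J" by auto
    thus "coeff (odd_deriv j c) I = 0" using c by (auto simp: coeff_odd_deriv gsupp_def)
  qed
  show "gsupp J (c - generator j * odd_deriv j c)"
    unfolding gsupp_def
  proof (intro allI impI)
    fix I assume I: "\<not> I \<subseteq> J"
    show "coeff (c - generator j * odd_deriv j c) I = 0"
    proof (cases "finite I")
      case True
      show ?thesis
      proof (cases "j \<in> I")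
        case True
        hence eq: "insert j (I - {j}) = I" by auto
        have "coeff (generator j * odd_deriv j c) I = coeff c I"
          using True \<open>finite I\<close> by (simp add: coeff_generator_mult coeff_odd_deriv merge_sign_singleton_left insert_absorb)
        thus ?thesis by simp
      next
        case False
        hence "\<not> I \<subseteq> insert j J" using I by auto
        thus ?thesis using c False \<open>finite I\<close> by (simp add: coeff_generator_mult gsupp_def)
      qed
    qed simp
  qed
qed

lemma gsupp_empty: "gsupp {} c \<Longrightarrow> c = of_real (coeff c {})"
  by (rule grassmann_eqI) (auto simp: gsupp_def coeff_of_real)

lemma const_fun_mult: "const_fun V (c * d) = const_fun V c * const_fun V d"
  by (auto simp: const_fun_def restr_apply fun_eq_iff)
lemma const_fun_add: "const_fun V (c + d) = const_fun V c + const_fun V d"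
  by (auto simp: const_fun_def restr_apply fun_eq_iff)
lemma coordinate_odd: "coordinate p V (p + j) = const_fun V (generator j)"
  by (auto simp: coordinate_def const_fun_def)

text \<open>
  By Hadamard's lemma \<open>f\<close> is a polynomial plus an element of an arbitrarily high power of the ideal
  generated by the coordinate differences. A derivation along \<open>t\<close> that kills the coordinates maps this
  power into terms of high degree in the finitely many generators of \<open>K\<close>, and these vanish.
\<close>
lemma derivation_eq_0:
  fixes e t :: "superfun \<Rightarrow> grassmann" and p :: nat and y0 :: "nat \<Rightarrow> real" and r :: real
  defines "U \<equiv> cube p y0 r"
  assumes r: "0 < r" and y0: "\<And>i. p \<le> i \<Longrightarrow> y0 i = 0" and J: "finite J" and K: "finite K"
    and e_add: "\<And>f g. f \<in> sfun p J U \<Longrightarrow> g \<in> sfun p J U \<Longrightarrow> e (f + g) = e f + e g"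
    and e_mult: "\<And>f g. f \<in> sfun p J U \<Longrightarrow> g \<in> sfun p J U \<Longrightarrow> e (f * g) = e f * t g + twist n (t f) * e g"
    and e_supp: "\<And>f. f \<in> sfun p J U \<Longrightarrow> gsupp K (e f)"
    and e_const: "\<And>c. e (const_fun U (of_real c)) = 0"
    and e_coord: "\<And>i. i < p \<Longrightarrow> e (coordinate p U i) = 0" "\<And>j. j \<in> J \<Longrightarrow> e (coordinate p U (p + j)) = 0"
    and t_coord: "\<And>i. i < p \<Longrightarrow> coeff (t (coordinate p U i - const_fun U (of_real (y0 i)))) {} = 0"
    and f: "f \<in> sfun p J U"
  shows "e f = 0"
proof -
  interpret open_domain p U by unfold_locales (simp add: U_def openin_cube)
  have e_diff: "e (f - g) = e f - e g" if "f \<in> sfun p J U" "g \<in> sfun p J U" for f g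
    using e_add[of "f - g" g] sfun_diff that by simp
  \<comment> \<open>Grassmann constants are generated by the odd coordinates and the real constants;
    one generator is split off at a time.\<close>
  have grass: "e (const_fun U c) = 0" if "J' \<subseteq> J" "gsupp J' c" for J' c
    using finite_subset[OF that(1) J] that
  proof (induction J' arbitrary: c rule: finite_induct)
    case empty
    show ?case using gsupp_empty[OF empty(2)] e_const by metis
  next
    case (insert j J')
    let ?d = "odd_deriv j c"
    note sp = grassmann_generator_split[OF insert.prems(2) insert.hyps(2)]
    have supp: "const_fun U (generator j) \<in> sfun p J U" "const_fun U ?d \<in> sfun p J U"
      "const_fun U (c - generator j * ?d) \<in> sfun p J U"
      using sp insert.prems by (auto intro!: sfun_const_fun gsupp_generator intro: gsupp_mono)
    have "const_fun U c = const_fun U (generator j) * const_fun U ?d + const_fun U (c - generator j * ?d)"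
      unfolding const_fun_mult[symmetric] const_fun_add[symmetric] by simp
    hence "e (const_fun U c) = e (const_fun U (generator j) * const_fun U ?d) + e (const_fun U (c - generator j * ?d))"
      using e_add[OF sfun_mult[OF supp(1,2)] supp(3)] by metis
    thus ?case using e_mult[OF supp(1,2)] insert.IH[OF _ sp(1)] insert.IH[OF _ sp(2)]
        insert.prems(1) e_coord(2)[of j] by (simp add: coordinate_odd)
  qed
  have "gord k (e f)" if "f \<in> sfun p J U" for f k
    using that
  proof (induction k arbitrary: f)
    case (Suc k)
    \<comment> \<open>The even coordinates are frozen at \<open>y0\<close> one after another. Each
      freezing changes \<open>e f\<close> only by an element of degree at least
      \<open>Suc k\<close>.\<close>
    have "\<exists>g\<in>sfun p J U. gord (Suc k) (e f - e g) \<and> (\<forall>x\<in>U. g x = f (\<lambda>j. if j < i then y0 j else x j))" if "i \<le> p" for i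
      using that
    proof (induction i)
      case 0
      show ?case by (rule bexI[OF _ Suc.prems]) simp
    next
      case (Suc i)
      from Suc.IH Suc.prems obtain g where g: "g \<in> sfun p J U" "gord (Suc k) (e f - e g)"
        "\<And>x. x \<in> U \<Longrightarrow> g x = f (\<lambda>j. if j < i then y0 j else x j)" by auto
      have i: "i < p" using Suc.prems by simp
      \<comment> \<open>The Hadamard quotient of \<open>g\<close> in direction \<open>i\<close>,
        formed coefficient by coefficient, so that \<open>g - z * h\<close> no longer depends on
        coordinate \<open>i\<close>.\<close>
      define h where "h = restr U (\<lambda>x. Abs_grassmann (\<lambda>I. segment_integral y0 i 0 (partial_real i (\<lambda>y. coeff (g y) I)) x))"
      have ch: "coeff (h x) I = segment_integral y0 i 0 (partial_real i (\<lambda>y. coeff (g y) I)) x" if "x \<in> U" for x I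
        using that unfolding h_def restr_apply
        by (simp, subst coeff_Abs) (auto simp: segment_integral_def partial_real_def)
      define z where "z = coordinate p U i - const_fun U (of_real (y0 i))"
      have z: "z \<in> sfun p J U" unfolding z_def using i by (intro sfun_diff sfun_coordinate sfun_const_fun) auto
      have "h \<in> sfun p J U"
      proof -
        have "smooth_on p U (\<lambda>x. coeff (h x) I)" for I
        proof -
          have "smooth_on p U (\<lambda>x. coeff (h x) I) \<longleftrightarrow> smooth_on p U (segment_integral y0 i 0 (partial_real i (\<lambda>y. coeff (g y) I)))"
            by (rule smooth_on_cong[OF open_V ch])
          thus ?thesis using Hadamard(1)[OF sfun_smooth[OF g(1), unfolded U_def] i] by (simp add: U_def)
        qed
        moreover have "gsupp J (h x)" for x
        proof (cases "x \<in> U")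
          case True
          have "coeff (h x) I = 0" if "\<not> I \<subseteq> J" for I
          proof -
            have "coeff (g y) I = 0" for y using g(1) that by (auto simp: sfun_def gsupp_def)
            thus ?thesis using ch[OF True] by (simp add: segment_integral_def partial_real_def)
          qed
          thus ?thesis by (simp add: gsupp_def)
        qed (simp add: h_def restr_apply)
        ultimately show ?thesis by (simp add: sfun_def h_def restr_apply)
      qed
      note zh = sfun_mult[OF z this]
      have val: "(g - z * h) x = g (x(i := y0 i))" if x: "x \<in> U" for x
      proof -
        have "z x = of_real (x i - y0 i)" using x i by (simp add: z_def coordinate_def const_fun_def restr_apply)
        hence "(z * h) x = (x i - y0 i) *\<^sub>R h x" by (simp add: of_real_def)
        moreover have "coeff (g x) I = coeff (g (x(i := y0 i))) I + (x i - y0 i) * coeff (h x) I" for I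
          using Hadamard(2)[OF sfun_smooth[OF g(1), unfolded U_def] i, of x I] x ch[OF x] by (simp add: U_def)
        ultimately show ?thesis by (intro grassmann_eqI) simp
      qed
      show ?case
      proof (intro bexI[of _ "g - z * h"] conjI ballI sfun_diff g(1) zh)
        have "e z = 0" unfolding z_def
          using e_diff[of "coordinate p U i" "const_fun U (of_real (y0 i))"] e_coord(1)[OF i] e_const i
          by (simp add: sfun_coordinate sfun_const_fun)
        hence "e (z * h) = twist n (t z) * e h" using e_mult[OF z \<open>h \<in> sfun p J U\<close>] by simp
        \<comment> \<open>Since \<open>t z\<close> has no body and \<open>e z = 0\<close>, the value
          of \<open>e\<close> on \<open>z * h\<close> gains one degree over that of
          \<open>e h\<close>.\<close>
        moreover have "gord 1 (t z)" unfolding gord_1 z_def by (rule t_coord[OF i])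
        ultimately have "gord (1 + k) (e (z * h))"
          using Suc.IH \<open>h \<in> sfun p J U\<close> \<open>\<And>f. f \<in> sfun p J U \<Longrightarrow> gord k (e f)\<close> by (simp only: gord_mult gord_twist)
        moreover have "e f - e (g - z * h) = (e f - e g) + e (z * h)"
          using e_diff[OF g(1) zh] by simp
        ultimately show "gord (Suc k) (e f - e (g - z * h))"
          using g(2) by (metis gord_add plus_1_eq_Suc)
      next
        fix x assume x: "x \<in> U"
        have "x(i := y0 i) \<in> U" using x i r by (auto simp: U_def cube_def)
        hence "g (x(i := y0 i)) = f (\<lambda>j. if j < i then y0 j else (x(i := y0 i)) j)" by (rule g(3))
        also have "(\<lambda>j. if j < i then y0 j else (x(i := y0 i)) j) = (\<lambda>j. if j < Suc i then y0 j else x j)"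
          by (auto simp: fun_eq_iff less_Suc_eq)
        finally show "(g - z * h) x = f (\<lambda>j. if j < Suc i then y0 j else x j)" unfolding val[OF x] .
      qed
    qed
    from this[of p] obtain g where g: "g \<in> sfun p J U" "gord (Suc k) (e f - e g)"
      "\<And>x. x \<in> U \<Longrightarrow> g x = f (\<lambda>j. if j < p then y0 j else x j)" by auto
    have "g x = f y0" if "x \<in> U" for x
    proof -
      have "(\<lambda>j. if j < p then y0 j else x j) = y0" using that y0 by (auto simp: U_def cube_def)
      thus ?thesis using g(3)[OF that] by simp
    qed
    hence "g = const_fun U (f y0)" using g(1) by (auto simp: const_fun_def restr_apply sfun_outside fun_eq_iff)
    moreover have "gsupp J (f y0)" using Suc.prems by (simp add: sfun_def)
    ultimately have "e g = 0" using grass by blast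
    thus ?case using g(2) by simp
  qed simp
  \<comment> \<open>The degree now exceeds the number of generators available to the values of
    \<open>e\<close>.\<close>
  thus ?thesis using gord_eq_0[of "Suc (card K)" "e f" K] e_supp f K by blast
qed

section \<open>The odd Laplace operator on a superdomain\<close>

declare plus_fun_apply [simp del] times_fun_apply [simp del] minus_apply [simp del] uminus_apply [simp del]

text \<open>A function instead of a product with \<open>(-1) ^ k\<close>, so that rewriting collects
  all signs of a term in one exponent, which is then compared modulo 2 by
  \<open>sg_cong\<close>.\<close>

definition sg :: "nat \<Rightarrow> 'a :: ring_1 \<Rightarrow> 'a" where "sg k f = (-1) ^ k * f"

lemma sg_0 [simp]: "sg 0 f = f" by (simp add: sg_def)
lemma sg_zero [simp]: "sg k 0 = 0" by (simp add: sg_def)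
lemma sg_mult_left [simp]: "sg k f * g = sg k (f * g)" by (simp add: sg_def mult.assoc)
lemma sg_mult_right [simp]: "f * sg k g = sg k (f * g)" unfolding sg_def by (rule minus_one_power_commute)
lemma sg_sg [simp]: "sg i (sg j f) = sg (i + j) f" by (simp add: sg_def power_add mult.assoc)
lemma sg_add: "sg k (f + g) = sg k f + sg k g" by (simp add: sg_def distrib_left)
lemma sg_minus: "sg k (- f) = - sg k f" by (simp add: sg_def)
lemma sg_diff: "sg k (f - g) = sg k f - sg k g" by (simp add: sg_def right_diff_distrib)
lemma sg_sum: "sg k (\<Sum>a\<in>A. f a) = (\<Sum>a\<in>A. sg k (f a))" by (simp add: sg_def sum_distrib_left)
lemma sg_cong: "even i = even j \<Longrightarrow> sg i f = sg j f" by (simp add: sg_def minus_one_power_iff)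
lemma sg_even: "even i \<Longrightarrow> sg i f = f" by (simp add: sg_def)
lemma sg_odd: "odd i \<Longrightarrow> sg i f = - f" by (simp add: sg_def)
lemma sg_eqD: "sg k f = sg k g \<Longrightarrow> f = g" unfolding sg_def by (metis sign_square)

lemma has_parity_sg: "has_parity n f \<Longrightarrow> has_parity n (sg k f)" unfolding sg_def by (rule has_parity_sign)
lemma sg_commute: "has_parity m f \<Longrightarrow> has_parity n g \<Longrightarrow> f * g = sg (m * n) (g * f)"
  unfolding sg_def by (rule superfun_commute)
lemma sg_left_commute: "has_parity m f \<Longrightarrow> has_parity n g \<Longrightarrow> f * (g * h) = sg (m * n) (g * (f * h))"
  unfolding sg_def by (rule superfun_left_commute)

lemma tw_sg: "has_parity m f \<Longrightarrow> tw n f = sg (n * m) f" unfolding sg_def by (rule tw_has_parity)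

lemma tw_add: "tw n (f + g) = tw n f + tw n g" by (rule ext) (simp add: tw_def twist_add plus_fun_apply)
lemma tw_part: "tw n f = part 0 f + sg n (part 1 f)"
  by (rule ext) (simp add: tw_def part_def twist_parity sg_def plus_fun_apply times_fun_apply)

text \<open>Only \<open>h\<close> has to be homogeneous: the sign differs on the two parts of
  \<open>f\<close>, and the twist supplies it.\<close>

lemma mult_tw_commute: "has_parity m h \<Longrightarrow> h * tw m f = f * h"
proof -
  assume h: "has_parity m h"
  have *: "h * tw m g = g * h" if "has_parity n g" for n g
    using sg_commute[OF h that] tw_sg[OF that, of m] by (simp add: sg_even)
  have "h * tw m f = h * tw m (part 0 f) + h * tw m (part 1 f)"
    by (metis part_decomposition tw_add distrib_left)
  also have "\<dots> = f * h"
    unfolding *[OF has_parity_part] by (metis part_decomposition distrib_right)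
  finally show ?thesis .
qed

text \<open>The left derivative in the generator recovers \<open>g\<close>, which does not contain
  it. This is how auxiliary parameters are removed.\<close>

lemma generator_mult_cancel:
  assumes "generator j * g = 0" "gsupp J g" "j \<notin> J" shows "g = 0"
proof -
  have "odd_deriv j (generator j * g) = g"
    using odd_deriv_gsupp[OF assms(2,3)] by (simp add: odd_deriv_mult odd_deriv_generator)
  thus ?thesis using assms(1) by simp
qed

lemma const_generator_mult_cancel:
  assumes "const_fun V (generator j) * f = 0" "f \<in> sfun p J V" "j \<notin> J" shows "f = 0"
proof (rule ext)
  fix x
  have "(const_fun V (generator j) * f) x = 0" using assms(1) by simp
  thus "f x = 0 x" using generator_mult_cancel[of j "f x" J] assms(2,3)
    by (cases "x \<in> V") (auto simp: const_fun_def restr_apply sfun_def times_fun_apply)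
qed

lemma has_parity_const_fun: "gpar m c \<Longrightarrow> has_parity m (const_fun V c)"
  by (simp add: has_parity_iff const_fun_def restr_apply)

context open_domain
begin

abbreviation s where "s a \<equiv> parity p a"

lemma sfun_sg: "f \<in> sfun p J V \<Longrightarrow> sg k f \<in> sfun p J V" unfolding sg_def by (rule sfun_sign)
lemma D_sg: "f \<in> sfun p J V \<Longrightarrow> D a (sg k f) = sg k (D a f)" unfolding sg_def by (rule D_sign)
lemma D_mult_sg: "f \<in> sfun p J V \<Longrightarrow> g \<in> sfun p J V \<Longrightarrow> has_parity m f \<Longrightarrow>
   D a (f * g) = D a f * g + sg (s a * m) (f * D a g)"
  unfolding sg_def by (rule D_mult_parity)
lemma D_swap: "f \<in> sfun p J V \<Longrightarrow> D a (D b f) = sg (s a * s b) (D b (D a f))"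
  unfolding sg_def by (rule D_commute)

lemma D_unit: "D a (restr V 1) = 0"
  unfolding restr_one D_const_fun using odd_deriv_of_real[of "a - p" 1] by (simp add: const_fun_def fun_eq_iff restr_def)

end

text \<open>The data of a chart before the Jacobi identity is imposed; the product rule and the
  coordinate change of the operator are proved at this level. The inverse of the density is a
  parameter, so that it restricts to smaller domains together with the density.\<close>

locale pre_poisson_domain = open_domain p V for p V +
  fixes q :: nat and S :: "nat \<Rightarrow> nat \<Rightarrow> superfun" and \<rho> \<rho>' :: superfun
  assumes S_sfun: "a < p + q \<Longrightarrow> b < p + q \<Longrightarrow> S a b \<in> sfun p {..<q} V"
    and S_parity: "a < p + q \<Longrightarrow> b < p + q \<Longrightarrow> has_parity (parity p a + parity p b + 1) (S a b)"
    and S_sym: "a < p + q \<Longrightarrow> b < p + q \<Longrightarrow> S a b = sg (parity p a * parity p b) (S b a)"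
    and rho_sfun: "\<rho> \<in> sfun p {..<q} V" and rho_inv_sfun: "\<rho>' \<in> sfun p {..<q} V"
    and rho_parity: "has_parity 0 \<rho>" and rho_inv: "\<rho> * \<rho>' = restr V 1"
begin

abbreviation I where "I \<equiv> {..<p + q}"

text \<open>The signs in the Hamiltonian field and in the divergence cancel, so one formula serves
  \<open>f\<close> of any parity; \<open>lap_sum_parts\<close> makes the link.\<close>

definition lap :: "superfun \<Rightarrow> superfun" where
  "lap f = \<rho>' * (\<Sum>a\<in>I. D a (\<rho> * (\<Sum>b\<in>I. S a b * D b f)))"

text \<open>
  The polarization of the operator, which is the bracket up to sign: \<open>{f,g} = - bra (tw 1 f) g\<close>.
\<close>
definition bra :: "superfun \<Rightarrow> superfun \<Rightarrow> superfun" where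
  "bra f g = (\<Sum>a\<in>I. \<Sum>b\<in>I. S a b * D b (tw (s a) f) * D a g)"

lemma rho_inv': "\<rho>' * \<rho> = restr V 1"
  using superfun_commute_even[OF rho_parity, of \<rho>'] rho_inv by simp

lemma rho_cancel: "f \<in> sfun p J V \<Longrightarrow> \<rho>' * (\<rho> * f) = f" "f \<in> sfun p J V \<Longrightarrow> \<rho> * (\<rho>' * f) = f"
  unfolding mult.assoc[symmetric] rho_inv rho_inv' by (auto simp: unit_mult_sfun)

text \<open>The density is even, hence central, and so is its inverse.\<close>

lemma rho_inv_commute: "f \<in> sfun p J V \<Longrightarrow> \<rho>' * f = f * \<rho>'"
proof -
  assume f: "f \<in> sfun p J V"
  have "sfun p J V \<subseteq> sfun p (J \<union> {..<q}) V" "sfun p {..<q} V \<subseteq> sfun p (J \<union> {..<q}) V"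
    using sfun_mono by blast+
  hence fr: "f * \<rho>' \<in> sfun p (J \<union> {..<q}) V" using f rho_inv_sfun by (intro sfun_mult) auto
  have "\<rho>' * f = \<rho>' * (f * (\<rho> * \<rho>'))" using unit_mult_sfun(2)[OF f] rho_inv by simp
  also have "\<dots> = \<rho>' * (\<rho> * (f * \<rho>'))" using superfun_commute_even[OF rho_parity, of f] by (simp add: mult.assoc[symmetric])
  also have "\<dots> = f * \<rho>'" by (rule rho_cancel(1)[OF fr])
  finally show ?thesis .
qed

text \<open>The odd part of the unit is zero and equals \<open>\<rho>\<close> times the odd part of
  \<open>\<rho>'\<close>; multiplication by \<open>\<rho>\<close> can be cancelled.\<close>

lemma rho_inv_parity: "has_parity 0 \<rho>'"
proof -
  have p1: "part 1 \<rho>' \<in> sfun p {..<q} V" by (rule sfun_part[OF rho_inv_sfun])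
  have "\<rho> * part 0 \<rho>' + \<rho> * part 1 \<rho>' = restr V 1"
    by (metis part_decomposition rho_inv distrib_left)
  hence "part 1 (\<rho> * part 0 \<rho>') + part 1 (\<rho> * part 1 \<rho>') = part 1 (restr V 1)"
    by (metis part_linear)
  moreover have "has_parity 0 (\<rho> * part 0 \<rho>')" "has_parity 1 (\<rho> * part 1 \<rho>')" "has_parity 0 (restr V 1)"
    using has_parity_mult[OF rho_parity has_parity_part[of 0]] has_parity_mult[OF rho_parity has_parity_part[of 1]]
    has_parity_const_fun[OF gpar_1, of V] by (simp_all add: restr_one)
  ultimately have "\<rho> * part 1 \<rho>' = 0"
    by (simp add: part_has_parity[of 0] part_has_parity[of 1])
  hence "part 1 \<rho>' = 0" using rho_cancel(1)[OF p1] by simp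
  hence "part 0 \<rho>' = \<rho>'" using part_decomposition[of \<rho>'] by simp
  thus ?thesis by (simp add: has_parity_def)
qed

definition act :: "(nat \<Rightarrow> superfun) \<Rightarrow> superfun \<Rightarrow> superfun" where
  "act X f = (\<Sum>a\<in>I. X a * D a f)"

text \<open>For a field of parity n the sign in the divergence is (-1)^(a(n+1)): it disappears for
  an odd field and is (-1)^a for an even one, whence two separate versions.\<close>

definition div_odd :: "(nat \<Rightarrow> superfun) \<Rightarrow> superfun" where
  "div_odd X = \<rho>' * (\<Sum>a\<in>I. D a (\<rho> * X a))"

definition div_even :: "(nat \<Rightarrow> superfun) \<Rightarrow> superfun" where
  "div_even X = \<rho>' * (\<Sum>a\<in>I. sg (s a) (D a (\<rho> * X a)))"

text \<open>The logarithmic derivative of the density.\<close>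

definition dlog :: "nat \<Rightarrow> superfun" where "dlog a = \<rho>' * D a \<rho>"

section \<open>Product rule of the operator and divergence of a commutator\<close>

context
  fixes J :: "nat set" assumes J: "{..<q} \<subseteq> J"
begin

lemma S_in: "a \<in> I \<Longrightarrow> b \<in> I \<Longrightarrow> S a b \<in> sfun p J V" using sfun_mono[OF S_sfun J] by simp
lemma rho_in: "\<rho> \<in> sfun p J V" "\<rho>' \<in> sfun p J V"
  using sfun_mono[OF rho_sfun J] sfun_mono[OF rho_inv_sfun J] by auto

lemma sfun_lap: "f \<in> sfun p J V \<Longrightarrow> lap f \<in> sfun p J V"
  unfolding lap_def by (intro sfun_mult sfun_sum sfun_D rho_in S_in)
lemma sfun_bra: "f \<in> sfun p J V \<Longrightarrow> g \<in> sfun p J V \<Longrightarrow> bra f g \<in> sfun p J V"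
  unfolding bra_def by (intro sfun_mult sfun_sum sfun_D rho_in S_in sfun_tw)

lemma lap_add: "f \<in> sfun p J V \<Longrightarrow> g \<in> sfun p J V \<Longrightarrow> lap (f + g) = lap f + lap g"
proof -
  assume f: "f \<in> sfun p J V" and g: "g \<in> sfun p J V"
  have "D a (\<rho> * (\<Sum>b\<in>I. S a b * D b (f + g))) = D a (\<rho> * (\<Sum>b\<in>I. S a b * D b f)) + D a (\<rho> * (\<Sum>b\<in>I. S a b * D b g))" if "a \<in> I" for a
  proof -
    have "\<rho> * (\<Sum>b\<in>I. S a b * D b (f + g)) = \<rho> * (\<Sum>b\<in>I. S a b * D b f) + \<rho> * (\<Sum>b\<in>I. S a b * D b g)"
      unfolding D_add[OF f g] by (simp add: distrib_left sum.distrib)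
    moreover have "\<rho> * (\<Sum>b\<in>I. S a b * D b f) \<in> sfun p J V" "\<rho> * (\<Sum>b\<in>I. S a b * D b g) \<in> sfun p J V"
      using that f g by (auto intro!: sfun_mult sfun_sum sfun_D rho_in S_in)
    ultimately show ?thesis by (simp only: D_add)
  qed
  thus ?thesis by (simp add: lap_def sum.distrib distrib_left)
qed

text \<open>Expanding both derivatives leaves two mixed terms, with the inner derivative on one
  factor and the outer one on the other. The symmetry of \<open>S\<close> makes both equal to
  \<open>bra f g\<close>, whence the factor 2.\<close>

lemma lap_mult:
  assumes f: "f \<in> sfun p J V" and g: "g \<in> sfun p J V" and m: "has_parity m f"
  shows "lap (f * g) = lap f * g + sg m (f * lap g) + 2 * bra f g"
proof -
  define F where "F a = (\<Sum>b\<in>I. S a b * D b f)" for a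
  define G where "G a = (\<Sum>b\<in>I. S a b * D b g)" for a
  have Fs: "F a \<in> sfun p J V" and Gs: "G a \<in> sfun p J V" if "a \<in> I" for a
    unfolding F_def G_def using that f g by (auto intro!: sfun_sum sfun_mult S_in sfun_D)
  have pF: "has_parity (s a + 1 + m) (F a)" if "a \<in> I" for a
    unfolding F_def
  proof (rule has_parity_sum)
    fix b assume "b \<in> I"
    hence "has_parity ((s a + s b + 1) + (s b + m)) (S a b * D b f)"
      using that m by (intro has_parity_mult S_parity has_parity_D) auto
    thus "has_parity (s a + 1 + m) (S a b * D b f)" by (rule has_parity_cong) presburger
  qed
  have inner: "(\<Sum>b\<in>I. S a b * D b (f * g)) = F a * g + sg ((s a + 1) * m) (f * G a)" if a: "a \<in> I" for a
  proof -
    have "S a b * D b (f * g) = S a b * D b f * g + sg ((s a + 1) * m) (f * (S a b * D b g))" if b: "b \<in> I" for b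
    proof -
      have "S a b * (f * D b g) = sg ((s a + s b + 1) * m) (f * (S a b * D b g))"
        using a b by (intro sg_left_commute S_parity m) auto
      thus ?thesis unfolding D_mult_sg[OF f g m]
        by (simp add: distrib_left mult.assoc) (rule sg_cong, auto)
    qed
    thus ?thesis by (simp add: F_def G_def sum.distrib sum_distrib_left sum_distrib_right sg_sum)
  qed
  have step: "D a (\<rho> * (\<Sum>b\<in>I. S a b * D b (f * g))) = D a (\<rho> * F a) * g + \<rho> * sg (s a * m) (F a * D a g)
     + \<rho> * sg ((s a + 1) * m) (D a f * G a) + sg m (f * D a (\<rho> * G a))" if a: "a \<in> I" for a
  proof -
    let ?k = "(s a + 1) * m"
    have "\<rho> * (F a * g + sg ?k (f * G a)) = (\<rho> * F a) * g + sg ?k (f * (\<rho> * G a))"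
      using superfun_commute_even[OF rho_parity, of f] by (simp add: distrib_left mult.assoc[symmetric])
    hence "D a (\<rho> * (\<Sum>b\<in>I. S a b * D b (f * g))) = D a ((\<rho> * F a) * g) + sg ?k (D a (f * (\<rho> * G a)))"
      unfolding inner[OF a] using a f g
      by (simp add: D_add[where J = J] D_sg[where J = J] sfun_mult sfun_sg Fs Gs rho_in)
    moreover have "D a ((\<rho> * F a) * g) = D a (\<rho> * F a) * g + sg (s a * (0 + (s a + 1 + m))) (\<rho> * F a * D a g)"
      using a by (intro D_mult_sg[where J = J] sfun_mult rho_in Fs g has_parity_mult rho_parity pF)
    moreover have "sg (s a * (0 + (s a + 1 + m))) (\<rho> * F a * D a g) = sg (s a * m) (\<rho> * F a * D a g)"
      by (rule sg_cong) auto
    moreover have "D a (f * (\<rho> * G a)) = D a f * (\<rho> * G a) + sg (s a * m) (f * D a (\<rho> * G a))"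
      using a by (intro D_mult_sg[where J = J] sfun_mult rho_in Gs f m)
    moreover have "D a f * (\<rho> * G a) = \<rho> * (D a f * G a)"
      using superfun_commute_even[OF rho_parity, of "D a f"] by (simp add: mult.assoc[symmetric])
    moreover have "sg ?k (sg (s a * m) (f * D a (\<rho> * G a))) = sg m (f * D a (\<rho> * G a))"
      unfolding sg_sg by (rule sg_cong) auto
    ultimately show ?thesis by (simp add: sg_add mult.assoc add.assoc)
  qed
  have sums: "(\<Sum>a\<in>I. D a (\<rho> * (\<Sum>b\<in>I. S a b * D b (f * g)))) = (\<Sum>a\<in>I. D a (\<rho> * F a) * g + \<rho> * sg (s a * m) (F a * D a g)
     + \<rho> * sg ((s a + 1) * m) (D a f * G a) + sg m (f * D a (\<rho> * G a)))"
    by (rule sum.cong[OF refl]) (rule step)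
  have "lap (f * g) = \<rho>' * (\<Sum>a\<in>I. D a (\<rho> * F a) * g) + \<rho>' * (\<rho> * (\<Sum>a\<in>I. sg (s a * m) (F a * D a g)))
     + \<rho>' * (\<rho> * (\<Sum>a\<in>I. sg ((s a + 1) * m) (D a f * G a))) + \<rho>' * (\<Sum>a\<in>I. sg m (f * D a (\<rho> * G a)))"
    unfolding lap_def sums by (simp only: sum.distrib distrib_left sum_distrib_left)
  also have "\<rho>' * (\<rho> * (\<Sum>a\<in>I. sg (s a * m) (F a * D a g))) = (\<Sum>a\<in>I. sg (s a * m) (F a * D a g))"
    by (rule rho_cancel(1)[where J = J], intro sfun_sum sfun_sg sfun_mult Fs sfun_D g)
  also have "\<rho>' * (\<rho> * (\<Sum>a\<in>I. sg ((s a + 1) * m) (D a f * G a))) = (\<Sum>a\<in>I. sg ((s a + 1) * m) (D a f * G a))"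
    by (rule rho_cancel(1)[where J = J], intro sfun_sum sfun_sg sfun_mult Gs sfun_D f)
  also have "\<rho>' * (\<Sum>a\<in>I. D a (\<rho> * F a) * g) = lap f * g"
    by (simp add: lap_def F_def sum_distrib_right mult.assoc)
  also have "\<rho>' * (\<Sum>a\<in>I. sg m (f * D a (\<rho> * G a))) = sg m (f * lap g)"
  proof -
    have "\<rho>' * (\<Sum>a\<in>I. sg m (f * D a (\<rho> * G a))) = sg m ((\<rho>' * f) * (\<Sum>a\<in>I. D a (\<rho> * G a)))"
      by (simp add: sg_sum[symmetric] sum_distrib_left[symmetric] mult.assoc)
    thus ?thesis unfolding rho_inv_commute[OF f] by (simp add: lap_def G_def mult.assoc)
  qed
  also have "(\<Sum>a\<in>I. sg (s a * m) (F a * D a g)) = bra f g"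
    unfolding bra_def tw_sg[OF m] D_sg[OF f] F_def by (simp add: sum_distrib_right sg_sum mult.assoc)
  also have "(\<Sum>a\<in>I. sg ((s a + 1) * m) (D a f * G a)) = bra f g"
  proof -
    have t: "sg ((s a + 1) * m) (D a f * (S a b * D b g)) = S b a * D a (tw (s b) f) * D b g" if a: "a \<in> I" and b: "b \<in> I" for a b
    proof -
      have "D a f * (S a b * D b g) = sg ((s a + m) * (s a + s b + 1)) (S a b * (D a f * D b g))"
        using a b by (intro sg_left_commute has_parity_D m S_parity) auto
      moreover have "S a b * (D a f * D b g) = sg (s a * s b) (S b a) * (D a f * D b g)"
        by (rule arg_cong[OF S_sym]) (use a b in auto)
      ultimately show ?thesis unfolding tw_sg[OF m] D_sg[OF f]
        by (simp add: mult.assoc) (rule sg_cong, auto)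
    qed
    have "(\<Sum>a\<in>I. sg ((s a + 1) * m) (D a f * G a)) = (\<Sum>a\<in>I. \<Sum>b\<in>I. S b a * D a (tw (s b) f) * D b g)"
      unfolding G_def sum_distrib_left sg_sum by (intro sum.cong refl t)
    also have "\<dots> = bra f g" unfolding bra_def by (rule sum.swap)
    finally show ?thesis .
  qed
  finally show ?thesis by (simp add: mult_2 add_ac)
qed

lemma sfun_dlog: "dlog a \<in> sfun p J V"
  unfolding dlog_def by (intro sfun_mult rho_in sfun_D)

lemma parity_dlog: "has_parity (s a) (dlog a)"
  unfolding dlog_def using has_parity_mult[OF rho_inv_parity has_parity_D[OF rho_parity, of a]] by simp

lemma D_rho_mult: "f \<in> sfun p J V \<Longrightarrow> \<rho>' * D a (\<rho> * f) = dlog a * f + D a f"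
proof -
  assume f: "f \<in> sfun p J V"
  have "D a (\<rho> * f) = D a \<rho> * f + \<rho> * D a f"
    using D_mult_sg[OF rho_in(1) f rho_parity, of a] by simp
  thus ?thesis using rho_cancel(1)[OF sfun_D[OF f]] by (simp add: distrib_left dlog_def mult.assoc)
qed

text \<open>Closedness of the logarithmic differential: \<open>dlog b * dlog a\<close> and the
  second derivative of the density are both graded symmetric.\<close>

lemma D_dlog: "D b (dlog a) = sg (s a * s b) (D a (dlog b))"
proof -
  have r: "D b \<rho>' = - (dlog b * \<rho>')" for b
  proof -
    have "0 = D b (\<rho> * \<rho>')" unfolding rho_inv by (simp add: D_unit)
    also have "\<dots> = D b \<rho> * \<rho>' + \<rho> * D b \<rho>'"
      using D_mult_sg[OF rho_in(1,2) rho_parity, of b] by simp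
    finally have "\<rho>' * (\<rho> * D b \<rho>') = \<rho>' * (- (D b \<rho> * \<rho>'))"
      by (metis add.inverse_unique)
    thus ?thesis using rho_cancel(1)[OF sfun_D[OF rho_in(2)]] by (simp add: dlog_def mult.assoc)
  qed
  have d: "D b (dlog a) = - (dlog b * dlog a) + \<rho>' * D b (D a \<rho>)" for a b
    using D_mult_sg[OF rho_in(2) sfun_D[OF rho_in(1)] rho_inv_parity, of b a]
    unfolding dlog_def[of a] r by (simp add: mult.assoc)
  have "dlog b * dlog a = sg (s a * s b) (dlog a * dlog b)"
    using sg_commute[OF parity_dlog parity_dlog, of b a] by (simp add: mult.commute)
  moreover have "D b (D a \<rho>) = sg (s a * s b) (D a (D b \<rho>))"
    using D_swap[OF rho_in(1), of b a] by (simp add: mult.commute)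
  ultimately show ?thesis unfolding d by (simp add: sg_diff)
qed

text \<open>\<open>act X (Y a) + act Y (X a)\<close> are the components of the commutator of the odd
  fields \<open>X\<close> and \<open>Y\<close>. For a single composition two terms disturb the
  formula: \<open>U\<close>, with the second derivatives of the logarithm of the density, and
  \<open>W\<close>, a signed trace of the product of the matrices of first derivatives. Both are
  antisymmetric in \<open>X\<close> and \<open>Y\<close> and cancel in the commutator.\<close>

lemma div_bracket:
  assumes X: "\<And>a. a \<in> I \<Longrightarrow> X a \<in> sfun p J V" "\<And>a. a \<in> I \<Longrightarrow> has_parity (s a + 1) (X a)"
    and Y: "\<And>a. a \<in> I \<Longrightarrow> Y a \<in> sfun p J V" "\<And>a. a \<in> I \<Longrightarrow> has_parity (s a + 1) (Y a)"
  shows "div_even (\<lambda>a. act X (Y a) + act Y (X a)) = act X (div_odd Y) + act Y (div_odd X)"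
proof -
  define U where "U X Y = (\<Sum>a\<in>I. \<Sum>b\<in>I. X b * (D b (dlog a) * Y a))" for X Y
  define W where "W X Y = (\<Sum>a\<in>I. \<Sum>b\<in>I. sg (s a) (D a (X b) * D b (Y a)))" for X Y :: "nat \<Rightarrow> superfun"
  have main: "div_even (\<lambda>a. act X (Y a)) = act X (div_odd Y) - U X Y + W X Y"
    if X: "\<And>a. a \<in> I \<Longrightarrow> X a \<in> sfun p J V" "\<And>a. a \<in> I \<Longrightarrow> has_parity (s a + 1) (X a)"
    and Y: "\<And>a. a \<in> I \<Longrightarrow> Y a \<in> sfun p J V" "\<And>a. a \<in> I \<Longrightarrow> has_parity (s a + 1) (Y a)" for X Y
  proof -
    have dY: "div_odd Y = (\<Sum>a\<in>I. dlog a * Y a + D a (Y a))"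
      unfolding div_odd_def sum_distrib_left by (rule sum.cong[OF refl]) (rule D_rho_mult[OF Y(1)])
    have DdY: "D b (div_odd Y) = (\<Sum>a\<in>I. D b (dlog a) * Y a + sg (s a * s b) (dlog a * D b (Y a)) + D b (D a (Y a)))" for b
      unfolding dY
    proof (subst D_sum[where J = J], goal_cases)
      case 2
      show ?case
      proof (rule sum.cong[OF refl])
        fix a assume a: "a \<in> I"
        show "D b (dlog a * Y a + D a (Y a)) = D b (dlog a) * Y a + sg (s a * s b) (dlog a * D b (Y a)) + D b (D a (Y a))"
          using a D_mult_sg[OF sfun_dlog Y(1)[OF a] parity_dlog, of b]
          by (simp add: D_add[where J = J] sfun_mult sfun_dlog sfun_D Y mult.commute)
      qed
    qed (intro sfun_add sfun_mult sfun_dlog sfun_D Y(1))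
    have actX: "act X (Y a) \<in> sfun p J V" if "a \<in> I" for a
      unfolding act_def using that by (intro sfun_sum sfun_mult X(1) sfun_D Y(1))
    have "div_even (\<lambda>a. act X (Y a)) = (\<Sum>a\<in>I. sg (s a) (dlog a * act X (Y a) + D a (act X (Y a))))"
      unfolding div_even_def sum_distrib_left sg_mult_right by (simp add: D_rho_mult actX)
    also have "\<dots> = (\<Sum>a\<in>I. \<Sum>b\<in>I. sg (s a) (dlog a * (X b * D b (Y a))) + sg (s a) (D a (X b) * D b (Y a))
        + X b * D b (D a (Y a)))"
    proof (rule sum.cong[OF refl])
      fix a assume a: "a \<in> I"
      have "D a (act X (Y a)) = (\<Sum>b\<in>I. D a (X b) * D b (Y a) + sg (s a) (X b * D b (D a (Y a))))"
        unfolding act_def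
      proof (subst D_sum[where J = J], goal_cases)
        case 2
        show ?case
        proof (rule sum.cong[OF refl])
          fix b assume b: "b \<in> I"
          have "D a (X b * D b (Y a)) = D a (X b) * D b (Y a) + sg (s a * (s b + 1)) (X b * D a (D b (Y a)))"
            using b a by (intro D_mult_sg[where J = J] X sfun_D Y)
          also have "sg (s a * (s b + 1)) (X b * D a (D b (Y a))) = sg (s a) (X b * D b (D a (Y a)))"
            using D_swap[OF Y(1)[OF a], of a b] by simp (rule sg_cong, auto)
          finally show "D a (X b * D b (Y a)) = D a (X b) * D b (Y a) + sg (s a) (X b * D b (D a (Y a)))" .
        qed
      qed (use a in \<open>intro sfun_mult X(1) sfun_D Y(1)\<close>)
      moreover have "sg (s a) (sg (s a) h) = h" for h :: superfun by (simp add: sg_even)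
      ultimately show "sg (s a) (dlog a * act X (Y a) + D a (act X (Y a))) =
        (\<Sum>b\<in>I. sg (s a) (dlog a * (X b * D b (Y a))) + sg (s a) (D a (X b) * D b (Y a)) + X b * D b (D a (Y a)))"
        by (simp add: act_def sg_add sg_sum sum.distrib sum_distrib_left sg_even add.assoc)
    qed
    also have "\<dots> = (\<Sum>a\<in>I. \<Sum>b\<in>I. sg (s a * s b) (X b * (dlog a * D b (Y a))) + sg (s a) (D a (X b) * D b (Y a))
        + X b * D b (D a (Y a)))"
    proof (intro sum.cong refl)
      fix a b assume a: "a \<in> I" and b: "b \<in> I"
      have "dlog a * (X b * D b (Y a)) = sg (s a * (s b + 1)) (X b * (dlog a * D b (Y a)))"
        using b by (intro sg_left_commute parity_dlog X)
      hence "sg (s a) (dlog a * (X b * D b (Y a))) = sg (s a * s b) (X b * (dlog a * D b (Y a)))"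
        by simp (rule sg_cong, auto)
      thus "sg (s a) (dlog a * (X b * D b (Y a))) + sg (s a) (D a (X b) * D b (Y a)) + X b * D b (D a (Y a)) =
         sg (s a * s b) (X b * (dlog a * D b (Y a))) + sg (s a) (D a (X b) * D b (Y a)) + X b * D b (D a (Y a))" by simp
    qed
    also have "\<dots> = (\<Sum>a\<in>I. \<Sum>b\<in>I. X b * (D b (dlog a) * Y a + sg (s a * s b) (dlog a * D b (Y a)) + D b (D a (Y a))))
        - U X Y + W X Y"
      unfolding U_def W_def by (simp add: sum.distrib distrib_left)
    also have "(\<Sum>a\<in>I. \<Sum>b\<in>I. X b * (D b (dlog a) * Y a + sg (s a * s b) (dlog a * D b (Y a)) + D b (D a (Y a)))) =
        (\<Sum>b\<in>I. \<Sum>a\<in>I. X b * (D b (dlog a) * Y a + sg (s a * s b) (dlog a * D b (Y a)) + D b (D a (Y a))))"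
      by (rule sum.swap)
    also have "\<dots> = (\<Sum>b\<in>I. X b * D b (div_odd Y))"
      unfolding DdY sum_distrib_left ..
    finally show ?thesis by (simp add: act_def)
  qed
  have U: "U X Y + U Y X = 0"
  proof -
    have "Y b * (D b (dlog a) * X a) = - (X a * (D a (dlog b) * Y b))" if a: "a \<in> I" and b: "b \<in> I" for a b
    proof -
      have 1: "has_parity (s a + s b) (D a (dlog b))" by (intro has_parity_D parity_dlog)
      have "Y b * (D b (dlog a) * X a) = sg (s a * s b) (Y b * (D a (dlog b) * X a))" using D_dlog[of b a] by simp
      also have "D a (dlog b) * X a = sg ((s a + s b) * (s a + 1)) (X a * D a (dlog b))"
        by (intro sg_commute 1 X a)
      also have "Y b * sg ((s a + s b) * (s a + 1)) (X a * D a (dlog b)) =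
         sg ((s a + s b) * (s a + 1) + (s b + 1) * (s a + 1)) (X a * (Y b * D a (dlog b)))"
        using sg_left_commute[OF Y(2)[OF b] X(2)[OF a], of "D a (dlog b)"] by simp
      also have "Y b * D a (dlog b) = sg ((s b + 1) * (s a + s b)) (D a (dlog b) * Y b)"
        by (intro sg_commute 1 Y b)
      finally have "Y b * (D b (dlog a) * X a) = sg (s a * s b + ((s a + s b) * (s a + 1) + (s b + 1) * (s a + 1)) + (s b + 1) * (s a + s b)) (X a * (D a (dlog b) * Y b))"
        by (simp add: add_ac)
      also have "\<dots> = - (X a * (D a (dlog b) * Y b))" by (rule sg_odd) (simp, blast)
      finally show ?thesis .
    qed
    hence "U Y X = - (\<Sum>a\<in>I. \<Sum>b\<in>I. X a * (D a (dlog b) * Y b))"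
      unfolding U_def sum_negf[symmetric] by (intro sum.cong refl) auto
    also have "(\<Sum>a\<in>I. \<Sum>b\<in>I. X a * (D a (dlog b) * Y b)) = U X Y" unfolding U_def by (rule sum.swap)
    finally show ?thesis by simp
  qed
  have W: "W X Y + W Y X = 0"
  proof -
    have "sg (s a) (D a (Y b) * D b (X a)) = - sg (s b) (D b (X a) * D a (Y b))" if a: "a \<in> I" and b: "b \<in> I" for a b
    proof -
      have "D a (Y b) * D b (X a) = sg ((s a + (s b + 1)) * (s b + (s a + 1))) (D b (X a) * D a (Y b))"
        by (intro sg_commute has_parity_D X Y a b)
      hence "sg (s a) (D a (Y b) * D b (X a)) = sg (Suc (s b)) (D b (X a) * D a (Y b))"
        by simp (rule sg_cong, auto)
      thus ?thesis by (simp add: sg_def)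
    qed
    hence "W Y X = - (\<Sum>a\<in>I. \<Sum>b\<in>I. sg (s b) (D b (X a) * D a (Y b)))"
      unfolding W_def sum_negf[symmetric] by (intro sum.cong refl) auto
    also have "(\<Sum>a\<in>I. \<Sum>b\<in>I. sg (s b) (D b (X a) * D a (Y b))) = W X Y" unfolding W_def by (rule sum.swap)
    finally show ?thesis by simp
  qed
  have sf: "act X (Y a) \<in> sfun p J V" "act Y (X a) \<in> sfun p J V" if "a \<in> I" for a
    unfolding act_def using that by (auto intro!: sfun_sum sfun_mult X(1) sfun_D Y(1))
  have "div_even (\<lambda>a. act X (Y a) + act Y (X a)) = div_even (\<lambda>a. act X (Y a)) + div_even (\<lambda>a. act Y (X a))"
    unfolding div_even_def distrib_left[symmetric] sum.distrib[symmetric]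
    by (rule arg_cong[where f = "\<lambda>z. \<rho>' * z"], rule sum.cong[OF refl])
       (simp add: distrib_left D_add[where J = J] sfun_mult rho_in sf sg_add)
  also have "\<dots> = act X (div_odd Y) + act Y (div_odd X) - (U X Y + U Y X) + (W X Y + W Y X)"
  proof -
    have "div_even (\<lambda>a. act X (Y a)) = act X (div_odd Y) - U X Y + W X Y"
      by (rule main) (fact X Y)+
    moreover have "div_even (\<lambda>a. act Y (X a)) = act Y (div_odd X) - U Y X + W Y X"
      by (rule main) (fact X Y)+
    ultimately show ?thesis by simp
  qed
  finally show ?thesis unfolding U W by simp
qed

end

end

section \<open>The square of the odd Laplace operator\<close>

lemma sg_Suc: "sg (Suc k) f = - sg k f" by (simp add: sg_def)

context pre_poisson_domain
begin

text \<open>For even \<open>f\<close> the components of its Hamiltonian field.\<close>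

definition ham :: "superfun \<Rightarrow> nat \<Rightarrow> superfun" where
  "ham f a = (\<Sum>b\<in>I. S a b * D b f)"

text \<open>The trilinear form behind \<open>(H,H)\<close>, evaluated on covectors at the point
  \<open>x\<close>. Its arguments are Grassmann numbers rather than functions, because the Jacobi
  identity is algebraic in the covectors.\<close>

definition trip :: "(nat \<Rightarrow> real) \<Rightarrow> (nat \<Rightarrow> grassmann) \<Rightarrow> (nat \<Rightarrow> grassmann) \<Rightarrow> (nat \<Rightarrow> grassmann) \<Rightarrow> grassmann" where
  "trip x u v w = (\<Sum>a\<in>I. \<Sum>e\<in>I. \<Sum>k\<in>I. \<Sum>l\<in>I. S a e x * u e * D a (S k l) x * v l * w k)"

definition triple :: "(nat \<Rightarrow> superfun) \<Rightarrow> (nat \<Rightarrow> superfun) \<Rightarrow> (nat \<Rightarrow> superfun) \<Rightarrow> superfun" where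
  "triple u v w = (\<Sum>a\<in>I. \<Sum>e\<in>I. \<Sum>k\<in>I. \<Sum>l\<in>I. S a e * (u e * (D a (S k l) * (v l * w k))))"

lemma triple_apply: "triple u v w x = trip x (\<lambda>e. u e x) (\<lambda>e. v e x) (\<lambda>e. w e x)"
  unfolding triple_def trip_def sum_fun_apply times_fun_apply by (simp add: mult.assoc)

end

text \<open>
  Three auxiliary odd parameters, with numbers beyond the \<open>2q\<close> odd coordinates of the cotangent bundle.
\<close>
abbreviation (input) param_gens :: "nat \<Rightarrow> nat set" where
  "param_gens q \<equiv> {..<q} \<union> {2 * q, 2 * q + 1, 2 * q + 2}"

text \<open>The Jacobi identity enters as a vanishing cyclic sum over covectors whose components
  have the parity of their index, as for the differential of an even function. Allowing the three
  parameters in the components lets odd components be tested as well.\<close>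

locale poisson_domain = pre_poisson_domain +
  assumes jacobi: "x \<in> V \<Longrightarrow>
    (\<And>c. c < p + q \<Longrightarrow> gpar (parity p c) (u c) \<and> gsupp (param_gens q) (u c)) \<Longrightarrow>
    (\<And>c. c < p + q \<Longrightarrow> gpar (parity p c) (v c) \<and> gsupp (param_gens q) (v c)) \<Longrightarrow>
    (\<And>c. c < p + q \<Longrightarrow> gpar (parity p c) (w c) \<and> gsupp (param_gens q) (w c)) \<Longrightarrow>
    trip x u v w + trip x v w u + trip x w u v = 0"
begin

abbreviation "JJ \<equiv> param_gens q"
abbreviation "J1 \<equiv> {..<q} \<union> {2 * q, 2 * q + 1}"

lemma J1_sub: "{..<q} \<subseteq> J1" by auto

lemma jacobi_fun:
  assumes u: "\<And>c. c \<in> I \<Longrightarrow> u c \<in> sfun p JJ V \<and> has_parity (s c) (u c)"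
    and v: "\<And>c. c \<in> I \<Longrightarrow> v c \<in> sfun p JJ V \<and> has_parity (s c) (v c)"
    and w: "\<And>c. c \<in> I \<Longrightarrow> w c \<in> sfun p JJ V \<and> has_parity (s c) (w c)"
  shows "triple u v w + triple v w u + triple w u v = 0"
proof (rule ext)
  fix x
  show "(triple u v w + triple v w u + triple w u v) x = 0 x"
  proof (cases "x \<in> V")
    case True
    show ?thesis unfolding plus_fun_apply triple_apply zero_fun_apply
      by (rule jacobi[OF True]) (use u v w in \<open>auto simp: sfun_def has_parity_iff\<close>)
  next
    case False
    have "S a e x = 0" if "a \<in> I" "e \<in> I" for a e using S_sfun[of a e] that False by (simp add: sfun_outside)
    thus ?thesis unfolding plus_fun_apply triple_apply trip_def by simp
  qed
qed

lemma sfun_ham: "{..<q} \<subseteq> J \<Longrightarrow> f \<in> sfun p J V \<Longrightarrow> a \<in> I \<Longrightarrow> ham f a \<in> sfun p J V"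
  unfolding ham_def by (intro sfun_sum sfun_mult S_in sfun_D)

lemma parity_ham: "has_parity m f \<Longrightarrow> a \<in> I \<Longrightarrow> has_parity (s a + 1 + m) (ham f a)"
  unfolding ham_def
proof (rule has_parity_sum)
  fix b assume m: "has_parity m f" and "a \<in> I" "b \<in> I"
  hence "has_parity ((s a + s b + 1) + (s b + m)) (S a b * D b f)"
    by (intro has_parity_mult S_parity has_parity_D) auto
  thus "has_parity (s a + 1 + m) (S a b * D b f)" by (rule has_parity_cong) presburger
qed

lemma bra_even: "has_parity 0 f \<Longrightarrow> bra f g = act (ham f) g"
  using tw_sg[of 0 f] unfolding bra_def act_def ham_def by (simp add: sum_distrib_right)

text \<open>The Jacobi identity for the differentials of \<open>f\<close> and \<open>g\<close> and a
  covector concentrated at the index \<open>c\<close>; the component \<open>\<omega>\<close> of that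
  covector is cancelled afterwards.\<close>

lemma jacobi_even:
  assumes f: "f \<in> sfun p J1 V" "has_parity 0 f" and g: "g \<in> sfun p J1 V" "has_parity 0 g" and c: "c \<in> I"
  shows "(\<Sum>a\<in>I. \<Sum>b\<in>I. ham f a * (D a (S c b) * D b g)) + (\<Sum>a\<in>I. \<Sum>b\<in>I. ham g a * (D a (S c b) * D b f))
    + sg (s c) (\<Sum>b\<in>I. S c b * (\<Sum>k\<in>I. \<Sum>l\<in>I. D b (S k l) * (D l f * D k g))) = 0"
    (is "?L1 + ?L2 + sg (s c) ?L3 = 0")
proof -
  \<comment> \<open>The component at \<open>c\<close> must have the parity of \<open>c\<close>: the
    unit serves for an even index, the third parameter for an odd one. As \<open>f\<close> and
    \<open>g\<close> do not contain that parameter, it can be cancelled.\<close>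
  define \<omega> where "\<omega> = const_fun V (if s c = 0 then 1 else generator (2 * q + 2))"
  have \<omega>: "\<omega> \<in> sfun p JJ V" "has_parity (s c) \<omega>"
  proof -
    show "\<omega> \<in> sfun p JJ V" unfolding \<omega>_def by (rule sfun_const_fun) (auto intro: gsupp_generator)
    show "has_parity (s c) \<omega>" unfolding \<omega>_def
      using gpar_generator[of "2 * q + 2"] by (intro has_parity_const_fun) (auto simp: parity_def)
  qed
  define w where "w k = (if k = c then \<omega> else 0)" for k
  let ?u = "\<lambda>l. D l f" and ?v = "\<lambda>l. D l g"
  have f': "f \<in> sfun p JJ V" and g': "g \<in> sfun p JJ V" using f g by (auto intro: sfun_mono)
  have pD: "has_parity (s l) (D l f)" "has_parity (s l) (D l g)" for l
    using has_parity_D[OF f(2), of l] has_parity_D[OF g(2), of l] by simp_all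
  have jac: "triple ?u ?v w + triple ?v w ?u + triple w ?u ?v = 0"
    by (rule jacobi_fun) (use f' g' pD \<omega> in \<open>auto simp: w_def intro: sfun_D\<close>)
  have t1: "triple ?u ?v w = ?L1 * \<omega>"
  proof -
    have "triple ?u ?v w = (\<Sum>a\<in>I. \<Sum>e\<in>I. \<Sum>k\<in>I. if k = c then (\<Sum>l\<in>I. S a e * (?u e * (D a (S k l) * (?v l * \<omega>)))) else 0)"
      unfolding triple_def by (intro sum.cong refl) (simp add: w_def)
    also have "\<dots> = (\<Sum>a\<in>I. \<Sum>e\<in>I. \<Sum>l\<in>I. S a e * (?u e * (D a (S c l) * (?v l * \<omega>))))"
      using c by (simp add: sum.delta)
    also have "\<dots> = (\<Sum>a\<in>I. \<Sum>l\<in>I. \<Sum>e\<in>I. S a e * (?u e * (D a (S c l) * (?v l * \<omega>))))"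
      by (intro sum.cong refl sum.swap)
    also have "\<dots> = ?L1 * \<omega>" by (simp add: ham_def sum_distrib_right mult.assoc)
    finally show ?thesis .
  qed
  have t2: "triple ?v w ?u = ?L2 * \<omega>"
  proof -
    have "triple ?v w ?u = (\<Sum>a\<in>I. \<Sum>e\<in>I. \<Sum>k\<in>I. \<Sum>l\<in>I. if l = c then S a e * (?v e * (D a (S k c) * (\<omega> * ?u k))) else 0)"
      unfolding triple_def by (intro sum.cong refl) (simp add: w_def)
    also have "\<dots> = (\<Sum>a\<in>I. \<Sum>e\<in>I. \<Sum>k\<in>I. S a e * (?v e * (D a (S k c) * (\<omega> * ?u k))))"
      using c by (simp add: sum.delta)
    also have "\<dots> = (\<Sum>a\<in>I. \<Sum>k\<in>I. \<Sum>e\<in>I. S a e * (?v e * (D a (S k c) * (\<omega> * ?u k))))"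
      by (intro sum.cong refl sum.swap)
    also have "\<dots> = (\<Sum>a\<in>I. \<Sum>k\<in>I. \<Sum>e\<in>I. S a e * (?v e * (D a (S c k) * (?u k * \<omega>))))"
    proof (intro sum.cong refl)
      fix a k e assume k: "k \<in> I"
      have 1: "D a (S k c) = sg (s k * s c) (D a (S c k))"
        using D_sg[OF S_sfun, of c k a "s k * s c"] S_sym[of k c] k c by simp
      have 2: "\<omega> * ?u k = sg (s c * s k) (?u k * \<omega>)" by (rule sg_commute[OF \<omega>(2) pD(1)])
      show "S a e * (?v e * (D a (S k c) * (\<omega> * ?u k))) = S a e * (?v e * (D a (S c k) * (?u k * \<omega>)))"
        unfolding 1 2 by (simp add: sg_even mult.commute[of "s c"])
    qed
    also have "\<dots> = ?L2 * \<omega>" by (simp add: ham_def sum_distrib_right mult.assoc)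
    finally show ?thesis .
  qed
  have t3: "triple w ?u ?v = sg (s c) ?L3 * \<omega>"
  proof -
    have "triple w ?u ?v = (\<Sum>a\<in>I. \<Sum>e\<in>I. if e = c then (\<Sum>k\<in>I. \<Sum>l\<in>I. S a c * (\<omega> * (D a (S k l) * (?u l * ?v k)))) else 0)"
      unfolding triple_def by (intro sum.cong refl) (simp add: w_def)
    also have "\<dots> = (\<Sum>a\<in>I. \<Sum>k\<in>I. \<Sum>l\<in>I. S a c * (\<omega> * (D a (S k l) * (?u l * ?v k))))"
      using c by (simp add: sum.delta)
    also have "\<dots> = (\<Sum>a\<in>I. \<Sum>k\<in>I. \<Sum>l\<in>I. sg (s c) (S c a * (D a (S k l) * (?u l * ?v k)) * \<omega>))"
    proof (intro sum.cong refl)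
      fix a k l assume a: "a \<in> I" and k: "k \<in> I" and l: "l \<in> I"
      have "has_parity ((s a + (s k + s l + 1)) + (s l + s k)) (D a (S k l) * (?u l * ?v k))"
        using k l by (intro has_parity_mult has_parity_D pD S_parity) auto
      hence pz: "has_parity (s a + 1) (D a (S k l) * (?u l * ?v k))" by (rule has_parity_cong) presburger
      let ?z = "D a (S k l) * (?u l * ?v k)"
      have "S a c * (\<omega> * ?z) = sg (s a * s c) (S c a) * (sg (s c * (s a + 1)) (?z * \<omega>))"
        using S_sym[of a c] a c sg_commute[OF \<omega>(2) pz] by simp
      also have "\<dots> = sg (s c) (S c a * ?z * \<omega>)"
        by (simp add: mult.assoc) (rule sg_cong, auto)
      finally show "S a c * (\<omega> * ?z) = sg (s c) (S c a * ?z * \<omega>)" .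
    qed
    also have "\<dots> = sg (s c) ?L3 * \<omega>"
      by (simp add: sum_distrib_right sum_distrib_left sg_sum mult.assoc)
    finally show ?thesis .
  qed
  define X where "X = ?L1 + ?L2 + sg (s c) ?L3"
  have X0: "X * \<omega> = 0" using jac unfolding t1 t2 t3 X_def by (simp add: distrib_right)
  note S1 = S_in[OF J1_sub]
  have Xs: "X \<in> sfun p J1 V" unfolding X_def
    by (intro sfun_add sfun_sg sfun_sum sfun_mult sfun_ham[OF J1_sub] S1 sfun_D f g c)
  have "has_parity (s c) X" unfolding X_def
  proof (intro has_parity_add has_parity_sg has_parity_sum)
    fix a b assume a: "a \<in> I" and b: "b \<in> I"
    have "has_parity ((s a + 1 + 0) + ((s a + (s c + s b + 1)) + s b)) (ham f a * (D a (S c b) * D b g))"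
      using a b c by (intro has_parity_mult parity_ham f has_parity_D S_parity pD) auto
    thus "has_parity (s c) (ham f a * (D a (S c b) * D b g))" by (rule has_parity_cong) presburger
    have "has_parity ((s a + 1 + 0) + ((s a + (s c + s b + 1)) + s b)) (ham g a * (D a (S c b) * D b f))"
      using a b c by (intro has_parity_mult parity_ham g has_parity_D S_parity pD) auto
    thus "has_parity (s c) (ham g a * (D a (S c b) * D b f))" by (rule has_parity_cong) presburger
  next
    fix b assume b: "b \<in> I"
    have "has_parity ((s c + s b + 1) + (s b + 1)) (S c b * (\<Sum>k\<in>I. \<Sum>l\<in>I. D b (S k l) * (D l f * D k g)))"
    proof (rule has_parity_mult)
      show "has_parity (s c + s b + 1) (S c b)" using b c by (intro S_parity) auto
      show "has_parity (s b + 1) (\<Sum>k\<in>I. \<Sum>l\<in>I. D b (S k l) * (D l f * D k g))"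
      proof (rule has_parity_sum, rule has_parity_sum)
      fix k l assume "k \<in> I" "l \<in> I"
      hence "has_parity ((s b + (s k + s l + 1)) + (s l + s k)) (D b (S k l) * (D l f * D k g))"
        by (intro has_parity_mult has_parity_D pD S_parity) auto
      thus "has_parity (s b + 1) (D b (S k l) * (D l f * D k g))" by (rule has_parity_cong) presburger
      qed
    qed
    thus "has_parity (s c) (S c b * (\<Sum>k\<in>I. \<Sum>l\<in>I. D b (S k l) * (D l f * D k g)))"
      by (rule has_parity_cong) presburger
  qed
  hence \<omega>X: "\<omega> * X = 0" using sg_commute[OF \<omega>(2), of "s c" X] X0 by simp
  have "X = 0"
  proof (cases "s c = 0")
    case True
    thus ?thesis using \<omega>X unit_mult_sfun(1)[OF Xs] by (simp add: \<omega>_def restr_one)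
  next
    case False
    thus ?thesis using const_generator_mult_cancel[OF _ Xs, of "2 * q + 2"] \<omega>X by (simp add: \<omega>_def)
  qed
  thus ?thesis by (simp add: X_def)
qed

text \<open>Terms with second derivatives of \<open>f\<close> and \<open>g\<close> occur on both
  sides alike, and the terms with derivatives of \<open>S\<close> are those that
  \<open>jacobi_even\<close> balances. In invariant form: the commutator of the two Hamiltonian
  fields is, up to sign, the field of \<open>bra f g\<close>.\<close>

lemma ham_bracket:
  assumes f: "f \<in> sfun p J1 V" "has_parity 0 f" and g: "g \<in> sfun p J1 V" "has_parity 0 g" and c: "c \<in> I"
  shows "act (ham f) (ham g c) + act (ham g) (ham f c) = - sg (s c) (\<Sum>b\<in>I. S c b * D b (bra f g))"
proof -
  have pD: "has_parity (s l) (D l f)" "has_parity (s l) (D l g)" for l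
    using has_parity_D[OF f(2), of l] has_parity_D[OF g(2), of l] by simp_all
  note S1 = S_in[OF J1_sub]
  have L: "act (ham f) (ham g c) = (\<Sum>a\<in>I. \<Sum>b\<in>I. ham f a * (D a (S c b) * D b g)) -
     sg (s c) (\<Sum>b\<in>I. S c b * sg (s b) (\<Sum>a\<in>I. ham f a * D a (D b g)))"
    if f: "f \<in> sfun p J1 V" "has_parity 0 f" and g: "g \<in> sfun p J1 V" "has_parity 0 g" for f g
  proof -
    have "act (ham f) (ham g c) = (\<Sum>a\<in>I. \<Sum>b\<in>I. ham f a * (D a (S c b) * D b g) - sg (s c) (S c b * sg (s b) (ham f a * D a (D b g))))"
      unfolding act_def
    proof (rule sum.cong[OF refl])
      fix a assume a: "a \<in> I"
      have "D a (ham g c) = (\<Sum>b\<in>I. D a (S c b) * D b g + sg (s a * (s c + s b + 1)) (S c b * D a (D b g)))"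
        unfolding ham_def
      proof (subst D_sum[where J = J1], goal_cases)
        case 2
        show ?case
        proof (rule sum.cong[OF refl])
          fix b assume b: "b \<in> I"
          show "D a (S c b * D b g) = D a (S c b) * D b g + sg (s a * (s c + s b + 1)) (S c b * D a (D b g))"
            using b c by (intro D_mult_sg[where J = J1] S1 sfun_D g S_parity) auto
        qed
      qed (intro sfun_mult S1 sfun_D g c)
      hence "ham f a * D a (ham g c) = (\<Sum>b\<in>I. ham f a * (D a (S c b) * D b g) + sg (s a * (s c + s b + 1)) (ham f a * (S c b * D a (D b g))))"
        by (simp add: sum_distrib_left distrib_left)
      also have "\<dots> = (\<Sum>b\<in>I. ham f a * (D a (S c b) * D b g) - sg (s c) (S c b * sg (s b) (ham f a * D a (D b g))))"
      proof (rule sum.cong[OF refl])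
        fix b assume b: "b \<in> I"
        have "ham f a * (S c b * D a (D b g)) = sg ((s a + 1 + 0) * (s c + s b + 1)) (S c b * (ham f a * D a (D b g)))"
          using b c by (intro sg_left_commute parity_ham f a S_parity) auto
        hence "sg (s a * (s c + s b + 1)) (ham f a * (S c b * D a (D b g))) = sg (Suc (s c + s b)) (S c b * (ham f a * D a (D b g)))"
          by simp (rule sg_cong, auto)
        thus "ham f a * (D a (S c b) * D b g) + sg (s a * (s c + s b + 1)) (ham f a * (S c b * D a (D b g))) =
          ham f a * (D a (S c b) * D b g) - sg (s c) (S c b * sg (s b) (ham f a * D a (D b g)))"
          by (simp add: sg_Suc)
      qed
      finally show "ham f a * D a (ham g c) = (\<Sum>b\<in>I. ham f a * (D a (S c b) * D b g) - sg (s c) (S c b * sg (s b) (ham f a * D a (D b g))))" .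
    qed
    also have "\<dots> = (\<Sum>a\<in>I. \<Sum>b\<in>I. ham f a * (D a (S c b) * D b g)) - (\<Sum>a\<in>I. \<Sum>b\<in>I. sg (s c) (S c b * sg (s b) (ham f a * D a (D b g))))"
      by (simp only: sum_subtractf)
    also have "(\<Sum>a\<in>I. \<Sum>b\<in>I. sg (s c) (S c b * sg (s b) (ham f a * D a (D b g)))) = (\<Sum>b\<in>I. \<Sum>a\<in>I. sg (s c) (S c b * sg (s b) (ham f a * D a (D b g))))"
      by (rule sum.swap)
    finally show ?thesis by (simp only: sg_sum sum_distrib_left)
  qed
  have B: "D b (bra f g) = (\<Sum>k\<in>I. \<Sum>l\<in>I. D b (S k l) * (D l f * D k g)) + sg (s b) (\<Sum>a\<in>I. ham g a * D a (D b f))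
    + sg (s b) (\<Sum>a\<in>I. ham f a * D a (D b g))" if b: "b \<in> I" for b
  proof -
    have "bra f g = (\<Sum>k\<in>I. \<Sum>l\<in>I. S k l * (D l f * D k g))"
      unfolding bra_even[OF f(2)] act_def ham_def by (simp add: sum_distrib_right mult.assoc)
    have sums: "D b (\<Sum>k\<in>I. \<Sum>l\<in>I. S k l * (D l f * D k g)) = (\<Sum>k\<in>I. \<Sum>l\<in>I. D b (S k l * (D l f * D k g)))"
    proof -
      have m: "S k l * (D l f * D k g) \<in> sfun p J1 V" if "k \<in> I" "l \<in> I" for k l
        using that by (intro sfun_mult S1 sfun_D f g)
      have "D b (\<Sum>k\<in>I. \<Sum>l\<in>I. S k l * (D l f * D k g)) = (\<Sum>k\<in>I. D b (\<Sum>l\<in>I. S k l * (D l f * D k g)))"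
        by (rule D_sum[where J = J1]) (intro sfun_sum m)
      also have "\<dots> = (\<Sum>k\<in>I. \<Sum>l\<in>I. D b (S k l * (D l f * D k g)))"
        by (intro sum.cong refl D_sum[where J = J1] m)
      finally show "D b (\<Sum>k\<in>I. \<Sum>l\<in>I. S k l * (D l f * D k g)) = (\<Sum>k\<in>I. \<Sum>l\<in>I. D b (S k l * (D l f * D k g)))" .
    qed
    have "D b (bra f g) = (\<Sum>k\<in>I. \<Sum>l\<in>I. D b (S k l * (D l f * D k g)))"
      unfolding \<open>bra f g = _\<close> by (rule sums)
    also have "\<dots> = (\<Sum>k\<in>I. \<Sum>l\<in>I. D b (S k l) * (D l f * D k g) + sg (s b) (S l k * (D k g * D l (D b f)))
       + sg (s b) (S k l * (D l f * D k (D b g))))"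
    proof (intro sum.cong refl)
      fix k l assume k: "k \<in> I" and l: "l \<in> I"
      have "D b (S k l * (D l f * D k g)) = D b (S k l) * (D l f * D k g) + sg (s b * (s k + s l + 1)) (S k l * D b (D l f * D k g))"
        using k l by (intro D_mult_sg[where J = J1] S1 sfun_mult sfun_D f g S_parity) auto
      moreover have "D b (D l f * D k g) = D b (D l f) * D k g + sg (s b * s l) (D l f * D b (D k g))"
        by (intro D_mult_sg[where J = J1] sfun_D f g pD)
      moreover have "sg (s b * (s k + s l + 1)) (S k l * (D b (D l f) * D k g)) = sg (s b) (S l k * (D k g * D l (D b f)))"
      proof -
        have 1: "D b (D l f) = sg (s b * s l) (D l (D b f))" by (rule D_swap[OF f(1)])
        have 2: "D l (D b f) * D k g = sg ((s l + s b) * s k) (D k g * D l (D b f))"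
          by (intro sg_commute has_parity_D pD)
        have 3: "S k l = sg (s k * s l) (S l k)" using k l by (intro S_sym) auto
        show ?thesis unfolding 1 sg_mult_left 2 3 by simp (rule sg_cong, auto)
      qed
      moreover have "sg (s b * (s k + s l + 1)) (S k l * sg (s b * s l) (D l f * D b (D k g))) = sg (s b) (S k l * (D l f * D k (D b g)))"
      proof -
        have 1: "D b (D k g) = sg (s b * s k) (D k (D b g))" by (rule D_swap[OF g(1)])
        show ?thesis unfolding 1 by simp (rule sg_cong, auto)
      qed
      ultimately show "D b (S k l * (D l f * D k g)) = D b (S k l) * (D l f * D k g) + sg (s b) (S l k * (D k g * D l (D b f)))
         + sg (s b) (S k l * (D l f * D k (D b g)))"
        by (simp only: distrib_left sg_add add.assoc)
    qed
    also have "\<dots> = (\<Sum>k\<in>I. \<Sum>l\<in>I. D b (S k l) * (D l f * D k g)) + (\<Sum>k\<in>I. \<Sum>l\<in>I. sg (s b) (S l k * (D k g * D l (D b f))))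
       + (\<Sum>k\<in>I. \<Sum>l\<in>I. sg (s b) (S k l * (D l f * D k (D b g))))"
      by (simp only: sum.distrib)
    also have "(\<Sum>k\<in>I. \<Sum>l\<in>I. sg (s b) (S l k * (D k g * D l (D b f)))) = (\<Sum>l\<in>I. \<Sum>k\<in>I. sg (s b) (S l k * (D k g * D l (D b f))))"
      by (rule sum.swap)
    finally show ?thesis by (simp add: ham_def sg_sum sum_distrib_right mult.assoc)
  qed
  have "(\<Sum>b\<in>I. S c b * D b (bra f g)) = (\<Sum>b\<in>I. S c b * (\<Sum>k\<in>I. \<Sum>l\<in>I. D b (S k l) * (D l f * D k g)))
     + (\<Sum>b\<in>I. S c b * sg (s b) (\<Sum>a\<in>I. ham g a * D a (D b f))) + (\<Sum>b\<in>I. S c b * sg (s b) (\<Sum>a\<in>I. ham f a * D a (D b g)))"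
    by (simp only: B distrib_left sum.distrib cong: sum.cong)
  note sums = this
  have grp: "x + y = - (c + b + a)" if "x = l - a" "y = m - b" "l + m + c = 0" for x y l m a b c :: superfun
  proof -
    have "x + y = (l + m) - (b + a)" using that(1,2) by simp
    also have "l + m = - c" using that(3) by (simp add: eq_neg_iff_add_eq_0)
    finally show ?thesis by simp
  qed
  show ?thesis unfolding sums sg_add by (rule grp[OF L[OF f g] L[OF g f] jacobi_even[OF f g c]])
qed

text \<open>\<open>lap h\<close> is the divergence of \<open>ham h\<close>, so this is the
  divergence of \<open>ham_bracket\<close>. The sign \<open>sg (s c)\<close> there turns the
  divergence of an even field into the expression defining \<open>lap\<close>.\<close>

lemma lap_bra_even:
  assumes f: "f \<in> sfun p J1 V" "has_parity 0 f" and g: "g \<in> sfun p J1 V" "has_parity 0 g"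
  shows "lap (bra f g) = - (bra f (lap g) + bra g (lap f))"
proof -
  have lapdiv: "lap h = div_odd (ham h)" for h by (simp add: lap_def div_odd_def ham_def)
  note S1 = S_in[OF J1_sub]
  have "lap (bra f g) = - div_even (\<lambda>c. act (ham f) (ham g c) + act (ham g) (ham f c))"
  proof -
    have "sg (s c) (D c (\<rho> * (act (ham f) (ham g c) + act (ham g) (ham f c)))) = - D c (\<rho> * (\<Sum>b\<in>I. S c b * D b (bra f g)))"
      if c: "c \<in> I" for c
    proof -
      have m: "\<rho> * (\<Sum>b\<in>I. S c b * D b (bra f g)) \<in> sfun p J1 V"
        by (intro sfun_mult sfun_sum S1 c sfun_D sfun_bra[OF J1_sub] f g rho_in(1)[OF J1_sub])
      show ?thesis unfolding ham_bracket[OF f g c]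
        by (simp add: D_uminus[OF sfun_sg[OF m]] D_sg[OF m] sg_minus sg_even)
    qed
    thus ?thesis by (simp add: lap_def div_even_def sum_negf)
  qed
  also have "div_even (\<lambda>c. act (ham f) (ham g c) + act (ham g) (ham f c)) = act (ham f) (div_odd (ham g)) + act (ham g) (div_odd (ham f))"
    using parity_ham[OF f(2)] parity_ham[OF g(2)] by (intro div_bracket[OF J1_sub] sfun_ham[OF J1_sub] f g) auto
  finally show ?thesis by (simp add: lapdiv bra_even f g)
qed

lemma parity_lap:
  assumes "has_parity m f" shows "has_parity (m + 1) (lap f)"
proof -
  have "has_parity (0 + (m + 1)) (\<rho>' * (\<Sum>a\<in>I. D a (\<rho> * ham f a)))"
  proof (intro has_parity_mult rho_inv_parity has_parity_sum)
    fix a assume "a \<in> I"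
    hence "has_parity (s a + (0 + (s a + 1 + m))) (D a (\<rho> * ham f a))"
      by (intro has_parity_D has_parity_mult rho_parity parity_ham assms)
    thus "has_parity (m + 1) (D a (\<rho> * ham f a))" by (rule has_parity_cong) presburger
  qed
  thus ?thesis by (simp add: lap_def ham_def)
qed

lemma parity_lap2: "has_parity m f \<Longrightarrow> has_parity m (lap (lap f))"
proof -
  assume "has_parity m f"
  hence "has_parity (m + 1 + 1) (lap (lap f))" by (intro parity_lap)
  thus ?thesis by (rule has_parity_cong) presburger
qed

text \<open>The mixed products cancel because \<open>lap f\<close> and \<open>lap g\<close> are odd
  and anticommute, the brackets by \<open>lap_bra_even\<close>. The functions may contain two
  parameters, which makes room for odd factors.\<close>

lemma lap2_mult_even:
  assumes f: "f \<in> sfun p J1 V" "has_parity 0 f" and g: "g \<in> sfun p J1 V" "has_parity 0 g"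
  shows "lap (lap (f * g)) = lap (lap f) * g + f * lap (lap g)"
proof -
  note lm = lap_mult[OF J1_sub] and la = lap_add[OF J1_sub] and ls = sfun_lap[OF J1_sub] and bs = sfun_bra[OF J1_sub]
  have odd: "has_parity 1 (lap f)" "has_parity 1 (lap g)" using parity_lap[of 0] f g by auto
  have 1: "lap (f * g) = g * lap f + f * lap g + (bra f g + bra f g)"
    using lm[OF f(1) g(1) f(2)] superfun_commute_even[OF g(2), of "lap f"] by (simp add: mult_2)
  have "lap (lap (f * g)) = lap (g * lap f) + lap (f * lap g) + (lap (bra f g) + lap (bra f g))"
  proof -
    have m: "g * lap f \<in> sfun p J1 V" "f * lap g \<in> sfun p J1 V" "bra f g \<in> sfun p J1 V"
      by (intro sfun_mult ls bs f g)+
    show ?thesis unfolding 1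
      by (simp only: la[OF sfun_add[OF m(1,2)] sfun_add[OF m(3,3)]] la[OF m(1,2)] la[OF m(3,3)])
  qed
  also have "\<dots> = lap (lap f) * g + f * lap (lap g)"
  proof -
    have 2: "lap (g * lap f) = lap g * lap f + g * lap (lap f) + 2 * bra g (lap f)"
      using lm[OF g(1) ls[OF f(1)] g(2)] by simp
    have 3: "lap (f * lap g) = lap f * lap g + f * lap (lap g) + 2 * bra f (lap g)"
      using lm[OF f(1) ls[OF g(1)] f(2)] by simp
    have 4: "lap g * lap f = - (lap f * lap g)"
      using sg_commute[OF odd(2,1)] by (simp add: sg_odd)
    have 5: "g * lap (lap f) = lap (lap f) * g" by (rule superfun_commute_even[OF g(2)])
    show ?thesis unfolding 2 3 4 5 lap_bra_even[OF f g] by (simp add: mult_2)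
  qed
  finally show ?thesis .
qed

end

lemma double_cancel: "f + f = g + g \<Longrightarrow> f = (g :: superfun)"
proof (rule ext, rule grassmann_eqI)
  fix x I assume "f + f = g + g"
  hence "coeff ((f + f) x) I = coeff ((g + g) x) I" by simp
  thus "coeff (f x) I = coeff (g x) I" by (simp add: plus_fun_apply)
qed

lemma const_fun_0 [simp]: "const_fun V 0 = 0"
  by (simp add: const_fun_def restr_def fun_eq_iff)

section \<open>Removing the restriction to even functions\<close>

context pre_poisson_domain
begin

lemma lap_0 [simp]: "lap 0 = 0" by (simp add: lap_def)

context
  fixes J :: "nat set" assumes J: "{..<q} \<subseteq> J"
begin

lemma lap_uminus: "f \<in> sfun p J V \<Longrightarrow> lap (- f) = - lap f"
  using lap_add[OF J, of f "- f"] sfun_uminus[of f J] by (simp add: add.inverse_unique)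

lemma lap_diff: "f \<in> sfun p J V \<Longrightarrow> g \<in> sfun p J V \<Longrightarrow> lap (f - g) = lap f - lap g"
  using lap_add[OF J, of f "- g"] sfun_uminus[of g J] lap_uminus[of g] by simp

lemma lap_sg: "f \<in> sfun p J V \<Longrightarrow> lap (sg k f) = sg k (lap f)"
  using lap_uminus[of f] by (cases "even k") (simp_all add: sg_even sg_odd)

text \<open>All derivatives of a parameter vanish, so moving it in front of the odd operator costs
  exactly one sign.\<close>

lemma lap_generator:
  assumes f: "f \<in> sfun p J V" and j: "q \<le> j" "j \<in> J"
  shows "lap (const_fun V (generator j) * f) = - (const_fun V (generator j) * lap f)"
proof -
  let ?\<eta> = "const_fun V (generator j)"
  have \<eta>: "?\<eta> \<in> sfun p J V" "has_parity 1 ?\<eta>"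
    using j gpar_generator by (auto intro!: sfun_const_fun gsupp_generator has_parity_const_fun)
  define F where "F a = (\<Sum>b\<in>I. S a b * D b f)" for a
  have F: "F a \<in> sfun p J V" if "a \<in> I" for a
    unfolding F_def using that by (intro sfun_sum sfun_mult S_in[OF J] sfun_D f)
  have D\<eta>: "D b ?\<eta> = 0" if "b \<in> I" for b
    using that j by (auto simp: D_const_fun odd_deriv_generator)
  have 1: "(\<Sum>b\<in>I. S a b * D b (?\<eta> * f)) = sg (s a + 1) (?\<eta> * F a)" if a: "a \<in> I" for a
    unfolding F_def sum_distrib_left sg_sum
  proof (rule sum.cong[OF refl])
    fix b assume b: "b \<in> I"
    have "D b (?\<eta> * f) = sg (s b * 1) (?\<eta> * D b f)"
      using D_mult_sg[OF \<eta>(1) f \<eta>(2), of b] D\<eta>[OF b] by simp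
    moreover have "S a b * (?\<eta> * D b f) = sg ((s a + s b + 1) * 1) (?\<eta> * (S a b * D b f))"
      using a b by (intro sg_left_commute S_parity \<eta>) auto
    ultimately show "S a b * D b (?\<eta> * f) = sg (s a + 1) (?\<eta> * (S a b * D b f))"
      by simp (rule sg_cong, auto)
  qed
  have 2: "D a (\<rho> * sg (s a + 1) (?\<eta> * F a)) = - (?\<eta> * D a (\<rho> * F a))" if a: "a \<in> I" for a
  proof -
    have m: "\<rho> * F a \<in> sfun p J V" using a by (intro sfun_mult rho_in[OF J] F)
    have "\<rho> * sg (s a + 1) (?\<eta> * F a) = sg (s a + 1) (?\<eta> * (\<rho> * F a))"
      using superfun_commute_even[OF rho_parity, of ?\<eta>] by (simp add: mult.assoc[symmetric])
    hence "D a (\<rho> * sg (s a + 1) (?\<eta> * F a)) = sg (s a + 1) (D a (?\<eta> * (\<rho> * F a)))"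
      using D_sg[OF sfun_mult[OF \<eta>(1) m]] by simp
    also have "D a (?\<eta> * (\<rho> * F a)) = sg (s a * 1) (?\<eta> * D a (\<rho> * F a))"
      using D_mult_sg[OF \<eta>(1) m \<eta>(2), of a] D\<eta>[OF a] by simp
    finally show ?thesis by (simp add: sg_odd)
  qed
  have "lap (?\<eta> * f) = \<rho>' * (\<Sum>a\<in>I. - (?\<eta> * D a (\<rho> * F a)))"
    unfolding lap_def by (simp only: 1 2 cong: sum.cong)
  also have "\<dots> = - ((\<rho>' * ?\<eta>) * (\<Sum>a\<in>I. D a (\<rho> * F a)))"
    by (simp add: sum_negf sum_distrib_left[symmetric] mult.assoc)
  also have "\<rho>' * ?\<eta> = ?\<eta> * \<rho>'" by (rule rho_inv_commute[OF \<eta>(1)])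
  finally show ?thesis by (simp add: lap_def F_def mult.assoc)
qed

lemma lap_const_real: "lap (const_fun V (of_real r)) = 0"
proof -
  have "D b (const_fun V (of_real r)) = 0" for b
    by (simp add: D_const_fun)
  thus ?thesis by (simp add: lap_def)
qed

end

end

lemma generator_cancel_unless_even:
  assumes "const_fun V (if m = (0 :: nat) then 1 else generator j) * h = 0" "h \<in> sfun p J V" "j \<notin> J"
  shows "h = 0"
  using assms const_generator_mult_cancel[of V j h p J] unit_mult_sfun(1)[OF assms(2)]
  by (cases "m = 0") (simp_all add: restr_one)

context poisson_domain
begin

text \<open>The sign of \<open>lap_generator\<close> occurs twice.\<close>

lemma lap2_unit_or_generator:
  assumes f: "f \<in> sfun p J1 V" and j: "j \<in> {2 * q, 2 * q + 1}"
  shows "lap (lap (const_fun V (if m = (0 :: nat) then 1 else generator j) * f)) = const_fun V (if m = 0 then 1 else generator j) * lap (lap f)"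
proof (cases "m = (0 :: nat)")
  case True
  have "const_fun V 1 * h = h" if "h \<in> sfun p J1 V" for h
    using unit_mult_sfun(1)[OF that] by (simp add: restr_one)
  thus ?thesis using True f sfun_lap[OF J1_sub] by simp
next
  case False
  have j': "q \<le> j" "j \<in> J1" using j by auto
  have "const_fun V (generator j) * lap f \<in> sfun p J1 V"
    using j' by (intro sfun_mult sfun_const_fun sfun_lap[OF J1_sub] f gsupp_generator)
  thus ?thesis using False
    by (simp only: if_False lap_generator[OF J1_sub f j'] lap_generator[OF J1_sub sfun_lap[OF J1_sub f] j'] lap_uminus[OF J1_sub] minus_minus)
qed

text \<open>
  Multiplication by an auxiliary odd generator turns an odd factor into an even one. Such a
  generator commutes with the square of the operator, and multiplication by it can be cancelled.
\<close>
lemma lap2_mult_parity: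
  assumes f: "f \<in> sfun p {..<q} V" "has_parity m f" and g: "g \<in> sfun p {..<q} V" "has_parity n g"
    and mn: "m < 2" "n < 2"
  shows "lap (lap (f * g)) = lap (lap f) * g + f * lap (lap g)"
proof -
  define e0 where "e0 = const_fun V (if m = 0 then 1 else generator (2 * q))"
  define e1 where "e1 = const_fun V (if n = 0 then 1 else generator (2 * q + 1))"
  define DD where "DD f = lap (lap f)" for f
  have e0: "e0 \<in> sfun p J1 V" "has_parity m e0"
    unfolding e0_def using mn gpar_generator[of "2 * q"]
    by (auto intro!: sfun_const_fun gsupp_generator has_parity_const_fun simp: less_2_cases_iff)
  \<comment> \<open>\<open>e1\<close> is kept free of the generator \<open>2 * q\<close>, so that
    \<open>e0\<close> can be cancelled from \<open>e0 * (e1 * h)\<close> before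
    \<open>e1\<close>.\<close>
  have e1: "e1 \<in> sfun p ({..<q} \<union> {2 * q + 1}) V" "has_parity n e1"
    unfolding e1_def using mn gpar_generator[of "2 * q + 1"]
    by (auto intro!: sfun_const_fun gsupp_generator has_parity_const_fun simp: less_2_cases_iff)
  have e1': "e1 \<in> sfun p J1 V" using e1(1) by (rule sfun_mono) auto
  have f1: "f \<in> sfun p J1 V" and g1: "g \<in> sfun p J1 V" using f g by (auto intro: sfun_mono)
  have dd0: "DD (e0 * h) = e0 * DD h" and dd1: "DD (e1 * h) = e1 * DD h" if "h \<in> sfun p J1 V" for h
    unfolding DD_def e0_def e1_def by (rule lap2_unit_or_generator[OF that]; simp)+
  have DDs: "DD h \<in> sfun p J V" if "h \<in> sfun p J V" "{..<q} \<subseteq> J" for h J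
    unfolding DD_def using that by (intro sfun_lap)
  have ev: "has_parity 0 (e0 * f)" "has_parity 0 (e1 * g)"
    using has_parity_mult[OF e0(2) f(2)] has_parity_mult[OF e1(2) g(2)] by (auto elim!: has_parity_cong)
  have comm: "(e0 * x) * (e1 * y) = sg (m * n) (e0 * (e1 * (x * y)))" if "has_parity m x" for x y
    using sg_left_commute[OF that e1(2), of y] by (simp add: mult.assoc)
  have pf: "has_parity m (DD f)" unfolding DD_def by (rule parity_lap2[OF f(2)])
  have "DD ((e0 * f) * (e1 * g)) = DD (e0 * f) * (e1 * g) + (e0 * f) * DD (e1 * g)"
    unfolding DD_def by (rule lap2_mult_even) (intro sfun_mult e0 e1' f1 g1 ev)+
  moreover have "DD ((e0 * f) * (e1 * g)) = sg (m * n) (e0 * (e1 * DD (f * g)))"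
  proof -
    have "e0 * (e1 * (f * g)) \<in> sfun p J1 V" by (intro sfun_mult e0 e1' f1 g1)
    hence "DD (sg (m * n) (e0 * (e1 * (f * g)))) = sg (m * n) (DD (e0 * (e1 * (f * g))))"
      unfolding DD_def by (simp only: lap_sg[OF J1_sub] sfun_lap[OF J1_sub])
    thus ?thesis unfolding comm[OF f(2)] by (simp only: dd0 dd1 sfun_mult e1' f1 g1)
  qed
  ultimately have "sg (m * n) (e0 * (e1 * DD (f * g))) = sg (m * n) (e0 * (e1 * (DD f * g)) + e0 * (e1 * (f * DD g)))"
    unfolding dd0[OF f1] dd1[OF g1] comm[OF f(2)] comm[OF pf] sg_add by simp
  hence "e0 * (e1 * DD (f * g)) = e0 * (e1 * (DD f * g)) + e0 * (e1 * (f * DD g))" by (rule sg_eqD)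
  hence 0: "e0 * (e1 * (DD (f * g) - (DD f * g + f * DD g))) = 0"
    by (simp add: right_diff_distrib distrib_left)
  define h where "h = DD (f * g) - (DD f * g + f * DD g)"
  have h: "h \<in> sfun p {..<q} V" unfolding h_def by (intro sfun_diff sfun_add sfun_mult DDs f g order_refl)
  have e1h: "e1 * h \<in> sfun p ({..<q} \<union> {2 * q + 1}) V"
    by (intro sfun_mult e1 sfun_mono[OF h]) auto
  have "e1 * h = 0"
    by (rule generator_cancel_unless_even[OF _ e1h, of m "2 * q"]) (use 0 in \<open>auto simp: e0_def h_def\<close>)
  hence "h = 0"
    by (intro generator_cancel_unless_even[OF _ h, of n "2 * q + 1"]) (auto simp: e1_def)
  thus ?thesis by (simp add: h_def DD_def)
qed

lemma Q_sub: "{..<q} \<subseteq> {..<q}" by simp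
lemmas lapQ = lap_add[OF Q_sub] sfun_lap[OF Q_sub]

lemma lap2_add: "f \<in> sfun p {..<q} V \<Longrightarrow> g \<in> sfun p {..<q} V \<Longrightarrow> lap (lap (f + g)) = lap (lap f) + lap (lap g)"
  by (simp only: lapQ)

lemma lap2_mult:
  assumes f: "f \<in> sfun p {..<q} V" and g: "g \<in> sfun p {..<q} V"
  shows "lap (lap (f * g)) = lap (lap f) * g + f * lap (lap g)"
proof -
  have one: "(1 :: nat) < 2" by simp
  have 1: "lap (lap (f * g)) = lap (lap f) * g + f * lap (lap g)" if f: "f \<in> sfun p {..<q} V" "has_parity m f" and m: "m < 2" for f m
  proof -
    let ?g = "\<lambda>n. part n g"
    have gs: "?g n \<in> sfun p {..<q} V" for n by (rule sfun_part[OF g])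
    have "lap (lap (f * (?g 0 + ?g 1))) = lap (lap f) * (?g 0 + ?g 1) + f * lap (lap (?g 0 + ?g 1))"
      unfolding distrib_left lap2_add[OF sfun_mult[OF f(1) gs] sfun_mult[OF f(1) gs]] lap2_add[OF gs gs]
        lap2_mult_parity[OF f gs has_parity_part m pos2] lap2_mult_parity[OF f gs has_parity_part m one]
      by (simp add: algebra_simps)
    thus ?thesis by (simp only: part_decomposition)
  qed
  let ?f = "\<lambda>n. part n f"
  have fs: "?f n \<in> sfun p {..<q} V" for n by (rule sfun_part[OF f])
  have "lap (lap ((?f 0 + ?f 1) * g)) = lap (lap (?f 0 + ?f 1)) * g + (?f 0 + ?f 1) * lap (lap g)"
    unfolding distrib_right lap2_add[OF sfun_mult[OF fs g] sfun_mult[OF fs g]] lap2_add[OF fs fs]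
      1[OF fs has_parity_part pos2] 1[OF fs has_parity_part one]
    by (simp add: algebra_simps)
  thus ?thesis by (simp only: part_decomposition)
qed

lemma bra_add_left: "f \<in> sfun p {..<q} V \<Longrightarrow> f' \<in> sfun p {..<q} V \<Longrightarrow> bra (f + f') g = bra f g + bra f' g"
  unfolding bra_def by (simp add: tw_add D_add[OF sfun_tw sfun_tw] distrib_left distrib_right sum.distrib)

lemma lap_mult_tw:
  assumes f: "f \<in> sfun p {..<q} V" and g: "g \<in> sfun p {..<q} V"
  shows "lap (f * g) = lap f * g + tw 1 f * lap g + (bra f g + bra f g)"
proof -
  let ?f = "\<lambda>n. part n f"
  have fs: "?f n \<in> sfun p {..<q} V" for n by (rule sfun_part[OF f])
  have "lap ((?f 0 + ?f 1) * g) = lap (?f 0 + ?f 1) * g + (?f 0 + sg 1 (?f 1)) * lap g + (bra (?f 0 + ?f 1) g + bra (?f 0 + ?f 1) g)"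
    unfolding distrib_right lapQ(1)[OF sfun_mult[OF fs g] sfun_mult[OF fs g]] lapQ(1)[OF fs fs] bra_add_left[OF fs fs]
      lap_mult[OF Q_sub fs g has_parity_part]
    by (simp add: algebra_simps mult_2)
  thus ?thesis unfolding part_decomposition tw_part .
qed

text \<open>The square is an even operator, so it preserves the two parts on which the twist
  acts.\<close>

lemma lap2_tw:
  assumes f: "f \<in> sfun p {..<q} V"
  shows "lap (lap (tw 1 f)) = tw 1 (lap (lap f))"
proof -
  let ?f = "\<lambda>n. part n f"
  have fs: "?f n \<in> sfun p {..<q} V" for n by (rule sfun_part[OF f])
  have p: "tw 1 (lap (lap (?f n))) = sg n (lap (lap (?f n)))" for n
    using tw_sg[OF parity_lap2[OF has_parity_part]] by simp
  have "lap (lap (tw 1 f)) = lap (lap (?f 0)) + sg 1 (lap (lap (?f 1)))"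
    unfolding tw_part by (simp only: lap2_add fs sfun_sg lap_sg[OF Q_sub] lapQ)
  also have "\<dots> = tw 1 (lap (lap (?f 0)) + lap (lap (?f 1)))" unfolding tw_add p by simp
  also have "\<dots> = tw 1 (lap (lap f))" by (metis fs lap2_add part_decomposition)
  finally show ?thesis .
qed

lemma lap2_bra:
  assumes f: "f \<in> sfun p {..<q} V" and g: "g \<in> sfun p {..<q} V"
  shows "lap (lap (bra f g)) = bra (lap (lap f)) g + bra f (lap (lap g))"
proof (rule double_cancel)
  define DD where "DD f = lap (lap f)" for f
  note ls = sfun_lap[OF Q_sub] and bs = sfun_bra[OF Q_sub]
  have DDs: "DD h \<in> sfun p {..<q} V" if "h \<in> sfun p {..<q} V" for h unfolding DD_def using that by (intro ls)
  have b: "bra f g + bra f g = lap (f * g) - lap f * g - tw 1 f * lap g"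
    if "f \<in> sfun p {..<q} V" "g \<in> sfun p {..<q} V" for f g
    using lap_mult_tw[OF that] by simp
  have Dm: "DD (x * y) = DD x * y + x * DD y" if "x \<in> sfun p {..<q} V" "y \<in> sfun p {..<q} V" for x y
    unfolding DD_def by (rule lap2_mult[OF that])
  have Dd: "DD (x - y) = DD x - DD y" if "x \<in> sfun p {..<q} V" "y \<in> sfun p {..<q} V" for x y
    unfolding DD_def using that by (simp only: lap_diff[OF Q_sub] ls)
  have Da: "DD (x + y) = DD x + DD y" if "x \<in> sfun p {..<q} V" "y \<in> sfun p {..<q} V" for x y
    unfolding DD_def using that by (rule lap2_add)
  have Dl: "DD (lap x) = lap (DD x)" for x by (simp add: DD_def)
  have Dt: "DD (tw 1 f) = tw 1 (DD f)" unfolding DD_def by (rule lap2_tw[OF f])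
  have m: "lap (f * g) \<in> sfun p {..<q} V" "lap f * g \<in> sfun p {..<q} V" "tw 1 f * lap g \<in> sfun p {..<q} V"
    "DD f * g \<in> sfun p {..<q} V" "f * DD g \<in> sfun p {..<q} V"
    by (intro ls sfun_mult sfun_tw f g DDs)+
  \<comment> \<open>The product rule determines twice the bracket, so the doubled identity is
    computed.\<close>
  have "DD (bra f g) + DD (bra f g) = DD (bra f g + bra f g)"
    by (rule Da[symmetric]) (intro bs f g)+
  also have "\<dots> = DD (lap (f * g)) - DD (lap f * g) - DD (tw 1 f * lap g)"
    unfolding b[OF f g] by (simp only: Dd sfun_diff m)
  also have "DD (lap (f * g)) = lap (DD f * g) + lap (f * DD g)"
    unfolding Dl Dm[OF f g] by (rule lapQ(1)[OF m(4,5)])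
  also have "DD (lap f * g) = lap (DD f) * g + lap f * DD g"
    unfolding Dm[OF ls[OF f] g] Dl ..
  also have "DD (tw 1 f * lap g) = tw 1 (DD f) * lap g + tw 1 f * lap (DD g)"
    unfolding Dm[OF sfun_tw[OF f] ls[OF g]] Dl Dt ..
  also have "lap (DD f * g) + lap (f * DD g) - (lap (DD f) * g + lap f * DD g) - (tw 1 (DD f) * lap g + tw 1 f * lap (DD g))
    = (bra (DD f) g + bra (DD f) g) + (bra f (DD g) + bra f (DD g))"
    unfolding b[OF DDs[OF f] g] b[OF f DDs[OF g]] by simp
  finally show "lap (lap (bra f g)) + lap (lap (bra f g)) =
    bra (lap (lap f)) g + bra f (lap (lap g)) + (bra (lap (lap f)) g + bra f (lap (lap g)))"
    by (simp add: DD_def add_ac)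
qed

end

lemma restr_sg: "restr V' (sg k f) = sg k (restr V' f)"
  unfolding sg_def by (rule restr_sign)

section \<open>Localization, and the square as a combination of partial derivatives\<close>

context pre_poisson_domain
begin

lemma pre_poisson_restr:
  assumes "open_domain p V'" "V' \<subseteq> V"
  shows "pre_poisson_domain p V' q (\<lambda>a b. restr V' (S a b)) (restr V' \<rho>) (restr V' \<rho>')"
proof -
  interpret V': open_domain p V' by fact
  show ?thesis
  proof
    fix a b assume ab: "a < p + q" "b < p + q"
    show "restr V' (S a b) \<in> sfun p {..<q} V'" by (rule restr_sfun_subset[OF assms S_sfun[OF ab]])
    show "has_parity (parity p a + parity p b + 1) (restr V' (S a b))" by (rule has_parity_restr[OF S_parity[OF ab]])
    show "restr V' (S a b) = sg (parity p a * parity p b) (restr V' (S b a))"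
      unfolding restr_sg[symmetric] by (rule arg_cong[OF S_sym[OF ab]])
  next
    show "restr V' \<rho> * restr V' \<rho>' = restr V' 1"
      unfolding restr_mult[symmetric] rho_inv by (rule restr_restr[OF assms(2)])
  qed (intro restr_sfun_subset[OF assms] rho_sfun rho_inv_sfun has_parity_restr rho_parity)+
qed

lemma restr_lap:
  assumes "open_domain p V'" "V' \<subseteq> V"
  shows "pre_poisson_domain.lap p V' q (\<lambda>a b. restr V' (S a b)) (restr V' \<rho>) (restr V' \<rho>') (restr V' f) = restr V' (lap f)"
proof -
  interpret P': pre_poisson_domain p V' q "\<lambda>a b. restr V' (S a b)" "restr V' \<rho>" "restr V' \<rho>'"
    by (rule pre_poisson_restr[OF assms])
  show ?thesis unfolding P'.lap_def lap_def
    by (simp only: D_restr[OF assms] restr_mult[symmetric] restr_sum[symmetric])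
qed

end

context poisson_domain
begin

lemma poisson_restr:
  assumes "open_domain p V'" "V' \<subseteq> V"
  shows "poisson_domain p V' q (\<lambda>a b. restr V' (S a b)) (restr V' \<rho>) (restr V' \<rho>')"
proof -
  interpret P': pre_poisson_domain p V' q "\<lambda>a b. restr V' (S a b)" "restr V' \<rho>" "restr V' \<rho>'"
    by (rule pre_poisson_restr[OF assms])
  have "P'.trip x u v w = trip x u v w" if "x \<in> V'" for x u v w
    using that unfolding P'.trip_def trip_def D_restr[OF assms] by (simp add: restr_apply)
  thus ?thesis using jacobi assms(2) by unfold_locales (auto simp: subset_iff)
qed

text \<open>Both sides are derivations in \<open>f\<close> and agree on the coordinates;
  \<open>derivation_eq_0\<close> is applied to their difference \<open>e\<close>, with evaluation at
  \<open>y0\<close> as the homomorphism. The derivations are even and need no twist, hence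
  \<open>n = 0\<close>.\<close>

lemma lap2_cube:
  assumes V: "V = cube p y0 r" and r: "0 < r" and y0: "\<And>i. p \<le> i \<Longrightarrow> y0 i = 0" and f: "f \<in> sfun p {..<q} V"
  shows "lap (lap f) y0 = (\<Sum>a\<in>I. lap (lap (coordinate p V a)) * D a f) y0"
proof -
  define X where "X a = lap (lap (coordinate p V a))" for a
  define e where "e f = (lap (lap f) - (\<Sum>a\<in>I. X a * D a f)) y0" for f
  note ls = sfun_lap[OF Q_sub]
  have y0V: "y0 \<in> V" using r y0 by (simp add: V cube_def)
  have Xs: "X a \<in> sfun p {..<q} V" if "a \<in> I" for a
    unfolding X_def using that by (intro ls sfun_coordinate) auto
  have Xp: "has_parity (s a) (X a)" for a
    unfolding X_def by (intro parity_lap2 has_parity_coordinate)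
  have XD: "(\<Sum>a\<in>I. X a * D a (f * g)) = (\<Sum>a\<in>I. X a * D a f) * g + f * (\<Sum>a\<in>I. X a * D a g)"
    if "f \<in> sfun p {..<q} V" "g \<in> sfun p {..<q} V" for f g
  proof -
    have "X a * D a (f * g) = X a * D a f * g + f * (X a * D a g)" for a
      unfolding D_mult[OF that] distrib_left mult.assoc[symmetric] mult_tw_commute[OF Xp] ..
    thus ?thesis by (simp add: sum.distrib sum_distrib_left sum_distrib_right)
  qed
  have coord: "(\<Sum>a\<in>I. X a * D a (coordinate p V b)) = X b" if "b \<in> I" for b
  proof -
    have "(\<Sum>a\<in>I. X a * D a (coordinate p V b)) = (\<Sum>a\<in>I. if a = b then X b else 0)"
      by (rule sum.cong[OF refl]) (use that in \<open>simp add: D_coordinate unit_mult_sfun(2)[OF Xs]\<close>)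
    thus ?thesis using that by (simp add: sum.delta)
  qed
  have "e f = 0"
  proof (rule derivation_eq_0[where t = "\<lambda>f. f y0" and J = "{..<q}" and K = "{..<q}" and n = 0 and r = r and p = p and ?y0.0 = y0 and e = e and f = f])
    fix f g assume "f \<in> sfun p {..<q} (cube p y0 r)" "g \<in> sfun p {..<q} (cube p y0 r)"
    hence fg: "f \<in> sfun p {..<q} V" "g \<in> sfun p {..<q} V" by (simp_all add: V)
    have "(\<Sum>a\<in>I. X a * D a (f + g)) = (\<Sum>a\<in>I. X a * D a f) + (\<Sum>a\<in>I. X a * D a g)"
      by (simp add: D_add[OF fg] distrib_left sum.distrib)
    thus "e (f + g) = e f + e g"
      unfolding e_def lap2_add[OF fg] by (simp add: plus_fun_apply minus_apply)
    have "lap (lap (f * g)) - (\<Sum>a\<in>I. X a * D a (f * g)) =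
      (lap (lap f) - (\<Sum>a\<in>I. X a * D a f)) * g + f * (lap (lap g) - (\<Sum>a\<in>I. X a * D a g))"
      unfolding lap2_mult[OF fg] XD[OF fg] by (simp add: algebra_simps)
    thus "e (f * g) = e f * g y0 + twist 0 (f y0) * e g"
      by (simp add: e_def plus_fun_apply times_fun_apply)
  next
    fix f assume "f \<in> sfun p {..<q} (cube p y0 r)"
    hence f: "f \<in> sfun p {..<q} V" by (simp add: V)
    have "lap (lap f) - (\<Sum>a\<in>I. X a * D a f) \<in> sfun p {..<q} V"
      by (intro sfun_diff ls f sfun_sum sfun_mult Xs sfun_D)
    thus "gsupp {..<q} (e f)" by (simp add: e_def sfun_def)
  next
    fix c
    have "D a (const_fun V (of_real c)) = 0" for a by (simp add: D_const_fun)
    thus "e (const_fun (cube p y0 r) (of_real c)) = 0"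
      unfolding V[symmetric] e_def by (simp add: lap_const_real[OF Q_sub])
  next
    fix i assume "i < p"
    thus "e (coordinate p (cube p y0 r) i) = 0"
      unfolding V[symmetric] e_def using coord[of i] by (simp add: X_def)
    show "coeff ((coordinate p (cube p y0 r) i - const_fun (cube p y0 r) (of_real (y0 i))) y0) {} = 0"
      unfolding V[symmetric] using \<open>i < p\<close> y0V by (simp add: coordinate_def const_fun_def restr_apply minus_apply)
  next
    fix j assume "j \<in> {..<q}"
    thus "e (coordinate p (cube p y0 r) (p + j)) = 0"
      unfolding V[symmetric] e_def using coord[of "p + j"] by (simp add: X_def)
  qed (use r y0 f V in auto)
  thus ?thesis by (simp add: e_def X_def minus_apply)
qed

text \<open>The identity is local: around each point everything restricts to a cube, where
  \<open>lap2_cube\<close> evaluates it at the centre.\<close>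

theorem lap2_field:
  assumes f: "f \<in> sfun p {..<q} V"
  shows "lap (lap f) = (\<Sum>a\<in>I. lap (lap (coordinate p V a)) * D a f)"
proof (rule ext)
  fix x
  note ls = sfun_lap[OF Q_sub]
  have R: "(\<Sum>a\<in>I. lap (lap (coordinate p V a)) * D a f) \<in> sfun p {..<q} V"
    by (intro sfun_sum sfun_mult ls sfun_coordinate sfun_D f) auto
  show "lap (lap f) x = (\<Sum>a\<in>I. lap (lap (coordinate p V a)) * D a f) x"
  proof (cases "x \<in> V")
    case True
    obtain r where r: "r > 0" "cube p x r \<subseteq> V" using cube_subset_open[OF open_V True] by blast
    let ?U = "cube p x r"
    have U: "open_domain p ?U" by unfold_locales (rule openin_cube)
    interpret P': poisson_domain p ?U q "\<lambda>a b. restr ?U (S a b)" "restr ?U \<rho>" "restr ?U \<rho>'"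
      by (rule poisson_restr[OF U r(2)])
    have xU: "x \<in> ?U" using open_V True r(1) by simp
    have l: "P'.lap (P'.lap (restr ?U f)) = restr ?U (lap (lap f))" for f
      unfolding restr_lap[OF U r(2)] ..
    have "P'.lap (P'.lap (restr ?U f)) x = (\<Sum>a\<in>I. P'.lap (P'.lap (coordinate p ?U a)) * partial p ?U a (restr ?U f)) x"
      by (rule P'.lap2_cube[OF refl r(1) Euclidean_space_eq_0[OF open_V True] restr_sfun_subset[OF U r(2) f]])
    also have "(\<Sum>a\<in>I. P'.lap (P'.lap (coordinate p ?U a)) * partial p ?U a (restr ?U f)) =
       restr ?U (\<Sum>a\<in>I. lap (lap (coordinate p V a)) * D a f)"
      unfolding restr_coordinate[OF r(2), symmetric] l D_restr[OF U r(2)] restr_mult[symmetric] restr_sum[symmetric] ..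
    finally have "restr ?U (lap (lap f)) x = restr ?U (\<Sum>a\<in>I. lap (lap (coordinate p V a)) * D a f) x"
      unfolding l .
    thus ?thesis using xU by (simp only: restr_apply if_True)
  next
    case False
    thus ?thesis using sfun_outside[OF ls[OF ls[OF f]]] sfun_outside[OF R] by simp
  qed
qed

end

section \<open>The Jacobi identity from the canonical bracket\<close>

lemma (in open_domain) open_cotangent: "open_domain (2 * p) (cotangent p V)"
proof
  obtain U where U: "open U" "V = U \<inter> {x. \<forall>i\<ge>p. x i = 0}"
    using open_V by (auto simp: openin_Euclidean_space_iff)
  have "continuous_on UNIV (base_point p)"
  proof (rule continuous_on_coordinatewise_then_product)
    show "continuous_on UNIV (\<lambda>y. base_point p y i)" for i
      by (cases "i < p") (auto simp: base_point_def)
  qed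
  hence "open (base_point p -` U)" using U(1) open_vimage by blast
  moreover have "cotangent p V = base_point p -` U \<inter> {x. \<forall>i\<ge>2 * p. x i = 0}"
    unfolding cotangent_def U(2) topspace_Euclidean_space by (auto simp: base_point_def)
  ultimately show "openin (Euclidean_space (2 * p)) (cotangent p V)"
    unfolding openin_Euclidean_space_iff by blast
qed

locale cotangent_domain = open_domain p V for p V +
  fixes q :: nat
begin

abbreviation "C \<equiv> cotangent p V"

sublocale Ct: open_domain "2 * p" C by (rule open_cotangent)

abbreviation lift where "lift f \<equiv> lift_to_cotangent p V f"
abbreviation \<pi> where "\<pi> a \<equiv> partial (2 * p) C (mom_index p q a)"
abbreviation \<xi> where "\<xi> a \<equiv> partial (2 * p) C (pos_index p a)"
abbreviation P where "P a \<equiv> coordinate (2 * p) C (mom_index p q a)"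

lemma base_point_cotangent: "y \<in> C \<Longrightarrow> base_point p y \<in> V" by (simp add: cotangent_def)

lemma lift_apply: "lift f y = (if y \<in> C then f (base_point p y) else 0)"
  by (simp add: lift_to_cotangent_def restr_apply)

lemma base_point_update: "base_point p (y(i := t)) = (if i < p then (base_point p y)(i := t) else base_point p y)"
  by (auto simp: base_point_def fun_eq_iff)

text \<open>The composite is constant in the momenta, and its derivatives in the base directions are
  composites of the same kind.\<close>

lemma Ck_base_point: "smooth_on p V h \<Longrightarrow> Ck_on (2 * p) k C (\<lambda>y. h (base_point p y))"
proof (induction k arbitrary: h)
  case 0
  have "continuous_on C (base_point p)"
  proof (rule continuous_on_coordinatewise_then_product)
    show "continuous_on C (\<lambda>y. base_point p y i)" for i
      by (cases "i < p") (auto simp: base_point_def intro: continuous_on_subset[OF continuous_on_product_coordinates])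
  qed
  thus ?case using continuous_on_compose2[OF smooth_on_continuous[OF 0]] base_point_cotangent by (auto simp: image_subset_iff)
next
  case (Suc k)
  show ?case
  proof (rule Ck_on_SucI[OF Ct.open_V, where D = "\<lambda>i y. if i < p then partial_real i h (base_point p y) else 0"])
    show "continuous_on C (\<lambda>y. h (base_point p y))"
    proof (rule continuous_on_compose2[OF smooth_on_continuous[OF Suc.prems]])
      show "continuous_on C (base_point p)"
      proof (rule continuous_on_coordinatewise_then_product)
        show "continuous_on C (\<lambda>y. base_point p y i)" for i
          by (cases "i < p") (auto simp: base_point_def intro: continuous_on_subset[OF continuous_on_product_coordinates])
      qed
    qed (use base_point_cotangent in auto)
    show "((\<lambda>t. h (base_point p (y(i := t)))) has_real_derivative (if i < p then partial_real i h (base_point p y) else 0)) (at (y i))"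
      if "i < 2 * p" "y \<in> C" for i y
    proof (cases "i < p")
      case True
      hence "base_point p y i = y i" by (simp add: base_point_def)
      thus ?thesis using smooth_on_DERIV[OF Suc.prems base_point_cotangent[OF that(2)] True] True
        by (simp only: base_point_update if_True)
    qed (simp add: base_point_update)
    show "Ck_on (2 * p) k C (\<lambda>y. if i < p then partial_real i h (base_point p y) else 0)" if "i < 2 * p" for i
      using Suc.IH[OF smooth_on_partial[OF Suc.prems]] by (cases "i < p") auto
  qed
qed

lemma sfun_lift: "f \<in> sfun p J V \<Longrightarrow> lift f \<in> sfun (2 * p) J C"
proof -
  assume f: "f \<in> sfun p J V"
  have "smooth_on (2 * p) C (\<lambda>y. coeff (lift f y) I)" for I
  proof -
    have "smooth_on (2 * p) C (\<lambda>y. coeff (lift f y) I) \<longleftrightarrow> smooth_on (2 * p) C (\<lambda>y. coeff (f (base_point p y)) I)"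
      by (rule smooth_on_cong[OF Ct.open_V]) (simp add: lift_apply)
    thus ?thesis using Ck_base_point[OF sfun_smooth[OF f]] by (simp add: smooth_on_def)
  qed
  thus ?thesis using f by (simp add: sfun_def lift_apply)
qed

lemma has_parity_lift: "has_parity n f \<Longrightarrow> has_parity n (lift f)"
  by (simp add: has_parity_iff lift_apply)

lemma lift_sg: "lift (sg k f) = sg k (lift f)"
  by (auto simp: lift_apply sg_def times_fun_apply fun_eq_iff)

lemma xi_lift:
  assumes f: "f \<in> sfun p J V" shows "\<xi> a (lift f) = lift (D a f)"
proof (rule Ct.D_eqI, goal_cases)
  case (1 y I)
  hence a: "a < p" "pos_index p a = a" by (auto simp: pos_index_def split: if_splits)
  have "((\<lambda>t. coeff (f (base_point p (y(a := t)))) I) has_real_derivative coeff (D a f (base_point p y)) I) (at (y a))"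
    using coeff_DERIV[OF f base_point_cotangent[OF 1(1)] a(1), of I] a by (simp add: base_point_update) (simp add: base_point_def)
  hence "partial_real a (\<lambda>y. coeff (f (base_point p y)) I) y = coeff (D a f (base_point p y)) I"
    by (rule partial_real_eqI)
  moreover have "partial_real a (\<lambda>y. coeff (lift f y) I) y = partial_real a (\<lambda>y. coeff (f (base_point p y)) I) y"
    by (rule partial_real_cong[OF Ct.open_V]) (use 1 a in \<open>auto simp: lift_apply\<close>)
  ultimately show ?case using 1 a by (simp add: lift_apply)
next
  case (2 y)
  hence "\<not> a < p" by (auto simp: pos_index_def split: if_splits)
  thus ?case using 2 base_point_cotangent[OF 2(1)] by (simp add: pos_index_def lift_apply D_odd)
qed (simp add: lift_apply)

text \<open>A lifted function is constant in the even momenta and uses only odd generators below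
  \<open>q\<close>, while the odd momenta are the generators from \<open>q\<close> to
  \<open>2 * q - 1\<close>.\<close>

lemma pi_lift:
  assumes f: "f \<in> sfun p {..<q} V" shows "\<pi> a (lift f) = 0"
proof (rule Ct.D_eqI, goal_cases)
  case (1 y I)
  hence a: "a < p" "mom_index p q a = p + a" by (auto simp: mom_index_def split: if_splits)
  have "partial_real (p + a) (\<lambda>y. coeff (lift f y) I) y = partial_real (p + a) (\<lambda>y. coeff (f (base_point p y)) I) y"
    by (rule partial_real_cong[OF Ct.open_V]) (use 1 a in \<open>auto simp: lift_apply\<close>)
  thus ?case by (simp add: a partial_real_def base_point_update)
next
  case (2 y)
  hence a: "\<not> a < p" by (auto simp: mom_index_def split: if_splits)
  have "gsupp {..<q} (lift f y)" using f by (simp add: sfun_def lift_apply)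
  thus ?case using odd_deriv_gsupp[of "{..<q}" "lift f y" "mom_index p q a - 2 * p"] a by (simp add: mom_index_def)
qed simp

lemma index_parity: "a < p + q \<Longrightarrow> parity (2 * p) (mom_index p q a) = parity p a" "parity (2 * p) (pos_index p a) = parity p a"
  by (auto simp: parity_def mom_index_def pos_index_def)

lemma pi_P: "a < p + q \<Longrightarrow> b < p + q \<Longrightarrow> \<pi> a (P b) = (if a = b then restr C 1 else 0)"
  unfolding Ct.D_coordinate by (auto simp: mom_index_def split: if_splits)

lemma xi_P: "a < p + q \<Longrightarrow> b < p + q \<Longrightarrow> \<xi> a (P b) = 0"
  unfolding Ct.D_coordinate by (auto simp: mom_index_def pos_index_def split: if_splits)

lemma sfun_P: "a < p + q \<Longrightarrow> {..<2 * q} \<subseteq> J \<Longrightarrow> P a \<in> sfun (2 * p) J C"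
  by (rule Ct.sfun_coordinate) (auto simp: mom_index_def split: if_splits)

lemma parity_P: "a < p + q \<Longrightarrow> has_parity (parity p a) (P a)"
  using Ct.has_parity_coordinate[of "mom_index p q a"] index_parity by simp

end

locale cotangent_structure = cotangent_domain p V q for p V q +
  fixes S :: "nat \<Rightarrow> nat \<Rightarrow> superfun"
  assumes S_sfun: "a < p + q \<Longrightarrow> b < p + q \<Longrightarrow> S a b \<in> sfun p {..<q} V"
    and S_parity: "a < p + q \<Longrightarrow> b < p + q \<Longrightarrow> has_parity (parity p a + parity p b + 1) (S a b)"
    and S_sym: "a < p + q \<Longrightarrow> b < p + q \<Longrightarrow> S a b = sg (parity p a * parity p b) (S b a)"
begin

abbreviation I where "I \<equiv> {..<p + q}"
text \<open>The \<open>2 * q\<close> odd coordinates of the cotangent bundle and the three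
  parameters.\<close>

abbreviation "K \<equiv> {..<2 * q + 3}"

definition "H \<equiv> quadratic_hamiltonian p q V S"

text \<open>Twice \<open>H\<close>; the constant 1/2 is carried separately, so that only sums of
  products are differentiated.\<close>

definition "H2 = (\<Sum>a\<in>I. \<Sum>b\<in>I. lift (S a b) * (P b * P a))"

lemma lift_in: "f \<in> sfun p {..<q} V \<Longrightarrow> lift f \<in> sfun (2 * p) K C"
  by (rule sfun_mono[OF sfun_lift]) auto
lemma P_in: "a \<in> I \<Longrightarrow> P a \<in> sfun (2 * p) K C" by (rule sfun_P) auto
lemma S_in': "a \<in> I \<Longrightarrow> b \<in> I \<Longrightarrow> lift (S a b) \<in> sfun (2 * p) K C" by (rule lift_in) (simp add: S_sfun)
lemma parP: "a \<in> I \<Longrightarrow> has_parity (s a) (P a)" by (rule parity_P) auto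
lemma parS: "a \<in> I \<Longrightarrow> b \<in> I \<Longrightarrow> has_parity (s a + s b + 1) (lift (S a b))"
  by (rule has_parity_lift, rule S_parity) auto

lemma H2_in: "H2 \<in> sfun (2 * p) K C"
  unfolding H2_def by (intro Ct.sfun_sum Ct.sfun_mult S_in' P_in)

lemma H_eq: "H = const_fun C (of_real (1/2)) * H2"
proof
  fix y
  have "(\<Sum>a\<in>I. \<Sum>b\<in>I. lift (S a b) * P b * P a) = H2" by (simp add: H2_def mult.assoc)
  hence "H y = (1/2) *\<^sub>R H2 y" unfolding H_def quadratic_hamiltonian_def Let_def by simp
  thus "H y = (const_fun C (of_real (1/2)) * H2) y"
    using sfun_outside[OF H2_in, of y] by (simp add: times_fun_apply const_fun_def restr_apply of_real_def)
qed

lemma half_double: "f \<in> sfun (2 * p) K C \<Longrightarrow> const_fun C (of_real (1/2)) * f + const_fun C (of_real (1/2)) * f = f"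
  unfolding distrib_right[symmetric] const_fun_add[symmetric] of_real_add[symmetric]
  using unit_mult_sfun(1)[of f] by (simp add: restr_one)

lemma half: "const_fun C (of_real (1/2)) \<in> sfun (2 * p) K C" "has_parity 0 (const_fun C (of_real (1/2)))"
  by (auto intro!: Ct.sfun_const_fun has_parity_const_fun)

lemma H_parity: "has_parity 1 H"
proof -
  have "has_parity (0 + 1) H" unfolding H_eq H2_def
  proof (intro has_parity_mult half has_parity_sum)
    fix a b assume "a \<in> I" "b \<in> I"
    hence "has_parity ((s a + s b + 1) + (s b + s a)) (lift (S a b) * (P b * P a))"
      by (intro has_parity_mult parS parP)
    thus "has_parity 1 (lift (S a b) * (P b * P a))" by (rule has_parity_cong) presburger
  qed
  thus ?thesis by simp
qed

lemma D_H: "partial (2 * p) C i H + partial (2 * p) C i H = partial (2 * p) C i H2"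
proof -
  have "partial (2 * p) C i H = const_fun C (of_real (1/2)) * partial (2 * p) C i H2"
    unfolding H_eq Ct.D_mult_sg[OF half(1) H2_in half(2)] Ct.D_const_fun by simp
  thus ?thesis using half_double[OF Ct.sfun_D[OF H2_in]] by simp
qed

text \<open>Either momentum in a quadratic term can be differentiated; the symmetry of
  \<open>S\<close> makes the two contributions equal, which uses up the factor 1/2.\<close>

lemma pi_H:
  assumes a: "a \<in> I" shows "\<pi> a H = (\<Sum>c\<in>I. lift (S a c) * P c)"
proof (rule double_cancel)
  have PP: "\<pi> a (P e * P c) = (if a = e then P c else 0) + sg (s a * s e) (if a = c then P e else 0)"
    if "e \<in> I" "c \<in> I" for e c
    using a that Ct.D_mult_sg[OF P_in P_in parP, of e c "mom_index p q a"] pi_P[of a e] pi_P[of a c] index_parity[of a]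
      unit_mult_sfun[OF P_in] by auto
  have t: "\<pi> a (lift (S c e) * (P e * P c)) = (if a = e then lift (S a c) * P c else 0) + (if a = c then lift (S a e) * P e else 0)"
    if e: "e \<in> I" and c: "c \<in> I" for e c
  proof -
    have "\<pi> a (lift (S c e) * (P e * P c)) = sg (s a * (s c + s e + 1)) (lift (S c e) * \<pi> a (P e * P c))"
      using Ct.D_mult_sg[OF S_in'[OF c e] Ct.sfun_mult[OF P_in[OF e] P_in[OF c]] parS[OF c e], of "mom_index p q a"]
        pi_lift[OF S_sfun, of c e a] index_parity[of a] a c e by simp
    also have "\<dots> = sg (s a * (s c + s e + 1)) (if a = e then lift (S c e) * P c else 0) + sg (s a * (s c + s e + 1) + s a * s e) (if a = c then lift (S c e) * P e else 0)"
      unfolding PP[OF e c] by (simp add: distrib_left sg_add)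
    also have "sg (s a * (s c + s e + 1)) (if a = e then lift (S c e) * P c else 0) = (if a = e then lift (S a c) * P c else 0)"
    proof (cases "a = e")
      case True
      have "lift (S c a) = sg (s c * s a) (lift (S a c))" using S_sym[of c a] a c lift_sg by auto
      thus ?thesis using True by simp (rule sg_even, simp, blast)
    qed simp
    also have "sg (s a * (s c + s e + 1) + s a * s e) (if a = c then lift (S c e) * P e else 0) = (if a = c then lift (S a e) * P e else 0)"
      by (cases "a = c") (simp, rule sg_even, simp, blast, simp)
    finally show ?thesis .
  qed
  have "\<pi> a H + \<pi> a H = \<pi> a H2" by (rule D_H)
  also have "\<dots> = (\<Sum>c\<in>I. \<Sum>e\<in>I. \<pi> a (lift (S c e) * (P e * P c)))"
  proof -
    have m: "lift (S c e) * (P e * P c) \<in> sfun (2 * p) K C" if "c \<in> I" "e \<in> I" for c e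
      using that by (intro Ct.sfun_mult S_in' P_in)
    have "\<pi> a H2 = (\<Sum>c\<in>I. \<pi> a (\<Sum>e\<in>I. lift (S c e) * (P e * P c)))"
      unfolding H2_def by (rule Ct.D_sum[where J = K]) (intro Ct.sfun_sum m)
    also have "\<dots> = (\<Sum>c\<in>I. \<Sum>e\<in>I. \<pi> a (lift (S c e) * (P e * P c)))"
      by (intro sum.cong refl Ct.D_sum[where J = K] m)
    finally show ?thesis .
  qed
  also have "\<dots> = (\<Sum>c\<in>I. \<Sum>e\<in>I. (if a = e then lift (S a c) * P c else 0) + (if a = c then lift (S a e) * P e else 0))"
    by (intro sum.cong refl t)
  also have "\<dots> = (\<Sum>c\<in>I. \<Sum>e\<in>I. if a = e then lift (S a c) * P c else 0) + (\<Sum>c\<in>I. \<Sum>e\<in>I. if a = c then lift (S a e) * P e else 0)"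
    by (simp only: sum.distrib)
  also have "(\<Sum>c\<in>I. \<Sum>e\<in>I. if a = e then lift (S a c) * P c else 0) = (\<Sum>c\<in>I. lift (S a c) * P c)"
    using a by (simp add: sum.delta')
  also have "(\<Sum>c\<in>I. \<Sum>e\<in>I. if a = c then lift (S a e) * P e else 0) = (\<Sum>e\<in>I. \<Sum>c\<in>I. if a = c then lift (S a e) * P e else 0)"
    by (rule sum.swap)
  also have "\<dots> = (\<Sum>e\<in>I. lift (S a e) * P e)"
    using a by (simp add: sum.delta')
  finally show "\<pi> a H + \<pi> a H = (\<Sum>c\<in>I. lift (S a c) * P c) + (\<Sum>c\<in>I. lift (S a c) * P c)" .
qed

lemma xi_H:
  assumes a: "a \<in> I" shows "\<xi> a H + \<xi> a H = (\<Sum>k\<in>I. \<Sum>l\<in>I. lift (D a (S k l)) * (P l * P k))"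
proof -
  have m: "lift (S c e) * (P e * P c) \<in> sfun (2 * p) K C" if "c \<in> I" "e \<in> I" for c e
    using that by (intro Ct.sfun_mult S_in' P_in)
  have "\<xi> a H + \<xi> a H = \<xi> a H2" by (rule D_H)
  also have "\<dots> = (\<Sum>c\<in>I. \<xi> a (\<Sum>e\<in>I. lift (S c e) * (P e * P c)))"
    unfolding H2_def by (rule Ct.D_sum[where J = K]) (intro Ct.sfun_sum m)
  also have "\<dots> = (\<Sum>c\<in>I. \<Sum>e\<in>I. \<xi> a (lift (S c e) * (P e * P c)))"
    by (intro sum.cong refl Ct.D_sum[where J = K] m)
  also have "\<dots> = (\<Sum>c\<in>I. \<Sum>e\<in>I. lift (D a (S c e)) * (P e * P c))"
  proof (intro sum.cong refl)
    fix c e assume c: "c \<in> I" and e: "e \<in> I"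
    have "\<xi> a (P e * P c) = 0"
      using a c e Ct.D_mult_sg[OF P_in P_in parP, of e c "pos_index p a"] xi_P[of a e] xi_P[of a c] by simp
    thus "\<xi> a (lift (S c e) * (P e * P c)) = lift (D a (S c e)) * (P e * P c)"
      using Ct.D_mult_sg[OF S_in'[OF c e] Ct.sfun_mult[OF P_in[OF e] P_in[OF c]] parS[OF c e], of "pos_index p a"]
        xi_lift[OF S_sfun, of c e a] c e by simp
  qed
  finally show ?thesis .
qed

text \<open>The trilinear form \<open>trip\<close> transported to the cotangent bundle. With the
  momenta in all three places it becomes \<open>(H,H)\<close>.\<close>

definition cubic :: "(nat \<Rightarrow> superfun) \<Rightarrow> (nat \<Rightarrow> superfun) \<Rightarrow> (nat \<Rightarrow> superfun) \<Rightarrow> superfun" where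
  "cubic u v w = (\<Sum>a\<in>I. \<Sum>c\<in>I. \<Sum>k\<in>I. \<Sum>l\<in>I. lift (S a c) * (u c * (lift (D a (S k l)) * (v l * w k))))"

text \<open>For odd \<open>H\<close> the two halves of the canonical bracket coincide, and the
  resulting factor 2 completes \<open>\<xi> a H\<close> to the expression of
  \<open>xi_H\<close>.\<close>

lemma cubic_P:
  assumes "canonical_bracket p q V H H = 0" shows "cubic P P P = 0"
proof -
  have 0: "part 0 H = 0" "part 1 H = H" using part_has_parity[OF H_parity] by simp_all
  have pp: "has_parity (s a + 1) (\<pi> a H)" "has_parity (s a + 1) (\<xi> a H)" if "a \<in> I" for a
    using Ct.has_parity_D[OF H_parity, of "mom_index p q a"] Ct.has_parity_D[OF H_parity, of "pos_index p a"]
      index_parity[of a] that by simp_all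
  have two: "(\<Sum>n<2. h n) = h 0 + h 1" for h :: "nat \<Rightarrow> superfun" by (simp add: numeral_2_eq_2)
  have "0 = (\<Sum>a\<in>I. (-1) ^ (s a * 2) * \<pi> a H * \<xi> a H - (-1) ^ s a * \<xi> a H * \<pi> a H)"
    using assms unfolding canonical_bracket_def Let_def two 0 by simp
  also have "\<dots> = (\<Sum>a\<in>I. \<pi> a H * \<xi> a H + \<pi> a H * \<xi> a H)"
  proof (rule sum.cong[OF refl])
    fix a assume a: "a \<in> I"
    have "(-1) ^ s a * \<xi> a H * \<pi> a H = sg (s a) (\<xi> a H * \<pi> a H)" unfolding sg_def by (rule mult.assoc)
    also have "\<xi> a H * \<pi> a H = sg ((s a + 1) * (s a + 1)) (\<pi> a H * \<xi> a H)"
      by (intro sg_commute pp a)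
    also have "sg (s a) (sg ((s a + 1) * (s a + 1)) (\<pi> a H * \<xi> a H)) = - (\<pi> a H * \<xi> a H)"
      unfolding sg_sg by (rule sg_odd) simp
    finally have 1: "(-1) ^ s a * \<xi> a H * \<pi> a H = - (\<pi> a H * \<xi> a H)" .
    show "(-1) ^ (s a * 2) * \<pi> a H * \<xi> a H - (-1) ^ s a * \<xi> a H * \<pi> a H = \<pi> a H * \<xi> a H + \<pi> a H * \<xi> a H"
      unfolding 1 by simp
  qed
  also have "\<dots> = (\<Sum>a\<in>I. (\<Sum>c\<in>I. lift (S a c) * P c) * (\<Sum>k\<in>I. \<Sum>l\<in>I. lift (D a (S k l)) * (P l * P k)))"
    by (rule sum.cong[OF refl]) (simp only: distrib_left[symmetric] xi_H pi_H)
  also have "\<dots> = cubic P P P"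
    unfolding cubic_def sum_distrib_right by (intro sum.cong refl) (simp only: sum_distrib_left mult.assoc)
  finally show ?thesis by simp
qed

text \<open>
  The derivation \<open>p\<^sub>a \<mapsto> u\<^sub>a\<close>. Three such shifts polarize the form \<open>(H,H)\<close>, which is cubic in the momenta.
\<close>
definition shift :: "(nat \<Rightarrow> grassmann) \<Rightarrow> superfun \<Rightarrow> superfun" where
  "shift u f = (\<Sum>a\<in>I. const_fun C (u a) * \<pi> a f)"

text \<open>The component \<open>u c\<close> has the parity of the momentum it replaces, so that
  \<open>shift u\<close> is an even derivation; it contains no odd momentum, so that every shift
  annihilates it.\<close>

definition admissible :: "(nat \<Rightarrow> grassmann) \<Rightarrow> bool" where
  "admissible u \<longleftrightarrow> (\<forall>c<p + q. gpar (s c) (u c) \<and> gsupp (param_gens q) (u c))"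

lemma const_in: "gsupp (param_gens q) c \<Longrightarrow> const_fun C c \<in> sfun (2 * p) K C"
  by (rule Ct.sfun_const_fun, erule gsupp_mono) auto

lemma shift_mult:
  assumes u: "admissible u" and f: "f \<in> sfun (2 * p) K C" and g: "g \<in> sfun (2 * p) K C"
  shows "shift u (f * g) = shift u f * g + f * shift u g"
proof -
  have "const_fun C (u a) * \<pi> a (f * g) = const_fun C (u a) * \<pi> a f * g + f * (const_fun C (u a) * \<pi> a g)"
    if a: "a \<in> I" for a
  proof -
    have "has_parity (s a) (const_fun C (u a))" using u a by (auto simp: admissible_def intro: has_parity_const_fun)
    from mult_tw_commute[OF this, of f] show ?thesis
      using Ct.D_mult[OF f g, of "mom_index p q a"] index_parity[of a] a by (simp add: distrib_left mult.assoc[symmetric])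
  qed
  thus ?thesis by (simp add: shift_def sum.distrib sum_distrib_left sum_distrib_right)
qed

lemma shift_add: "f \<in> sfun (2 * p) K C \<Longrightarrow> g \<in> sfun (2 * p) K C \<Longrightarrow> shift u (f + g) = shift u f + shift u g"
  unfolding shift_def by (simp add: Ct.D_add distrib_left sum.distrib)

lemma shift_0 [simp]: "shift u 0 = 0" by (simp add: shift_def)

lemma shift_sum: "(\<And>a. a \<in> A \<Longrightarrow> f a \<in> sfun (2 * p) K C) \<Longrightarrow> shift u (\<Sum>a\<in>A. f a) = (\<Sum>a\<in>A. shift u (f a))"
  by (induction A rule: infinite_finite_induct) (simp_all add: shift_add Ct.sfun_sum)

lemma shift_lift: "f \<in> sfun p {..<q} V \<Longrightarrow> shift u (lift f) = 0"
  by (simp add: shift_def pi_lift)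

lemma shift_P: "admissible u \<Longrightarrow> c \<in> I \<Longrightarrow> shift u (P c) = const_fun C (u c)"
proof -
  assume u: "admissible u" and c: "c \<in> I"
  have "shift u (P c) = (\<Sum>a\<in>I. if a = c then const_fun C (u c) else 0)"
    unfolding shift_def
    by (rule sum.cong[OF refl]) (use u c in \<open>auto simp: pi_P admissible_def intro!: unit_mult_sfun(2) const_in\<close>)
  thus ?thesis using c by (simp add: sum.delta)
qed

text \<open>The numbers \<open>q\<close> to \<open>2 * q - 1\<close> of the odd momenta are missing
  from \<open>param_gens q\<close>.\<close>

lemma shift_const: "gsupp (param_gens q) d \<Longrightarrow> shift u (const_fun C d) = 0"
proof -
  assume d: "gsupp (param_gens q) d"
  have "\<pi> a (const_fun C d) = 0" if "a \<in> I" for a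
  proof (cases "a < p")
    case False
    hence "mom_index p q a - 2 * p \<notin> param_gens q" using that by (auto simp: mom_index_def)
    from odd_deriv_gsupp[OF d this] show ?thesis by (simp add: Ct.D_const_fun)
  qed (simp add: Ct.D_const_fun mom_index_def)
  thus ?thesis by (simp add: shift_def)
qed

lemma shift_cubic:
  assumes u: "admissible u" and x: "\<And>c. c \<in> I \<Longrightarrow> x1 c \<in> sfun (2 * p) K C" "\<And>c. c \<in> I \<Longrightarrow> x2 c \<in> sfun (2 * p) K C" "\<And>c. c \<in> I \<Longrightarrow> x3 c \<in> sfun (2 * p) K C"
  shows "shift u (cubic x1 x2 x3) = cubic (\<lambda>c. shift u (x1 c)) x2 x3 + cubic x1 (\<lambda>c. shift u (x2 c)) x3 + cubic x1 x2 (\<lambda>c. shift u (x3 c))"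
proof -
  let ?t = "\<lambda>x1 x2 x3 a c k l. lift (S a c) * (x1 c * (lift (D a (S k l)) * (x2 l * x3 k)))"
  have DS: "lift (D a (S k l)) \<in> sfun (2 * p) K C" if "k \<in> I" "l \<in> I" for a k l
    using that by (intro lift_in sfun_D S_sfun) auto
  have m: "?t x1 x2 x3 a c k l \<in> sfun (2 * p) K C" if "a \<in> I" "c \<in> I" "k \<in> I" "l \<in> I" for a c k l
    using that by (intro Ct.sfun_mult S_in' x DS)
  have "shift u (cubic x1 x2 x3) = (\<Sum>a\<in>I. \<Sum>c\<in>I. \<Sum>k\<in>I. \<Sum>l\<in>I. shift u (?t x1 x2 x3 a c k l))"
    unfolding cubic_def by (subst shift_sum, intro Ct.sfun_sum m, assumption+, rule sum.cong[OF refl])+ (rule refl)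
  also have "\<dots> = (\<Sum>a\<in>I. \<Sum>c\<in>I. \<Sum>k\<in>I. \<Sum>l\<in>I. ?t (\<lambda>c. shift u (x1 c)) x2 x3 a c k l + ?t x1 (\<lambda>c. shift u (x2 c)) x3 a c k l
      + ?t x1 x2 (\<lambda>c. shift u (x3 c)) a c k l)"
  proof (intro sum.cong refl)
    fix a c k l assume i: "a \<in> I" "c \<in> I" "k \<in> I" "l \<in> I"
    have S0: "shift u (lift (S a c)) = 0" "shift u (lift (D a (S k l))) = 0"
      using i by (auto intro!: shift_lift sfun_D S_sfun)
    have m2: "x2 l * x3 k \<in> sfun (2 * p) K C" using i by (intro Ct.sfun_mult x)
    have m3: "lift (D a (S k l)) * (x2 l * x3 k) \<in> sfun (2 * p) K C" using i by (intro Ct.sfun_mult DS m2)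
    have m4: "x1 c * (lift (D a (S k l)) * (x2 l * x3 k)) \<in> sfun (2 * p) K C" using i by (intro Ct.sfun_mult x m3)
    show "shift u (?t x1 x2 x3 a c k l) = ?t (\<lambda>c. shift u (x1 c)) x2 x3 a c k l + ?t x1 (\<lambda>c. shift u (x2 c)) x3 a c k l
      + ?t x1 x2 (\<lambda>c. shift u (x3 c)) a c k l"
      unfolding shift_mult[OF u S_in'[OF i(1,2)] m4] shift_mult[OF u x(1)[OF i(2)] m3] shift_mult[OF u DS[OF i(3,4)] m2]
        shift_mult[OF u x(2)[OF i(4)] x(3)[OF i(3)]] S0
      by (simp add: distrib_left add.assoc)
  qed
  finally show ?thesis by (simp only: sum.distrib cubic_def)
qed

lemma cubic_cong:
  "(\<And>c. c \<in> I \<Longrightarrow> x1 c = y1 c) \<Longrightarrow> (\<And>c. c \<in> I \<Longrightarrow> x2 c = y2 c) \<Longrightarrow> (\<And>c. c \<in> I \<Longrightarrow> x3 c = y3 c) \<Longrightarrow>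
   cubic x1 x2 x3 = cubic y1 y2 y3"
  unfolding cubic_def by (intro sum.cong refl) simp

lemma cubic_zero:
  "(\<And>c. c \<in> I \<Longrightarrow> x1 c = 0) \<Longrightarrow> cubic x1 x2 x3 = 0"
  "(\<And>c. c \<in> I \<Longrightarrow> x2 c = 0) \<Longrightarrow> cubic x1 x2 x3 = 0"
  "(\<And>c. c \<in> I \<Longrightarrow> x3 c = 0) \<Longrightarrow> cubic x1 x2 x3 = 0"
  unfolding cubic_def by simp_all

lemma shift_cubic':
  assumes "admissible u"
    and "\<And>c. c \<in> I \<Longrightarrow> x1 c \<in> sfun (2 * p) K C" "\<And>c. c \<in> I \<Longrightarrow> x2 c \<in> sfun (2 * p) K C" "\<And>c. c \<in> I \<Longrightarrow> x3 c \<in> sfun (2 * p) K C"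
    and "\<And>c. c \<in> I \<Longrightarrow> shift u (x1 c) = y1 c" "\<And>c. c \<in> I \<Longrightarrow> shift u (x2 c) = y2 c" "\<And>c. c \<in> I \<Longrightarrow> shift u (x3 c) = y3 c"
  shows "shift u (cubic x1 x2 x3) = cubic y1 x2 x3 + cubic x1 y2 x3 + cubic x1 x2 y3"
proof -
  have "shift u (cubic x1 x2 x3) = cubic (\<lambda>c. shift u (x1 c)) x2 x3 + cubic x1 (\<lambda>c. shift u (x2 c)) x3 + cubic x1 x2 (\<lambda>c. shift u (x3 c))"
    by (rule shift_cubic) (use assms in auto)
  also have "\<dots> = cubic y1 x2 x3 + cubic x1 y2 x3 + cubic x1 x2 y3"
    by (intro arg_cong2[where f = plus] cubic_cong refl assms)
  finally show ?thesis .
qed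

text \<open>Each shift replaces one momentum by its direction, so three shifts of a cubic form give
  the sum over all six assignments of the directions to the arguments.\<close>

lemma cubic_polarization:
  assumes F: "cubic P P P = 0" and adm: "admissible u" "admissible v" "admissible w"
  defines "cu \<equiv> \<lambda>c. const_fun C (u c)" and "cv \<equiv> \<lambda>c. const_fun C (v c)" and "cw \<equiv> \<lambda>c. const_fun C (w c)"
  shows "cubic cw cv cu + cubic cw cu cv + cubic cv cw cu + cubic cu cw cv + cubic cv cu cw + cubic cu cv cw = 0"
proof -
  have cin: "cu c \<in> sfun (2 * p) K C" "cv c \<in> sfun (2 * p) K C" "cw c \<in> sfun (2 * p) K C" if "c \<in> I" for c
    unfolding cu_def cv_def cw_def using that adm by (auto intro!: const_in simp: admissible_def)
  have s0: "shift z (cu c) = 0" "shift z (cv c) = 0" "shift z (cw c) = 0" if "c \<in> I" for c z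
    unfolding cu_def cv_def cw_def using that adm by (auto intro!: shift_const simp: admissible_def)
  have sP: "shift u (P c) = cu c" "shift v (P c) = cv c" "shift w (P c) = cw c" if "c \<in> I" for c
    unfolding cu_def cv_def cw_def using that adm by (simp_all add: shift_P)
  have cubic_in: "cubic x1 x2 x3 \<in> sfun (2 * p) K C"
    if "\<And>c. c \<in> I \<Longrightarrow> x1 c \<in> sfun (2 * p) K C" "\<And>c. c \<in> I \<Longrightarrow> x2 c \<in> sfun (2 * p) K C" "\<And>c. c \<in> I \<Longrightarrow> x3 c \<in> sfun (2 * p) K C" for x1 x2 x3
    unfolding cubic_def by (intro Ct.sfun_sum Ct.sfun_mult S_in' lift_in sfun_D S_sfun that) auto
  have 1: "cubic cu P P + cubic P cu P + cubic P P cu = 0"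
  proof -
    have "0 = shift u (cubic P P P)" by (simp add: F)
    also have "\<dots> = cubic (\<lambda>c. shift u (P c)) P P + cubic P (\<lambda>c. shift u (P c)) P + cubic P P (\<lambda>c. shift u (P c))"
      by (rule shift_cubic[OF adm(1)]) (rule P_in, assumption)+
    also have "\<dots> = cubic cu P P + cubic P cu P + cubic P P cu"
      by (intro arg_cong2[where f = plus] cubic_cong refl sP)
    finally show ?thesis by simp
  qed
  have d0: "shift v (cubic cu P P) = cubic (\<lambda>_. 0) P P + cubic cu cv P + cubic cu P cv"
    by (rule shift_cubic'[OF adm(2)]; erule P_in cin s0 sP)
  have d1: "shift v (cubic P cu P) = cubic cv cu P + cubic P (\<lambda>_. 0) P + cubic P cu cv"
    by (rule shift_cubic'[OF adm(2)]; erule P_in cin s0 sP)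
  have d2: "shift v (cubic P P cu) = cubic cv P cu + cubic P cv cu + cubic P P (\<lambda>_. 0)"
    by (rule shift_cubic'[OF adm(2)]; erule P_in cin s0 sP)
  have d3: "shift w (cubic cu cv P) = cubic (\<lambda>_. 0) cv P + cubic cu (\<lambda>_. 0) P + cubic cu cv cw"
    by (rule shift_cubic'[OF adm(3)]; erule P_in cin s0 sP)
  have d4: "shift w (cubic cu P cv) = cubic (\<lambda>_. 0) P cv + cubic cu cw cv + cubic cu P (\<lambda>_. 0)"
    by (rule shift_cubic'[OF adm(3)]; erule P_in cin s0 sP)
  have d5: "shift w (cubic cv cu P) = cubic (\<lambda>_. 0) cu P + cubic cv (\<lambda>_. 0) P + cubic cv cu cw"
    by (rule shift_cubic'[OF adm(3)]; erule P_in cin s0 sP)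
  have d6: "shift w (cubic P cu cv) = cubic cw cu cv + cubic P (\<lambda>_. 0) cv + cubic P cu (\<lambda>_. 0)"
    by (rule shift_cubic'[OF adm(3)]; erule P_in cin s0 sP)
  have d7: "shift w (cubic cv P cu) = cubic (\<lambda>_. 0) P cu + cubic cv cw cu + cubic cv P (\<lambda>_. 0)"
    by (rule shift_cubic'[OF adm(3)]; erule P_in cin s0 sP)
  have d8: "shift w (cubic P cv cu) = cubic cw cv cu + cubic P (\<lambda>_. 0) cu + cubic P cv (\<lambda>_. 0)"
    by (rule shift_cubic'[OF adm(3)]; erule P_in cin s0 sP)
  have z: "cubic (\<lambda>_. 0) x y = 0" "cubic x (\<lambda>_. 0) y = 0" "cubic x y (\<lambda>_. 0) = 0" for x y
    by (simp_all add: cubic_zero)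
  have m: "cubic cu P P \<in> sfun (2 * p) K C" "cubic P cu P \<in> sfun (2 * p) K C" "cubic P P cu \<in> sfun (2 * p) K C"
    "cubic cu cv P \<in> sfun (2 * p) K C" "cubic cu P cv \<in> sfun (2 * p) K C" "cubic cv cu P \<in> sfun (2 * p) K C"
    "cubic P cu cv \<in> sfun (2 * p) K C" "cubic cv P cu \<in> sfun (2 * p) K C" "cubic P cv cu \<in> sfun (2 * p) K C"
    by (rule cubic_in; erule P_in cin)+
  note 2 = d0 d1 d2 and 3 = d3 d4 d5 d6 d7 d8
  have "0 = shift v (cubic cu P P + cubic P cu P + cubic P P cu)" by (simp add: 1)
  also have "\<dots> = (cubic cu cv P + cubic cu P cv) + (cubic cv cu P + cubic P cu cv) + (cubic cv P cu + cubic P cv cu)"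
    by (simp only: shift_add Ct.sfun_add m 2 z) simp
  finally have "0 = shift w ((cubic cu cv P + cubic cu P cv) + (cubic cv cu P + cubic P cu cv) + (cubic cv P cu + cubic P cv cu))"
    by simp
  also have "\<dots> = cubic cu cv cw + cubic cu cw cv + (cubic cv cu cw + cubic cw cu cv) + (cubic cv cw cu + cubic cw cv cu)"
    by (simp only: shift_add Ct.sfun_add m 3 z) simp
  finally show ?thesis by (simp add: add_ac)
qed

text \<open>From the symmetry of \<open>S\<close>. It pairs the six terms of
  \<open>cubic_polarization\<close> into twice the cyclic sum.\<close>

lemma cubic_symmetric:
  assumes "admissible v" "admissible w"
  shows "cubic cu (\<lambda>c. const_fun C (v c)) (\<lambda>c. const_fun C (w c)) = cubic cu (\<lambda>c. const_fun C (w c)) (\<lambda>c. const_fun C (v c))"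
proof -
  let ?v = "\<lambda>c. const_fun C (v c)" and ?w = "\<lambda>c. const_fun C (w c)"
  have "cubic cu ?v ?w = (\<Sum>a\<in>I. \<Sum>c\<in>I. \<Sum>l\<in>I. \<Sum>k\<in>I. lift (S a c) * (cu c * (lift (D a (S k l)) * (?v l * ?w k))))"
    unfolding cubic_def by (intro sum.cong refl sum.swap)
  also have "\<dots> = (\<Sum>a\<in>I. \<Sum>c\<in>I. \<Sum>l\<in>I. \<Sum>k\<in>I. lift (S a c) * (cu c * (lift (D a (S l k)) * (?w k * ?v l))))"
  proof (intro sum.cong refl)
    fix a c k l assume i: "k \<in> I" "l \<in> I"
    have "lift (D a (S k l)) = sg (s k * s l) (lift (D a (S l k)))"
      using S_sym[of k l] D_sg[OF S_sfun, of l k a "s k * s l"] i lift_sg by auto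
    moreover have "?v l * ?w k = sg (s l * s k) (?w k * ?v l)"
      using i assms by (intro sg_commute has_parity_const_fun) (auto simp: admissible_def)
    ultimately show "lift (S a c) * (cu c * (lift (D a (S k l)) * (?v l * ?w k))) = lift (S a c) * (cu c * (lift (D a (S l k)) * (?w k * ?v l)))"
      by simp (rule sg_even, auto)
  qed
  finally show ?thesis by (simp add: cubic_def)
qed

theorem jacobi_of_bracket:
  assumes "canonical_bracket p q V H H = 0" "admissible u" "admissible v" "admissible w" "x \<in> V"
  defines "trip \<equiv> \<lambda>x u v w. (\<Sum>a\<in>I. \<Sum>e\<in>I. \<Sum>k\<in>I. \<Sum>l\<in>I. S a e x * u e * D a (S k l) x * v l * w k)"
  shows "trip x u v w + trip x v w u + trip x w u v = 0"
proof -
  let ?c = "\<lambda>u c. const_fun C (u c)"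
  \<comment> \<open>A point of \<open>V\<close> has zeros from index \<open>p\<close> on, so it is
    also the point of the cotangent bundle over itself with zero even momenta.\<close>
  have bx: "base_point p x = x"
    using Euclidean_space_eq_0[OF open_V assms(5)] by (auto simp: base_point_def fun_eq_iff not_less)
  hence xC: "x \<in> C" "base_point p x = x"
    using Euclidean_space_eq_0[OF open_V assms(5)] assms(5) by (simp_all add: cotangent_def topspace_Euclidean_space)
  have t: "cubic (?c u) (?c v) (?c w) x = trip x u v w" for u v w
    unfolding cubic_def trip_def sum_fun_apply times_fun_apply
    using xC by (simp add: lift_apply const_fun_def restr_apply mult.assoc)
  let ?X = "cubic (?c u) (?c v) (?c w) + cubic (?c v) (?c w) (?c u) + cubic (?c w) (?c u) (?c v)"
  have "?X + ?X = 0 + 0"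
    using cubic_polarization[OF cubic_P[OF assms(1)] assms(2-4)] cubic_symmetric[OF assms(3,4), of "?c u"]
      cubic_symmetric[OF assms(4,2), of "?c v"] cubic_symmetric[OF assms(2,3), of "?c w"] by (simp add: add_ac)
  hence "?X = 0" by (rule double_cancel)
  hence "?X x = 0" by simp
  thus ?thesis by (simp add: plus_fun_apply t)
qed

end

section \<open>Pullbacks of superfunctions\<close>

locale super_hom = A: open_domain p Vc + B: open_domain p Vd for p Vc Vd +
  fixes q :: nat and T :: "superfun \<Rightarrow> superfun"
  assumes hom: "superalgebra_hom p q Vd Vc T"
begin

abbreviation "Fc \<equiv> sfun p {..<q} Vc"
abbreviation "Fd \<equiv> sfun p {..<q} Vd"

lemma hom': "superalgebra_hom p q Vd Vc T \<longleftrightarrow> (\<forall>f\<in>Fd. T f \<in> Fc) \<and> T (restr Vd 1) = restr Vc 1 \<and>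
     (\<forall>f\<in>Fd. \<forall>g\<in>Fd. T (f + g) = T f + T g \<and> T (f * g) = T f * T g) \<and>
     (\<forall>r. \<forall>f\<in>Fd. T (\<lambda>x. r *\<^sub>R f x) = (\<lambda>x. r *\<^sub>R T f x)) \<and>
     (\<forall>n. \<forall>f\<in>Fd. has_parity n f \<longrightarrow> has_parity n (T f))"
  unfolding superalgebra_hom_def A.superfuns_eq_sfun B.superfuns_eq_sfun ..

lemma T_in: "f \<in> Fd \<Longrightarrow> T f \<in> Fc" using hom unfolding hom' by blast
lemma T_unit: "T (restr Vd 1) = restr Vc 1" using hom unfolding hom' by blast
lemma T_add: "f \<in> Fd \<Longrightarrow> g \<in> Fd \<Longrightarrow> T (f + g) = T f + T g" using hom unfolding hom' by blast
lemma T_mult: "f \<in> Fd \<Longrightarrow> g \<in> Fd \<Longrightarrow> T (f * g) = T f * T g" using hom unfolding hom' by blast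
lemma T_scaleR: "f \<in> Fd \<Longrightarrow> T (\<lambda>x. r *\<^sub>R f x) = (\<lambda>x. r *\<^sub>R T f x)" using hom unfolding hom' by blast
lemma T_parity: "f \<in> Fd \<Longrightarrow> has_parity n f \<Longrightarrow> has_parity n (T f)" using hom unfolding hom' by blast

lemma T_0 [simp]: "T 0 = 0"
  using T_scaleR[OF B.sfun_0, of 0] by (simp add: zero_fun_def)
lemma T_sum: "(\<And>a. a \<in> S \<Longrightarrow> f a \<in> Fd) \<Longrightarrow> T (\<Sum>a\<in>S. f a) = (\<Sum>a\<in>S. T (f a))"
  by (induction S rule: infinite_finite_induct) (simp_all add: T_add B.sfun_sum)
lemma T_uminus: "f \<in> Fd \<Longrightarrow> T (- f) = - T f"
  using T_add[of f "- f"] B.sfun_uminus[of f] by (simp add: add.inverse_unique)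
lemma T_sg: "f \<in> Fd \<Longrightarrow> T (sg k f) = sg k (T f)"
  by (cases "even k") (simp_all add: sg_even sg_odd T_uminus)

lemma T_const: "T (const_fun Vd (of_real r)) = const_fun Vc (of_real r)"
proof -
  have c: "const_fun V (of_real r) = (\<lambda>x. r *\<^sub>R restr V 1 x)" for V
    by (auto simp: const_fun_def restr_def fun_eq_iff of_real_def)
  show ?thesis unfolding c T_scaleR[OF B.sfun_unit] T_unit ..
qed

lemma T_tw: "f \<in> Fd \<Longrightarrow> T (tw n f) = tw n (T f)"
proof -
  assume f: "f \<in> Fd"
  have p: "part k f \<in> Fd" for k by (rule B.sfun_part[OF f])
  have t: "tw n (T (part k f)) = sg (n * k) (T (part k f))" for k
    by (rule tw_sg[OF T_parity[OF p has_parity_part]])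
  have "T (tw n f) = T (part 0 f) + sg n (T (part 1 f))"
    unfolding tw_part by (simp only: T_add T_sg p B.sfun_sg)
  also have "\<dots> = tw n (T (part 0 f) + T (part 1 f))" unfolding tw_add t by simp
  also have "T (part 0 f) + T (part 1 f) = T f" unfolding T_add[OF p p, symmetric] part_decomposition ..
  finally show ?thesis .
qed

end

text \<open>\<open>local_hom\<close> expresses compatibility of the algebra map with restriction to
  neighbourhoods; it is what ties \<open>T\<close> to the map \<open>\<phi>\<close> of
  points.\<close>

locale super_map = super_hom p Vc Vd q T for p Vc Vd q T +
  fixes \<phi> :: "(nat \<Rightarrow> real) \<Rightarrow> nat \<Rightarrow> real"
  assumes phi: "x \<in> Vc \<Longrightarrow> \<phi> x \<in> Vd"
    and local_hom: "x \<in> Vc \<Longrightarrow> openin (Euclidean_space p) U \<Longrightarrow> U \<subseteq> Vd \<Longrightarrow> \<phi> x \<in> U \<Longrightarrow>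
      \<exists>U' TU. openin (Euclidean_space p) U' \<and> x \<in> U' \<and> U' \<subseteq> Vc \<and> superalgebra_hom p q U U' TU \<and>
        (\<forall>f\<in>sfun p {..<q} Vd. TU (restr U f) = restr U' (T f))"
begin

abbreviation I where "I \<equiv> {..<p + q}"

lemma coordinate_in: "i \<in> I \<Longrightarrow> coordinate p Vd i \<in> Fd"
  by (rule B.sfun_coordinate) auto

text \<open>
  If the value \<open>r\<close> of the pulled back coordinate were wrong, \<open>y\<^sup>i - r\<close> would be invertible near \<open>\<phi> x\<close> while
  its pullback is nilpotent at \<open>x\<close>.
\<close>
lemma body_coordinate:
  assumes x: "x \<in> Vc" and i: "i < p"
  shows "coeff (T (coordinate p Vd i) x) {} = \<phi> x i"
proof (rule ccontr)
  define r where "r = coeff (T (coordinate p Vd i) x) {}"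
  assume "coeff (T (coordinate p Vd i) x) {} \<noteq> \<phi> x i"
  hence r: "r \<noteq> \<phi> x i" by (simp add: r_def)
  \<comment> \<open>The part of \<open>Vd\<close> on which the i-th coordinate minus
    \<open>r\<close> is invertible; it contains \<open>\<phi> x\<close> by assumption.\<close>
  define U where "U = Vd \<inter> {y. y i \<noteq> r}"
  obtain O' where O': "open O'" "Vd = O' \<inter> {x. \<forall>i\<ge>p. x i = 0}"
    using B.open_V by (auto simp: openin_Euclidean_space_iff)
  have "open {y :: nat \<Rightarrow> real. y i \<noteq> r}"
    by (intro open_Collect_neq continuous_on_product_coordinates continuous_intros)
  hence U: "openin (Euclidean_space p) U"
    unfolding openin_Euclidean_space_iff U_def O'(2) using O'(1) by (intro exI[of _ "O' \<inter> {y. y i \<noteq> r}"]) auto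
  obtain U' TU where U': "openin (Euclidean_space p) U'" "x \<in> U'" "U' \<subseteq> Vc" "superalgebra_hom p q U U' TU"
    "\<And>f. f \<in> sfun p {..<q} Vd \<Longrightarrow> TU (restr U f) = restr U' (T f)"
    using local_hom[OF x U] phi[OF x] r by (auto simp: U_def)
  interpret L: super_hom p U' U q TU by unfold_locales (fact U U')+
  define g where "g = restr U (\<lambda>y. of_real (inverse (y i - r)))"
  have g: "g \<in> sfun p {..<q} U"
  proof -
    have "smooth_on p U (\<lambda>y. coeff (g y) I)" for I
    proof -
      have "smooth_on p U (\<lambda>y. inverse (y i - r))"
        by (intro smooth_on_inverse smooth_on_diff U smooth_on_coordinate smooth_on_const) (simp add: U_def)
      moreover have "smooth_on p U (\<lambda>y. coeff (g y) I) \<longleftrightarrow> smooth_on p U (\<lambda>y. if I = {} then inverse (y i - r) else 0)"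
        by (rule smooth_on_cong[OF U]) (simp add: g_def restr_apply coeff_of_real)
      ultimately show ?thesis by (cases "I = {}") auto
    qed
    thus ?thesis by (auto simp: sfun_def g_def restr_apply)
  qed
  let ?h = "coordinate p U i - const_fun U (of_real r)"
  have ci: "coordinate p U i \<in> L.Fd" "const_fun U (of_real r) \<in> L.Fd"
    using i by (auto intro!: L.B.sfun_coordinate L.B.sfun_const_fun)
  have "?h * g = restr U 1"
  proof
    fix y
    show "(?h * g) y = restr U 1 y"
      using i by (auto simp: times_fun_apply minus_apply coordinate_def const_fun_def g_def restr_apply U_def
          simp flip: of_real_diff of_real_mult)
  qed
  hence "TU ?h * TU g = restr U' 1"
    using L.T_mult[OF L.B.sfun_diff[OF ci] g] L.T_unit by simp
  hence "(TU ?h * TU g) x = 1" using U'(2) by (simp add: restr_apply)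
  hence "coeff (TU ?h x) {} \<noteq> 0"
    by (metis coeff_mult_empty coeff_one mult_zero_left times_fun_apply zero_neq_one)
  moreover have "TU ?h = TU (coordinate p U i) - const_fun U' (of_real r)"
    using L.T_add[OF ci(1) L.B.sfun_uminus[OF ci(2)]] L.T_uminus[OF ci(2)] L.T_const by simp
  moreover have "TU (coordinate p U i) = restr U' (T (coordinate p Vd i))"
  proof -
    have "coordinate p U i = restr U (coordinate p Vd i)" by (rule restr_coordinate[symmetric]) (auto simp: U_def)
    thus ?thesis using U'(5)[OF coordinate_in, of i] i by simp
  qed
  ultimately show False using U'(2) by (simp add: minus_apply restr_apply const_fun_def r_def coeff_of_real)
qed

text \<open>Near \<open>x\<close> the difference \<open>E\<close> of the two sides is a derivation
  along the pullback, of the parity of the direction \<open>a\<close>, and kills the coordinates.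
  \<open>derivation_eq_0\<close> applies with the values of the pullback at \<open>x\<close>,
  because \<open>body_coordinate\<close> shows that the coordinate differences go to elements
  without body.\<close>

theorem chain_rule:
  assumes f: "f \<in> Fd"
  shows "A.D a (T f) = (\<Sum>i\<in>I. A.D a (T (coordinate p Vd i)) * T (B.D i f))"
proof
  fix x
  show "A.D a (T f) x = (\<Sum>i\<in>I. A.D a (T (coordinate p Vd i)) * T (B.D i f)) x"
  proof (cases "x \<in> Vc")
    case False
    thus ?thesis by (simp add: A.D_outside sum_fun_apply times_fun_apply)
  next
    case True
    note y = phi[OF True]
    obtain r where r: "r > 0" "cube p (\<phi> x) r \<subseteq> Vd" using cube_subset_open[OF B.open_V y] by blast
    define U where "U = cube p (\<phi> x) r"
    have U: "openin (Euclidean_space p) U" "U \<subseteq> Vd" "\<phi> x \<in> U"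
      using r openin_cube B.open_V y by (auto simp: U_def)
    obtain U' TU where U': "openin (Euclidean_space p) U'" "x \<in> U'" "U' \<subseteq> Vc" "superalgebra_hom p q U U' TU"
      "\<And>f. f \<in> sfun p {..<q} Vd \<Longrightarrow> TU (restr U f) = restr U' (T f)"
      using local_hom[OF True U] by auto
    interpret L: super_hom p U' U q TU by unfold_locales (fact U U')+
    have oU: "open_domain p U" "open_domain p U'" by unfold_locales
    define Ji where "Ji i = L.A.D a (TU (coordinate p U i))" for i
    have c_in: "coordinate p U i \<in> L.Fd" if "i \<in> I" for i using that by (intro L.B.sfun_coordinate) auto
    have pJ: "has_parity (L.A.s a + L.A.s i) (Ji i)" if "i \<in> I" for i
      unfolding Ji_def by (intro L.A.has_parity_D L.T_parity c_in that L.B.has_parity_coordinate)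
    have Js: "Ji i \<in> L.Fc" if "i \<in> I" for i unfolding Ji_def by (intro L.A.sfun_D L.T_in c_in that)
    define E where "E f = L.A.D a (TU f) - (\<Sum>i\<in>I. Ji i * TU (L.B.D i f))" for f
    have "E (restr U f) x = 0"
    proof (rule derivation_eq_0[where t = "\<lambda>f. TU f x" and J = "{..<q}" and K = "{..<q}" and n = "L.A.s a" and r = r and p = p
          and ?y0.0 = "\<phi> x" and e = "\<lambda>f. E f x" and f = "restr U f", folded U_def])
      fix f g assume fg: "f \<in> L.Fd" "g \<in> L.Fd"
      have "TU (L.B.D i (f + g)) = TU (L.B.D i f) + TU (L.B.D i g)" for i
        unfolding L.B.D_add[OF fg] by (intro L.T_add L.B.sfun_D fg)
      hence "E (f + g) = E f + E g"
        unfolding E_def by (simp add: L.T_add L.A.D_add[OF L.T_in L.T_in] fg distrib_left sum.distrib)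
      thus "E (f + g) x = E f x + E g x" by (simp add: plus_fun_apply)
      have "E (f * g) = E f * TU g + tw (L.A.s a) (TU f) * E g"
      proof -
        have "Ji i * TU (L.B.D i (f * g)) = Ji i * TU (L.B.D i f) * TU g + tw (L.A.s a) (TU f) * (Ji i * TU (L.B.D i g))"
          if i: "i \<in> I" for i
        proof -
          have "TU (L.B.D i (f * g)) = TU (L.B.D i f) * TU g + tw (L.A.s i) (TU f) * TU (L.B.D i g)"
            by (simp add: L.B.D_mult[OF fg] L.T_add L.T_mult L.T_tw fg L.B.sfun_mult L.B.sfun_D L.B.sfun_tw)
          moreover have "Ji i * tw (L.A.s i) (TU f) = tw (L.A.s a) (TU f) * Ji i"
          proof -
            \<comment> \<open>Two twists by the parity of \<open>a\<close> cancel, so one may be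
              added inside and one outside; the outer exponent is then the parity of
              \<open>Ji i\<close>.\<close>
            have "tw (L.A.s i) (TU f) = tw (L.A.s a + L.A.s i) (tw (L.A.s a) (TU f))"
              by (auto simp: tw_def intro!: grassmann_eqI ext simp: power_add[symmetric] algebra_simps)
                 (simp add: power_add algebra_simps flip: power_mult_distrib)
            thus ?thesis using mult_tw_commute[OF pJ[OF i], of "tw (L.A.s a) (TU f)"] by simp
          qed
          ultimately show ?thesis by (simp add: distrib_left mult.assoc[symmetric])
        qed
        hence "(\<Sum>i\<in>I. Ji i * TU (L.B.D i (f * g))) = (\<Sum>i\<in>I. Ji i * TU (L.B.D i f)) * TU g + tw (L.A.s a) (TU f) * (\<Sum>i\<in>I. Ji i * TU (L.B.D i g))"
          by (simp add: sum.distrib sum_distrib_left sum_distrib_right)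
        moreover have "L.A.D a (TU (f * g)) = L.A.D a (TU f) * TU g + tw (L.A.s a) (TU f) * L.A.D a (TU g)"
          by (simp add: L.T_mult fg L.A.D_mult[OF L.T_in L.T_in])
        ultimately show ?thesis by (simp add: E_def algebra_simps)
      qed
      thus "E (f * g) x = E f x * TU g x + twist (L.A.s a) (TU f x) * E g x"
        by (simp add: plus_fun_apply times_fun_apply tw_def)
    next
      fix f assume "f \<in> L.Fd"
      hence "E f \<in> L.Fc"
        unfolding E_def by (intro L.A.sfun_diff L.A.sfun_D L.T_in L.A.sfun_sum L.A.sfun_mult Js L.B.sfun_D) auto
      thus "gsupp {..<q} (E f x)" by (simp add: sfun_def)
    next
      fix c
      have "L.B.D i (const_fun U (of_real c)) = 0" for i by (simp add: L.B.D_const_fun)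
      thus "E (const_fun U (of_real c)) x = 0"
        by (simp add: E_def L.T_const L.A.D_const_fun)
    next
      have E0: "E (coordinate p U b) = 0" if b: "b \<in> I" for b
      proof -
        have "(\<Sum>i\<in>I. Ji i * TU (L.B.D i (coordinate p U b))) = (\<Sum>i\<in>I. if i = b then Ji b else 0)"
          by (rule sum.cong[OF refl]) (use b in \<open>auto simp: L.B.D_coordinate L.T_unit unit_mult_sfun(2)[OF Js]\<close>)
        thus ?thesis using b by (simp add: E_def sum.delta Ji_def)
      qed
      show "E (coordinate p U i) x = 0" if "i < p" for i using E0[of i] that by simp
      show "E (coordinate p U (p + j)) x = 0" if "j \<in> {..<q}" for j using E0[of "p + j"] that by simp
    next
      fix i assume i: "i < p"
      have ci: "coordinate p U i \<in> L.Fd" "const_fun U (of_real (\<phi> x i)) \<in> L.Fd"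
        using i by (auto intro!: L.B.sfun_coordinate L.B.sfun_const_fun)
      have "TU (coordinate p U i - const_fun U (of_real (\<phi> x i))) = TU (coordinate p U i) - const_fun U' (of_real (\<phi> x i))"
        using L.T_add[OF ci(1) L.B.sfun_uminus[OF ci(2)]] L.T_uminus[OF ci(2)] L.T_const by simp
      moreover have "TU (coordinate p U i) = restr U' (T (coordinate p Vd i))"
        using U'(5)[OF coordinate_in, of i] i restr_coordinate[OF U(2), of p i] by simp
      ultimately show "coeff (TU (coordinate p U i - const_fun U (of_real (\<phi> x i))) x) {} = 0"
        using U'(2) body_coordinate[OF True i] by (simp add: minus_apply restr_apply const_fun_def coeff_of_real)
    qed (use r Euclidean_space_eq_0[OF B.open_V y] B.restr_sfun_subset[OF oU(1) U(2) f] in auto)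
    moreover have "E (restr U f) = restr U' (A.D a (T f) - (\<Sum>i\<in>I. A.D a (T (coordinate p Vd i)) * T (B.D i f)))"
    proof -
      have 1: "L.A.D a (TU (restr U f)) = restr U' (A.D a (T f))"
        unfolding U'(5)[OF f] by (rule A.D_restr[OF oU(2) U'(3)])
      have 2: "Ji i * TU (L.B.D i (restr U f)) = restr U' (A.D a (T (coordinate p Vd i)) * T (B.D i f))" if "i \<in> I" for i
        unfolding Ji_def B.D_restr[OF oU(1) U(2)] U'(5)[OF B.sfun_D[OF f]] restr_mult
          restr_coordinate[OF U(2), symmetric] U'(5)[OF coordinate_in[OF that]] A.D_restr[OF oU(2) U'(3)] ..
      have 3: "restr U' (g - h) = restr U' g - restr U' h" for g h
        by (auto simp: restr_def minus_apply fun_eq_iff)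
      show ?thesis unfolding E_def 1 3 restr_sum by (intro arg_cong2[where f = minus] refl sum.cong 2)
    qed
    ultimately show ?thesis using U'(2) by (simp add: restr_apply minus_apply)
  qed
qed

end

locale super_iso = F: super_map p Vc Vd q T \<phi> + G: super_map p Vd Vc q T' \<phi>' for p Vc Vd q T \<phi> T' \<phi>' +
  assumes T_T': "f \<in> sfun p {..<q} Vc \<Longrightarrow> T (T' f) = f" and T'_T: "f \<in> sfun p {..<q} Vd \<Longrightarrow> T' (T f) = f"
begin

abbreviation I where "I \<equiv> {..<p + q}"
abbreviation s where "s a \<equiv> parity p a"
abbreviation "Fc \<equiv> sfun p {..<q} Vc"
abbreviation "Fd \<equiv> sfun p {..<q} Vd"

definition J where "J a i = F.A.D a (T (coordinate p Vd i))"
text \<open>The derivatives of the coordinates of the first chart with respect to those of the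
  second, expressed in the first chart.\<close>

definition K where "K i a = T (F.B.D i (T' (coordinate p Vc a)))"

lemma J_in: "i \<in> I \<Longrightarrow> J a i \<in> Fc" unfolding J_def by (intro F.A.sfun_D F.T_in F.coordinate_in)
lemma J_parity: "i \<in> I \<Longrightarrow> has_parity (s a + s i) (J a i)"
  unfolding J_def by (intro F.A.has_parity_D F.T_parity F.coordinate_in F.B.has_parity_coordinate)
lemma K_in: "a \<in> I \<Longrightarrow> K i a \<in> Fc" unfolding K_def by (intro F.T_in F.B.sfun_D G.T_in G.coordinate_in)
lemma K_parity: "a \<in> I \<Longrightarrow> has_parity (s i + s a) (K i a)"
  unfolding K_def by (intro F.T_parity F.B.sfun_D G.T_in F.B.has_parity_D G.T_parity G.coordinate_in F.A.has_parity_coordinate)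

lemma chain: "f \<in> Fd \<Longrightarrow> F.A.D a (T f) = (\<Sum>i\<in>I. J a i * T (F.B.D i f))"
  unfolding J_def by (rule F.chain_rule)

text \<open>The chain rule for a coordinate of the first chart, written as the pullback of its own
  inverse pullback.\<close>

lemma J_K: "b \<in> I \<Longrightarrow> (\<Sum>i\<in>I. J a i * K i b) = (if a = b then restr Vc 1 else 0)"
  unfolding K_def using chain[of "T' (coordinate p Vc b)" a] T_T'[of "coordinate p Vc b"]
  by (simp add: G.T_in G.coordinate_in F.A.D_coordinate)

text \<open>The entries do not commute, so the usual determinant argument does not derive this from
  \<open>J_K\<close>; the chain rule of the inverse map gives it directly.\<close>

lemma K_J:
  assumes i: "i \<in> I" and j: "j \<in> I" shows "(\<Sum>b\<in>I. K i b * J b j) = (if i = j then restr Vc 1 else 0)"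
proof -
  let ?y = "T (coordinate p Vd j)"
  have y: "?y \<in> Fc" by (intro F.T_in F.coordinate_in j)
  have "F.B.D i (T' ?y) = (\<Sum>b\<in>I. F.B.D i (T' (coordinate p Vc b)) * T' (F.A.D b ?y))"
    by (rule G.chain_rule[OF y])
  moreover have m: "F.B.D i (T' (coordinate p Vc b)) \<in> Fd" "T' (F.A.D b ?y) \<in> Fd" if "b \<in> I" for b
    using that by (auto intro!: F.B.sfun_D G.T_in G.coordinate_in F.A.sfun_D y)
  ultimately have "T (F.B.D i (T' ?y)) = (\<Sum>b\<in>I. T (F.B.D i (T' (coordinate p Vc b)) * T' (F.A.D b ?y)))"
    using F.T_sum[of I "\<lambda>b. F.B.D i (T' (coordinate p Vc b)) * T' (F.A.D b ?y)"] by (simp add: F.B.sfun_mult)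
  also have "\<dots> = (\<Sum>b\<in>I. K i b * T (T' (J b j)))"
    unfolding K_def J_def by (intro sum.cong refl F.T_mult m)
  also have "\<dots> = (\<Sum>b\<in>I. K i b * J b j)"
    by (intro sum.cong refl) (simp only: T_T'[OF J_in[OF j]])
  finally show ?thesis using T'_T[OF F.coordinate_in[OF j]] by (simp add: F.B.D_coordinate F.T_unit split: if_splits)
qed

lemma T_D:
  assumes f: "f \<in> Fd" and i: "i \<in> I" shows "T (F.B.D i f) = (\<Sum>a\<in>I. K i a * F.A.D a (T f))"
proof -
  have "(\<Sum>a\<in>I. K i a * F.A.D a (T f)) = (\<Sum>a\<in>I. \<Sum>j\<in>I. K i a * J a j * T (F.B.D j f))"
    unfolding chain[OF f] by (simp add: sum_distrib_left mult.assoc)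
  also have "\<dots> = (\<Sum>j\<in>I. (\<Sum>a\<in>I. K i a * J a j) * T (F.B.D j f))"
    unfolding sum_distrib_right by (rule sum.swap)
  also have "\<dots> = (\<Sum>j\<in>I. if j = i then T (F.B.D i f) else 0)"
    by (intro sum.cong refl) (use i in \<open>auto simp: K_J unit_mult_sfun(1)[OF F.T_in[OF F.B.sfun_D[OF f]]]\<close>)
  finally show ?thesis using i by (simp add: sum.delta)
qed

end

section \<open>Determinants of even superfunctions\<close>

declare one_fun_apply [simp del] zero_fun_apply [simp del]

text \<open>
  Even elements commute, so the theory of determinants over commutative rings applies to them.
\<close>
typedef even_grassmann = "{g. gpar 0 g}" morphisms of_even to_even
  by (rule exI[of _ 0]) simp

setup_lifting type_definition_even_grassmann

instantiation even_grassmann :: comm_ring_1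
begin

lift_definition zero_even_grassmann :: even_grassmann is 0 by simp
lift_definition one_even_grassmann :: even_grassmann is 1 by simp
lift_definition plus_even_grassmann :: "even_grassmann \<Rightarrow> even_grassmann \<Rightarrow> even_grassmann" is plus by (rule gpar_add)
lift_definition minus_even_grassmann :: "even_grassmann \<Rightarrow> even_grassmann \<Rightarrow> even_grassmann" is minus by (rule gpar_diff)
lift_definition uminus_even_grassmann :: "even_grassmann \<Rightarrow> even_grassmann" is uminus by (rule gpar_uminus)
lift_definition times_even_grassmann :: "even_grassmann \<Rightarrow> even_grassmann \<Rightarrow> even_grassmann" is times
  using gpar_mult[of 0 _ 0] by simp

instance
proof
  fix a b c :: even_grassmann
  show "a * b * c = a * (b * c)" by transfer (rule mult.assoc)
  show "a * b = b * a" by transfer (metis grassmann_commute mult_0 mult_1 power_0)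
  show "1 * a = a" by transfer simp
  show "a + b + c = a + (b + c)" by transfer (rule add.assoc)
  show "a + b = b + a" by transfer (rule add.commute)
  show "0 + a = a" by transfer simp
  show "- a + a = 0" by transfer simp
  show "a - b = a + - b" by transfer simp
  show "(a + b) * c = a * c + b * c" by transfer (rule distrib_right)
  show "(0 :: even_grassmann) \<noteq> 1" by transfer simp
qed

end

lemma of_even_sum: "of_even (\<Sum>a\<in>A. f a) = (\<Sum>a\<in>A. of_even (f a))"
  by (induction A rule: infinite_finite_induct)
     (simp_all add: zero_even_grassmann.rep_eq plus_even_grassmann.rep_eq)

lemma of_even_prod_list: "of_even (prod_list xs) = prod_list (map of_even xs)"
  by (induction xs) (simp_all add: one_even_grassmann.rep_eq times_even_grassmann.rep_eq)

lemma of_even_sign: "of_even (of_int (sign \<sigma>)) = of_int (sign \<sigma>)"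
  by (auto simp: sign_def one_even_grassmann.rep_eq uminus_even_grassmann.rep_eq)

lemma of_even_to_even [simp]: "gpar 0 g \<Longrightarrow> of_even (to_even g) = g"
  by (rule to_even_inverse) simp

lemma prod_interval_prod_list: "(\<Prod>i = 0..<n. f i) = prod_list (map f [0..<n])"
  by (metis atLeastLessThan_upt interv_sum_list_conv_sum_set_nat prod.distinct_set_conv_list distinct_upt)

lemma prod_list_fun_apply: "prod_list (map f xs) x = prod_list (map (\<lambda>i. f i x) xs)"
  by (induction xs) (simp_all add: times_fun_apply one_fun_apply)

lemma of_int_fun_apply: "(of_int k :: 'a \<Rightarrow> 'b :: ring_1) x = of_int k"
  by (induction k) (simp_all add: minus_apply uminus_apply one_fun_apply zero_fun_apply)

lemma superdet_apply: "superdet n A x = (\<Sum>\<sigma> | \<sigma> permutes {..<n}. of_int (sign \<sigma>) * prod_list (map (\<lambda>i. A i (\<sigma> i) x) [0..<n]))"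
  unfolding superdet_def sum_fun_apply times_fun_apply prod_list_fun_apply of_int_fun_apply ..

definition even_mat :: "nat \<Rightarrow> (nat \<Rightarrow> nat \<Rightarrow> superfun) \<Rightarrow> (nat \<Rightarrow> real) \<Rightarrow> even_grassmann mat" where
  "even_mat n A x = Matrix.mat n n (\<lambda>(i, j). to_even (A i j x))"

lemma even_mat_carrier [simp]: "even_mat n A x \<in> carrier_mat n n" by (simp add: even_mat_def)

lemma superdet_det:
  assumes A: "\<And>i j. i < n \<Longrightarrow> j < n \<Longrightarrow> gpar 0 (A i j x)"
  shows "superdet n A x = of_even (Determinant.det (even_mat n A x))"
proof -
  have "of_even (Determinant.det (even_mat n A x)) =
     (\<Sum>\<sigma> | \<sigma> permutes {0..<n}. of_even (of_int (sign \<sigma>)) * of_even (prod_list (map (\<lambda>i. even_mat n A x $$ (i, \<sigma> i)) [0..<n])))"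
    unfolding det_def'[OF even_mat_carrier] of_even_sum times_even_grassmann.rep_eq prod_interval_prod_list ..
  also have "\<dots> = superdet n A x"
    unfolding superdet_apply of_even_sign of_even_prod_list atLeast0LessThan
  proof (intro sum.cong refl arg_cong2[where f = times] arg_cong[where f = prod_list])
    fix \<sigma> assume "\<sigma> \<in> {\<sigma>. \<sigma> permutes {..<n}}"
    hence "\<sigma> i < n" if "i < n" for i using that permutes_in_image[of \<sigma> "{..<n}" i] by auto
    thus "map of_even (map (\<lambda>i. even_mat n A x $$ (i, \<sigma> i)) [0..<n]) = map (\<lambda>i. A i (\<sigma> i) x) [0..<n]"
      using A by (simp add: even_mat_def)
  qed
  finally show ?thesis ..
qed

text \<open>Product of matrices of arbitrary format with entries that need not commute; only the
  inner dimension is recorded.\<close>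

definition mm :: "nat \<Rightarrow> (nat \<Rightarrow> nat \<Rightarrow> 'a :: ring_1) \<Rightarrow> (nat \<Rightarrow> nat \<Rightarrow> 'a) \<Rightarrow> nat \<Rightarrow> nat \<Rightarrow> 'a" where
  "mm n A B i j = (\<Sum>k<n. A i k * B k j)"

lemma mm_assoc: "mm n (mm m A B) C = mm m A (mm n B C)"
proof (intro ext)
  fix i j
  have "mm n (mm m A B) C i j = (\<Sum>k<n. \<Sum>l<m. A i l * (B l k * C k j))"
    by (simp add: mm_def sum_distrib_right mult.assoc)
  also have "\<dots> = (\<Sum>l<m. \<Sum>k<n. A i l * (B l k * C k j))" by (rule sum.swap)
  finally show "mm n (mm m A B) C i j = mm m A (mm n B C) i j" by (simp add: mm_def sum_distrib_left)
qed

lemma mm_cong: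
  "(\<And>k. k < n \<Longrightarrow> A i k = A' i k) \<Longrightarrow> (\<And>k. k < n \<Longrightarrow> B k j = B' k j) \<Longrightarrow> mm n A B i j = mm n A' B' i j"
  by (simp add: mm_def)

context open_domain
begin

text \<open>Restriction matters for \<open>n = 0\<close>: the empty determinant is the constant 1,
  which does not vanish outside \<open>V\<close>.\<close>

definition sdet :: "nat \<Rightarrow> (nat \<Rightarrow> nat \<Rightarrow> superfun) \<Rightarrow> superfun" where
  "sdet n A = restr V (superdet n A)"

text \<open>The cofactor, obtained by replacing row \<open>i\<close> with the unit row at
  \<open>j\<close>. Unlike deleting a row and a column, this leaves all other indices in
  place.\<close>

definition scof :: "nat \<Rightarrow> (nat \<Rightarrow> nat \<Rightarrow> superfun) \<Rightarrow> nat \<Rightarrow> nat \<Rightarrow> superfun" where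
  "scof n A i j = sdet n (\<lambda>k l. if k = i then (if l = j then restr V 1 else 0) else A k l)"

definition one_mat :: "nat \<Rightarrow> nat \<Rightarrow> superfun" where
  "one_mat i j = (if i = j then restr V 1 else 0)"

lemma restr_prod_list_in: "(\<And>i. i < n \<Longrightarrow> f i \<in> sfun p J V) \<Longrightarrow> restr V (prod_list (map f [0..<n])) \<in> sfun p J V"
proof (induction n)
  case (Suc n)
  have "restr V (prod_list (map f [0..<Suc n])) = restr V (prod_list (map f [0..<n])) * f n"
    using restr_sfun[OF Suc.prems[of n]] by (simp add: restr_mult)
  thus ?case using sfun_mult[OF Suc.IH Suc.prems[of n]] Suc.prems by simp
qed (simp add: sfun_unit)

lemma restr_prod_list_parity: "(\<And>i. i < n \<Longrightarrow> has_parity 0 (f i)) \<Longrightarrow> has_parity 0 (restr V (prod_list (map f [0..<n])))"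
proof (induction n)
  case 0
  thus ?case using has_parity_const_fun[OF gpar_1, of V] by (simp add: restr_one)
next
  case (Suc n)
  have "has_parity (0 + 0) (restr V (prod_list (map f [0..<n])) * restr V (f n))"
    by (rule has_parity_mult[OF Suc.IH has_parity_restr]) (use Suc.prems in auto)
  thus ?case by (simp add: restr_mult)
qed

lemma of_int_sign_mult: "of_int (sign \<sigma>) * f = (if sign \<sigma> = 1 then f else - f)"
  by (auto simp: sign_def)

lemma sdet_sum: "sdet n A = (\<Sum>\<sigma> | \<sigma> permutes {..<n}. of_int (sign \<sigma>) * restr V (prod_list (map (\<lambda>i. A i (\<sigma> i)) [0..<n])))"
proof -
  have "restr V (of_int (sign \<sigma>) * f) = of_int (sign \<sigma>) * restr V f" for \<sigma> :: "nat \<Rightarrow> nat" and f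
    unfolding of_int_sign_mult by (auto simp: restr_def uminus_apply fun_eq_iff)
  thus ?thesis by (simp add: sdet_def superdet_def restr_sum)
qed

lemma permutes_less: "\<sigma> permutes {..<n} \<Longrightarrow> i < n \<Longrightarrow> \<sigma> i < (n :: nat)"
  using permutes_in_image[of \<sigma> "{..<n}" i] by auto

lemma sdet_in:
  assumes "\<And>i j. i < n \<Longrightarrow> j < n \<Longrightarrow> A i j \<in> sfun p J V" shows "sdet n A \<in> sfun p J V"
  unfolding sdet_sum of_int_sign_mult using assms
  by (intro sfun_sum) (auto intro!: restr_prod_list_in sfun_uminus permutes_less)

lemma sdet_parity:
  assumes "\<And>i j. i < n \<Longrightarrow> j < n \<Longrightarrow> has_parity 0 (A i j)" shows "has_parity 0 (sdet n A)"
  unfolding sdet_sum of_int_sign_mult using assms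
  by (intro has_parity_sum) (auto intro!: restr_prod_list_parity has_parity_uminus permutes_less)

lemma scof_in:
  assumes "\<And>i j. i < n \<Longrightarrow> j < n \<Longrightarrow> A i j \<in> sfun p J V" shows "scof n A i j \<in> sfun p J V"
  unfolding scof_def using assms by (intro sdet_in) (auto simp: sfun_unit)

lemma unit_parity: "has_parity 0 (restr V 1)"
  using has_parity_const_fun[OF gpar_1, of V] by (simp add: restr_one)

text \<open>Laplace expansion along the replaced row leaves a single term.\<close>

lemma scof_apply:
  assumes A: "\<And>i j. i < n \<Longrightarrow> j < n \<Longrightarrow> has_parity 0 (A i j)" and i: "i < n" and j: "j < n" and x: "x \<in> V"
  shows "scof n A i j x = of_even (cofactor (even_mat n A x) i j)"
proof -
  let ?B = "\<lambda>k l. if k = i then (if l = j then restr V 1 else 0) else A k l"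
  let ?M = "even_mat n A x" and ?N = "even_mat n ?B x"
  have "scof n A i j x = of_even (Determinant.det ?N)"
    unfolding scof_def sdet_def using x A
    by (subst restr_apply) (auto intro!: superdet_det simp: has_parity_iff restr_apply one_fun_apply zero_fun_apply)
  also have "Determinant.det ?N = (\<Sum>l<n. ?N $$ (i, l) * cofactor ?N i l)"
    by (rule laplace_expansion_row[OF even_mat_carrier i])
  also have "\<dots> = (\<Sum>l<n. if l = j then cofactor ?N i j else 0)"
    using i x by (intro sum.cong refl)
      (auto simp: even_mat_def restr_apply one_fun_apply zero_fun_apply one_even_grassmann.abs_eq[symmetric] zero_even_grassmann.abs_eq[symmetric])
  also have "\<dots> = cofactor ?N i j" using j by simp
  also have "\<dots> = cofactor ?M i j"
  proof -
    have "mat_delete ?N i j = mat_delete ?M i j"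
      unfolding mat_delete_def using i by (intro eq_matI) (auto simp: even_mat_def)
    thus ?thesis by (simp add: cofactor_def)
  qed
  finally show ?thesis .
qed

text \<open>The adjugate identities, valid at each point over the commutative ring of even elements;
  outside \<open>V\<close> both sides vanish.\<close>

lemma mm_scof:
  assumes A: "\<And>i j. i < n \<Longrightarrow> j < n \<Longrightarrow> A i j \<in> sfun p J V" "\<And>i j. i < n \<Longrightarrow> j < n \<Longrightarrow> has_parity 0 (A i j)"
    and k: "k < n" and i: "i < n"
  shows "mm n A (\<lambda>j i. scof n A i j) k i = (if k = i then sdet n A else 0)"
    and "mm n (\<lambda>j i. scof n A i j) A k i = (if k = i then sdet n A else 0)"
proof -
  have 1: "mm n A (\<lambda>j i. scof n A i j) k i x = (if k = i then sdet n A else 0) x \<and>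
     mm n (\<lambda>j i. scof n A i j) A k i x = (if k = i then sdet n A else 0) x" for x
  proof (cases "x \<in> V")
    case True
    let ?M = "even_mat n A x"
    note adj = adj_mat[OF even_mat_carrier[of n A x]]
    have e: "of_even (?M $$ (k, j)) = A k j x" if "k < n" "j < n" for k j
      using A(2)[OF that] that by (simp add: even_mat_def has_parity_iff)
    have sd: "sdet n A x = of_even (Determinant.det ?M)"
      unfolding sdet_def using True A(2) by (subst restr_apply) (auto intro!: superdet_det simp: has_parity_iff)
    have adjM: "adj_mat ?M $$ (j, i) = cofactor ?M i j" if "i < n" "j < n" for i j
      using that by (simp add: adj_mat_def even_mat_def)
    have dims: "dim_row (adj_mat ?M) = n" "dim_col (adj_mat ?M) = n" "dim_row ?M = n" "dim_col ?M = n"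
      by (auto simp: adj_mat_def even_mat_def)
    have dd: "(Determinant.det ?M \<cdot>\<^sub>m 1\<^sub>m n) $$ (k, i) = (if k = i then Determinant.det ?M else 0)"
      using k i by simp
    have "(?M * adj_mat ?M) $$ (k, i) = (\<Sum>j<n. ?M $$ (k, j) * adj_mat ?M $$ (j, i))"
      using k i dims by (simp add: scalar_prod_def atLeast0LessThan)
    also have "\<dots> = (\<Sum>j<n. ?M $$ (k, j) * cofactor ?M i j)" using adjM[OF i] by simp
    finally have "(\<Sum>j<n. ?M $$ (k, j) * cofactor ?M i j) = (if k = i then Determinant.det ?M else 0)"
      unfolding adj(2) dd by (rule sym)
    hence "of_even (\<Sum>j<n. ?M $$ (k, j) * cofactor ?M i j) = of_even (if k = i then Determinant.det ?M else 0)" by simp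
    hence 1: "(\<Sum>j<n. A k j x * scof n A i j x) = (if k = i then sdet n A x else 0)"
      using e k i scof_apply[OF A(2) i _ True] sd
      by (simp add: of_even_sum times_even_grassmann.rep_eq zero_even_grassmann.rep_eq split: if_splits)
    have "(adj_mat ?M * ?M) $$ (k, i) = (\<Sum>j<n. adj_mat ?M $$ (k, j) * ?M $$ (j, i))"
      using k i dims by (simp add: scalar_prod_def atLeast0LessThan)
    also have "\<dots> = (\<Sum>j<n. cofactor ?M j k * ?M $$ (j, i))" using adjM[OF _ k] by simp
    finally have "(\<Sum>j<n. cofactor ?M j k * ?M $$ (j, i)) = (if k = i then Determinant.det ?M else 0)"
      unfolding adj(3) dd by (rule sym)
    hence "of_even (\<Sum>j<n. cofactor ?M j k * ?M $$ (j, i)) = of_even (if k = i then Determinant.det ?M else 0)" by simp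
    hence 2: "(\<Sum>j<n. scof n A j k x * A j i x) = (if k = i then sdet n A x else 0)"
      using e k i scof_apply[OF A(2) _ k True] sd
      by (simp add: of_even_sum times_even_grassmann.rep_eq zero_even_grassmann.rep_eq split: if_splits)
    show ?thesis using 1 2 by (simp add: mm_def sum_fun_apply times_fun_apply zero_fun_apply)
  next
    case False
    have "mm n A (\<lambda>j i. scof n A i j) k i \<in> sfun p J V" "mm n (\<lambda>j i. scof n A i j) A k i \<in> sfun p J V"
      unfolding mm_def using A k i by (auto intro!: sfun_sum sfun_mult scof_in)
    thus ?thesis using sdet_in[of n A J] A False by (simp add: sfun_outside zero_fun_apply)
  qed
  show "mm n A (\<lambda>j i. scof n A i j) k i = (if k = i then sdet n A else 0)"
    "mm n (\<lambda>j i. scof n A i j) A k i = (if k = i then sdet n A else 0)"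
    using 1 by (blast intro: ext)+
qed

text \<open>Even factors let the derivative pass, and its result move to the front, without sign;
  the unit fills the place of the differentiated factor.\<close>

lemma D_prod_list:
  assumes "\<And>i. i < n \<Longrightarrow> f i \<in> sfun p J V" "\<And>i. i < n \<Longrightarrow> has_parity 0 (f i)"
  shows "D a (restr V (prod_list (map f [0..<n]))) = (\<Sum>i<n. D a (f i) * restr V (prod_list (map (f(i := restr V 1)) [0..<n])))"
  using assms
proof (induction n)
  case 0
  show ?case by (simp add: D_unit)
next
  case (Suc n)
  let ?P = "\<lambda>f n. restr V (prod_list (map f [0..<n]))"
  have f: "f n \<in> sfun p J V" "has_parity 0 (f n)" using Suc.prems by auto
  have P: "?P f n \<in> sfun p J V" "has_parity 0 (?P f n)"
    using Suc.prems by (auto intro!: restr_prod_list_in restr_prod_list_parity)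
  have S: "?P g (Suc n) = ?P g n * restr V (g n)" for g by (simp add: restr_mult)
  have 1: "?P (f(i := restr V 1)) (Suc n) = ?P (f(i := restr V 1)) n * f n" if "i < n" for i
    using that restr_sfun[OF f(1)] unfolding S by simp
  have "map (f(n := restr V 1)) [0..<n] = map f [0..<n]" by auto
  hence 2: "?P (f(n := restr V 1)) (Suc n) = ?P f n"
    unfolding S using restr_restr[of V V] unit_mult_sfun(2)[OF P(1)] by simp
  have "D a (?P f (Suc n)) = D a (?P f n) * f n + ?P f n * D a (f n)"
    unfolding S restr_sfun[OF f(1)] using D_mult_sg[OF P(1) f(1) P(2), of a] by simp
  also have "D a (?P f n) * f n = (\<Sum>i<n. D a (f i) * ?P (f(i := restr V 1)) (Suc n))"
  proof -
    have IH: "D a (?P f n) = (\<Sum>i<n. D a (f i) * ?P (f(i := restr V 1)) n)"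
      by (rule Suc.IH) (use Suc.prems in auto)
    show ?thesis unfolding IH sum_distrib_right
      by (intro sum.cong refl) (simp only: 1 mult.assoc lessThan_iff)
  qed
  also have "?P f n * D a (f n) = D a (f n) * ?P f n" by (rule superfun_commute_even[OF P(2)])
  finally show ?case by (simp only: sum.lessThan_Suc 2)
qed

lemma prod_list_zero: "0 \<in> set xs \<Longrightarrow> prod_list xs = (0 :: 'a :: ring_1)"
  by (induction xs) auto

text \<open>Jacobi's formula. With the differentiated factor replaced by the unit, the permutations
  sending row \<open>i\<close> to column \<open>j\<close> add up to the cofactor at that
  place.\<close>

lemma D_sdet:
  assumes A: "\<And>i j. i < n \<Longrightarrow> j < n \<Longrightarrow> A i j \<in> sfun p J V" "\<And>i j. i < n \<Longrightarrow> j < n \<Longrightarrow> has_parity 0 (A i j)"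
  shows "D a (sdet n A) = (\<Sum>i<n. \<Sum>j<n. D a (A i j) * scof n A i j)"
proof -
  let ?S = "{\<sigma>. \<sigma> permutes {..<n}}"
  define R where "R \<sigma> i = restr V (prod_list (map ((\<lambda>k. A k (\<sigma> k))(i := restr V 1)) [0..<n]))" for \<sigma> :: "nat \<Rightarrow> nat" and i
  have m: "restr V (prod_list (map (\<lambda>i. A i (\<sigma> i)) [0..<n])) \<in> sfun p J V" if "\<sigma> \<in> ?S" for \<sigma>
    using that A by (auto intro!: restr_prod_list_in permutes_less)
  have "D a (sdet n A) = (\<Sum>\<sigma>\<in>?S. of_int (sign \<sigma>) * D a (restr V (prod_list (map (\<lambda>i. A i (\<sigma> i)) [0..<n]))))"
  proof -
    have "D a (sdet n A) = (\<Sum>\<sigma>\<in>?S. D a (of_int (sign \<sigma>) * restr V (prod_list (map (\<lambda>i. A i (\<sigma> i)) [0..<n]))))"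
      unfolding sdet_sum of_int_sign_mult by (rule D_sum[where J = J]) (simp add: m sfun_uminus)
    also have "\<dots> = (\<Sum>\<sigma>\<in>?S. of_int (sign \<sigma>) * D a (restr V (prod_list (map (\<lambda>i. A i (\<sigma> i)) [0..<n]))))"
      unfolding of_int_sign_mult
    proof (rule sum.cong[OF refl])
      fix \<sigma> assume "\<sigma> \<in> ?S"
      from D_uminus[OF m[OF this], of a]
      show "D a (if sign \<sigma> = 1 then restr V (prod_list (map (\<lambda>i. A i (\<sigma> i)) [0..<n])) else - restr V (prod_list (map (\<lambda>i. A i (\<sigma> i)) [0..<n]))) =
         (if sign \<sigma> = 1 then D a (restr V (prod_list (map (\<lambda>i. A i (\<sigma> i)) [0..<n]))) else - D a (restr V (prod_list (map (\<lambda>i. A i (\<sigma> i)) [0..<n]))))"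
        by (simp split: if_split del: map_eq_conv)
    qed
    finally show ?thesis .
  qed
  also have "\<dots> = (\<Sum>\<sigma>\<in>?S. \<Sum>i<n. of_int (sign \<sigma>) * (D a (A i (\<sigma> i)) * R \<sigma> i))"
  proof (rule sum.cong[OF refl])
    fix \<sigma> assume "\<sigma> \<in> ?S"
    hence si: "\<sigma> i < n" if "i < n" for i using that by (auto intro: permutes_less)
    have "D a (restr V (prod_list (map (\<lambda>i. A i (\<sigma> i)) [0..<n]))) = (\<Sum>i<n. D a (A i (\<sigma> i)) * R \<sigma> i)"
      unfolding R_def by (rule D_prod_list[where J = J]) (simp_all add: A si)
    thus "of_int (sign \<sigma>) * D a (restr V (prod_list (map (\<lambda>i. A i (\<sigma> i)) [0..<n]))) = (\<Sum>i<n. of_int (sign \<sigma>) * (D a (A i (\<sigma> i)) * R \<sigma> i))"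
      by (simp add: sum_distrib_left)
  qed
  also have "\<dots> = (\<Sum>i<n. \<Sum>\<sigma>\<in>?S. of_int (sign \<sigma>) * (D a (A i (\<sigma> i)) * R \<sigma> i))" by (rule sum.swap)
  also have "\<dots> = (\<Sum>i<n. \<Sum>j<n. D a (A i j) * scof n A i j)"
  proof (rule sum.cong[OF refl])
    fix i assume i: "i \<in> {..<n}"
    have "(\<Sum>\<sigma>\<in>?S. of_int (sign \<sigma>) * (D a (A i (\<sigma> i)) * R \<sigma> i)) =
       (\<Sum>\<sigma>\<in>?S. \<Sum>j<n. D a (A i j) * (if \<sigma> i = j then of_int (sign \<sigma>) * R \<sigma> i else 0))"
    proof (rule sum.cong[OF refl])
      fix \<sigma> assume "\<sigma> \<in> ?S"
      hence si: "\<sigma> i < n" using i by (auto intro: permutes_less)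
      have "(\<Sum>j<n. D a (A i j) * (if \<sigma> i = j then of_int (sign \<sigma>) * R \<sigma> i else 0)) =
         (\<Sum>j<n. if j = \<sigma> i then D a (A i (\<sigma> i)) * (of_int (sign \<sigma>) * R \<sigma> i) else 0)"
        by (intro sum.cong refl) auto
      also have "\<dots> = of_int (sign \<sigma>) * (D a (A i (\<sigma> i)) * R \<sigma> i)"
        using si by (simp add: of_int_sign_mult)
      finally show "of_int (sign \<sigma>) * (D a (A i (\<sigma> i)) * R \<sigma> i) =
         (\<Sum>j<n. D a (A i j) * (if \<sigma> i = j then of_int (sign \<sigma>) * R \<sigma> i else 0))" by simp
    qed
    also have "\<dots> = (\<Sum>j<n. \<Sum>\<sigma>\<in>?S. D a (A i j) * (if \<sigma> i = j then of_int (sign \<sigma>) * R \<sigma> i else 0))" by (rule sum.swap)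
    also have "\<dots> = (\<Sum>j<n. D a (A i j) * scof n A i j)"
    proof (rule sum.cong[OF refl])
      fix j assume "j \<in> {..<n}"
      have "scof n A i j = (\<Sum>\<sigma>\<in>?S. if \<sigma> i = j then of_int (sign \<sigma>) * R \<sigma> i else 0)"
        unfolding scof_def sdet_sum
      proof (rule sum.cong[OF refl])
        fix \<sigma> assume "\<sigma> \<in> ?S"
        let ?f = "\<lambda>k. if k = i then if \<sigma> k = j then restr V 1 else 0 else A k (\<sigma> k)"
        show "of_int (sign \<sigma>) * restr V (prod_list (map ?f [0..<n])) = (if \<sigma> i = j then of_int (sign \<sigma>) * R \<sigma> i else 0)"
        proof (cases "\<sigma> i = j")
          case True
          hence "?f = (\<lambda>k. A k (\<sigma> k))(i := restr V 1)" by auto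
          thus ?thesis using True by (simp add: R_def)
        next
          case False
          hence "0 \<in> set (map ?f [0..<n])" using i by (auto simp: image_iff intro!: bexI[of _ i])
          thus ?thesis using False prod_list_zero[of "map ?f [0..<n]"] by simp
        qed
      qed
      thus "(\<Sum>\<sigma>\<in>?S. D a (A i j) * (if \<sigma> i = j then of_int (sign \<sigma>) * R \<sigma> i else 0)) = D a (A i j) * scof n A i j"
        by (simp add: sum_distrib_left)
    qed
    finally show "(\<Sum>\<sigma>\<in>?S. of_int (sign \<sigma>) * (D a (A i (\<sigma> i)) * R \<sigma> i)) = (\<Sum>j<n. D a (A i j) * scof n A i j)" .
  qed
  finally show ?thesis .
qed

text \<open>Multiplying the adjugate identity by the left inverse \<open>Q\<close> gives the
  cofactors as entries of \<open>Q\<close> times the determinant, and Jacobi's formula becomes a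
  trace.\<close>

lemma D_sdet_inverse:
  assumes A: "\<And>i j. i < n \<Longrightarrow> j < n \<Longrightarrow> A i j \<in> sfun p J V" "\<And>i j. i < n \<Longrightarrow> j < n \<Longrightarrow> has_parity 0 (A i j)"
    and Q: "\<And>i j. i < n \<Longrightarrow> j < n \<Longrightarrow> Q i j \<in> sfun p J V" "\<And>i j. i < n \<Longrightarrow> j < n \<Longrightarrow> has_parity 0 (Q i j)"
    and QA: "\<And>i j. i < n \<Longrightarrow> j < n \<Longrightarrow> mm n Q A i j = one_mat i j"
  shows "D a (sdet n A) = sdet n A * (\<Sum>i<n. mm n (\<lambda>i j. D a (A i j)) Q i i)"
proof -
  have dp: "has_parity 0 (sdet n A)" using A(2) by (rule sdet_parity)
  have c: "scof n A i l = Q l i * sdet n A" if i: "i < n" and l: "l < n" for i l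
  proof -
    have "mm n (mm n Q A) (\<lambda>j i. scof n A i j) l i = (\<Sum>j<n. if j = l then scof n A i l else 0)"
      unfolding mm_def[of n "mm n Q A"] using l A
      by (intro sum.cong refl) (auto simp: QA one_mat_def unit_mult_sfun(1)[OF scof_in[OF A(1)]])
    hence "scof n A i l = mm n Q (mm n A (\<lambda>j i. scof n A i j)) l i" using l by (simp add: mm_assoc)
    also have "\<dots> = (\<Sum>k<n. if k = i then Q l i * sdet n A else 0)"
      unfolding mm_def[of n Q] using i by (intro sum.cong refl) (auto simp: mm_scof[OF A])
    finally show ?thesis using i by simp
  qed
  have "D a (sdet n A) = (\<Sum>i<n. \<Sum>j<n. D a (A i j) * scof n A i j)"
    by (rule D_sdet) (fact A)+
  also have "\<dots> = (\<Sum>i<n. \<Sum>j<n. D a (A i j) * (Q j i * sdet n A))"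
    by (intro sum.cong refl) (simp add: c)
  also have "\<dots> = (\<Sum>i<n. mm n (\<lambda>i j. D a (A i j)) Q i i) * sdet n A"
    by (simp add: mm_def sum_distrib_right mult.assoc)
  also have "\<dots> = sdet n A * (\<Sum>i<n. mm n (\<lambda>i j. D a (A i j)) Q i i)"
    by (rule superfun_commute_even[OF dp, symmetric])
  finally show ?thesis .
qed

text \<open>An element without body has degree at least 1, so the degree of its power
  \<open>Suc q\<close> exceeds the number of generators.\<close>

lemma nilpotent_power:
  assumes n: "n \<in> sfun p {..<q} V" and body: "\<And>x. grassmann.coeff (n x) {} = 0"
  shows "n ^ Suc q = 0"
proof (rule ext)
  fix x
  have pw: "(n ^ k) x = n x ^ k" for k by (induction k) (simp_all add: times_fun_apply one_fun_apply)
  have "gord k (n x ^ k)" for k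
  proof (induction k)
    case (Suc k)
    have "gord 1 (n x)" using body gord_1 by blast
    from gord_mult[OF this Suc] show ?case by simp
  qed simp
  moreover have "gsupp {..<q} (n x ^ k)" for k
    using n by (induction k) (auto simp: sfun_def intro: gsupp_mult)
  ultimately have "n x ^ Suc q = 0" by (rule gord_eq_0) simp_all
  thus "(n ^ Suc q) x = 0 x" by (simp add: pw zero_fun_apply del: power_Suc)
qed

text \<open>Multiplied by the inverse of its body, \<open>f\<close> becomes the unit minus a
  nilpotent \<open>n\<close>, and a finite geometric series inverts that.\<close>

lemma sfun_invertible:
  assumes f: "f \<in> sfun p {..<q} V" and body: "\<And>x. x \<in> V \<Longrightarrow> grassmann.coeff (f x) {} \<noteq> 0"
  shows "\<exists>h\<in>sfun p {..<q} V. f * h = restr V 1 \<and> h * f = restr V 1"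
proof -
  define b where "b = restr V (\<lambda>x. of_real (inverse (grassmann.coeff (f x) {})))"
  have b: "b \<in> sfun p {..<q} V"
  proof -
    have "smooth_on p V (\<lambda>x. grassmann.coeff (b x) I)" for I
    proof -
      have "smooth_on p V (\<lambda>x. inverse (grassmann.coeff (f x) {}))"
        by (intro smooth_on_inverse open_V sfun_smooth[OF f] body)
      moreover have "smooth_on p V (\<lambda>x. grassmann.coeff (b x) I) \<longleftrightarrow> smooth_on p V (\<lambda>x. if I = {} then inverse (grassmann.coeff (f x) {}) else 0)"
        by (rule smooth_on_cong[OF open_V]) (simp add: b_def restr_apply coeff_of_real)
      ultimately show ?thesis by (cases "I = {}") auto
    qed
    thus ?thesis by (auto simp: sfun_def b_def restr_apply)
  qed
  have bp: "has_parity 0 b" by (simp add: has_parity_iff b_def restr_apply)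
  define n where "n = restr V 1 - f * b"
  have n: "n \<in> sfun p {..<q} V" unfolding n_def by (intro sfun_diff sfun_unit sfun_mult f b)
  have "grassmann.coeff (n x) {} = 0" for x
    using body[of x] by (cases "x \<in> V") (simp_all add: n_def b_def minus_apply times_fun_apply restr_apply coeff_of_real coeff_one one_fun_apply)
  hence n0: "n ^ Suc q = 0" by (rule nilpotent_power[OF n])
  \<comment> \<open>The series is summed in the ring of all Grassmann-valued functions, whose 1 does
    not vanish outside \<open>V\<close>; the factor \<open>b\<close> brings the result back to
    functions on \<open>V\<close>.\<close>
  define G where "G = (\<Sum>k<Suc q. n ^ k)"
  have G: "(1 - n) * G = 1 - n ^ m" "G * (1 - n) = 1 - n ^ m" if "G = (\<Sum>k<m. n ^ k)" for G m
  proof -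
    show "(1 - n) * G = 1 - n ^ m" unfolding that
    proof (induction m)
      case (Suc m)
      have "(1 - n) * (\<Sum>k<Suc m. n ^ k) = (1 - n) * (\<Sum>k<m. n ^ k) + (1 - n) * n ^ m" by (simp add: distrib_left)
      thus ?case unfolding Suc by (simp add: left_diff_distrib)
    qed simp
    show "G * (1 - n) = 1 - n ^ m" unfolding that
    proof (induction m)
      case (Suc m)
      have "(\<Sum>k<Suc m. n ^ k) * (1 - n) = (\<Sum>k<m. n ^ k) * (1 - n) + n ^ m * (1 - n)" by (simp add: distrib_right)
      thus ?case unfolding Suc by (simp add: right_diff_distrib power_commutes)
    qed simp
  qed
  have G1: "(1 - n) * G = 1" "G * (1 - n) = 1" using G[OF G_def] n0 by simp_all
  have fb: "f * b = restr V 1 * (1 - n)" "f * b = (1 - n) * restr V 1"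
    using unit_mult_sfun[OF n] by (simp_all add: n_def right_diff_distrib left_diff_distrib)
  have nk: "b * n ^ k \<in> sfun p {..<q} V" for k
  proof (induction k)
    case (Suc k)
    thus ?case using sfun_mult[OF Suc n] by (simp add: mult.assoc power_commutes)
  qed (simp add: b)
  have "b * G \<in> sfun p {..<q} V" unfolding G_def sum_distrib_left by (intro sfun_sum nk)
  moreover have "f * (b * G) = restr V 1"
    unfolding mult.assoc[symmetric] fb(1) by (simp only: mult.assoc G1(1) mult_1_right)
  moreover have "(b * G) * f = restr V 1"
  proof -
    have "(b * G) * f = G * (f * b)"
      unfolding superfun_commute_even[OF bp, of G] superfun_commute_even[OF bp, of f, symmetric] by (rule mult.assoc)
    also have "\<dots> = restr V 1" unfolding fb(2) by (simp only: mult.assoc[symmetric] G1(2) mult_1_left)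
    finally show ?thesis .
  qed
  ultimately show ?thesis by blast
qed

lemma superfun_inverse_eqI:
  assumes f: "h \<in> sfun p {..<q} V" "f * h = restr V 1" "h * f = restr V 1"
  shows "superfun_inverse p q V f = h"
  unfolding superfun_inverse_def superfuns_eq_sfun
proof (rule the_equality)
  fix g assume g: "g \<in> sfun p {..<q} V \<and> f * g = restr V 1 \<and> g * f = restr V 1"
  have "g = g * (f * h)" using g f(2) unit_mult_sfun(2)[of g p "{..<q}" V] by metis
  also have "\<dots> = h" using g f(1) unit_mult_sfun(1)[of h p "{..<q}" V] by (metis mult.assoc)
  finally show "g = h" .
qed (use f in auto)

end

section \<open>The Berezinian\<close>

lemma sum_lessThan_add: "(\<Sum>a<p + q. h a) = (\<Sum>i<p. h i) + (\<Sum>k<q. h (p + k :: nat))"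
  by (induction q) (simp_all add: add.assoc)

lemma coeff_prod_list_empty: "grassmann.coeff (prod_list xs) {} = prod_list (map (\<lambda>g. grassmann.coeff g {}) xs)"
  by (induction xs) (simp_all add: coeff_one)

lemma coeff_of_int_sign: "grassmann.coeff (of_int (sign \<sigma>)) {} = of_int (sign \<sigma>)"
  by (auto simp: sign_def coeff_one)

text \<open>Taking the body is a ring homomorphism to the reals, so it commutes with
  determinants.\<close>

lemma coeff_superdet:
  "grassmann.coeff (superdet n A x) {} = Determinant.det (Matrix.mat n n (\<lambda>(i, j). grassmann.coeff (A i j x) {}))"
proof -
  have "Determinant.det (Matrix.mat n n (\<lambda>(i, j). grassmann.coeff (A i j x) {})) =
     (\<Sum>\<sigma> | \<sigma> permutes {0..<n}. of_int (sign \<sigma>) * prod_list (map (\<lambda>i. Matrix.mat n n (\<lambda>(i, j). grassmann.coeff (A i j x) {}) $$ (i, \<sigma> i)) [0..<n]))"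
    by (subst det_def'[of _ n], simp, simp only: prod_interval_prod_list)
  also have "\<dots> = (\<Sum>\<sigma> | \<sigma> permutes {..<n}. of_int (sign \<sigma>) * prod_list (map (\<lambda>i. grassmann.coeff (A i (\<sigma> i) x) {}) [0..<n]))"
    unfolding atLeast0LessThan
  proof (intro sum.cong refl arg_cong2[where f = times] arg_cong[where f = prod_list])
    fix \<sigma> assume "\<sigma> \<in> {\<sigma>. \<sigma> permutes {..<n}}"
    hence "\<sigma> i < n" if "i < n" for i using that permutes_in_image[of \<sigma> "{..<n}" i] by auto
    thus "map (\<lambda>i. Matrix.mat n n (\<lambda>(i, j). grassmann.coeff (A i j x) {}) $$ (i, \<sigma> i)) [0..<n] =
      map (\<lambda>i. grassmann.coeff (A i (\<sigma> i) x) {}) [0..<n]" by simp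
  qed
  finally show ?thesis
    by (simp add: superdet_apply coeff_prod_list_empty coeff_of_int_sign o_def)
qed

lemma body_odd: "gpar 1 g \<Longrightarrow> grassmann.coeff g {} = 0"
  by (auto simp: gpar_def)

context open_domain
begin

text \<open>The odd part of \<open>E\<close> is annihilated by the even matrix \<open>A\<close>,
  because the unit matrix is even; multiplying by \<open>E\<close> from the left recovers
  it.\<close>

lemma inverse_matrix_parity:
  assumes A: "\<And>i j. i < n \<Longrightarrow> j < n \<Longrightarrow> has_parity 0 (A i j)"
    and E: "\<And>i j. i < n \<Longrightarrow> j < n \<Longrightarrow> E i j \<in> sfun p J V"
    and AE: "\<And>i j. i < n \<Longrightarrow> j < n \<Longrightarrow> mm n A E i j = one_mat i j"
    and EA: "\<And>i j. i < n \<Longrightarrow> j < n \<Longrightarrow> mm n E A i j = one_mat i j"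
    and ij: "i < n" "j < n"
  shows "has_parity 0 (E i j)"
proof -
  let ?E = "\<lambda>i j. part 1 (E i j)"
  have z: "mm n A ?E i j = 0" if ij: "i < n" "j < n" for i j
  proof -
    have "part 1 (A i k * E k j) = A i k * ?E k j" if k: "k < n" for k
    proof -
      have "has_parity 0 (A i k * part 0 (E k j))" "has_parity 1 (A i k * part 1 (E k j))"
        using has_parity_mult[OF A[OF ij(1) k] has_parity_part[of 0]] has_parity_mult[OF A[OF ij(1) k] has_parity_part[of 1]] by simp_all
      moreover have "A i k * E k j = A i k * part 0 (E k j) + A i k * part 1 (E k j)"
        unfolding distrib_left[symmetric] part_decomposition ..
      ultimately show ?thesis
        by (simp add: part_linear part_has_parity[of 0] part_has_parity[of 1])
    qed
    hence "mm n A ?E i j = part 1 (mm n A E i j)" by (simp add: mm_def part_sum)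
    also have "\<dots> = 0" unfolding AE[OF ij] one_mat_def using part_has_parity[OF unit_parity, of 1] by simp
    finally show ?thesis .
  qed
  have "mm n (mm n E A) ?E i j = (\<Sum>k<n. if k = i then ?E i j else 0)"
    unfolding mm_def[of n "mm n E A"] using ij E
    by (intro sum.cong refl) (auto simp: EA one_mat_def unit_mult_sfun(1)[OF sfun_part[OF E]])
  hence "?E i j = mm n E (mm n A ?E) i j" using ij by (simp add: mm_assoc)
  also have "\<dots> = 0" using z ij unfolding mm_def[of n E] by simp
  finally have "part 1 (E i j) = 0" .
  hence "part 0 (E i j) = E i j" using part_decomposition[of "E i j"] by simp
  thus ?thesis by (simp add: has_parity_def)
qed

lemma inverse_parity:
  assumes "has_parity 0 f" "h \<in> sfun p J V" "f * h = restr V 1" "h * f = restr V 1"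
  shows "has_parity 0 h"
  using inverse_matrix_parity[of 1 "\<lambda>i j. f" "\<lambda>i j. h" J 0 0] assms by (simp add: mm_def one_mat_def)

lemma mm_one_left: "X i j \<in> sfun p J V \<Longrightarrow> i < n \<Longrightarrow> (\<And>k. k < n \<Longrightarrow> M i k = one_mat i k) \<Longrightarrow> mm n M X i j = X i j"
proof -
  assume X: "X i j \<in> sfun p J V" and i: "i < n" and M: "\<And>k. k < n \<Longrightarrow> M i k = one_mat i k"
  have "mm n M X i j = (\<Sum>k<n. if k = i then X i j else 0)"
    unfolding mm_def by (intro sum.cong refl) (auto simp: M one_mat_def unit_mult_sfun(1)[OF X])
  thus ?thesis using i by simp
qed

lemma mm_one_right: "X i j \<in> sfun p J V \<Longrightarrow> j < n \<Longrightarrow> (\<And>k. k < n \<Longrightarrow> M k j = one_mat k j) \<Longrightarrow> mm n X M i j = X i j"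
proof -
  assume X: "X i j \<in> sfun p J V" and i: "j < n" and M: "\<And>k. k < n \<Longrightarrow> M k j = one_mat k j"
  have "mm n X M i j = (\<Sum>k<n. if k = j then X i j else 0)"
    unfolding mm_def by (intro sum.cong refl) (auto simp: M one_mat_def unit_mult_sfun(2)[OF X])
  thus ?thesis using i by simp
qed

lemma D_mm:
  assumes "\<And>k. k < n \<Longrightarrow> X i k \<in> sfun p J V" "\<And>k. k < n \<Longrightarrow> has_parity m (X i k)" "\<And>k. k < n \<Longrightarrow> Y k j \<in> sfun p J V"
  shows "D a (mm n X Y i j) = mm n (\<lambda>i j. D a (X i j)) Y i j + sg (s a * m) (mm n X (\<lambda>i j. D a (Y i j)) i j)"
proof -
  have "D a (mm n X Y i j) = (\<Sum>k<n. D a (X i k * Y k j))"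
    unfolding mm_def by (rule D_sum[where J = J]) (use assms in \<open>auto intro: sfun_mult\<close>)
  also have "\<dots> = (\<Sum>k<n. D a (X i k) * Y k j + sg (s a * m) (X i k * D a (Y k j)))"
    by (intro sum.cong refl D_mult_sg[where J = J]) (use assms in auto)
  finally show ?thesis by (simp add: mm_def sum.distrib sg_sum)
qed

end

text \<open>Trace of the product of an n by m and an m by n matrix. The factors stay separate
  arguments because exchanging them costs a sign.\<close>

definition tr :: "nat \<Rightarrow> nat \<Rightarrow> (nat \<Rightarrow> nat \<Rightarrow> superfun) \<Rightarrow> (nat \<Rightarrow> nat \<Rightarrow> superfun) \<Rightarrow> superfun" where
  "tr n m X Y = (\<Sum>i<n. mm m X Y i i)"

lemma tr_swap:
  assumes "\<And>i k. i < n \<Longrightarrow> k < m \<Longrightarrow> has_parity \<alpha> (X i k)" "\<And>i k. i < n \<Longrightarrow> k < m \<Longrightarrow> has_parity \<beta> (Y k i)"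
  shows "tr n m X Y = sg (\<alpha> * \<beta>) (tr m n Y X)"
proof -
  have "tr n m X Y = (\<Sum>i<n. \<Sum>k<m. sg (\<alpha> * \<beta>) (Y k i * X i k))"
    unfolding tr_def mm_def by (intro sum.cong refl sg_commute) (use assms in auto)
  also have "\<dots> = (\<Sum>k<m. \<Sum>i<n. sg (\<alpha> * \<beta>) (Y k i * X i k))" by (rule sum.swap)
  finally show ?thesis by (simp add: tr_def mm_def sg_sum)
qed

lemma tr_cong:
  "(\<And>i k. i < n \<Longrightarrow> k < m \<Longrightarrow> X i k = X' i k) \<Longrightarrow> (\<And>i k. i < n \<Longrightarrow> k < m \<Longrightarrow> Y k i = Y' k i) \<Longrightarrow> tr n m X Y = tr n m X' Y'"
  unfolding tr_def by (intro sum.cong refl mm_cong) auto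

lemma tr_assoc: "tr n m (mm l X Y) Z = tr n l X (mm m Y Z)"
  unfolding tr_def mm_assoc ..

lemma tr_uminus_right: "tr n m X (\<lambda>i j. - Y i j) = - tr n m X Y"
  by (simp add: tr_def mm_def sum_negf)

lemma tr_diff_left: "tr n m (\<lambda>i j. X i j - Y i j) Z = tr n m X Z - tr n m Y Z"
  by (simp add: tr_def mm_def left_diff_distrib sum_subtractf)
lemma tr_diff_right: "tr n m X (\<lambda>i j. Y i j - Z i j) = tr n m X Y - tr n m X Z"
  by (simp add: tr_def mm_def right_diff_distrib sum_subtractf)
lemma tr_sg_left: "tr n m (\<lambda>i j. sg k (X i j)) Z = sg k (tr n m X Z)"
  by (simp add: tr_def mm_def sg_sum)

text \<open>A Jacobian matrix with its two-sided inverse, freed from the charts.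
  \<open>J_closed\<close> is the symmetry of second derivatives: for fixed \<open>i\<close> the
  entries \<open>J a i\<close> are the derivatives of one function.\<close>

locale jacobian_domain = open_domain p V for p V +
  fixes q :: nat and J K :: "nat \<Rightarrow> nat \<Rightarrow> superfun"
  assumes J_in: "a < p + q \<Longrightarrow> i < p + q \<Longrightarrow> J a i \<in> sfun p {..<q} V"
    and K_in: "i < p + q \<Longrightarrow> a < p + q \<Longrightarrow> K i a \<in> sfun p {..<q} V"
    and J_parity: "a < p + q \<Longrightarrow> i < p + q \<Longrightarrow> has_parity (parity p a + parity p i) (J a i)"
    and K_parity: "i < p + q \<Longrightarrow> a < p + q \<Longrightarrow> has_parity (parity p i + parity p a) (K i a)"
    and J_K: "a < p + q \<Longrightarrow> b < p + q \<Longrightarrow> (\<Sum>i<p + q. J a i * K i b) = (if a = b then restr V 1 else 0)"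
    and K_J: "i < p + q \<Longrightarrow> j < p + q \<Longrightarrow> (\<Sum>b<p + q. K i b * J b j) = (if i = j then restr V 1 else 0)"
    and J_closed: "a < p + q \<Longrightarrow> b < p + q \<Longrightarrow> i < p + q \<Longrightarrow>
       D a (J b i) = sg (parity p a * parity p b) (D b (J a i))"
begin

abbreviation "F \<equiv> sfun p {..<q} V"
abbreviation "I \<equiv> {..<p + q}"

abbreviation "A \<equiv> J"
abbreviation "B \<equiv> \<lambda>i k. J i (p + k)"
abbreviation "C \<equiv> \<lambda>k j. J (p + k) j"
abbreviation "Dm \<equiv> \<lambda>k l. J (p + k) (p + l)"
abbreviation "Q \<equiv> K"
abbreviation "K01 \<equiv> \<lambda>i k. K i (p + k)"
abbreviation "K10 \<equiv> \<lambda>k j. K (p + k) j"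
abbreviation "K11 \<equiv> \<lambda>k l. K (p + k) (p + l)"

lemma block_in:
  "i < p \<Longrightarrow> j < p \<Longrightarrow> A i j \<in> F" "i < p \<Longrightarrow> k < q \<Longrightarrow> B i k \<in> F" "k < q \<Longrightarrow> j < p \<Longrightarrow> C k j \<in> F" "k < q \<Longrightarrow> l < q \<Longrightarrow> Dm k l \<in> F"
  "i < p \<Longrightarrow> j < p \<Longrightarrow> Q i j \<in> F" "i < p \<Longrightarrow> k < q \<Longrightarrow> K01 i k \<in> F" "k < q \<Longrightarrow> j < p \<Longrightarrow> K10 k j \<in> F" "k < q \<Longrightarrow> l < q \<Longrightarrow> K11 k l \<in> F"
  by (auto intro!: J_in K_in)

lemma block_parity:
  "i < p \<Longrightarrow> j < p \<Longrightarrow> has_parity 0 (A i j)" "i < p \<Longrightarrow> k < q \<Longrightarrow> has_parity 1 (B i k)"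
  "k < q \<Longrightarrow> j < p \<Longrightarrow> has_parity 1 (C k j)" "k < q \<Longrightarrow> l < q \<Longrightarrow> has_parity 0 (Dm k l)"
  "i < p \<Longrightarrow> j < p \<Longrightarrow> has_parity 0 (Q i j)" "i < p \<Longrightarrow> k < q \<Longrightarrow> has_parity 1 (K01 i k)"
  "k < q \<Longrightarrow> j < p \<Longrightarrow> has_parity 1 (K10 k j)" "k < q \<Longrightarrow> l < q \<Longrightarrow> has_parity 0 (K11 k l)"
  using J_parity[of i j] J_parity[of i "p + k"] J_parity[of "p + k" j] J_parity[of "p + k" "p + l"]
    K_parity[of i j] K_parity[of i "p + k"] K_parity[of "p + k" j] K_parity[of "p + k" "p + l"]
  by (auto simp: parity_def elim!: has_parity_cong)

lemma block_products:
  "k < q \<Longrightarrow> i < p \<Longrightarrow> mm p C Q k i + mm q Dm K10 k i = 0"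
  "i < p \<Longrightarrow> k < q \<Longrightarrow> mm p Q B i k + mm q K01 Dm i k = 0"
  "k < q \<Longrightarrow> l < q \<Longrightarrow> mm p K10 B k l + mm q K11 Dm k l = one_mat k l"
  "i < p \<Longrightarrow> j < p \<Longrightarrow> mm p Q A i j + mm q K01 C i j = one_mat i j"
  using J_K[of "p + k" i] K_J[of i "p + k"] K_J[of "p + k" "p + l"] K_J[of i j]
  by (simp_all add: mm_def sum_lessThan_add one_mat_def)

text \<open>The odd blocks have no body, so the bodies of \<open>K11\<close> and \<open>Dm\<close>
  are inverse real matrices.\<close>

lemma Dm_body:
  assumes x: "x \<in> V" shows "grassmann.coeff (sdet q Dm x) {} \<noteq> 0"
proof -
  define MD where "MD = Matrix.mat q q (\<lambda>(k, l). grassmann.coeff (Dm k l x) {})"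
  define MK where "MK = Matrix.mat q q (\<lambda>(k, l). grassmann.coeff (K11 k l x) {})"
  have c: "MD \<in> carrier_mat q q" "MK \<in> carrier_mat q q" by (simp_all add: MD_def MK_def)
  have "MK * MD = 1\<^sub>m q"
  proof (rule eq_matI)
    fix k l assume "k < dim_row (1\<^sub>m q :: real mat)" "l < dim_col (1\<^sub>m q :: real mat)"
    hence kl: "k < q" "l < q" by simp_all
    have "grassmann.coeff ((mm p K10 B k l + mm q K11 Dm k l) x) {} = grassmann.coeff (one_mat k l x) {}"
      using block_products(3)[OF kl] by simp
    moreover have "grassmann.coeff (K10 k i x) {} = 0" if "i < p" for i
      using block_parity(7)[OF kl(1) that] by (intro body_odd) (simp add: has_parity_iff)
    moreover have "(MK * MD) $$ (k, l) = (\<Sum>m<q. grassmann.coeff (K11 k m x) {} * grassmann.coeff (Dm m l x) {})"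
      using kl by (simp add: MK_def MD_def scalar_prod_def atLeast0LessThan)
    ultimately show "(MK * MD) $$ (k, l) = 1\<^sub>m q $$ (k, l)"
      using kl x by (simp add: mm_def plus_fun_apply sum_fun_apply times_fun_apply one_mat_def restr_apply one_fun_apply zero_fun_apply coeff_one)
  qed (simp_all add: MK_def MD_def)
  hence "Determinant.det MK * Determinant.det MD = 1" using det_mult[OF c(2,1)] by simp
  hence "Determinant.det MD \<noteq> 0" by auto
  moreover have "sdet q Dm x = superdet q Dm x" unfolding sdet_def using x by (subst restr_apply) simp
  ultimately show ?thesis using coeff_superdet[of q Dm x] by (simp add: MD_def)
qed

lemma sdet_Dm: "sdet q Dm \<in> F" "has_parity 0 (sdet q Dm)"
  by (intro sdet_in block_in; simp) (intro sdet_parity block_parity; simp)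

definition "h = superfun_inverse p q V (superdet q Dm)"

lemma h: "h \<in> F" "sdet q Dm * h = restr V 1" "h * sdet q Dm = restr V 1" "has_parity 0 h"
proof -
  obtain g where g: "g \<in> F" "sdet q Dm * g = restr V 1" "g * sdet q Dm = restr V 1"
    using sfun_invertible[OF sdet_Dm(1) Dm_body] by blast
  \<comment> \<open>For \<open>q = 0\<close> the unrestricted determinant is nonzero outside
    \<open>V\<close>; the factor \<open>g\<close> vanishes there.\<close>
  have r: "superdet q Dm * g = sdet q Dm * g" "g * superdet q Dm = g * sdet q Dm"
    using sfun_outside[OF g(1)] by (auto simp: sdet_def restr_def times_fun_apply fun_eq_iff)
  have "h = g" unfolding h_def by (rule superfun_inverse_eqI[OF g(1)]) (simp_all add: r g)
  thus "h \<in> F" "sdet q Dm * h = restr V 1" "h * sdet q Dm = restr V 1" using g by simp_all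
  thus "has_parity 0 h" by (rule inverse_parity[OF sdet_Dm(2)])
qed

definition "E = supermatrix_inverse p q V q Dm"

lemma E:
  assumes "k < q" "l < q"
  shows "E k l \<in> F" "mm q Dm E k l = one_mat k l" "mm q E Dm k l = one_mat k l" "has_parity 0 (E k l)"
proof -
  have o: "restr V (if i = j then 1 else 0) = one_mat i j" for i j :: nat by (simp add: one_mat_def)
  \<comment> \<open>The adjugate divided by the determinant shows that an inverse exists, so the
    choice made in \<open>supermatrix_inverse\<close> is a true inverse.\<close>
  let ?E = "\<lambda>j i. h * scof q Dm i j"
  have 1: "?E i j \<in> superfuns p q V \<and> (\<Sum>k<q. Dm i k * ?E k j) = restr V (if i = j then 1 else 0) \<and>
     (\<Sum>k<q. ?E i k * Dm k j) = restr V (if i = j then 1 else 0)" if ij: "i < q" "j < q" for i j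
  proof (intro conjI)
    have sc: "mm q Dm (\<lambda>j i. scof q Dm i j) i j = (if i = j then sdet q Dm else 0)"
      "mm q (\<lambda>j i. scof q Dm i j) Dm i j = (if i = j then sdet q Dm else 0)"
      by (rule mm_scof[where J = "{..<q}"]; use ij in \<open>auto intro!: block_in(4) block_parity(4)\<close>)+
    show "?E i j \<in> superfuns p q V"
      unfolding superfuns_eq_sfun by (intro sfun_mult h scof_in block_in)
    have "(\<Sum>k<q. Dm i k * ?E k j) = h * mm q Dm (\<lambda>j i. scof q Dm i j) i j"
      unfolding mm_def sum_distrib_left
    proof (intro sum.cong refl)
      fix k assume "k \<in> {..<q}"
      thus "Dm i k * (h * scof q Dm j k) = h * (Dm i k * scof q Dm j k)"
        using superfun_commute_even[OF block_parity(4)[OF ij(1)], of k h] by (simp add: mult.assoc[symmetric])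
    qed
    thus "(\<Sum>k<q. Dm i k * ?E k j) = restr V (if i = j then 1 else 0)"
      by (simp only: sc(1) o one_mat_def) (simp add: h(3))
    have "(\<Sum>k<q. ?E i k * Dm k j) = h * mm q (\<lambda>j i. scof q Dm i j) Dm i j"
      unfolding mm_def sum_distrib_left by (simp add: mult.assoc)
    thus "(\<Sum>k<q. ?E i k * Dm k j) = restr V (if i = j then 1 else 0)"
      by (simp only: sc(2) o one_mat_def) (simp add: h(3))
  qed
  have "\<forall>i<q. \<forall>j<q. E i j \<in> superfuns p q V \<and>
     (\<Sum>k<q. Dm i k * E k j) = restr V (if i = j then 1 else 0) \<and>
     (\<Sum>k<q. E i k * Dm k j) = restr V (if i = j then 1 else 0)"
    unfolding E_def supermatrix_inverse_def by (rule someI[where x = ?E]) (use 1 in blast)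
  hence E: "E i j \<in> F \<and> mm q Dm E i j = one_mat i j \<and> mm q E Dm i j = one_mat i j" if "i < q" "j < q" for i j
    using that unfolding superfuns_eq_sfun mm_def o by blast
  thus "E k l \<in> F" "mm q Dm E k l = one_mat k l" "mm q E Dm k l = one_mat k l" using assms by blast+
  show "has_parity 0 (E k l)"
    by (rule inverse_matrix_parity[where A = Dm and n = q and J = "{..<q}"]) (use E assms block_parity(4) in blast)+
qed

abbreviation "BE \<equiv> mm q B E"

text \<open>The Schur complement of \<open>Dm\<close> in \<open>J\<close>; the block
  \<open>Q\<close> of \<open>K\<close> will be its inverse.\<close>

definition "P i j = A i j - mm q BE C i j"

lemma BE_in: "i < p \<Longrightarrow> k < q \<Longrightarrow> BE i k \<in> F"
  unfolding mm_def by (intro sfun_sum sfun_mult block_in E) auto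
lemma BE_parity: "i < p \<Longrightarrow> k < q \<Longrightarrow> has_parity 1 (BE i k)"
  unfolding mm_def
proof (rule has_parity_sum)
  fix l assume "i < p" "k < q" "l \<in> {..<q}"
  thus "has_parity 1 (B i l * E l k)" using has_parity_mult[OF block_parity(2)[of i l] E(4)[of l k]] by simp
qed
lemma P_in: "i < p \<Longrightarrow> j < p \<Longrightarrow> P i j \<in> F"
  unfolding P_def mm_def[of q BE] by (intro sfun_diff sfun_sum sfun_mult block_in BE_in) auto
lemma P_parity: "i < p \<Longrightarrow> j < p \<Longrightarrow> has_parity 0 (P i j)"
  unfolding P_def mm_def[of q BE]
proof (intro has_parity_diff has_parity_sum block_parity)
  fix l assume "i < p" "j < p" "l \<in> {..<q}"
  thus "has_parity 0 (BE i l * C l j)"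
    using has_parity_mult[OF BE_parity[of i l] block_parity(3)[of l j]] by (auto elim: has_parity_cong)
qed

text \<open>The block equation for \<open>C\<close> and \<open>K10\<close>, multiplied by the
  inverse \<open>E\<close> of \<open>Dm\<close>. This and the next two formulas are the block
  inversion rules that express products with \<open>E\<close> through the blocks of
  \<open>K\<close>.\<close>

lemma K10_eq: assumes "k < q" "i < p" shows "mm q E (mm p C Q) k i = - K10 k i"
proof -
  have "mm q E (mm p C Q) k i + mm q (mm q E Dm) K10 k i = (\<Sum>l<q. E k l * (mm p C Q l i + mm q Dm K10 l i))"
    unfolding mm_assoc by (simp add: mm_def[of q E] distrib_left sum.distrib)
  also have "\<dots> = 0" by (rule sum.neutral) (simp add: block_products(1) assms)
  finally show ?thesis
    using mm_one_left[of K10 k i "{..<q}" q "mm q E Dm", OF block_in(7)[OF assms] assms(1)] E(3) assms by (simp add: eq_neg_iff_add_eq_0)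
qed

lemma K01_eq: assumes "i < p" "k < q" shows "mm p Q BE i k = - K01 i k"
proof -
  have "mm q (mm p Q B) E i k + mm q K01 (mm q Dm E) i k = (\<Sum>l<q. (mm p Q B i l + mm q K01 Dm i l) * E l k)"
    unfolding mm_assoc[symmetric] by (simp add: mm_def[of q _ E] distrib_right sum.distrib)
  also have "\<dots> = 0" by (rule sum.neutral) (simp add: block_products(2) assms)
  finally show ?thesis
    using mm_one_right[of K01 i k "{..<q}" q "mm q Dm E", OF block_in(6)[OF assms] assms(2)] E(2) assms by (simp add: eq_neg_iff_add_eq_0 mm_assoc)
qed

lemma K11_eq: assumes "k < q" "l < q" shows "mm p K10 BE k l = E k l - K11 k l"
proof -
  have "mm q (mm p K10 B) E k l + mm q K11 (mm q Dm E) k l = (\<Sum>m<q. (mm p K10 B k m + mm q K11 Dm k m) * E m l)"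
    unfolding mm_assoc[symmetric] by (simp add: mm_def[of q _ E] distrib_right sum.distrib)
  also have "\<dots> = mm q one_mat E k l" unfolding mm_def[of q one_mat] by (rule sum.cong) (simp_all add: block_products(3) assms)
  also have "\<dots> = E k l" by (rule mm_one_left[of E k l "{..<q}" q one_mat, OF E(1)[OF assms] assms(1)]) simp
  finally show ?thesis
    using mm_one_right[of K11 k l "{..<q}" q "mm q Dm E", OF block_in(8)[OF assms] assms(2)] E(2) assms by (simp add: eq_diff_eq mm_assoc)
qed

text \<open>\<open>K01_eq\<close> turns the correction term of \<open>P\<close> into the product of
  \<open>K01\<close> and \<open>C\<close>; what remains is the upper left block of the product of
  \<open>K\<close> and \<open>J\<close>.\<close>

lemma Q_P: assumes "i < p" "j < p" shows "mm p Q P i j = one_mat i j"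
proof -
  have "mm p Q P i j = mm p Q A i j - mm p Q (mm q BE C) i j"
    by (simp add: mm_def[of p Q] P_def right_diff_distrib sum_subtractf)
  also have "mm p Q (mm q BE C) i j = mm q (mm p Q BE) C i j" by (simp only: mm_assoc)
  also have "\<dots> = (\<Sum>k<q. - K01 i k * C k j)"
    unfolding mm_def[of q "mm p Q BE"] by (intro sum.cong refl) (simp add: K01_eq assms)
  also have "mm p Q A i j - \<dots> = mm p Q A i j + mm q K01 C i j" by (simp add: mm_def sum_negf)
  finally show ?thesis using block_products(4)[OF assms] by simp
qed

definition "Ber = sdet p P * h"

lemma berezinian_eq: "berezinian p q V J = Ber"
proof -
  have P: "J i j - (\<Sum>k<q. \<Sum>l<q. J i (p + k) * E k l * J (p + l) j) = P i j" for i j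
    unfolding P_def mm_def sum_distrib_right by (subst sum.swap) (rule refl)
  have "berezinian p q V J = superdet p P * h"
    unfolding berezinian_def Let_def E_def[symmetric] h_def[symmetric] P by simp
  also have "\<dots> = sdet p P * h"
    using sfun_outside[OF h(1)] by (auto simp: sdet_def restr_def times_fun_apply fun_eq_iff)
  finally show ?thesis by (simp add: Ber_def)
qed

lemma Ber_in: "Ber \<in> F" unfolding Ber_def by (intro sfun_mult sdet_in P_in h)
lemma Ber_parity: "has_parity 0 Ber"
  using has_parity_mult[OF sdet_parity[OF P_parity] h(4)] by (simp add: Ber_def)

text \<open>
  The supertrace of \<open>\<partial>\<^sub>a J J\<^sup>-\<^sup>1\<close>.
\<close>
definition dlogBer :: "nat \<Rightarrow> superfun" where
  "dlogBer a = (\<Sum>b\<in>I. sg (s b) (\<Sum>i\<in>I. D a (J b i) * K i b))"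

text \<open>The logarithmic derivative of \<open>det P / det Dm\<close> is the trace of
  \<open>?d P\<close> with \<open>Q\<close> minus that of \<open>?d Dm\<close> with
  \<open>E\<close>. In \<open>?d P\<close> the terms from the odd blocks are moved cyclically, with
  sign, next to the blocks of \<open>K\<close>; the result is the supertrace.\<close>

lemma D_Ber: "D a Ber = Ber * dlogBer a"
proof -
  define \<epsilon> where "\<epsilon> = s a"
  let ?d = "\<lambda>X i j. D a (X i j :: superfun)"
  define U where "U = mm q E (mm p C Q)"
  have dpar: "has_parity (\<epsilon> + m) (D a f)" if "has_parity m f" for m f
    unfolding \<epsilon>_def by (rule has_parity_D[OF that])
  have dE: "?d E k l = - mm q E (mm q (?d Dm) E) k l" if kl: "k < q" "l < q" for k l
  proof -
    have z: "mm q (?d Dm) E m l + mm q Dm (?d E) m l = 0" if m: "m < q" for m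
    proof -
      have "D a (mm q Dm E m l) = mm q (?d Dm) E m l + sg (s a * 0) (mm q Dm (?d E) m l)"
        by (rule D_mm[where J = "{..<q}"]) (auto intro!: block_in(4) block_parity(4) E(1) m kl)
      moreover have "D a (mm q Dm E m l) = 0" unfolding E(2)[OF m kl(2)] one_mat_def by (simp add: D_unit)
      ultimately show ?thesis by simp
    qed
    have "mm q E (mm q (?d Dm) E) k l + mm q (mm q E Dm) (?d E) k l = (\<Sum>m<q. E k m * (mm q (?d Dm) E m l + mm q Dm (?d E) m l))"
      unfolding mm_assoc by (simp add: mm_def[of q E] distrib_left sum.distrib)
    also have "\<dots> = 0" by (rule sum.neutral) (simp add: z)
    finally show ?thesis
      using mm_one_left[of "?d E" k l "{..<q}" q "mm q E Dm", OF sfun_D[OF E(1)[OF kl]] kl(1)] E(3)[OF kl(1)] by (simp add: eq_neg_iff_add_eq_0 add.commute)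
  qed
  have dBE: "?d BE i k = mm q (?d B) E i k - sg \<epsilon> (mm q BE (mm q (?d Dm) E) i k)" if ik: "i < p" "k < q" for i k
  proof -
    have "D a (BE i k) = mm q (?d B) E i k + sg (s a * 1) (mm q B (?d E) i k)"
      by (rule D_mm[where J = "{..<q}"]) (auto intro!: block_in(2) block_parity(2)[unfolded One_nat_def] E(1) ik)
    also have "mm q B (?d E) i k = mm q B (\<lambda>i j. - mm q E (mm q (?d Dm) E) i j) i k"
      by (rule mm_cong) (simp_all add: dE ik)
    also have "\<dots> = - mm q BE (mm q (?d Dm) E) i k"
      unfolding mm_assoc by (simp add: mm_def[of q B] sum_negf)
    finally show ?thesis by (simp add: \<epsilon>_def sg_minus)
  qed
  have dP: "?d P i j = ?d A i j - mm q (?d BE) C i j - sg \<epsilon> (mm q BE (?d C) i j)" if ij: "i < p" "j < p" for i j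
  proof -
    have "D a (P i j) = D a (A i j) - D a (mm q BE C i j)"
      unfolding P_def by (rule D_diff[where J = "{..<q}"])
        (use ij in \<open>auto simp: mm_def[of q BE] intro!: block_in(1) sfun_sum sfun_mult BE_in block_in(3)\<close>)
    also have "D a (mm q BE C i j) = mm q (?d BE) C i j + sg (s a * 1) (mm q BE (?d C) i j)"
      by (rule D_mm[where J = "{..<q}"]) (auto intro!: BE_in BE_parity[unfolded One_nat_def] block_in(3) ij)
    finally show ?thesis by (simp add: \<epsilon>_def)
  qed
  \<comment> \<open>The derivative of \<open>BE\<close> contributes through \<open>B\<close> and,
    via the derivative of the inverse \<open>E\<close>, through \<open>Dm\<close>. The trace of
    \<open>?d Dm\<close> with \<open>E\<close> produced here will cancel the one from the
    denominator of the Berezinian.\<close>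
  have T2: "tr p p (mm q (?d BE) C) Q = - tr p q (?d B) K10 - tr q q (?d Dm) E + tr q q (?d Dm) K11"
  proof -
    have "tr p p (mm q (?d BE) C) Q = tr p q (?d BE) (mm p C Q)" by (rule tr_assoc)
    also have "\<dots> = tr p q (\<lambda>i k. mm q (?d B) E i k - sg \<epsilon> (mm q BE (mm q (?d Dm) E) i k)) (mm p C Q)"
      by (rule tr_cong) (simp_all add: dBE)
    also have "\<dots> = tr p q (?d B) U - sg \<epsilon> (tr p q BE (mm q (?d Dm) U))"
      unfolding tr_diff_left tr_sg_left tr_assoc mm_assoc U_def ..
    also have "tr p q BE (mm q (?d Dm) U) = sg (1 * (\<epsilon> + 1)) (tr q p (mm q (?d Dm) U) BE)"
    proof (rule tr_swap)
      fix i k assume ik: "i < p" "k < q"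
      show "has_parity 1 (BE i k)" by (rule BE_parity[OF ik])
      show "has_parity (\<epsilon> + 1) (mm q (?d Dm) U k i)"
        unfolding mm_def[of q "?d Dm"]
      proof (rule has_parity_sum)
        fix l assume l: "l \<in> {..<q}"
        have "has_parity 1 (U l i)" unfolding U_def using l ik by (simp add: K10_eq has_parity_uminus block_parity(7)[unfolded One_nat_def])
        from has_parity_mult[OF dpar[OF block_parity(4)[OF ik(2)]] this, of l] l
        show "has_parity (\<epsilon> + 1) (D a (Dm k l) * U l i)" by simp
      qed
    qed
    also have "tr q p (mm q (?d Dm) U) BE = tr q q (?d Dm) (mm p U BE)" by (rule tr_assoc)
    finally have 1: "tr p p (mm q (?d BE) C) Q = tr p q (?d B) U + tr q q (?d Dm) (mm p U BE)"
      by (simp add: sg_odd)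
    have "tr p q (?d B) U = tr p q (?d B) (\<lambda>i j. - K10 i j)"
      unfolding U_def by (rule tr_cong) (simp_all add: K10_eq)
    moreover have "tr q q (?d Dm) (mm p U BE) = tr q q (?d Dm) (\<lambda>i j. K11 i j - E i j)"
    proof (rule tr_cong)
      fix k l assume kl: "k < q" "l < q"
      have "mm p U BE l k = mm p (\<lambda>i j. - K10 i j) BE l k"
        unfolding U_def by (rule mm_cong) (simp_all add: K10_eq kl)
      also have "\<dots> = - mm p K10 BE l k" by (simp add: mm_def[of p] sum_negf)
      finally show "mm p U BE l k = K11 l k - E l k" by (simp add: K11_eq kl)
    qed simp
    ultimately show ?thesis unfolding 1 tr_uminus_right tr_diff_right by simp
  qed
  have T3: "sg \<epsilon> (tr p p (mm q BE (?d C)) Q) = tr q p (?d C) K01"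
  proof -
    have "tr p p (mm q BE (?d C)) Q = tr p q BE (mm p (?d C) Q)" by (rule tr_assoc)
    also have "\<dots> = sg (1 * (\<epsilon> + 1)) (tr q p (mm p (?d C) Q) BE)"
    proof (rule tr_swap)
      fix i k assume ik: "i < p" "k < q"
      show "has_parity 1 (BE i k)" by (rule BE_parity[OF ik])
      show "has_parity (\<epsilon> + 1) (mm p (?d C) Q k i)"
        unfolding mm_def
      proof (rule has_parity_sum)
        fix l assume l: "l \<in> {..<p}"
        from has_parity_mult[OF dpar[OF block_parity(3)[OF ik(2)]] block_parity(5)[OF _ ik(1)], of l l] l
        show "has_parity (\<epsilon> + 1) (D a (C k l) * Q l i)" by simp
      qed
    qed
    also have "tr q p (mm p (?d C) Q) BE = tr q p (?d C) (mm p Q BE)" by (rule tr_assoc)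
    also have "\<dots> = tr q p (?d C) (\<lambda>i j. - K01 i j)" by (rule tr_cong) (simp_all add: K01_eq)
    finally show ?thesis unfolding tr_uminus_right by (simp add: sg_minus sg_odd)
  qed
  have tP: "tr p p (?d P) Q = tr p p (?d A) Q + tr p q (?d B) K10 + tr q q (?d Dm) E - tr q q (?d Dm) K11 - tr q p (?d C) K01"
  proof -
    have "tr p p (?d P) Q = tr p p (\<lambda>i j. ?d A i j - mm q (?d BE) C i j - sg \<epsilon> (mm q BE (?d C) i j)) Q"
      by (rule tr_cong) (simp_all add: dP)
    thus ?thesis unfolding tr_diff_left tr_sg_left T2 T3 by (simp add: algebra_simps)
  qed
  have dPdet: "D a (sdet p P) = sdet p P * tr p p (?d P) Q"
    unfolding tr_def by (rule D_sdet_inverse[where J = "{..<q}"]) (auto intro!: P_in P_parity block_in(5) block_parity(5) Q_P)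
  have dDdet: "D a (sdet q Dm) = sdet q Dm * tr q q (?d Dm) E"
    unfolding tr_def by (rule D_sdet_inverse[where J = "{..<q}"]) (auto intro!: block_in(4) block_parity(4) E)
  have tD_in: "tr q q (?d Dm) E \<in> F" unfolding tr_def mm_def by (intro sfun_sum sfun_mult sfun_D block_in(4) E) auto
  have dh: "D a h = - (h * tr q q (?d Dm) E)"
  proof -
    have "0 = D a (sdet q Dm * h)" unfolding h(2) by (simp add: D_unit)
    also have "\<dots> = D a (sdet q Dm) * h + sdet q Dm * D a h"
      using D_mult_sg[OF sdet_Dm(1) h(1) sdet_Dm(2), of a] by simp
    finally have "sdet q Dm * D a h = - (sdet q Dm * tr q q (?d Dm) E * h)"
      unfolding dDdet by (simp add: eq_neg_iff_add_eq_0 add.commute)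
    hence "h * (sdet q Dm * D a h) = - (h * (sdet q Dm * (tr q q (?d Dm) E * h)))" by (simp add: mult.assoc)
    hence "D a h = - (tr q q (?d Dm) E * h)"
      unfolding mult.assoc[symmetric] h(3) using unit_mult_sfun(1)[OF sfun_D[OF h(1)]] unit_mult_sfun(1)[OF tD_in]
      by simp
    thus ?thesis using superfun_commute_even[OF h(4), of "tr q q (?d Dm) E"] by simp
  qed
  have sP: "sdet p P \<in> F" "has_parity 0 (sdet p P)" by (auto intro!: sdet_in P_in sdet_parity P_parity)
  have "D a Ber = D a (sdet p P) * h + sdet p P * D a h"
    using D_mult_sg[OF sP(1) h(1) sP(2), of a] by (simp add: Ber_def)
  also have "\<dots> = Ber * (tr p p (?d P) Q - tr q q (?d Dm) E)"
    unfolding dPdet dh Ber_def using superfun_commute_even[OF h(4), of "tr p p (?d P) Q"] by (simp add: mult.assoc right_diff_distrib)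
  also have "tr p p (?d P) Q - tr q q (?d Dm) E = dlogBer a"
  proof -
    have "dlogBer a = (\<Sum>b<p. (\<Sum>i<p. D a (J b i) * K i b) + (\<Sum>k<q. D a (J b (p + k)) * K (p + k) b)) -
        (\<Sum>l<q. (\<Sum>i<p. D a (J (p + l) i) * K i (p + l)) + (\<Sum>k<q. D a (J (p + l) (p + k)) * K (p + k) (p + l)))"
      unfolding dlogBer_def sum_lessThan_add by (simp add: parity_def sg_odd sum_negf sum.distrib sum_subtractf)
    also have "\<dots> = tr p p (?d A) Q + tr p q (?d B) K10 - tr q p (?d C) K01 - tr q q (?d Dm) K11"
      by (simp add: tr_def mm_def sum.distrib)
    finally show ?thesis unfolding tP by simp
  qed
  finally show ?thesis .
qed

end

section \<open>Invariance of the odd Laplace operator\<close>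

context jacobian_domain
begin

text \<open>The product rule leaves terms with derivatives of \<open>J\<close>;
  \<open>J_closed\<close> turns them into \<open>Y a * dlogBer a\<close>, which by
  \<open>D_Ber\<close> is the contribution of differentiating the density \<open>Ber\<close>. Here
  \<open>Y\<close> are the components of a field of parity \<open>\<nu> + 1\<close>, and the inner
  sum on the left its components in the other coordinates.\<close>

lemma divergence_change:
  assumes Y: "\<And>a. a \<in> I \<Longrightarrow> Y a \<in> F" "\<And>a. a \<in> I \<Longrightarrow> has_parity (s a + \<nu> + 1) (Y a)"
  shows "Ber * (\<Sum>i\<in>I. sg (s i * \<nu>) (\<Sum>b\<in>I. K i b * D b (\<Sum>a\<in>I. Y a * J a i))) =
    (\<Sum>a\<in>I. sg (s a * \<nu>) (D a (Ber * Y a)))"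
proof -
  have JI: "J a i \<in> F" if "a \<in> I" "i \<in> I" for a i using J_in that by auto
  \<comment> \<open>For each triple of indices the product rule gives one term that contracts
    \<open>J\<close> with \<open>K\<close> and one summand of the supertrace.\<close>
  have t: "sg (s i * \<nu>) (K i b * D b (Y a * J a i)) =
     sg (s a * \<nu>) (J a i * K i b * D b (Y a)) + Y a * sg (s b) (D a (J b i) * K i b)"
    if a: "a \<in> I" and b: "b \<in> I" and i: "i \<in> I" for a b i
  proof -
    have pK: "has_parity (s i + s b) (K i b)" and pJ: "has_parity (s a + s i) (J a i)" "has_parity (s b + s i) (J b i)"
      using K_parity[of i b] J_parity[of a i] J_parity[of b i] a b i by auto
    have "has_parity ((s i + s b) + (s b + (s a + \<nu> + 1))) (K i b * D b (Y a))"
      by (intro has_parity_mult pK has_parity_D Y a)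
    hence pKY: "has_parity (s i + s a + \<nu> + 1) (K i b * D b (Y a))" by (rule has_parity_cong) presburger
    have "D b (Y a * J a i) = D b (Y a) * J a i + sg (s b * (s a + \<nu> + 1)) (Y a * D b (J a i))"
      by (rule D_mult_sg[OF Y(1)[OF a] JI[OF a i] Y(2)[OF a]])
    moreover have "sg (s i * \<nu>) (K i b * (D b (Y a) * J a i)) = sg (s a * \<nu>) (J a i * K i b * D b (Y a))"
      using sg_commute[OF pKY pJ(1)] by (simp add: mult.assoc[symmetric]) (rule sg_cong, auto)
    moreover have "sg (s i * \<nu> + s b * (s a + \<nu> + 1)) (K i b * (Y a * D b (J a i))) = Y a * sg (s b) (D a (J b i) * K i b)"
    proof -
      have 1: "D b (J a i) = sg (s b * s a) (D a (J b i))" using J_closed[of b a i] a b i by simp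
      have 2: "K i b * (Y a * D a (J b i)) = sg ((s i + s b) * (s a + \<nu> + 1)) (Y a * (K i b * D a (J b i)))"
        by (rule sg_left_commute[OF pK Y(2)[OF a]])
      have 3: "K i b * D a (J b i) = sg ((s i + s b) * (s a + (s b + s i))) (D a (J b i) * K i b)"
        by (intro sg_commute pK has_parity_D pJ)
      show ?thesis unfolding 1 sg_mult_right 2 3 sg_sg by (rule sg_cong) auto
    qed
    ultimately show ?thesis by (simp add: distrib_left sg_add)
  qed
  have LHS: "(\<Sum>i\<in>I. sg (s i * \<nu>) (\<Sum>b\<in>I. K i b * D b (\<Sum>a\<in>I. Y a * J a i))) =
     (\<Sum>a\<in>I. sg (s a * \<nu>) (D a (Y a))) + (\<Sum>a\<in>I. Y a * dlogBer a)"
  proof -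
    have "(\<Sum>i\<in>I. sg (s i * \<nu>) (\<Sum>b\<in>I. K i b * D b (\<Sum>a\<in>I. Y a * J a i))) =
      (\<Sum>i\<in>I. \<Sum>b\<in>I. \<Sum>a\<in>I. sg (s i * \<nu>) (K i b * D b (Y a * J a i)))"
    proof (rule sum.cong[OF refl])
      fix i assume i: "i \<in> I"
      have "D b (\<Sum>a\<in>I. Y a * J a i) = (\<Sum>a\<in>I. D b (Y a * J a i))" for b
        by (rule D_sum[where J = "{..<q}"]) (intro sfun_mult Y JI i)
      thus "sg (s i * \<nu>) (\<Sum>b\<in>I. K i b * D b (\<Sum>a\<in>I. Y a * J a i)) = (\<Sum>b\<in>I. \<Sum>a\<in>I. sg (s i * \<nu>) (K i b * D b (Y a * J a i)))"
        by (simp add: sum_distrib_left sg_sum)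
    qed
    also have "\<dots> = (\<Sum>i\<in>I. \<Sum>b\<in>I. \<Sum>a\<in>I. sg (s a * \<nu>) (J a i * K i b * D b (Y a)) + Y a * sg (s b) (D a (J b i) * K i b))"
      by (intro sum.cong refl t)
    also have "\<dots> = (\<Sum>i\<in>I. \<Sum>b\<in>I. \<Sum>a\<in>I. sg (s a * \<nu>) (J a i * K i b * D b (Y a))) +
        (\<Sum>i\<in>I. \<Sum>b\<in>I. \<Sum>a\<in>I. Y a * sg (s b) (D a (J b i) * K i b))"
      by (simp only: sum.distrib)
    also have "(\<Sum>i\<in>I. \<Sum>b\<in>I. \<Sum>a\<in>I. sg (s a * \<nu>) (J a i * K i b * D b (Y a))) = (\<Sum>a\<in>I. sg (s a * \<nu>) (D a (Y a)))"
    proof -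
      have "(\<Sum>i\<in>I. \<Sum>b\<in>I. \<Sum>a\<in>I. sg (s a * \<nu>) (J a i * K i b * D b (Y a))) =
         (\<Sum>b\<in>I. \<Sum>i\<in>I. \<Sum>a\<in>I. sg (s a * \<nu>) (J a i * K i b * D b (Y a)))" by (rule sum.swap)
      also have "\<dots> = (\<Sum>b\<in>I. \<Sum>a\<in>I. \<Sum>i\<in>I. sg (s a * \<nu>) (J a i * K i b * D b (Y a)))"
        by (intro sum.cong refl sum.swap)
      also have "\<dots> = (\<Sum>b\<in>I. \<Sum>a\<in>I. if a = b then sg (s a * \<nu>) (D a (Y a)) else 0)"
      proof (intro sum.cong refl)
        fix a b assume a: "a \<in> I" and b: "b \<in> I"
        have "(\<Sum>i\<in>I. sg (s a * \<nu>) (J a i * K i b * D b (Y a))) = sg (s a * \<nu>) ((\<Sum>i\<in>I. J a i * K i b) * D b (Y a))"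
          by (simp add: sg_sum sum_distrib_right)
        thus "(\<Sum>i\<in>I. sg (s a * \<nu>) (J a i * K i b * D b (Y a))) = (if a = b then sg (s a * \<nu>) (D a (Y a)) else 0)"
          using J_K[of a b] a b unit_mult_sfun(1)[OF sfun_D[OF Y(1)[OF b]]] by simp
      qed
      also have "\<dots> = (\<Sum>a\<in>I. sg (s a * \<nu>) (D a (Y a)))" by (simp add: sum.delta)
      finally show ?thesis .
    qed
    also have "(\<Sum>i\<in>I. \<Sum>b\<in>I. \<Sum>a\<in>I. Y a * sg (s b) (D a (J b i) * K i b)) = (\<Sum>a\<in>I. Y a * dlogBer a)"
    proof -
      have "(\<Sum>i\<in>I. \<Sum>b\<in>I. \<Sum>a\<in>I. Y a * sg (s b) (D a (J b i) * K i b)) = (\<Sum>i\<in>I. \<Sum>a\<in>I. \<Sum>b\<in>I. Y a * sg (s b) (D a (J b i) * K i b))"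
        by (intro sum.cong refl sum.swap)
      also have "\<dots> = (\<Sum>a\<in>I. \<Sum>i\<in>I. \<Sum>b\<in>I. Y a * sg (s b) (D a (J b i) * K i b))" by (rule sum.swap)
      also have "\<dots> = (\<Sum>a\<in>I. \<Sum>b\<in>I. \<Sum>i\<in>I. Y a * sg (s b) (D a (J b i) * K i b))" by (intro sum.cong refl sum.swap)
      also have "\<dots> = (\<Sum>a\<in>I. Y a * dlogBer a)" unfolding dlogBer_def by (simp only: sum_distrib_left sg_sum)
      finally show ?thesis .
    qed
    finally show ?thesis .
  qed
  have RHS: "sg (s a * \<nu>) (D a (Ber * Y a)) = Ber * (sg (s a * \<nu>) (D a (Y a)) + Y a * dlogBer a)" if a: "a \<in> I" for a
  proof -
    have "D a (Ber * Y a) = D a Ber * Y a + Ber * D a (Y a)"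
      using D_mult_sg[OF Ber_in Y(1)[OF a] Ber_parity, of a] by simp
    moreover have "sg (s a * \<nu>) (D a Ber * Y a) = Ber * (Y a * dlogBer a)"
    proof -
      have "D a Ber * Y a = sg ((s a + 0) * (s a + \<nu> + 1)) (Y a * D a Ber)"
        by (intro sg_commute has_parity_D Ber_parity Y a)
      hence "sg (s a * \<nu>) (D a Ber * Y a) = Y a * D a Ber" by simp (rule sg_even, auto)
      also have "\<dots> = Ber * (Y a * dlogBer a)"
        unfolding D_Ber using superfun_commute_even[OF Ber_parity, of "Y a"] by (simp add: mult.assoc[symmetric])
      finally show ?thesis .
    qed
    ultimately show ?thesis by (simp add: sg_add distrib_left add.commute)
  qed
  have "(\<Sum>a\<in>I. sg (s a * \<nu>) (D a (Ber * Y a))) = (\<Sum>a\<in>I. Ber * (sg (s a * \<nu>) (D a (Y a)) + Y a * dlogBer a))"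
    by (rule sum.cong[OF refl RHS])
  thus ?thesis unfolding LHS by (simp only: sum.distrib distrib_left sum_distrib_left)
qed

end

sublocale super_iso \<subseteq> Jac: jacobian_domain p Vc q J K
proof
  fix a b i assume "a < p + q" "b < p + q" "i < p + q"
  thus "F.A.D a (J b i) = sg (parity p a * parity p b) (F.A.D b (J a i))"
    unfolding J_def by (intro F.A.D_swap[where J = "{..<q}"] F.T_in F.coordinate_in) auto
qed (auto intro: J_in K_in J_parity K_parity simp: J_K K_J)

locale poisson_iso = super_iso p Vc Vd q T \<phi> T' \<phi>' + PC: pre_poisson_domain p Vc q Sc \<rho>c \<rho>c' +
    PD: pre_poisson_domain p Vd q Sd \<rho>d \<rho>d' for p Vc Vd q T \<phi> T' \<phi>' Sc \<rho>c \<rho>c' Sd \<rho>d \<rho>d' +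
  assumes S_transform: "i < p + q \<Longrightarrow> j < p + q \<Longrightarrow> T (Sd i j) =
      (\<Sum>a<p + q. \<Sum>b<p + q. sg (parity p j * (parity p a + parity p i)) (Sc a b * J b j * J a i))"
    and rho_transform: "\<rho>c = T \<rho>d * Jac.Ber"
begin

text \<open>With the sign \<open>sg (s a * n)\<close> the \<open>H a\<close> are the components of
  the Hamiltonian field and transform as a vector, which is what \<open>TG\<close> verifies. The
  divergence then changes by \<open>divergence_change\<close> with \<open>\<nu> = n\<close>.\<close>

lemma T_lap_parity:
  assumes f: "f \<in> Fd" and n: "has_parity n f"
  shows "T (PD.lap f) = PC.lap (T f)"
proof -
  define G where "G i = (\<Sum>j\<in>I. Sd i j * F.B.D j f)" for i
  define H where "H a = (\<Sum>b\<in>I. Sc a b * F.A.D b (T f))" for a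
  have Q: "{..<q} \<subseteq> {..<q}" by simp
  note Sd_in = PD.S_in[OF Q] and Sc_in = PC.S_in[OF Q] and rd = PD.rho_in[OF Q] and rc = PC.rho_in[OF Q]
  have TDf: "T (F.B.D j f) \<in> Fc" "has_parity (s j + n) (T (F.B.D j f))" for j
    by (intro F.T_in F.T_parity F.B.sfun_D f F.B.has_parity_D n)+
  have G_in: "G i \<in> Fd" if "i \<in> I" for i unfolding G_def using that by (intro F.B.sfun_sum F.B.sfun_mult Sd_in F.B.sfun_D f)
  have H_in: "H a \<in> Fc" if "a \<in> I" for a unfolding H_def using that by (intro F.A.sfun_sum F.A.sfun_mult Sc_in F.A.sfun_D F.T_in f)
  have H_par: "has_parity (s a + 1 + n) (H a)" if a: "a \<in> I" for a
    unfolding H_def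
  proof (rule has_parity_sum)
    fix b assume "b \<in> I"
    hence "has_parity ((s a + s b + 1) + (s b + n)) (Sc a b * F.A.D b (T f))"
      using a by (intro has_parity_mult PC.S_parity F.A.has_parity_D F.T_parity f n) auto
    thus "has_parity (s a + 1 + n) (Sc a b * F.A.D b (T f))" by (rule has_parity_cong) presburger
  qed
  have TG: "T (G i) = sg (s i * n) (\<Sum>a\<in>I. sg (s a * n) (H a) * J a i)" if i: "i \<in> I" for i
  proof -
    have "T (G i) = (\<Sum>j\<in>I. T (Sd i j * F.B.D j f))"
      unfolding G_def by (rule F.T_sum) (intro F.B.sfun_mult Sd_in i F.B.sfun_D f)
    also have "\<dots> = (\<Sum>j\<in>I. T (Sd i j) * T (F.B.D j f))"
      by (intro sum.cong refl F.T_mult Sd_in i F.B.sfun_D f)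
    also have "\<dots> = (\<Sum>j\<in>I. \<Sum>a\<in>I. \<Sum>b\<in>I. sg (s i * n + s a * n) (Sc a b * (J b j * T (F.B.D j f)) * J a i))"
    proof (rule sum.cong[OF refl])
      fix j assume j: "j \<in> I"
      have "T (Sd i j) * T (F.B.D j f) = (\<Sum>a\<in>I. \<Sum>b\<in>I. sg (s j * (s a + s i)) (Sc a b * J b j * J a i) * T (F.B.D j f))"
        using S_transform[of i j] i j by (simp add: sum_distrib_right)
      also have "\<dots> = (\<Sum>a\<in>I. \<Sum>b\<in>I. sg (s i * n + s a * n) (Sc a b * (J b j * T (F.B.D j f)) * J a i))"
      proof (intro sum.cong refl)
        fix a b assume a: "a \<in> I" and b: "b \<in> I"
        have "J a i * T (F.B.D j f) = sg ((s a + s i) * (s j + n)) (T (F.B.D j f) * J a i)"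
          by (rule sg_commute[OF J_parity[OF i] TDf(2)])
        thus "sg (s j * (s a + s i)) (Sc a b * J b j * J a i) * T (F.B.D j f) =
           sg (s i * n + s a * n) (Sc a b * (J b j * T (F.B.D j f)) * J a i)"
          by (simp add: mult.assoc) (rule sg_cong, auto)
      qed
      finally show "T (Sd i j) * T (F.B.D j f) = (\<Sum>a\<in>I. \<Sum>b\<in>I. sg (s i * n + s a * n) (Sc a b * (J b j * T (F.B.D j f)) * J a i))" .
    qed
    also have "\<dots> = (\<Sum>a\<in>I. \<Sum>j\<in>I. \<Sum>b\<in>I. sg (s i * n + s a * n) (Sc a b * (J b j * T (F.B.D j f)) * J a i))" by (rule sum.swap)
    also have "\<dots> = (\<Sum>a\<in>I. \<Sum>b\<in>I. \<Sum>j\<in>I. sg (s i * n + s a * n) (Sc a b * (J b j * T (F.B.D j f)) * J a i))" by (intro sum.cong refl sum.swap)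
    also have "\<dots> = (\<Sum>a\<in>I. \<Sum>b\<in>I. sg (s i * n + s a * n) (Sc a b * F.A.D b (T f) * J a i))"
      unfolding chain[OF f] by (simp add: sum_distrib_left sum_distrib_right sg_sum)
    finally show ?thesis by (simp add: H_def sum_distrib_left sum_distrib_right sg_sum mult.assoc)
  qed
  \<comment> \<open>The field is weighted with the pulled back density of the second chart;
    multiplied by the Berezinian this becomes the density of the first.\<close>
  define Y where "Y a = T \<rho>d * sg (s a * n) (H a)" for a
  have Tr: "T \<rho>d \<in> Fc" "has_parity 0 (T \<rho>d)" by (intro F.T_in F.T_parity rd PD.rho_parity)+
  have Y: "Y a \<in> Fc" "has_parity (s a + n + 1) (Y a)" if "a \<in> I" for a
  proof -
    show "Y a \<in> Fc" unfolding Y_def using that by (intro F.A.sfun_mult F.A.sfun_sg Tr H_in)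
    show "has_parity (s a + n + 1) (Y a)"
      using has_parity_mult[OF Tr(2) has_parity_sg[OF H_par[OF that], of "s a * n"]] by (simp add: Y_def ac_simps)
  qed
  have YJ: "T (\<rho>d * G i) = sg (s i * n) (\<Sum>a\<in>I. Y a * J a i)" if i: "i \<in> I" for i
    unfolding F.T_mult[OF rd(1) G_in[OF i]] TG[OF i] Y_def by (simp add: sum_distrib_left mult.assoc)
  have YJ_in: "(\<Sum>a\<in>I. Y a * J a i) \<in> Fc" if "i \<in> I" for i using that by (intro F.A.sfun_sum F.A.sfun_mult Y J_in)
  have "T (PD.lap f) = T \<rho>d' * (\<Sum>i\<in>I. T (F.B.D i (\<rho>d * G i)))"
  proof -
    have m: "F.B.D i (\<rho>d * G i) \<in> Fd" if "i \<in> I" for i using that by (intro F.B.sfun_D F.B.sfun_mult rd G_in)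
    show ?thesis unfolding PD.lap_def G_def[symmetric]
      using F.T_mult[OF rd(2) F.B.sfun_sum[OF m, of I "\<lambda>i. i"]] F.T_sum[of I "\<lambda>i. F.B.D i (\<rho>d * G i)", OF m] by simp
  qed
  also have "(\<Sum>i\<in>I. T (F.B.D i (\<rho>d * G i))) = (\<Sum>i\<in>I. sg (s i * n) (\<Sum>b\<in>I. K i b * F.A.D b (\<Sum>a\<in>I. Y a * J a i)))"
  proof (rule sum.cong[OF refl])
    fix i assume i: "i \<in> I"
    have "T (F.B.D i (\<rho>d * G i)) = (\<Sum>b\<in>I. K i b * F.A.D b (T (\<rho>d * G i)))"
      by (rule T_D) (intro F.B.sfun_mult rd G_in i)+
    thus "T (F.B.D i (\<rho>d * G i)) = sg (s i * n) (\<Sum>b\<in>I. K i b * F.A.D b (\<Sum>a\<in>I. Y a * J a i))"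
      unfolding YJ[OF i] F.A.D_sg[OF YJ_in[OF i]] by (simp add: sg_sum)
  qed
  also have "T \<rho>d' * \<dots> = \<rho>c' * (Jac.Ber * (\<Sum>i\<in>I. sg (s i * n) (\<Sum>b\<in>I. K i b * F.A.D b (\<Sum>a\<in>I. Y a * J a i))))"
  proof -
    have "T \<rho>d * T \<rho>d' = restr Vc 1" using F.T_mult[OF rd(1,2)] PD.rho_inv F.T_unit by simp
    hence 1: "T \<rho>d' * T \<rho>d = restr Vc 1" using superfun_commute_even[OF Tr(2), of "T \<rho>d'"] by simp
    have "T \<rho>d' = T \<rho>d' * (\<rho>c * \<rho>c')"
      unfolding PC.rho_inv using unit_mult_sfun(2)[OF F.T_in[OF rd(2)]] by simp
    also have "\<dots> = (T \<rho>d' * T \<rho>d) * (Jac.Ber * \<rho>c')" unfolding rho_transform by (simp only: mult.assoc)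
    also have "\<dots> = Jac.Ber * \<rho>c'" unfolding 1 by (rule unit_mult_sfun(1)[OF F.A.sfun_mult[OF Jac.Ber_in rc(2)]])
    also have "\<dots> = \<rho>c' * Jac.Ber" by (rule superfun_commute_even[OF Jac.Ber_parity])
    finally show ?thesis by (simp only: mult.assoc)
  qed
  also have "Jac.Ber * (\<Sum>i\<in>I. sg (s i * n) (\<Sum>b\<in>I. K i b * F.A.D b (\<Sum>a\<in>I. Y a * J a i))) = (\<Sum>a\<in>I. sg (s a * n) (F.A.D a (Jac.Ber * Y a)))"
    by (rule Jac.divergence_change) (rule Y; assumption)+
  also have "\<dots> = (\<Sum>a\<in>I. F.A.D a (\<rho>c * H a))"
  proof (rule sum.cong[OF refl])
    fix a assume a: "a \<in> I"
    have m: "\<rho>c * H a \<in> Fc" by (intro F.A.sfun_mult rc H_in a)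
    have "Jac.Ber * Y a = sg (s a * n) (\<rho>c * H a)"
      unfolding Y_def rho_transform using superfun_commute_even[OF Jac.Ber_parity, of "T \<rho>d"] by (simp add: mult.assoc[symmetric])
    thus "sg (s a * n) (F.A.D a (Jac.Ber * Y a)) = F.A.D a (\<rho>c * H a)"
      by (simp add: F.A.D_sg[OF m] sg_even)
  qed
  finally show ?thesis by (simp add: PC.lap_def H_def)
qed

theorem T_lap: assumes f: "f \<in> Fd" shows "T (PD.lap f) = PC.lap (T f)"
proof -
  have Q: "{..<q} \<subseteq> {..<q}" by simp
  have p: "part n f \<in> Fd" for n by (rule F.B.sfun_part[OF f])
  have "T (PD.lap (part 0 f + part 1 f)) = PC.lap (T (part 0 f + part 1 f))"
    unfolding PD.lap_add[OF Q p p] F.T_add[OF p p] F.T_add[OF PD.sfun_lap[OF Q p] PD.sfun_lap[OF Q p]]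
      PC.lap_add[OF Q F.T_in[OF p] F.T_in[OF p]] T_lap_parity[OF p has_parity_part] ..
  thus ?thesis by (simp only: part_decomposition)
qed

end

section \<open>Odd Poisson manifolds\<close>

lemma sum_lessThan_2: "(\<Sum>n<2. h n) = h 0 + h (1 :: nat)"
  by (simp add: numeral_2_eq_2)

lemma partial_zero [simp]: "partial p V a 0 = 0"
proof -
  have "odd_deriv j 0 = 0" for j by (rule grassmann_eqI) (simp add: coeff_odd_deriv)
  moreover have "Abs_grassmann (\<lambda>I. 0) = 0" by (simp add: zero_grassmann_def)
  ultimately show ?thesis by (auto simp: partial_def restr_apply partial_real_def fun_eq_iff zero_fun_apply)
qed

text \<open>On the part of parity \<open>n\<close> the twist by 1 and the twist by the parity of
  \<open>a\<close> together give the exponent \<open>n * (s a + 1)\<close> of the odd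
  bracket.\<close>

lemma (in pre_poisson_domain) bra_tw:
  assumes f: "f \<in> sfun p {..<q} V"
  shows "bra (tw 1 f) g = (\<Sum>n<2. \<Sum>a\<in>I. \<Sum>b\<in>I. sg (n * (s a + 1)) (S a b * D b (part n f) * D a g))"
proof -
  have tw: "tw (s a) (tw 1 f) = part 0 f + sg (s a + 1) (part 1 f)" for a
    unfolding tw_part[of 1] tw_add using tw_sg[OF has_parity_part, of "s a" 0 f]
      tw_sg[OF has_parity_sg[OF has_parity_part], of "s a" 1 1 f] by simp
  have p: "part n f \<in> sfun p {..<q} V" for n by (rule sfun_part[OF f])
  have "D b (tw (s a) (tw 1 f)) = D b (part 0 f) + sg (s a + 1) (D b (part 1 f))" for a b
    unfolding tw by (simp only: D_add[OF p sfun_sg[OF p]] D_sg[OF p])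
  thus ?thesis unfolding bra_def sum_lessThan_2 by (simp add: distrib_left distrib_right sum.distrib)
qed

lemma (in pre_poisson_domain) lap_sum_parts:
  assumes f: "f \<in> sfun p {..<q} V"
  shows "lap f = (\<Sum>n<2. \<rho>' * (\<Sum>a\<in>I. sg (s a * (n + 1 + 1)) (D a (\<rho> * (\<Sum>b\<in>I. sg (s a * n) (S a b * D b (part n f)))))))"
proof -
  have Q: "{..<q} \<subseteq> {..<q}" by simp
  have p: "part n f \<in> sfun p {..<q} V" for n by (rule sfun_part[OF f])
  have "sg (s a * (n + 1 + 1)) (D a (\<rho> * (\<Sum>b\<in>I. sg (s a * n) (S a b * D b (part n f))))) =
      D a (\<rho> * (\<Sum>b\<in>I. S a b * D b (part n f)))" if "a \<in> I" for a n
  proof -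
    have m: "\<rho> * (\<Sum>b\<in>I. S a b * D b (part n f)) \<in> sfun p {..<q} V"
      using that by (intro sfun_mult sfun_sum sfun_D rho_in[OF Q] S_in[OF Q] p)
    have "\<rho> * (\<Sum>b\<in>I. sg (s a * n) (S a b * D b (part n f))) = sg (s a * n) (\<rho> * (\<Sum>b\<in>I. S a b * D b (part n f)))"
      by (simp add: sg_sum[symmetric])
    thus ?thesis by (simp add: D_sg[OF m]) (rule sg_even, auto)
  qed
  hence "\<rho>' * (\<Sum>a\<in>I. sg (s a * (n + 1 + 1)) (D a (\<rho> * (\<Sum>b\<in>I. sg (s a * n) (S a b * D b (part n f)))))) = lap (part n f)" for n
    unfolding lap_def by (intro arg_cong2[where f = times] sum.cong refl) simp
  thus ?thesis unfolding sum_lessThan_2 using lap_add[OF Q p p, of 0 1] by (simp only: part_decomposition)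
qed

section \<open>Charts and transition maps of a supermanifold\<close>

locale supermanifold_charts =
  fixes M :: "('m, 'c) supermanifold_data"
  assumes M: "supermanifold M"
begin

abbreviation p where "p \<equiv> edim M"
abbreviation q where "q \<equiv> odim M"
abbreviation I where "I \<equiv> {..<p + q}"

lemma chart:
  assumes "c \<in> charts M"
  shows "openin (body M) (cdom M c) \<and> openin (Euclidean_space p) (crange M c) \<and>
    homeomorphic_map (subtopology (body M) (cdom M c)) (subtopology (Euclidean_space p) (crange M c)) (cmap M c)"
  using M assms unfolding supermanifold_def by simp

lemma topspace_chart: "c \<in> charts M \<Longrightarrow> topspace (subtopology (body M) (cdom M c)) = cdom M c"
  using chart[of c] openin_subset[of "body M" "cdom M c"] by (auto simp: topspace_subtopology)

lemma cmap_inj: "c \<in> charts M \<Longrightarrow> inj_on (cmap M c) (cdom M c)"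
  using chart[of c] homeomorphic_imp_injective_map topspace_chart by metis

lemma cimg_open:
  assumes "c \<in> charts M" "openin (body M) W" "W \<subseteq> cdom M c"
  shows "openin (Euclidean_space p) (cimg M c W)"
proof -
  have "open_map (subtopology (body M) (cdom M c)) (subtopology (Euclidean_space p) (crange M c)) (cmap M c)"
    using chart[OF assms(1)] homeomorphic_imp_open_map by blast
  thus ?thesis unfolding open_map_def cimg_def[of M c W]
    using assms chart[OF assms(1)] by (metis openin_open_subtopology)
qed

lemma open_domain_cimg: "c \<in> charts M \<Longrightarrow> openin (body M) W \<Longrightarrow> W \<subseteq> cdom M c \<Longrightarrow> open_domain p (cimg M c W)"
  by unfold_locales (rule cimg_open)

lemma open_domain_crange: "c \<in> charts M \<Longrightarrow> open_domain p (crange M c)"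
  using chart[of c] by unfold_locales simp

lemma overlap_open: "c \<in> charts M \<Longrightarrow> d \<in> charts M \<Longrightarrow> openin (body M) (overlap M c d)"
  unfolding overlap_def using chart by blast

lemma pull_hom:
  assumes "c \<in> charts M" "d \<in> charts M" "openin (body M) W" "W \<subseteq> overlap M c d"
  shows "superalgebra_hom p q (cimg M d W) (cimg M c W) (pull M c d W)"
  using M assms unfolding supermanifold_def by simp

lemma pull_restr:
  assumes "c \<in> charts M" "d \<in> charts M" "openin (body M) W" "W \<subseteq> overlap M c d" "openin (body M) W'" "W' \<subseteq> W"
    "f \<in> superfuns p q (cimg M d W)"
  shows "pull M c d W' (restr (cimg M d W') f) = restr (cimg M c W') (pull M c d W f)"
  using M assms unfolding supermanifold_def by simp

lemma pull_pull:
  assumes "c \<in> charts M" "d \<in> charts M" "openin (body M) W" "W \<subseteq> overlap M c d" "f \<in> superfuns p q (cimg M c W)"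
  shows "pull M c d W (pull M d c W f) = f"
proof -
  have "pull M c d W (pull M d c W f) = pull M c c W f"
    using M assms unfolding supermanifold_def overlap_def by simp
  also have "\<dots> = f" using M assms unfolding supermanifold_def overlap_def by simp
  finally show ?thesis .
qed

definition transition :: "'c \<Rightarrow> 'c \<Rightarrow> (nat \<Rightarrow> real) \<Rightarrow> nat \<Rightarrow> real" where
  "transition c d x = cmap M d (inv_into (cdom M c) (cmap M c) x)"

lemma transition_cmap: "c \<in> charts M \<Longrightarrow> m \<in> cdom M c \<Longrightarrow> transition c d (cmap M c m) = cmap M d m"
  unfolding transition_def by (simp add: inv_into_f_f cmap_inj)

text \<open>Since \<open>pull\<close> commutes with restrictions, its version on the preimage
  \<open>W'\<close> of a smaller open set supplies the required local homomorphism.\<close>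

lemma super_map_pull:
  assumes c: "c \<in> charts M" and d: "d \<in> charts M" and W: "openin (body M) W" "W \<subseteq> overlap M c d"
  shows "super_map p (cimg M c W) (cimg M d W) q (pull M c d W) (transition c d)"
proof -
  have Wc: "W \<subseteq> cdom M c" and Wd: "W \<subseteq> cdom M d" using W(2) by (auto simp: overlap_def)
  show ?thesis
  proof
    show "openin (Euclidean_space p) (cimg M c W)" by (rule cimg_open[OF c W(1) Wc])
    show "openin (Euclidean_space p) (cimg M d W)" by (rule cimg_open[OF d W(1) Wd])
    show "superalgebra_hom p q (cimg M d W) (cimg M c W) (pull M c d W)" by (rule pull_hom[OF c d W])
  next
    fix x assume "x \<in> cimg M c W"
    then obtain m where m: "m \<in> W" "x = cmap M c m" by (auto simp: cimg_def)
    have t: "transition c d x = cmap M d m" using m Wc by (auto simp: transition_cmap[OF c])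
    thus "transition c d x \<in> cimg M d W" using m by (simp add: cimg_def)
    fix U assume U: "openin (Euclidean_space p) U" "U \<subseteq> cimg M d W" "transition c d x \<in> U"
    define W' where "W' = {m \<in> W. cmap M d m \<in> U}"
    have img: "cimg M d W' = U" using U(2) by (auto simp: W'_def cimg_def)
    have "U \<subseteq> crange M d" using U(2) Wd by (auto simp: cimg_def)
    hence "openin (subtopology (Euclidean_space p) (crange M d)) U"
      using U(1) chart[OF d] by (simp add: openin_open_subtopology)
    moreover have cont: "continuous_map (subtopology (body M) (cdom M d)) (subtopology (Euclidean_space p) (crange M d)) (cmap M d)"
      using chart[OF d] homeomorphic_imp_continuous_map by blast
    ultimately have "openin (subtopology (body M) (cdom M d)) {m \<in> cdom M d. cmap M d m \<in> U}"
      using openin_continuous_map_preimage[OF cont] unfolding topspace_chart[OF d] by blast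
    hence "openin (body M) {m \<in> cdom M d. cmap M d m \<in> U}"
      using chart[OF d] by (simp add: openin_open_subtopology)
    moreover have "W' = W \<inter> {m \<in> cdom M d. cmap M d m \<in> U}" using Wd by (auto simp: W'_def)
    ultimately have W': "openin (body M) W'" "W' \<subseteq> W" using W(1) by auto
    have W'': "W' \<subseteq> overlap M c d" "W' \<subseteq> cdom M c" using W' W(2) Wc by auto
    interpret d: open_domain p "cimg M d W" by (rule open_domain_cimg[OF d W(1) Wd])
    show "\<exists>U' TU. openin (Euclidean_space p) U' \<and> x \<in> U' \<and> U' \<subseteq> cimg M c W \<and> superalgebra_hom p q U U' TU \<and>
        (\<forall>f\<in>sfun p {..<q} (cimg M d W). TU (restr U f) = restr U' (pull M c d W f))"
    proof (intro exI conjI ballI)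
      show "openin (Euclidean_space p) (cimg M c W')" by (rule cimg_open[OF c W'(1) W''(2)])
      show "x \<in> cimg M c W'" using m t U(3) by (auto simp: W'_def cimg_def)
      show "cimg M c W' \<subseteq> cimg M c W" using W'(2) by (auto simp: cimg_def)
      show "superalgebra_hom p q U (cimg M c W') (pull M c d W')"
        using pull_hom[OF c d W'(1) W''(1)] by (simp add: img)
      fix f assume "f \<in> sfun p {..<q} (cimg M d W)"
      thus "pull M c d W' (restr U f) = restr (cimg M c W') (pull M c d W f)"
        using pull_restr[OF c d W W'] by (simp add: img d.superfuns_eq_sfun)
    qed
  qed
qed

lemma super_iso_pull:
  assumes c: "c \<in> charts M" and d: "d \<in> charts M" and W: "openin (body M) W" "W \<subseteq> overlap M c d"
  shows "super_iso p (cimg M c W) (cimg M d W) q (pull M c d W) (transition c d) (pull M d c W) (transition d c)"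
proof -
  have W': "W \<subseteq> overlap M d c" using W(2) by (auto simp: overlap_def)
  interpret F: super_map p "cimg M c W" "cimg M d W" q "pull M c d W" "transition c d" by (rule super_map_pull[OF c d W])
  interpret G: super_map p "cimg M d W" "cimg M c W" q "pull M d c W" "transition d c" by (rule super_map_pull[OF d c W(1) W'])
  show ?thesis
    by unfold_locales (use pull_pull[OF c d W] pull_pull[OF d c W(1) W'] in
      \<open>simp_all add: F.A.superfuns_eq_sfun F.B.superfuns_eq_sfun\<close>)
qed

end

section \<open>Gluing the results in the charts\<close>

locale odd_poisson_manifold = supermanifold_charts M for M :: "('m, 'c) supermanifold_data" +
  fixes S :: "'c \<Rightarrow> nat \<Rightarrow> nat \<Rightarrow> superfun" and \<rho> :: "'c \<Rightarrow> superfun"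
  assumes S: "odd_poisson_structure M S" and rho: "nondegenerate_volume_form M \<rho>"
begin

definition rho_inv :: "'c \<Rightarrow> superfun" where
  "rho_inv c = superfun_inverse p q (crange M c) (\<rho> c)"

abbreviation L where "L c \<equiv> pre_poisson_domain.lap p (crange M c) q (S c) (\<rho> c) (rho_inv c)"
abbreviation F where "F c \<equiv> sfun p {..<q} (crange M c)"

text \<open>Nondegeneracy gives a one-sided inverse of the density, which is two-sided because the
  density is even; the Jacobi identity comes from \<open>jacobi_of_bracket\<close>.\<close>

lemma poisson_chart:
  assumes c: "c \<in> charts M"
  shows "poisson_domain p (crange M c) q (S c) (\<rho> c) (rho_inv c)"
proof -
  interpret V: open_domain p "crange M c" by (rule open_domain_crange[OF c])
  have S': "S c a b \<in> F c" "has_parity (par M a + par M b + 1) (S c a b)" "S c a b = sg (par M a * par M b) (S c b a)"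
    if "a < p + q" "b < p + q" for a b
  proof -
    have "a \<in> I" "b \<in> I" using that by simp_all
    hence "S c a b \<in> superfuns p q (crange M c) \<and> has_parity (par M a + par M b + 1) (S c a b) \<and>
        S c a b = (-1) ^ (par M a * par M b) * S c b a"
      using S c unfolding odd_poisson_structure_def by blast
    thus "S c a b \<in> F c" "has_parity (par M a + par M b + 1) (S c a b)" "S c a b = sg (par M a * par M b) (S c b a)"
      unfolding V.superfuns_eq_sfun sg_def by blast+
  qed
  interpret C: cotangent_structure p "crange M c" q "S c" by unfold_locales (fact S')+
  have r: "\<rho> c \<in> F c" "has_parity 0 (\<rho> c)" using rho c unfolding nondegenerate_volume_form_def V.superfuns_eq_sfun[symmetric] by blast+
  obtain h where h: "h \<in> F c" "\<rho> c * h = restr (crange M c) 1"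
    using rho c unfolding nondegenerate_volume_form_def V.superfuns_eq_sfun[symmetric] by blast
  have "rho_inv c = h" unfolding rho_inv_def
    by (rule V.superfun_inverse_eqI[OF h]) (use superfun_commute_even[OF r(2), of h] h(2) in simp)
  with h have h: "rho_inv c \<in> F c" "\<rho> c * rho_inv c = restr (crange M c) 1" by auto
  interpret P: pre_poisson_domain p "crange M c" q "S c" "\<rho> c" "rho_inv c"
    by unfold_locales (fact S' r h)+
  have "canonical_bracket p q (crange M c) C.H C.H = 0"
    using S c unfolding odd_poisson_structure_def C.H_def Let_def by blast
  note jac = C.jacobi_of_bracket[OF this]
  show ?thesis
    by unfold_locales (unfold P.trip_def, rule jac, unfold C.admissible_def, blast+)
qed

lemma L_in: "c \<in> charts M \<Longrightarrow> f \<in> F c \<Longrightarrow> L c f \<in> F c"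
  using pre_poisson_domain.sfun_lap[OF poisson_domain.axioms(1)[OF poisson_chart]] by blast

lemma odd_laplacian_chart:
  assumes c: "c \<in> charts M" and f: "f c \<in> F c"
  shows "odd_laplacian M S \<rho> f c = L c (f c)"
proof -
  interpret P: poisson_domain p "crange M c" q "S c" "\<rho> c" "rho_inv c" by (rule poisson_chart[OF c])
  show ?thesis
    unfolding odd_laplacian_def divergence_def hamiltonian_field_def sum_fun_apply[where x = c]
      rho_inv_def[symmetric] P.lap_sum_parts[OF f] sg_def by (simp only: mult.assoc)
qed

text \<open>Families of local expressions vanish at indices that are not charts, and equality of
  families is tested there too.\<close>

lemma odd_laplacian_outside: "f c = 0 \<Longrightarrow> odd_laplacian M S \<rho> f c = 0"
  unfolding odd_laplacian_def divergence_def hamiltonian_field_def sum_fun_apply[where x = c] by simp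

lemma odd_bracket_chart:
  assumes c: "c \<in> charts M" and f: "f c \<in> F c"
  shows "odd_bracket M S f g c = - pre_poisson_domain.bra p (crange M c) q (S c) (tw 1 (f c)) (g c)"
proof -
  interpret P: poisson_domain p "crange M c" q "S c" "\<rho> c" "rho_inv c" by (rule poisson_chart[OF c])
  show ?thesis unfolding odd_bracket_def P.bra_tw[OF f] sg_def by (simp add: sum_negf mult.assoc)
qed

lemma odd_bracket_outside: "f c = 0 \<Longrightarrow> odd_bracket M S f g c = 0"
  unfolding odd_bracket_def by simp

text \<open>A vector field is determined by its values on the coordinates.\<close>

definition X :: "'c \<Rightarrow> nat \<Rightarrow> superfun" where
  "X c a = L c (L c (coordinate p (crange M c) a))"

text \<open>By \<open>T_lap\<close> the pullback takes the operator of \<open>d\<close> to that of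
  \<open>c\<close> on the overlap. So the left side is the square of the latter applied to the
  pulled back coordinate, and \<open>lap2_field\<close> expands this in the coordinates of
  \<open>c\<close>.\<close>

lemma X_transfer:
  assumes c: "c \<in> charts M" and d: "d \<in> charts M" and i: "i \<in> I"
  shows "transfer M c d (X d i) = (\<Sum>a\<in>I. X c a * jacobian M c d a i)"
proof -
  define W where "W = overlap M c d"
  define Vc where "Vc = cimg M c W"
  define Vd where "Vd = cimg M d W"
  define T where "T = pull M c d W"
  have W: "openin (body M) W" "W \<subseteq> overlap M c d" "W \<subseteq> cdom M c" "W \<subseteq> cdom M d"
    unfolding W_def using overlap_open[OF c d] by (auto simp: overlap_def)
  have sub: "Vc \<subseteq> crange M c" "Vd \<subseteq> crange M d" using W by (auto simp: Vc_def Vd_def cimg_def)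
  have dom: "open_domain p Vc" "open_domain p Vd"
    unfolding Vc_def Vd_def using open_domain_cimg[OF c W(1,3)] open_domain_cimg[OF d W(1,4)] by auto
  interpret c: poisson_domain p "crange M c" q "S c" "\<rho> c" "rho_inv c" by (rule poisson_chart[OF c])
  interpret d: poisson_domain p "crange M d" q "S d" "\<rho> d" "rho_inv d" by (rule poisson_chart[OF d])
  interpret iso: super_iso p Vc Vd q T "transition c d" "pull M d c W" "transition d c"
    unfolding Vc_def Vd_def T_def by (rule super_iso_pull[OF c d W(1,2)])
  interpret PC: poisson_domain p Vc q "\<lambda>a b. restr Vc (S c a b)" "restr Vc (\<rho> c)" "restr Vc (rho_inv c)"
    by (rule c.poisson_restr[OF dom(1) sub(1)])
  interpret PD: poisson_domain p Vd q "\<lambda>a b. restr Vd (S d a b)" "restr Vd (\<rho> d)" "restr Vd (rho_inv d)"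
    by (rule d.poisson_restr[OF dom(2) sub(2)])
  have tr: "transfer M c d f = T (restr Vd f)" for f by (simp add: transfer_def W_def Vd_def T_def)
  have jac: "jacobian M c d = iso.J"
    unfolding jacobian_def iso.J_def tr restr_coordinate[OF sub(2)] by (simp add: Vc_def W_def fun_eq_iff)
  \<comment> \<open>The factor \<open>g\<close> vanishes outside \<open>Vc\<close> and so does the
    work of restricting \<open>f\<close>; the transformation laws in the definitions are stated with
    the unrestricted coefficients of the chart \<open>c\<close>.\<close>
  have absorb: "restr Vc f * g = f * g" if "g \<in> sfun p {..<q} Vc" for f g
    using that by (auto simp: fun_eq_iff times_fun_apply restr_apply sfun_outside)
  interpret poisson_iso p Vc Vd q T "transition c d" "pull M d c W" "transition d c"
    "\<lambda>a b. restr Vc (S c a b)" "restr Vc (\<rho> c)" "restr Vc (rho_inv c)"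
    "\<lambda>a b. restr Vd (S d a b)" "restr Vd (\<rho> d)" "restr Vd (rho_inv d)"
  proof
    fix i j assume ij: "i < p + q" "j < p + q"
    have "T (restr Vd (S d i j)) = (\<Sum>a<p + q. \<Sum>b<p + q. sg (parity p j * (parity p a + parity p i)) (S c a b * iso.J b j * iso.J a i))"
    proof -
      have "i \<in> I" "j \<in> I" using ij by simp_all
      hence "transfer M c d (S d i j) = (\<Sum>a\<in>I. \<Sum>b\<in>I.
          (-1) ^ (par M j * (par M a + par M i)) * S c a b * jacobian M c d b j * jacobian M c d a i)"
        using S c d unfolding odd_poisson_structure_def by blast
      thus ?thesis unfolding tr jac sg_def by (simp only: mult.assoc)
    qed
    also have "\<dots> = (\<Sum>a<p + q. \<Sum>b<p + q. sg (parity p j * (parity p a + parity p i)) (restr Vc (S c a b) * iso.J b j * iso.J a i))"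
      using ij by (simp add: absorb iso.J_in)
    finally show "T (restr Vd (S d i j)) = (\<Sum>a<p + q. \<Sum>b<p + q. sg (parity p j * (parity p a + parity p i)) (restr Vc (S c a b) * iso.J b j * iso.J a i))" .
  next
    have "restr Vc (\<rho> c) = transfer M c d (\<rho> d) * berezinian p q Vc (jacobian M c d)"
      using rho c d unfolding nondegenerate_volume_form_def Vc_def W_def by blast
    thus "restr Vc (\<rho> c) = T (restr Vd (\<rho> d)) * iso.Jac.Ber"
      unfolding jac iso.Jac.berezinian_eq tr .
  qed
  have y: "coordinate p Vd i \<in> sfun p {..<q} Vd" by (rule iso.F.coordinate_in[OF i])
  have "transfer M c d (X d i) = T (PD.lap (PD.lap (coordinate p Vd i)))"
    unfolding tr X_def d.restr_lap[OF dom(2) sub(2), symmetric] restr_coordinate[OF sub(2)] ..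
  also have "\<dots> = PC.lap (PC.lap (T (coordinate p Vd i)))"
    by (simp only: T_lap[OF PD.sfun_lap[OF PD.Q_sub y]] T_lap[OF y])
  also have "\<dots> = (\<Sum>a\<in>I. PC.lap (PC.lap (coordinate p Vc a)) * iso.J a i)"
    unfolding iso.J_def by (rule PC.lap2_field[OF iso.F.T_in[OF y]])
  also have "\<dots> = (\<Sum>a\<in>I. restr Vc (X c a) * iso.J a i)"
    unfolding X_def c.restr_lap[OF dom(1) sub(1), symmetric] restr_coordinate[OF sub(1)] ..
  also have "\<dots> = (\<Sum>a\<in>I. X c a * jacobian M c d a i)"
    unfolding jac using iso.J_in[OF i] by (simp add: absorb)
  finally show ?thesis .
qed

lemma vector_field_X: "vector_field M 0 X"
proof -
  have "X c a \<in> superfuns p q (crange M c)" "has_parity (par M a + 0) (X c a)" if c: "c \<in> charts M" and a: "a \<in> I" for c a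
  proof -
    interpret c: poisson_domain p "crange M c" q "S c" "\<rho> c" "rho_inv c" by (rule poisson_chart[OF c])
    show "X c a \<in> superfuns p q (crange M c)"
      unfolding X_def c.superfuns_eq_sfun using a by (intro L_in c c.sfun_coordinate) auto
    show "has_parity (par M a + 0) (X c a)"
      unfolding X_def add_0_right by (intro c.parity_lap2 c.has_parity_coordinate)
  qed
  thus ?thesis unfolding vector_field_def using X_transfer by blast
qed

lemma smooth_chart:
  assumes f: "f \<in> smooth_functions M"
  shows "c \<in> charts M \<Longrightarrow> f c \<in> F c" "c \<notin> charts M \<Longrightarrow> f c = 0"
  using f open_domain.superfuns_eq_sfun[OF open_domain_crange, of c q] by (auto simp: smooth_functions_def)

lemma laplacian2_chart:
  "c \<in> charts M \<Longrightarrow> f c \<in> F c \<Longrightarrow> odd_laplacian M S \<rho> (odd_laplacian M S \<rho> f) c = L c (L c (f c))"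
  by (simp add: odd_laplacian_chart L_in)

lemma laplacian2_outside: "f c = 0 \<Longrightarrow> odd_laplacian M S \<rho> (odd_laplacian M S \<rho> f) c = 0"
  by (intro odd_laplacian_outside)

lemma laplacian2_X:
  assumes f: "f \<in> smooth_functions M"
  shows "odd_laplacian M S \<rho> (odd_laplacian M S \<rho> f) = apply_field M X f"
proof
  fix c
  show "odd_laplacian M S \<rho> (odd_laplacian M S \<rho> f) c = apply_field M X f c"
  proof (cases "c \<in> charts M")
    case True
    interpret c: poisson_domain p "crange M c" q "S c" "\<rho> c" "rho_inv c" by (rule poisson_chart[OF True])
    show ?thesis
      unfolding laplacian2_chart[where f = f, OF True smooth_chart(1)[OF f True]] apply_field_def X_def
      by (rule c.lap2_field[OF smooth_chart(1)[OF f True]])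
  next
    case False
    thus ?thesis using smooth_chart(2)[OF f] by (simp add: laplacian2_outside apply_field_def)
  qed
qed

text \<open>In a chart this is \<open>lap2_bra\<close> for \<open>tw 1 (f c)\<close>; the square
  commutes with the twist and with the minus sign that relate \<open>bra\<close> to the odd
  bracket.\<close>

lemma laplacian2_bracket:
  assumes f: "f \<in> smooth_functions M" and g: "g \<in> smooth_functions M"
  defines "\<Delta> \<equiv> odd_laplacian M S \<rho>"
  shows "\<Delta> (\<Delta> (odd_bracket M S f g)) = odd_bracket M S (\<Delta> (\<Delta> f)) g + odd_bracket M S f (\<Delta> (\<Delta> g))"
proof
  fix c
  show "\<Delta> (\<Delta> (odd_bracket M S f g)) c = (odd_bracket M S (\<Delta> (\<Delta> f)) g + odd_bracket M S f (\<Delta> (\<Delta> g))) c"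
  proof (cases "c \<in> charts M")
    case True
    interpret c: poisson_domain p "crange M c" q "S c" "\<rho> c" "rho_inv c" by (rule poisson_chart[OF True])
    note fc = smooth_chart(1)[OF f True] and gc = smooth_chart(1)[OF g True]
    note Q = c.Q_sub
    have tf: "tw 1 (f c) \<in> F c" by (rule c.sfun_tw[OF fc])
    have b: "c.bra (tw 1 (f c)) (g c) \<in> F c" by (rule c.sfun_bra[OF Q tf gc])
    have D2: "\<Delta> (\<Delta> h) c = c.lap (c.lap (h c))" if "h c \<in> F c" for h
      unfolding \<Delta>_def by (rule laplacian2_chart[where f = h, OF True that])
    have ob: "odd_bracket M S h k c = - c.bra (tw 1 (h c)) (k c)" if "h c \<in> F c" for h k
      by (rule odd_bracket_chart[where f = h, OF True that])
    have m: "c.lap (c.lap (f c)) \<in> F c" by (intro c.sfun_lap[OF Q] fc)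
    have "\<Delta> (\<Delta> (odd_bracket M S f g)) c = c.lap (c.lap (- c.bra (tw 1 (f c)) (g c)))"
      using D2[of "odd_bracket M S f g"] ob[of f g, OF fc] c.sfun_uminus[OF b] by simp
    also have "\<dots> = - c.lap (c.lap (c.bra (tw 1 (f c)) (g c)))"
      by (simp only: c.lap_uminus[OF Q b] c.lap_uminus[OF Q c.sfun_lap[OF Q b]])
    also have "\<dots> = - (c.bra (tw 1 (c.lap (c.lap (f c)))) (g c) + c.bra (tw 1 (f c)) (c.lap (c.lap (g c))))"
      by (simp only: c.lap2_bra[OF tf gc] c.lap2_tw[OF fc])
    also have "\<dots> = odd_bracket M S (\<Delta> (\<Delta> f)) g c + odd_bracket M S f (\<Delta> (\<Delta> g)) c"
      using ob[of "\<Delta> (\<Delta> f)" g] ob[of f "\<Delta> (\<Delta> g)", OF fc] D2[of f, OF fc] D2[of g, OF gc] m by simp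
    finally show ?thesis by (simp only: plus_fun_apply)
  next
    case False
    hence 0: "f c = 0" "g c = 0" using smooth_chart(2) f g by auto
    show ?thesis
      unfolding plus_fun_apply[where x = c] \<Delta>_def by (simp add: laplacian2_outside odd_bracket_outside 0)
  qed
qed

end

theorem proposition2p1:
  fixes M :: "('m, 'c) supermanifold_data"
    and S :: "'c \<Rightarrow> nat \<Rightarrow> nat \<Rightarrow> superfun"
    and \<rho> :: "'c \<Rightarrow> superfun"
  assumes "supermanifold M"
    and "odd_poisson_structure M S"
    and "nondegenerate_volume_form M \<rho>"
  defines "\<Delta> \<equiv> odd_laplacian M S \<rho>"
  shows "(\<exists>X. vector_field M 0 X \<and> (\<forall>f\<in>smooth_functions M. \<Delta> (\<Delta> f) = apply_field M X f)) \<and>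
    (\<forall>f\<in>smooth_functions M. \<forall>g\<in>smooth_functions M.
       \<Delta> (\<Delta> (odd_bracket M S f g)) =
         odd_bracket M S (\<Delta> (\<Delta> f)) g + odd_bracket M S f (\<Delta> (\<Delta> g)))"
proof -
  interpret odd_poisson_manifold M S \<rho> by unfold_locales fact+
  show ?thesis unfolding \<Delta>_def using vector_field_X laplacian2_X laplacian2_bracket by blast
qed

end
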